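(* Let $A',A''$ be dg algebras over $k$ and let $\Phi(u)=\mathbf{sh}+u\,\mathbf{Sh}$, extended $k(\!(u)\!)$-linearly. Then $\Phi(u)$ is a morphism of complexes $$\big((\overline{\mathsf{C}}(A')\otimes\overline{\mathsf{C}}(A''))(\!(u)\!),\ (b+uB)\otimes1+1\otimes(b+uB)\big)\to\big(\overline{\mathsf{C}}(A'\otimes A'')(\!(u)\!),\ b+uB\big),$$ and it is a morphism of mixed complexes with $u$-connections from $\big(\overline{\mathsf{C}}(A')\otimes\overline{\mathsf{C}}(A''),\,b\otimes1+1\otimes b,\,B\otimes1+1\otimes B,\,\nabla_{A'}\otimes1+1\otimes\nabla_{A''}\big)$ to $\big(\overline{\mathsf{C}}(A'\otimes A''),\,b,\,B,\,\nabla_{A'\otimes A''}\big)$. Explicitly: writing $\mathcal{A}_A(u)=\frac{e(\delta)}{2u^2}+\frac{E(\delta)-\gamma}{2u}$, the morphism of complexes $$\frac{d\Phi(u)}{du}+\mathcal{A}_{A'\otimes A''}(u)\,\Phi(u)-\Phi(u)\big(\mathcal{A}_{A'}(u)\otimes1+1\otimes\mathcal{A}_{A''}(u)\big)$$ between the two complexes above is homotopic to $0$.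
   Context: Fix a field $k$ of characteristic $0$. All vector spaces are $\mathbb{Z}/2$-graded and the Koszul sign rule is used throughout; $|v|$ denotes the parity of $v$, $\Pi V$ denotes $V$ with reversed parity, and $|\Pi a|=|a|+1$. A dg algebra is a unital $\mathbb{Z}/2$-graded associative $k$-algebra $A$ with an odd derivation $d$ with $d^2=0$. Put $\mathsf{C}(A)=\bigoplus_{n\ge0}A\otimes(\Pi A)^{\otimes n}$, with elements written $a_0[a_1|\dots|a_n]$. On the summand $A\otimes(\Pi A)^{\otimes n}$ define: $\tau(a_0[a_1|\dots|a_n])=(-1)^{|\Pi a_0|\sum_{i=1}^n|\Pi a_i|}a_1[a_2|\dots|a_n|a_0]$; $\delta^{(0)}(a_0[a_1|\dots|a_n])=da_0[a_1|\dots|a_n]$; $\mu^{(0)}(a_0[a_1|\dots|a_n])=0$ if $n=0$ and $=(-1)^{|a_0|}a_0a_1[a_2|\dots|a_n]$ if $n\ge1$; $\delta^{(i)}=\tau^{-i}\delta^{(0)}\tau^{i}$, $\mu^{(i)}=\tau^{-i}\mu^{(0)}\tau^{i}$ for $1\le i\le n$; $b(\delta)=\sum_{i=0}^n\delta^{(i)}$, $b(\mu)=\sum_{i=0}^n\mu^{(i)}$, $b=b(\delta)+b(\mu)$ (Hochschild differential); $N=\sum_{i=0}^n\tau^i$, $h(a_0[a_1|\dots|a_n])=1[a_0|a_1|\dots|a_n]$, $B=(1-\tau^{-1})hN$. Let $\mathsf{C}'(A)\subset\mathsf{C}(A)$ be spanned by the $a_0[a_1|\dots|a_n]$ with at least one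 of $a_1,\dots,a_n$ equal to $1$; it is preserved by $b$ and $B$, and the normalized complex is $\overline{\mathsf{C}}(A)=\mathsf{C}(A)/\mathsf{C}'(A)=\bigoplus_{n\ge0}A\otimes(\Pi\overline{A})^{\otimes n}$, $\overline{A}=A/k\cdot1$, with the induced $b$ and $B$ (on the quotient $B=hN$). Further, on the summand with $n$ bar-entries set $\gamma=n\cdot\mathrm{id}$, $e(\delta)=-\mu^{(0)}\delta^{(1)}$ (so $e(\delta)(a_0[a_1|\dots|a_n])=a_0\,da_1[a_2|\dots|a_n]$), and $E(\delta)=-\sum_{i=1}^n\sum_{j=0}^{n-i}h\tau^{-j}\delta^{(i)}$; these descend to $\overline{\mathsf{C}}(A)$. Here $u$ is an even formal variable, and $\nabla_A=\frac{d}{du}+\frac{e(\delta)}{2u^2}+\frac{E(\delta)-\gamma}{2u}$ on $\overline{\mathsf{C}}(A)(\!(u)\!)$. Künneth maps. For dg algebras $A',A''$, $A'\otimes A''$ is the tensor product dg algebra; write $a'$ for $a'\otimes1$, $a''$ for $1\otimes a''$, and $\mathbf{1}=1\otimes1$. For operators $X,Y$, $(X\otimes Y)(x\otimes y)=(-1)^{|Y||x|}Xx\otimes Yy$. Define $\mathbf{sh}:\overline{\mathsf{C}}(A')\otimes\overline{\mathsf{C}}(A'')\to\overline{\mathsf{C}}(A'\otimes A'')$ by $\mathbf{sh}(a'_0[a'_1|\dots|a'_n]\otimes a''_0[a''_1|\dots|a''_m])=(-1)^{*}(a'_0\otimes a''_0)\,sh[a'_1|\dots|a'_n|a''_1|\dots|a''_m]$,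 where $*=|a''_0|\sum_{i=1}^n|\Pi a'_i|$ and $sh$ is the signed sum over all $(n,m)$-shuffles (permutations preserving the relative orders of the $a'$-entries and of the $a''$-entries), the sign computed by the rule that an adjacent transposition $[\dots|x|y|\dots]\to[\dots|y|x|\dots]$ contributes $(-1)^{(|x|+1)(|y|+1)}$. Define $\mathbf{Sh}(a'_0[a'_1|\dots|a'_n]\otimes a''_0[a''_1|\dots|a''_m])=(-1)^{**}\mathbf{1}\,Sh[a'_0|\dots|a'_n|a''_0|\dots|a''_m]$, where $**=|a'_0|+\sum_{i=1}^n|\Pi a'_i|$ and $Sh$ is the signed sum over cyclic shuffles: cyclically permute (with the signs of $\tau$) $a'_0,\dots,a'_n$ and $a''_0,\dots,a''_m$, then shuffle the $a'$-entries with the $a''$-entries so that $a'_0$ stays to the left of $a''_0$ (same sign rule). A $u$-connection on a mixed complex $(\mathsf{C},b,B)$ is an even operator $\nabla=\frac{d}{du}+\mathcal{A}(u)$, $\mathcal{A}(u)\in\mathrm{End}(\mathsf{C})(\!(u)\!)$, with $[\nabla,b+uB]=\frac{1}{2u}(b+uB)$. A morphism from $(\mathsf{C}',b',B',\frac{d}{du}+\mathcal{A}'(u))$ to $(\mathsf{C}'',b'',B'',\frac{d}{du}+\mathcal{A}''(u))$ is a $k(\!(u)\!)$-linear morphism of complexes $\psi(u):(\mathsf{C}'(\!(u)\!),b'+uB')\to(\mathsf{C}''(\!(u)\!),b''+uB'')$ such that $\frac{d\psi}{du}+\mathcal{A}''\psi-\psi\mathcal{A}'$ is homotopic to $0$ as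 a morphism of these complexes. *)

theory Defs
  imports Main
begin

text \<open>Vectors in a space with basis 'b are finitely supported functions 'b => 'k.
  A k-linear map is given by the images of the basis vectors: an operator
  T :: 'b => 'c => 'k sends the basis vector b to the vector T b.\<close>

definition ksgn :: "bool \<Rightarrow> 'k::comm_ring_1" where
  "ksgn p = (if p then -1 else 1)"

definition bv :: "'b \<Rightarrow> 'b \<Rightarrow> 'k::comm_ring_1" where
  "bv b = (\<lambda>b'. if b' = b then 1 else 0)"

definition vsupp :: "('b \<Rightarrow> 'k::zero) \<Rightarrow> 'b set" where
  "vsupp v = {b. v b \<noteq> 0}"

definition lin :: "('b \<Rightarrow> 'c \<Rightarrow> 'k::comm_ring_1) \<Rightarrow> ('b \<Rightarrow> 'k) \<Rightarrow> 'c \<Rightarrow> 'k" where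
  "lin T v = (\<lambda>c. \<Sum>b\<in>vsupp v. v b * T b c)"

definition ocomp :: "('c \<Rightarrow> 'd \<Rightarrow> 'k::comm_ring_1) \<Rightarrow> ('b \<Rightarrow> 'c \<Rightarrow> 'k) \<Rightarrow> 'b \<Rightarrow> 'd \<Rightarrow> 'k" where
  "ocomp T S = (\<lambda>b. lin T (S b))"

definition opow :: "('b \<Rightarrow> 'b \<Rightarrow> 'k::comm_ring_1) \<Rightarrow> nat \<Rightarrow> 'b \<Rightarrow> 'b \<Rightarrow> 'k" where
  "opow T k = ((ocomp T) ^^ k) bv"

section \<open>dg algebras, presented by a homogeneous basis containing 1\<close>

text \<open>mult A i j l = coefficient of e_l in e_i e_j; dif A i l = coefficient of e_l in d e_i;
  par A i = parity of e_i (True = odd); one_idx A = index of the unit.\<close>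

record ('i, 'k) dga =
  one_idx :: 'i
  par :: "'i \<Rightarrow> bool"
  mult :: "'i \<Rightarrow> 'i \<Rightarrow> 'i \<Rightarrow> 'k"
  dif :: "'i \<Rightarrow> 'i \<Rightarrow> 'k"

definition is_dga :: "('i, 'k::field_char_0) dga \<Rightarrow> bool" where
  "is_dga A \<longleftrightarrow>
     par A (one_idx A) = False
   \<and> (\<forall>i j. finite (vsupp (mult A i j)))
   \<and> (\<forall>i. finite (vsupp (dif A i)))
   \<and> (\<forall>i j l. mult A i j l \<noteq> 0 \<longrightarrow> par A l = (par A i \<noteq> par A j))
   \<and> (\<forall>i l. dif A i l \<noteq> 0 \<longrightarrow> par A l = (\<not> par A i))
   \<and> (\<forall>j. mult A (one_idx A) j = bv j \<and> mult A j (one_idx A) = bv j)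
   \<and> (\<forall>i j l q. (\<Sum>p\<in>vsupp (mult A i j). mult A i j p * mult A p l q)
              = (\<Sum>p\<in>vsupp (mult A j l). mult A j l p * mult A i p q))
   \<and> (\<forall>i q. (\<Sum>p\<in>vsupp (dif A i). dif A i p * dif A p q) = 0)
   \<and> (\<forall>i j q. (\<Sum>p\<in>vsupp (mult A i j). mult A i j p * dif A p q)
              = (\<Sum>p\<in>vsupp (dif A i). dif A i p * mult A p j q)
                + ksgn (par A i) * (\<Sum>p\<in>vsupp (dif A j). dif A j p * mult A i p q))"

definition dga_tensor :: "('i, 'k::field_char_0) dga \<Rightarrow> ('j, 'k) dga \<Rightarrow> ('i \<times> 'j, 'k) dga" where
  "dga_tensor A B =
    \<lparr> one_idx = (one_idx A, one_idx B),
      par = (\<lambda>(i, j). par A i \<noteq> par B j),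
      mult = (\<lambda>(i, j) (i2, j2) (l, l2).
               ksgn (par B j \<and> par A i2) * mult A i i2 l * mult B j j2 l2),
      dif = (\<lambda>(i, j) (l, l2).
               (if l2 = j then dif A i l else 0)
             + (if l = i then ksgn (par A i) * dif B j l2 else 0)) \<rparr>"

text \<open>A basis chain (i0, [i1,...,in]) stands for e_i0[e_i1|...|e_in] in A \<otimes> (\<Pi>A)^n.\<close>

definition pisum :: "('i, 'k) dga \<Rightarrow> 'i list \<Rightarrow> nat" where
  "pisum A is = length (filter (\<lambda>j. \<not> par A j) is)"

definition cpar :: "('i, 'k) dga \<Rightarrow> 'i \<times> 'i list \<Rightarrow> bool" where
  "cpar A c = odd ((if par A (fst c) then 1 else 0) + pisum A (snd c))"

definition vsc :: "'k::comm_ring_1 \<Rightarrow> ('b \<Rightarrow> 'k) \<Rightarrow> 'b \<Rightarrow> 'k" where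
  "vsc r v = (\<lambda>x. r * v x)"

definition tau :: "('i, 'k::field_char_0) dga \<Rightarrow> 'i \<times> 'i list \<Rightarrow> 'i \<times> 'i list \<Rightarrow> 'k" where
  "tau A c = (if snd c = [] then bv c
     else vsc (ksgn (\<not> par A (fst c) \<and> odd (pisum A (snd c))))
              (bv (hd (snd c), tl (snd c) @ [fst c])))"

definition tauinv :: "('i, 'k::field_char_0) dga \<Rightarrow> 'i \<times> 'i list \<Rightarrow> 'i \<times> 'i list \<Rightarrow> 'k" where
  "tauinv A c = (if snd c = [] then bv c
     else vsc (ksgn (\<not> par A (last (snd c)) \<and> odd (pisum A (fst c # butlast (snd c)))))
              (bv (last (snd c), fst c # butlast (snd c))))"

definition delta0 :: "('i, 'k::field_char_0) dga \<Rightarrow> 'i \<times> 'i list \<Rightarrow> 'i \<times> 'i list \<Rightarrow> 'k" where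
  "delta0 A c = (\<lambda>d. if snd d = snd c then dif A (fst c) (fst d) else 0)"

definition mu0 :: "('i, 'k::field_char_0) dga \<Rightarrow> 'i \<times> 'i list \<Rightarrow> 'i \<times> 'i list \<Rightarrow> 'k" where
  "mu0 A c = (case snd c of [] \<Rightarrow> (\<lambda>d. 0)
     | i1 # rest \<Rightarrow> (\<lambda>d. if snd d = rest
                          then ksgn (par A (fst c)) * mult A (fst c) i1 (fst d) else 0))"

definition deltai :: "('i, 'k::field_char_0) dga \<Rightarrow> nat \<Rightarrow> 'i \<times> 'i list \<Rightarrow> 'i \<times> 'i list \<Rightarrow> 'k" where
  "deltai A i = ocomp (opow (tauinv A) i) (ocomp (delta0 A) (opow (tau A) i))"

definition mui :: "('i, 'k::field_char_0) dga \<Rightarrow> nat \<Rightarrow> 'i \<times> 'i list \<Rightarrow> 'i \<times> 'i list \<Rightarrow> 'k" where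
  "mui A i = ocomp (opow (tauinv A) i) (ocomp (mu0 A) (opow (tau A) i))"

definition hoch_b :: "('i, 'k::field_char_0) dga \<Rightarrow> 'i \<times> 'i list \<Rightarrow> 'i \<times> 'i list \<Rightarrow> 'k" where
  "hoch_b A c = (\<lambda>d. \<Sum>i\<in>{0..length (snd c)}. deltai A i c d + mui A i c d)"

definition Nop :: "('i, 'k::field_char_0) dga \<Rightarrow> 'i \<times> 'i list \<Rightarrow> 'i \<times> 'i list \<Rightarrow> 'k" where
  "Nop A c = (\<lambda>d. \<Sum>i\<in>{0..length (snd c)}. opow (tau A) i c d)"

definition hop :: "('i, 'k::field_char_0) dga \<Rightarrow> 'i \<times> 'i list \<Rightarrow> 'i \<times> 'i list \<Rightarrow> 'k" where
  "hop A c = bv (one_idx A, fst c # snd c)"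

definition Bop :: "('i, 'k::field_char_0) dga \<Rightarrow> 'i \<times> 'i list \<Rightarrow> 'i \<times> 'i list \<Rightarrow> 'k" where
  "Bop A = ocomp (\<lambda>c d. bv c d - tauinv A c d) (ocomp (hop A) (Nop A))"

definition gam :: "('i, 'k::field_char_0) dga \<Rightarrow> 'i \<times> 'i list \<Rightarrow> 'i \<times> 'i list \<Rightarrow> 'k" where
  "gam A c = (\<lambda>d. of_nat (length (snd c)) * bv c d)"

definition edel :: "('i, 'k::field_char_0) dga \<Rightarrow> 'i \<times> 'i list \<Rightarrow> 'i \<times> 'i list \<Rightarrow> 'k" where
  "edel A = (\<lambda>c d. - ocomp (mui A 0) (deltai A 1) c d)"

definition Ebig :: "('i, 'k::field_char_0) dga \<Rightarrow> 'i \<times> 'i list \<Rightarrow> 'i \<times> 'i list \<Rightarrow> 'k" where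
  "Ebig A c = (\<lambda>d. - (\<Sum>i\<in>{1..length (snd c)}. \<Sum>j\<in>{0..length (snd c) - i}.
       ocomp (hop A) (ocomp (opow (tauinv A) j) (deltai A i)) c d))"

text \<open>With a basis containing 1, C'(A) is spanned by the basis chains having some bar entry
  equal to the unit index, so the normalized complex has as basis the remaining chains;
  an operator preserving C'(A) induces nop A T on the quotient.\<close>

definition normal :: "('i, 'k) dga \<Rightarrow> 'i \<times> 'i list \<Rightarrow> bool" where
  "normal A c \<longleftrightarrow> one_idx A \<notin> set (snd c)"

definition nop :: "('i, 'k::field_char_0) dga \<Rightarrow> ('b \<Rightarrow> 'i \<times> 'i list \<Rightarrow> 'k)
                    \<Rightarrow> 'b \<Rightarrow> 'i \<times> 'i list \<Rightarrow> 'k" where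
  "nop A T = (\<lambda>c d. if normal A d then T c d else 0)"

section \<open>Laurent series of operators (elements of Hom(C,C')((u)))\<close>

definition lbb :: "(int \<Rightarrow> 'b \<Rightarrow> 'c \<Rightarrow> 'k::zero) \<Rightarrow> bool" where
  "lbb F \<longleftrightarrow> (\<exists>N. \<forall>n<N. F n = (\<lambda>_ _. 0))"

definition lmul :: "(int \<Rightarrow> 'c \<Rightarrow> 'd \<Rightarrow> 'k::comm_ring_1) \<Rightarrow> (int \<Rightarrow> 'b \<Rightarrow> 'c \<Rightarrow> 'k)
                    \<Rightarrow> int \<Rightarrow> 'b \<Rightarrow> 'd \<Rightarrow> 'k" where
  "lmul F G n = (\<lambda>c d. \<Sum>i\<in>{i. F i \<noteq> (\<lambda>_ _. 0) \<and> G (n - i) \<noteq> (\<lambda>_ _. 0)}.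
                         ocomp (F i) (G (n - i)) c d)"

definition lderiv :: "(int \<Rightarrow> 'b \<Rightarrow> 'c \<Rightarrow> 'k::comm_ring_1) \<Rightarrow> int \<Rightarrow> 'b \<Rightarrow> 'c \<Rightarrow> 'k" where
  "lderiv F n = (\<lambda>c d. of_int (n + 1) * F (n + 1) c d)"

definition conn :: "('i, 'k::field_char_0) dga \<Rightarrow> int \<Rightarrow> 'i \<times> 'i list \<Rightarrow> 'i \<times> 'i list \<Rightarrow> 'k" where
  "conn A n = (if n = -2 then (\<lambda>c d. (1/2) * nop A (edel A) c d)
               else if n = -1 then (\<lambda>c d. (1/2) * (nop A (Ebig A) c d - nop A (gam A) c d))
               else (\<lambda>_ _. 0))"

text \<open>(X \<otimes> 1)(x \<otimes> y) = Xx \<otimes> y;  (1 \<otimes> Y)(x \<otimes> y) = (-1)^{|Y||x|} x \<otimes> Yy,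
  where p is the parity of Y.\<close>
definition ten1 :: "('a \<Rightarrow> 'a \<Rightarrow> 'k::comm_ring_1) \<Rightarrow> 'a \<times> 'b \<Rightarrow> 'a \<times> 'b \<Rightarrow> 'k" where
  "ten1 T = (\<lambda>(x, y) (x', y'). if y' = y then T x x' else 0)"

definition ten2 :: "('i, 'k::field_char_0) dga \<Rightarrow> bool \<Rightarrow> ('b \<Rightarrow> 'b \<Rightarrow> 'k)
                    \<Rightarrow> ('i \<times> 'i list) \<times> 'b \<Rightarrow> ('i \<times> 'i list) \<times> 'b \<Rightarrow> 'k" where
  "ten2 A p T = (\<lambda>(x, y) (x', y'). if x' = x then ksgn (p \<and> cpar A x) * T y y' else 0)"

text \<open>A permutation is a list p of tags 0..N-1; position a of the result holds entry p!a.
  Its Koszul sign (adjacent transposition of x,y contributes (-1)^{|\<Pi>x||\<Pi>y|}) is the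
  parity of the number of inversions between entries of odd \<Pi>-parity (pp).\<close>
definition ksign :: "(nat \<Rightarrow> bool) \<Rightarrow> nat list \<Rightarrow> bool" where
  "ksign pp p = odd (card {(a, b). a < b \<and> b < length p \<and> p ! b < p ! a
                                  \<and> pp (p ! a) \<and> pp (p ! b)})"

definition is_perm :: "nat list \<Rightarrow> nat \<Rightarrow> bool" where
  "is_perm p N \<longleftrightarrow> distinct p \<and> set p = {0..<N}"

definition shuffles :: "nat \<Rightarrow> nat \<Rightarrow> nat list set" where
  "shuffles n m = {p. is_perm p (n + m) \<and> sorted (filter (\<lambda>t. t < n) p)
                      \<and> sorted (filter (\<lambda>t. n \<le> t) p)}"

definition cshuffles :: "nat \<Rightarrow> nat \<Rightarrow> nat list set" where
  "cshuffles n m = {p. is_perm p (n + m + 2)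
      \<and> (\<exists>k. filter (\<lambda>t. t \<le> n) p = rotate k [0..<Suc n])
      \<and> (\<exists>k. filter (\<lambda>t. n < t) p = rotate k [Suc n..<n + m + 2])
      \<and> (\<exists>a b. a < b \<and> b < length p \<and> p ! a = 0 \<and> p ! b = Suc n)}"

definition sh :: "('i, 'k::field_char_0) dga \<Rightarrow> ('j, 'k) dga
     \<Rightarrow> ('i \<times> 'i list) \<times> ('j \<times> 'j list) \<Rightarrow> ('i \<times> 'j) \<times> ('i \<times> 'j) list \<Rightarrow> 'k" where
  "sh A B c = (let i0 = fst (fst c); is = snd (fst c); j0 = fst (snd c); js = snd (snd c);
      n = length is; m = length js;
      E = (\<lambda>t. if t < n then (is ! t, one_idx B) else (one_idx A, js ! (t - n)));
      pp = (\<lambda>t. if t < n then \<not> par A (is ! t) else \<not> par B (js ! (t - n)));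
      st = (par B j0 \<and> odd (pisum A is))
    in (\<lambda>d. \<Sum>p\<in>shuffles n m. ksgn (st \<noteq> ksign pp p) * bv ((i0, j0), map E p) d))"

definition Sh :: "('i, 'k::field_char_0) dga \<Rightarrow> ('j, 'k) dga
     \<Rightarrow> ('i \<times> 'i list) \<times> ('j \<times> 'j list) \<Rightarrow> ('i \<times> 'j) \<times> ('i \<times> 'j) list \<Rightarrow> 'k" where
  "Sh A B c = (let L1 = fst (fst c) # snd (fst c); L2 = fst (snd c) # snd (snd c);
      n = length (snd (fst c)); m = length (snd (snd c));
      E = (\<lambda>t. if t \<le> n then (L1 ! t, one_idx B) else (one_idx A, L2 ! (t - Suc n)));
      pp = (\<lambda>t. if t \<le> n then \<not> par A (L1 ! t) else \<not> par B (L2 ! (t - Suc n)));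
      st = (par A (fst (fst c)) \<noteq> odd (pisum A (snd (fst c))))
    in (\<lambda>d. \<Sum>p\<in>cshuffles n m. ksgn (st \<noteq> ksign pp p)
                                  * bv ((one_idx A, one_idx B), map E p) d))"

definition Phi :: "('i, 'k::field_char_0) dga \<Rightarrow> ('j, 'k) dga \<Rightarrow> int
     \<Rightarrow> ('i \<times> 'i list) \<times> ('j \<times> 'j list) \<Rightarrow> ('i \<times> 'j) \<times> ('i \<times> 'j) list \<Rightarrow> 'k" where
  "Phi A B n = (if n = 0 then nop (dga_tensor A B) (sh A B)
                else if n = 1 then nop (dga_tensor A B) (Sh A B) else (\<lambda>_ _. 0))"

definition diffu :: "('i, 'k::field_char_0) dga \<Rightarrow> int \<Rightarrow> 'i \<times> 'i list \<Rightarrow> 'i \<times> 'i list \<Rightarrow> 'k" where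
  "diffu A n = (if n = 0 then nop A (hoch_b A) else if n = 1 then nop A (Bop A) else (\<lambda>_ _. 0))"

definition src_diffu :: "('i, 'k::field_char_0) dga \<Rightarrow> ('j, 'k) dga \<Rightarrow> int
     \<Rightarrow> ('i \<times> 'i list) \<times> ('j \<times> 'j list) \<Rightarrow> ('i \<times> 'i list) \<times> ('j \<times> 'j list) \<Rightarrow> 'k" where
  "src_diffu A B n = (\<lambda>c d. ten1 (diffu A n) c d + ten2 A True (diffu B n) c d)"

definition src_conn :: "('i, 'k::field_char_0) dga \<Rightarrow> ('j, 'k) dga \<Rightarrow> int
     \<Rightarrow> ('i \<times> 'i list) \<times> ('j \<times> 'j list) \<Rightarrow> ('i \<times> 'i list) \<times> ('j \<times> 'j list) \<Rightarrow> 'k" where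
  "src_conn A B n = (\<lambda>c d. ten1 (conn A n) c d + ten2 A False (conn B n) c d)"

definition defect :: "('i, 'k::field_char_0) dga \<Rightarrow> ('j, 'k) dga \<Rightarrow> int
     \<Rightarrow> ('i \<times> 'i list) \<times> ('j \<times> 'j list) \<Rightarrow> ('i \<times> 'j) \<times> ('i \<times> 'j) list \<Rightarrow> 'k" where
  "defect A B n = (\<lambda>c d. lderiv (Phi A B) n c d
                        + lmul (conn (dga_tensor A B)) (Phi A B) n c d
                        - lmul (Phi A B) (src_conn A B) n c d)"

end

theory Submission
  imports Defs "HOL-Library.Multiset"
begin

text \<open>
  An operator T on chains is studied through its transpose, which acts on functions f of basis chains;
  the normalized complex is seen by the functions vanishing on chains with a unit among the bar entries.
  Every odd symbol (an even basis element, read in \<Pi>A, d, a product, the separator of the two factors)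
  gets a natural number as tag, and a word carries the sign of the permutation sorting its tags.
  In this model rotations, shuffles, b and B are sign-free sums over words.

  Write d = d' + d'' for the two parts of the differential of the tensor product and e', e'', E', E'' for the
  corresponding parts of e and E. Let Q be the sum over cyclic shuffles (a'_0 left of a''_0) in which d'' hits
  one of the entries that follow a''_0 in the rotated list of the a''-entries, and P the same with the roles of
  the two factors exchanged. Let Z = sh (B \<otimes> 1)(1 \<otimes> B), up to sign the sum over all cyclic shuffles. Then
  [b, Q] = sh (1 \<otimes> E) - E'' sh + Sh (1 \<otimes> e) - e'' Sh and
  [b, P] = E' sh - sh (E \<otimes> 1) + (Z - Sh)(e \<otimes> 1) - e' (Z - Sh).
  The identity b Sh + B sh = sh B + Sh b turns Z (e \<otimes> 1) - e' Z into the commutator of B with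
  sh (e \<otimes> 1)(1 \<otimes> B), whence the homotopy is - sh (e \<otimes> 1)(1 \<otimes> B) / (2 u^2) + (P - Q) / (2 u).
\<close>

text \<open>Why P uses the exchanged order: \<open>b\<close> multiplies the unit of 1[...] into both
  ends of the word, and these terms cancel cyclically except where the left one of the two zeroth
  letters comes first or the right one comes last. If d hits a letter following the right one, the
  second kind is void and the first is the wanted sh after E; if it hit a letter following the left
  one, an unwanted boundary term would survive. So each factor is differentiated in the order in
  which its own zeroth letter is the right one. For the second factor this is the order of Sh, for
  the first it is the complementary order, which is how Z - Sh enters. The surplus with Z is
  absorbed through B, at the price of a term in u^(-2); that term is harmless because its commutator
  with b vanishes. The derivative d/du (u Sh) = Sh is cancelled by the grading: Sh turns both zeroth
  letters into bar entries, so its commutator with \<gamma> is 2 Sh, and the connection contains -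
  \<gamma> / (2 u).\<close>

section \<open>Linear functionals with finitely many coefficients\<close>

definition fs :: "(('a \<Rightarrow> 'k::comm_ring_1) \<Rightarrow> 'k) \<Rightarrow> bool" where
  "fs X \<longleftrightarrow> (\<exists>Z c. finite Z \<and> (\<forall>G. X G = (\<Sum>z\<in>Z. c z * G z)))"

lemma fsE:
  assumes "fs X" obtains Z c where "finite Z" "\<And>G. X G = (\<Sum>z\<in>Z. c z * G z)"
  using assms unfolding fs_def by blast

lemma fs_add: "fs X \<Longrightarrow> X (\<lambda>z. G z + G' z) = X G + X G'"
  by (erule fsE) (simp add: sum.distrib distrib_left)

lemma fs_minus: "fs X \<Longrightarrow> X (\<lambda>z. - G z) = - X G"
  by (erule fsE) (simp add: sum_negf)

lemma fs_diff: "fs X \<Longrightarrow> X (\<lambda>z. G z - G' z) = X G - X G'"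
  by (erule fsE) (simp add: sum_subtractf right_diff_distrib)

lemma fs_scale: "fs X \<Longrightarrow> X (\<lambda>z. c * G z) = c * X G"
  by (erule fsE) (simp add: sum_distrib_left algebra_simps)

lemma fs_zero: "fs X \<Longrightarrow> X (\<lambda>z. 0) = 0"
  by (erule fsE) simp

text \<open>An exchange of two finite sums. Operators acting at different places of a word commute
  for this reason alone; many of the later lemmas ending in \<open>_bind\<close> are
  instances.\<close>

lemma fs_commute:
  assumes "fs X" "fs Y"
  shows "X (\<lambda>z. Y (\<lambda>w. \<phi> z w)) = Y (\<lambda>w. X (\<lambda>z. \<phi> z w))"
proof -
  obtain Z c where X: "finite Z" "\<And>G. X G = (\<Sum>z\<in>Z. c z * G z)" using assms(1) unfolding fs_def by blast
  obtain W d where Y: "finite W" "\<And>G. Y G = (\<Sum>z\<in>W. d z * G z)" using assms(2) unfolding fs_def by blast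
  show ?thesis unfolding X Y sum_distrib_left
    by (subst sum.swap) (simp add: mult.left_commute)
qed

lemma fs_sum: "(\<And>i. i \<in> I \<Longrightarrow> fs (X i)) \<Longrightarrow> finite I \<Longrightarrow> fs (\<lambda>\<phi>. \<Sum>i\<in>I. a i * X i \<phi>)"
proof -
  assume *: "\<And>i. i \<in> I \<Longrightarrow> fs (X i)" and I: "finite I"
  obtain Z c where Z: "\<And>i. i \<in> I \<Longrightarrow> finite (Z i) \<and> (\<forall>G. X i G = (\<Sum>z\<in>Z i. c i z * G z))"
    using * unfolding fs_def by metis
  let ?U = "\<Union>i\<in>I. Z i"
  have fU: "finite ?U" using I Z by blast
  have "X i G = (\<Sum>z\<in>?U. (if z \<in> Z i then c i z else 0) * G z)" if "i \<in> I" for i G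
  proof -
    have "(\<Sum>z\<in>?U. (if z \<in> Z i then c i z else 0) * G z) = (\<Sum>z\<in>Z i. c i z * G z)"
      by (rule sum.mono_neutral_cong_right) (use fU that in auto)
    then show ?thesis using Z that by simp
  qed
  then have "(\<Sum>i\<in>I. a i * X i G) = (\<Sum>z\<in>?U. (\<Sum>i\<in>I. a i * (if z \<in> Z i then c i z else 0)) * G z)" for G
    by (simp add: sum_distrib_left sum_distrib_right sum.swap[of _ I] mult.assoc)
  then show ?thesis unfolding fs_def using fU by (intro exI[of _ ?U] exI) auto
qed

lemma fs_point: "fs (\<lambda>\<phi>. \<phi> a)"
  unfolding fs_def by (intro exI[of _ "{a}"] exI[of _ "\<lambda>_. 1"]) simp

lemma fs_0: "fs (\<lambda>\<phi>. 0)"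
  unfolding fs_def by (intro exI[of _ "{}"]) simp

lemma fs_plus: "fs X \<Longrightarrow> fs Y \<Longrightarrow> fs (\<lambda>\<phi>. X \<phi> + Y \<phi>)"
  using fs_sum[of "UNIV::bool set" "\<lambda>i. if i then X else Y" "\<lambda>_. 1"] by (simp add: UNIV_bool add.commute)

lemma fs_mult: "fs X \<Longrightarrow> fs (\<lambda>\<phi>. c * X \<phi>)"
  using fs_sum[of "{()}" "\<lambda>i. X" "\<lambda>_. c"] by simp

lemma fs_uminus: "fs X \<Longrightarrow> fs (\<lambda>\<phi>. - X \<phi>)"
  using fs_mult[of X "-1"] by simp

lemma fs_bind:
  assumes "fs X" "\<And>z. fs (Y z)" shows "fs (\<lambda>\<phi>. X (\<lambda>z. Y z \<phi>))"
proof -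
  obtain Z c where X: "finite Z" "\<And>G. X G = (\<Sum>z\<in>Z. c z * G z)" using assms(1) unfolding fs_def by blast
  show ?thesis unfolding X by (rule fs_sum) (use assms X in auto)
qed

lemma fs_map: "fs X \<Longrightarrow> fs (\<lambda>\<phi>. X (\<lambda>z. \<phi> (g z)))"
  using fs_bind[of X "\<lambda>z \<phi>. \<phi> (g z)"] by (simp add: fs_point)


section \<open>Words\<close>

text \<open>The value 0 on the empty word makes terms with a missing neighbour vanish by themselves:
  a product with the next letter is written as \<open>Fst\<close> of the remaining word.\<close>

definition Fst :: "('a \<Rightarrow> 'a list \<Rightarrow> 'k::comm_ring_1) \<Rightarrow> 'a list \<Rightarrow> 'k" where
  "Fst f w = (case w of [] \<Rightarrow> 0 | x # w' \<Rightarrow> f x w')"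

definition Lst :: "('a \<Rightarrow> 'a list \<Rightarrow> 'k::comm_ring_1) \<Rightarrow> 'a list \<Rightarrow> 'k" where
  "Lst f w = (if w = [] then 0 else f (last w) (butlast w))"

lemma Fst_simps [simp]: "Fst f [] = 0" "Fst f (x # w) = f x w"
  by (simp_all add: Fst_def)

lemma Lst_simps [simp]: "Lst f [] = 0" "Lst f (w @ [x]) = f x w"
  by (simp_all add: Lst_def)

lemma Lst_Cons: "Lst f (x # w) = (if w = [] then f x [] else Lst (\<lambda>l w'. f l (x # w')) w)"
  by (simp add: Lst_def)

lemma Lst_append: "w \<noteq> [] \<Longrightarrow> Lst f (u @ w) = Lst (\<lambda>l w'. f l (u @ w')) w"
  by (simp add: Lst_def butlast_append)

lemma Fst_add: "Fst (\<lambda>x w. f x w + g x w) u = Fst f u + Fst g u"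
  by (cases u) auto

lemma Lst_add: "Lst (\<lambda>x w. f x w + g x w) u = Lst f u + Lst g u"
  by (simp add: Lst_def)

lemma Fst_0: "Fst (\<lambda>x w. 0) u = 0"
  by (cases u) auto

lemma Lst_0: "Lst (\<lambda>x w. 0) u = 0"
  by (simp add: Lst_def)

lemma Fst_bind: "fs X \<Longrightarrow> X (\<lambda>z. Fst (f z) w) = Fst (\<lambda>x w'. X (\<lambda>z. f z x w')) w"
  by (cases w) (auto simp: fs_zero)

lemma Lst_bind: "fs X \<Longrightarrow> X (\<lambda>z. Lst (f z) w) = Lst (\<lambda>x w'. X (\<lambda>z. f z x w')) w"
  by (cases w rule: rev_cases) (auto simp: fs_zero)

lemma fs_Fst: "(\<And>x w. fs (f x w)) \<Longrightarrow> fs (\<lambda>\<phi>. Fst (\<lambda>x w. f x w \<phi>) u)"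
  by (cases u) (auto intro: fs_0)

lemma fs_Lst: "(\<And>x w. fs (f x w)) \<Longrightarrow> fs (\<lambda>\<phi>. Lst (\<lambda>x w. f x w \<phi>) u)"
  by (cases u rule: rev_cases) (auto intro: fs_0)

section \<open>Shuffles and deconcatenations of words\<close>

text \<open>A shuffle is a functional of a test function instead of a set of words, so
  multiplicities and linearity need no care. No signs occur, because the letters are going to carry
  their own tags.\<close>

fun shf :: "('a list \<Rightarrow> 'k::comm_ring_1) \<Rightarrow> 'a list \<Rightarrow> 'a list \<Rightarrow> 'k" where
  "shf \<phi> [] v = \<phi> v"
| "shf \<phi> (p # u) [] = \<phi> (p # u)"
| "shf \<phi> (p # u) (q # v) = shf (\<lambda>w. \<phi> (p # w)) u (q # v) + shf (\<lambda>w. \<phi> (q # w)) (p # u) v"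

lemma shf_Nil1 [simp]: "shf \<phi> [] = \<phi>"
  by (rule ext) simp

lemma shf_Nil2 [simp]: "shf \<phi> u [] = \<phi> u"
  by (cases u) auto

lemma fs_shf: "fs (\<lambda>\<phi>. shf \<phi> u v)"
proof (induction u arbitrary: v)
  case (Cons p u)
  note IHu = Cons.IH
  show ?case
  proof (induction v)
    case (Cons q v)
    show ?case
      using fs_plus[OF fs_map[OF IHu[of "q # v"], of "(#) p"] fs_map[OF Cons.IH, of "(#) q"]] by simp
  qed (simp add: fs_point)
qed (simp add: fs_point)

text \<open>The test function matters only on rearrangements of the given letters. Through this
  rule, parity and tag conditions on the two factors become available for the shuffled word.\<close>

lemma shf_cong:
  "(\<And>w. mset w = mset u + mset v \<Longrightarrow> \<phi> w = \<psi> w) \<Longrightarrow> shf \<phi> u v = shf \<psi> u v"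
proof (induction \<phi> u v arbitrary: \<psi> rule: shf.induct)
  case (3 \<phi> p u q v)
  then show ?case by (auto intro!: arg_cong2[of _ _ _ _ "(+)"] "3.IH")
qed auto

lemma shf_add: "shf (\<lambda>w. \<phi> w + \<psi> w) u v = shf \<phi> u v + shf \<psi> u v"
  by (rule fs_add[OF fs_shf])

lemma shf_bind: "fs X \<Longrightarrow> X (\<lambda>z. shf (\<phi> z) u v) = shf (\<lambda>w. X (\<lambda>z. \<phi> z w)) u v"
  by (rule fs_commute[OF _ fs_shf])

lemma shf_commute: "shf \<phi> u v = shf \<phi> v u"
proof (induction \<phi> u v rule: shf.induct)
  case (3 \<phi> p u q v)
  then show ?case by (simp add: add.commute)
qed auto

lemma shf_map: "shf (\<lambda>w. \<phi> (map g w)) u v = shf \<phi> (map g u) (map g v)"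
proof (induction u arbitrary: v \<phi>)
  case (Cons p u)
  show ?case
  proof (induction v arbitrary: \<phi>)
    case (Cons q v)
    show ?case
      using Cons.IH[of "\<lambda>w. \<phi> (g q # w)"] \<open>\<And>v \<phi>. shf (\<lambda>w. \<phi> (map g w)) u v = shf \<phi> (map g u) (map g v)\<close>[of "\<lambda>w. \<phi> (g p # w)" "q # v"]
      by simp
  qed simp
qed simp

lemma shf_Fst:
  "shf (Fst f) u v = Fst (\<lambda>p u'. shf (f p) u' v) u + Fst (\<lambda>q v'. shf (f q) u v') v"
  by (cases u; cases v) auto

text \<open>The last letter of a shuffle is the last letter of one of the two words. Since
  \<open>shf\<close> peels off first letters, this needs an induction, unlike
  \<open>shf_Fst\<close>.\<close>

lemma shf_Lst:
  "shf (Lst f) u v = Lst (\<lambda>p u'. shf (f p) u' v) u + Lst (\<lambda>q v'. shf (f q) u v') v"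
proof (induction "length u + length v" arbitrary: u v f rule: less_induct)
  case less
  show ?case
  proof (cases u; cases v)
    fix p u' q v' assume u: "u = p # u'" and v: "v = q # v'"
    have 1: "shf (\<lambda>w. Lst f (p # w)) u' (q # v') = shf (Lst (\<lambda>l w. f l (p # w))) u' (q # v')"
      by (rule shf_cong) (auto simp: Lst_Cons)
    have 2: "shf (\<lambda>w. Lst f (q # w)) (p # u') v' = shf (Lst (\<lambda>l w. f l (q # w))) (p # u') v'"
      by (rule shf_cong) (auto simp: Lst_Cons)
    have 3: "shf (Lst (\<lambda>l w. f l (p # w))) u' (q # v') =
       Lst (\<lambda>x w. shf (\<lambda>y. f x (p # y)) w (q # v')) u' + Lst (\<lambda>x w. shf (\<lambda>y. f x (p # y)) u' w) (q # v')"
      by (rule less) (auto simp: u v)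
    have 4: "shf (Lst (\<lambda>l w. f l (q # w))) (p # u') v' =
       Lst (\<lambda>x w. shf (\<lambda>y. f x (q # y)) w v') (p # u') + Lst (\<lambda>x w. shf (\<lambda>y. f x (q # y)) (p # u') w) v'"
      by (rule less) (auto simp: u v)
    show ?thesis unfolding u v shf.simps 1 2 3 4
      by (auto simp: Lst_Cons Lst_add algebra_simps)
  qed auto
qed

text \<open>Deconcatenation, the coproduct of the tensor coalgebra, evaluated on
  \<open>\<psi>\<close>.\<close>

fun spl :: "('a list \<Rightarrow> 'a list \<Rightarrow> 'k::comm_ring_1) \<Rightarrow> 'a list \<Rightarrow> 'k" where
  "spl \<psi> [] = \<psi> [] []"
| "spl \<psi> (x # w) = \<psi> [] (x # w) + spl (\<lambda>a b. \<psi> (x # a) b) w"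

lemma fs_spl: "fs (\<lambda>\<phi>. spl (\<lambda>a b. \<phi> (a, b)) w)"
proof (induction w)
  case (Cons x w)
  show ?case using fs_plus[OF fs_point fs_map[OF Cons, of "\<lambda>(a,b). (x # a, b)"]] by simp
qed (simp add: fs_point)

lemma spl_bind: "fs X \<Longrightarrow> X (\<lambda>z. spl (\<phi> z) w) = spl (\<lambda>a b. X (\<lambda>z. \<phi> z a b)) w"
  using fs_commute[OF _ fs_spl, of X "\<lambda>z (a,b). \<phi> z a b" w] by simp

lemma spl_add: "spl (\<lambda>a b. \<phi> a b + \<psi> a b) w = spl \<phi> w + spl \<psi> w"
  using fs_add[OF fs_spl, of "\<lambda>(a,b). \<phi> a b" "\<lambda>(a,b). \<psi> a b" w] by simp

lemma spl_minus: "spl (\<lambda>a b. - \<phi> a b) w = - spl \<phi> w"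
  using fs_minus[OF fs_spl, of "\<lambda>(a,b). \<phi> a b" w] by simp

lemma spl_0: "spl (\<lambda>a b. 0) w = 0"
  using fs_zero[OF fs_spl[of w]] by simp

lemma fs_splI: "(\<And>a b. fs (\<lambda>\<phi>. F \<phi> a b)) \<Longrightarrow> fs (\<lambda>\<phi>. spl (F \<phi>) w)"
  using fs_bind[OF fs_spl, of "\<lambda>p \<phi>. F \<phi> (fst p) (snd p)" w] by simp

lemma spl_cong: "(\<And>a b. w = a @ b \<Longrightarrow> \<phi> a b = \<psi> a b) \<Longrightarrow> spl \<phi> w = spl \<psi> w"
proof (induction w arbitrary: \<phi> \<psi>)
  case (Cons x w)
  have "spl (\<lambda>a b. \<phi> (x # a) b) w = spl (\<lambda>a b. \<psi> (x # a) b) w"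
    by (rule Cons.IH) (simp add: Cons.prems)
  then show ?case by (simp add: Cons.prems)
qed simp

lemma spl_map: "spl (\<lambda>a b. \<phi> (map g a) (map g b)) w = spl \<phi> (map g w)"
proof (induction w arbitrary: \<phi>)
  case (Cons x w)
  show ?case using Cons.IH[of "\<lambda>a. \<phi> (g x # a)"] by simp
qed simp

lemma spl_snoc: "spl \<psi> (w @ [x]) = spl (\<lambda>a b. \<psi> a (b @ [x])) w + \<psi> (w @ [x]) []"
  by (induction w arbitrary: \<psi>) (auto simp: add.assoc)

text \<open>Both sides run over the choices of one letter of \<open>w\<close>, seen either as the
  first letter of the right piece or as the last letter of the left piece. This reindexing is the
  source of the cyclic cancellations below.\<close>

lemma spl_Fst_Lst:
  fixes G :: "'a \<Rightarrow> 'a list \<Rightarrow> 'a list \<Rightarrow> 'b::comm_ring_1"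
  shows
  "spl (\<lambda>a b. Fst (\<lambda>x b'. G x a b') b) w = spl (\<lambda>a b. Lst (\<lambda>x a'. G x a' b) a) w"
proof (induction w arbitrary: G)
  case (Cons x w)
  have E: "(if a = [] then G x [] b else Lst (\<lambda>l w'. G l (x # w') b) a)
        = (if a = [] then G x [] b else 0) + Lst (\<lambda>l w'. G l (x # w') b) a" for a b
      by simp
  have F: "spl (\<lambda>a b. if a = [] then g b else 0) w = g w" for g :: "'a list \<Rightarrow> 'b" and w :: "'a list"
    by (cases w) (simp_all add: spl_0)
  show ?case using Cons.IH[of "\<lambda>y a b. G y (x # a) b"] by (simp add: Lst_Cons E spl_add F)
qed simp

lemma spl_Nil1: "spl (\<lambda>a b. if a = [] then g a b else 0) w = g [] w"
  by (cases w) (simp_all add: spl_0)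

lemma spl_Nil2: "spl (\<lambda>a b. if b = [] then g a b else 0) w = g w []"
  by (cases w rule: rev_cases) (simp_all add: spl_0 spl_snoc)

text \<open>Cutting a shuffled word amounts to cutting both words and shuffling the pieces on each
  side: the compatibility of product and coproduct in the shuffle bialgebra.\<close>

lemma shf_spl:
  "shf (spl \<psi>) u v = spl (\<lambda>u1 u2. spl (\<lambda>v1 v2. shf (\<lambda>a. shf (\<psi> a) u2 v2) u1 v1) v) u"
proof (induction "length u + length v" arbitrary: u v \<psi> rule: less_induct)
  case less
  show ?case
  proof (cases u; cases v)
    fix p u' q v' assume u: "u = p # u'" and v: "v = q # v'"
    have 1: "shf (\<lambda>w. spl \<psi> (p # w)) u' v = shf (\<lambda>w. \<psi> [] (p # w)) u' v + 
       spl (\<lambda>u1 u2. spl (\<lambda>v1 v2. shf (\<lambda>a. shf (\<psi> (p # a)) u2 v2) u1 v1) v) u'"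
      using less[of u' v "\<lambda>a. \<psi> (p # a)"] by (simp add: u v shf_add)
    have 2: "shf (\<lambda>w. spl \<psi> (q # w)) u v' = shf (\<lambda>w. \<psi> [] (q # w)) u v' + 
       spl (\<lambda>u1 u2. spl (\<lambda>v1 v2. shf (\<lambda>a. shf (\<psi> (q # a)) u2 v2) u1 v1) v') u"
      using less[of u v' "\<lambda>a. \<psi> (q # a)"] by (simp add: u v shf_add)
    have "shf (spl \<psi>) u v = shf (\<lambda>w. spl \<psi> (p # w)) u' v + shf (\<lambda>w. spl \<psi> (q # w)) u v'"
      by (simp add: u v)
    then show ?thesis unfolding 1 2
      by (simp add: u v spl_add algebra_simps)
  qed auto
qed

section \<open>The bar differential, and shuffles with an order constraint\<close>

text \<open>The bar differential: the coderivation of the tensor coalgebra with linear part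
  \<open>D\<close> and quadratic part \<open>m\<close>, without the cyclic product of the last
  letter with the first.\<close>

primrec dd :: "('a \<Rightarrow> 'a \<Rightarrow> ('a \<Rightarrow> 'k) \<Rightarrow> 'k) \<Rightarrow> ('a \<Rightarrow> ('a \<Rightarrow> 'k) \<Rightarrow> 'k)
    \<Rightarrow> ('a list \<Rightarrow> 'k::comm_ring_1) \<Rightarrow> 'a list \<Rightarrow> 'k" where
  "dd m D \<phi> [] = 0"
| "dd m D \<phi> (x # w) = D x (\<lambda>y. \<phi> (y # w)) + Fst (\<lambda>y w'. m x y (\<lambda>z. \<phi> (z # w'))) w
     + dd m D (\<lambda>w. \<phi> (x # w)) w"

text \<open>The bar differential of \<open>u @ a # v\<close>, keeping track of the marked letter: a
  product of \<open>a\<close> with a neighbour is marked again, as for the zeroth letter of a cyclic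
  word.\<close>

definition ddp where
  "ddp m D \<psi> u a v = dd m D (\<lambda>u'. \<psi> u' a v) u + Lst (\<lambda>l u'. m l a (\<lambda>z. \<psi> u' z v)) u + D a (\<lambda>z. \<psi> u z v)
     + Fst (\<lambda>f v'. m a f (\<lambda>z. \<psi> u z v')) v + dd m D (\<psi> u a) v"

text \<open>The shuffles of u1 a u2 with v1 c v2 in which a stays to the left of c.\<close>

fun S :: "('a list \<Rightarrow> 'k::comm_ring_1) \<Rightarrow> 'a list \<Rightarrow> 'a \<Rightarrow> 'a list \<Rightarrow> 'a list \<Rightarrow> 'a \<Rightarrow> 'a list \<Rightarrow> 'k" where
  "S \<phi> [] a u2 [] c v2 = shf (\<lambda>w. \<phi> (a # w)) u2 (c # v2)"
| "S \<phi> [] a u2 (q # v1) c v2 = shf (\<lambda>w. \<phi> (a # w)) u2 (q # v1 @ c # v2) + S (\<lambda>w. \<phi> (q # w)) [] a u2 v1 c v2"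
| "S \<phi> (p # u1) a u2 [] c v2 = S (\<lambda>w. \<phi> (p # w)) u1 a u2 [] c v2"
| "S \<phi> (p # u1) a u2 (q # v1) c v2 = S (\<lambda>w. \<phi> (p # w)) u1 a u2 (q # v1) c v2
     + S (\<lambda>w. \<phi> (q # w)) (p # u1) a u2 v1 c v2"

text \<open>Unapplied forms of the recursion, needed because \<open>S\<close> is mostly passed on
  with its last arguments missing.\<close>

lemma S_ext [simp]:
  "S \<phi> [] a u2 [] = (\<lambda>c v2. shf (\<lambda>w. \<phi> (a # w)) u2 (c # v2))"
  "S \<phi> [] a u2 (q # v1) = (\<lambda>c v2. shf (\<lambda>w. \<phi> (a # w)) u2 (q # v1 @ c # v2) + S (\<lambda>w. \<phi> (q # w)) [] a u2 v1 c v2)"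
  "S \<phi> (p # u1) a u2 [] = S (\<lambda>w. \<phi> (p # w)) u1 a u2 []"
  "S \<phi> (p # u1) a u2 (q # v1) = (\<lambda>c v2. S (\<lambda>w. \<phi> (p # w)) u1 a u2 (q # v1) c v2
     + S (\<lambda>w. \<phi> (q # w)) (p # u1) a u2 v1 c v2)"
  by (intro ext, simp)+

lemma fs_S: "fs (\<lambda>\<phi> :: 'a list \<Rightarrow> 'k::comm_ring_1. S \<phi> u1 a u2 v1 c v2)"
proof (induction "length u1 + length v1" arbitrary: u1 v1 rule: less_induct)
  case less
  have 1: "fs (\<lambda>\<phi>::'a list \<Rightarrow> 'k. shf (\<lambda>w. \<phi> (a # w)) u2 w')" for w'
    by (rule fs_map[OF fs_shf])
  show ?case
  proof (cases u1; cases v1)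
    fix q v assume u: "u1 = []" and v: "v1 = q # v"
    have "fs (\<lambda>\<phi>::'a list \<Rightarrow> 'k. S \<phi> [] a u2 v c v2)" by (rule less) (auto simp: u v)
    from fs_plus[OF 1 fs_map[OF this, of "(#) q"]] show ?thesis by (simp add: u v)
  next
    fix p u assume u: "u1 = p # u" and v: "v1 = []"
    have "fs (\<lambda>\<phi>::'a list \<Rightarrow> 'k. S \<phi> u a u2 v1 c v2)" by (rule less) (auto simp: u v)
    from fs_map[OF this, of "(#) p"] show ?thesis by (simp add: u v)
  next
    fix p u q v assume u: "u1 = p # u" and v: "v1 = q # v"
    have *: "fs (\<lambda>\<phi>::'a list \<Rightarrow> 'k. S \<phi> u a u2 v1 c v2)" "fs (\<lambda>\<phi>::'a list \<Rightarrow> 'k. S \<phi> u1 a u2 v c v2)" by (rule less; simp add: u v)+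
    from fs_plus[OF fs_map[OF this(1), of "(#) p"] fs_map[OF this(2), of "(#) q"]]
    show ?thesis by (simp add: u v)
  qed (simp add: 1)
qed

lemma S_add: "S (\<lambda>w. \<phi> w + \<psi> w) u1 a u2 v1 c v2 = S \<phi> u1 a u2 v1 c v2 + S \<psi> u1 a u2 v1 c v2"
  by (rule fs_add[OF fs_S])

lemma S_bind: "fs X \<Longrightarrow> X (\<lambda>z. S (\<phi> z) u1 a u2 v1 c v2) = S (\<lambda>w. X (\<lambda>z. \<phi> z w)) u1 a u2 v1 c v2"
  by (rule fs_commute[OF _ fs_S])

lemma S_map: "S (\<lambda>w. \<phi> (map g w)) u1 a u2 v1 c v2
    = S \<phi> (map g u1) (g a) (map g u2) (map g v1) (g c) (map g v2)"
proof (induction "length u1 + length v1" arbitrary: u1 v1 \<phi> rule: less_induct)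
  case less
  have 1: "shf (\<lambda>w. \<phi> (g a # map g w)) u2 x = shf (\<lambda>w. \<phi> (g a # w)) (map g u2) (map g x)" for x \<phi>
    by (rule shf_map)
  have 2: "S (\<lambda>w. \<phi> (x # map g w)) u a u2 v c v2 = S (\<lambda>w. \<phi> (x # w)) (map g u) (g a) (map g u2) (map g v) (g c) (map g v2)"
    if "length u + length v < length u1 + length v1" for x u v
    using less[of u v "\<lambda>w. \<phi> (x # w)"] that by simp
  show ?case by (cases u1; cases v1) (simp_all add: 1 2)
qed

lemma S_cong:
  "(\<And>w. mset w = mset u1 + {#a#} + mset u2 + mset v1 + {#c#} + mset v2 \<Longrightarrow> \<phi> w = \<psi> w) \<Longrightarrow>
   S \<phi> u1 a u2 v1 c v2 = S \<psi> u1 a u2 v1 c v2"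
proof (induction "length u1 + length v1" arbitrary: u1 v1 \<phi> \<psi> rule: less_induct)
  case less
  have 1: "shf (\<lambda>w. \<phi> (a # w)) u2 x = shf (\<lambda>w. \<psi> (a # w)) u2 x" if "u1 = []" "x = v1 @ c # v2" for x
    by (rule shf_cong) (use that in \<open>auto intro!: less.prems\<close>)
  have 2: "S (\<lambda>w. \<phi> (x # w)) u a u2 v c v2 = S (\<lambda>w. \<psi> (x # w)) u a u2 v c v2"
    if "length u + length v < length u1 + length v1" "add_mset x (mset u + mset v) = mset u1 + mset v1" for x u v
  proof (rule less.hyps[OF that(1)])
    fix w assume w: "mset w = mset u + {#a#} + mset u2 + mset v + {#c#} + mset v2"
    have "mset (x # w) = mset u1 + {#a#} + mset u2 + mset v1 + {#c#} + mset v2"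
      using that(2)[symmetric] w by (simp add: ac_simps)
    then show "\<phi> (x # w) = \<psi> (x # w)" by (rule less.prems)
  qed
  show ?case by (cases u1; cases v1) (simp_all add: 1 2)
qed

text \<open>\<open>c\<close> never comes first, because \<open>a\<close> precedes it. If
  \<open>a\<close> itself is removed from the front, the order constraint is fulfilled and an
  unrestricted shuffle remains.\<close>

lemma S_Fst:
  "S (Fst f) u1 a u2 v1 c v2 = Fst (\<lambda>p u. S (f p) u a u2 v1 c v2) u1 + Fst (\<lambda>q v. S (f q) u1 a u2 v c v2) v1
     + (if u1 = [] then shf (f a) u2 (v1 @ c # v2) else 0)"
  by (cases u1; cases v1) auto

text \<open>Mirror image of \<open>S_Fst\<close>: \<open>a\<close> never comes last, and removing
  \<open>c\<close> from the end leaves an unrestricted shuffle. The induction is needed because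
  \<open>S\<close> is defined from the front.\<close>

lemma S_Lst:
  "S (Lst f) u1 a u2 v1 c v2 = Lst (\<lambda>p u. S (f p) u1 a u v1 c v2) u2 + Lst (\<lambda>q v. S (f q) u1 a u2 v1 c v) v2
     + (if v2 = [] then shf (f c) (u1 @ a # u2) v1 else 0)"
proof (induction "length u1 + length v1" arbitrary: u1 v1 f rule: less_induct)
  case less
  have 1: "shf (\<lambda>w. Lst f (a # w)) u2 (v @ c # v2) =
     Lst (\<lambda>p u. shf (\<lambda>w. f p (a # w)) u (v @ c # v2)) u2
     + Lst (\<lambda>q w'. shf (\<lambda>w. f q (a # w)) u2 (v @ c # w')) v2
     + (if v2 = [] then shf (\<lambda>w. f c (a # w)) u2 v else 0)" for v
  proof -
    have "shf (\<lambda>w. Lst f (a # w)) u2 (v @ c # v2) = shf (Lst (\<lambda>l w. f l (a # w))) u2 (v @ c # v2)"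
      by (rule shf_cong) (auto simp: Lst_Cons)
    also have "\<dots> = Lst (\<lambda>p u. shf (\<lambda>w. f p (a # w)) u (v @ c # v2)) u2
       + Lst (\<lambda>q w'. shf (\<lambda>w. f q (a # w)) u2 w') (v @ c # v2)" by (rule shf_Lst)
    also have "Lst (\<lambda>q w'. shf (\<lambda>w. f q (a # w)) u2 w') (v @ c # v2)
       = Lst (\<lambda>q w'. shf (\<lambda>w. f q (a # w)) u2 (v @ c # w')) v2
     + (if v2 = [] then shf (\<lambda>w. f c (a # w)) u2 v else 0)"
      by (simp add: Lst_append Lst_Cons)
    finally show ?thesis by simp
  qed
  have 2: "S (\<lambda>w. Lst f (x # w)) u a u2 v c v2 = Lst (\<lambda>p u'. S (\<lambda>w. f p (x # w)) u a u' v c v2) u2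
      + Lst (\<lambda>q v'. S (\<lambda>w. f q (x # w)) u a u2 v c v') v2
     + (if v2 = [] then shf (\<lambda>w. f c (x # w)) (u @ a # u2) v else 0)"
    if "length u + length v < length u1 + length v1" for x u v
  proof -
    have "S (\<lambda>w. Lst f (x # w)) u a u2 v c v2 = S (Lst (\<lambda>l w. f l (x # w))) u a u2 v c v2"
      by (rule S_cong) (auto simp: Lst_Cons)
    also note less[OF that]
    finally show ?thesis .
  qed
  show ?case
  proof (cases u1; cases v1)
    assume "u1 = []" "v1 = []"
    then show ?thesis using 1[of "[]"] by simp
  next
    fix q v assume uv: "u1 = []" "v1 = q # v"
    show ?thesis using 1[of v1] 2[of "[]" v q] by (cases v2) (simp_all add: uv Lst_add)
  next
    fix p u assume uv: "u1 = p # u" "v1 = []"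
    show ?thesis using 2[of u "[]" p] by (cases v2) (simp_all add: uv Lst_add)
  next
    fix p u q v assume uv: "u1 = p # u" "v1 = q # v"
    show ?thesis using 2[of u v1 p] 2[of u1 v q] by (cases v2) (simp_all add: uv Lst_add)
  qed
qed

text \<open>Graded commutativity of two sets of letters, in the form that the products in the two
  orders cancel. It is required only after evaluation on \<open>\<phi>\<close>, since the signs of
  the tags sit in the test function and not in the letters.\<close>

definition comm where
  "comm m P Q \<phi> \<longleftrightarrow> (\<forall>p\<in>P. \<forall>q\<in>Q. \<forall>a b. m p q (\<lambda>z. \<phi> (a @ z # b)) + m q p (\<lambda>z. \<phi> (a @ z # b)) = (0::'k::comm_ring_1))"

lemma comm_Cons: "comm m P Q \<phi> \<Longrightarrow> comm m P Q (\<lambda>w. \<phi> (x # w))"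
  unfolding comm_def
proof (intro ballI allI)
  fix p q a b assume *: "\<forall>p\<in>P. \<forall>q\<in>Q. \<forall>a b. m p q (\<lambda>z. \<phi> (a @ z # b)) + m q p (\<lambda>z. \<phi> (a @ z # b)) = 0" "p \<in> P" "q \<in> Q"
  show "m p q (\<lambda>z. \<phi> (x # a @ z # b)) + m q p (\<lambda>z. \<phi> (x # a @ z # b)) = 0"
    using *(1)[rule_format, OF *(2,3), of "x # a" b] by simp
qed

lemma comm_Nil: "comm m P Q \<phi> \<Longrightarrow> p \<in> P \<Longrightarrow> q \<in> Q \<Longrightarrow> m p q (\<lambda>z. \<phi> (z # b)) + m q p (\<lambda>z. \<phi> (z # b)) = 0"
  unfolding comm_def by (drule bspec, assumption, drule bspec, assumption, drule spec[of _ "[]"]) simp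

locale letter_ops =
  fixes m :: "'a \<Rightarrow> 'a \<Rightarrow> ('a \<Rightarrow> 'k::comm_ring_1) \<Rightarrow> 'k" and D :: "'a \<Rightarrow> ('a \<Rightarrow> 'k) \<Rightarrow> 'k"
  assumes fs_m: "fs (m x y)" and fs_D: "fs (D x)"
begin

lemma fs_dd: "fs (\<lambda>\<phi>. dd m D \<phi> w)"
proof (induction w)
  case (Cons x w)
  have 1: "fs (\<lambda>\<phi>. Fst (\<lambda>y w'. m x y (\<lambda>z. \<phi> (z # w'))) w)"
    by (rule fs_Fst) (rule fs_map[OF fs_m])
  show ?case using fs_plus[OF fs_plus[OF fs_map[OF fs_D[of x], of "\<lambda>y. y # w"] 1] fs_map[OF Cons, of "(#) x"]] by simp
qed (simp add: fs_0)

lemma dd_add: "dd m D (\<lambda>w. \<phi> w + \<psi> w) w = dd m D \<phi> w + dd m D \<psi> w"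
  by (rule fs_add[OF fs_dd])

lemma dd_0: "dd m D (\<lambda>w. 0) w = 0"
  using fs_zero[OF fs_dd[of w]] by simp

lemma dd_bind: "fs X \<Longrightarrow> X (\<lambda>z. dd m D (\<phi> z) w) = dd m D (\<lambda>w. X (\<lambda>z. \<phi> z w)) w"
  by (rule fs_commute[OF _ fs_dd])

lemma ddp_Cons: "ddp m D \<psi> (p # u) a v = D p (\<lambda>y. \<psi> (y # u) a v) + Fst (\<lambda>y w. m p y (\<lambda>z. \<psi> (z # w) a v)) u
    + (if u = [] then m p a (\<lambda>z. \<psi> [] z v) else 0) + ddp m D (\<lambda>u'. \<psi> (p # u')) u a v"
  by (simp add: ddp_def Lst_Cons algebra_simps)

lemma ddp_add: "ddp m D (\<lambda>u a v. \<phi> u a v + \<psi> u a v) u a v = ddp m D \<phi> u a v + ddp m D \<psi> u a v"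
  by (simp add: ddp_def dd_add Lst_add Fst_add fs_add[OF fs_m] fs_add[OF fs_D] algebra_simps)

lemma dd_append: "dd m D \<phi> (u @ a # v) = ddp m D (\<lambda>u a v. \<phi> (u @ a # v)) u a v"
proof (induction u arbitrary: \<phi>)
  case Nil
  show ?case by (simp add: ddp_def)
next
  case (Cons p u)
  show ?case using Cons.IH[of "\<lambda>w. \<phi> (p # w)"] by (cases u) (simp_all add: ddp_Cons algebra_simps)
qed

text \<open>Two adjacent letters from different words occur in both orders, and their products
  cancel by \<open>comm\<close>. Only products within one word remain, so the bar differential is a
  derivation of the shuffle product.\<close>

lemma shf_dd:
  assumes "comm m P Q \<phi>" "set u \<subseteq> P" "set v \<subseteq> Q"
  shows "shf (dd m D \<phi>) u v = dd m D (\<lambda>u'. shf \<phi> u' v) u + dd m D (\<lambda>v'. shf \<phi> u v') v"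
  using assms
proof (induction "length u + length v" arbitrary: u v \<phi> rule: less_induct)
  case less
  show ?case
  proof (cases u; cases v)
    fix p u' q v' assume u: "u = p # u'" and v: "v = q # v'"
    have IH1: "shf (dd m D (\<lambda>w. \<phi> (p # w))) u' v = dd m D (\<lambda>u'. shf (\<lambda>w. \<phi> (p # w)) u' v) u' + dd m D (\<lambda>v'. shf (\<lambda>w. \<phi> (p # w)) u' v') v"
      by (rule less.hyps) (use less.prems u v comm_Cons in auto)
    have IH2: "shf (dd m D (\<lambda>w. \<phi> (q # w))) u v' = dd m D (\<lambda>u'. shf (\<lambda>w. \<phi> (q # w)) u' v') u + dd m D (\<lambda>v'. shf (\<lambda>w. \<phi> (q # w)) u v') v'"
      by (rule less.hyps) (use less.prems u v comm_Cons in auto)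
    have c: "shf (\<lambda>w. m p q (\<lambda>z. \<phi> (z # w))) u' v' + shf (\<lambda>w. m q p (\<lambda>z. \<phi> (z # w))) u' v' = 0"
      unfolding shf_add[symmetric] using less.prems
      by (subst comm_Nil) (auto simp: u v fs_zero[OF fs_shf])
    show ?thesis using IH1 IH2 c
      unfolding u v
      by (simp add: shf_add shf_Fst Fst_add fs_add[OF fs_m] fs_add[OF fs_D] shf_bind[OF fs_m] shf_bind[OF fs_D] dd_add)
  qed (simp_all add: dd_0)
qed

text \<open>As in \<open>shf_dd\<close>, with one exception: \<open>a\<close> and \<open>c\<close>
  are adjacent in one order only, so the product \<open>m a c\<close> finds no partner. This last
  summand is where \<open>B\<close> after \<open>sh\<close> is going to come from.\<close>

lemma S_dd:
  assumes "comm m P Q \<phi>" "set u1 \<subseteq> P" "a \<in> P" "set u2 \<subseteq> P" "set v1 \<subseteq> Q" "c \<in> Q" "set v2 \<subseteq> Q"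
  shows "S (dd m D \<phi>) u1 a u2 v1 c v2 = ddp m D (\<lambda>u1 a u2. S \<phi> u1 a u2 v1 c v2) u1 a u2
     + ddp m D (\<lambda>v1 c v2. S \<phi> u1 a u2 v1 c v2) v1 c v2
     + shf (\<lambda>x. shf (\<lambda>y. m a c (\<lambda>z. \<phi> (x @ z # y))) u2 v2) u1 v1"
  using assms
proof (induction "length u1 + length v1" arbitrary: u1 v1 \<phi> rule: less_induct)
  case less
  note cm = comm_Nil[OF less.prems(1)]
  have zero: "shf (\<lambda>w. m x y (\<lambda>z. \<phi> (z # w))) u v = - shf (\<lambda>w. m y x (\<lambda>z. \<phi> (z # w))) u v"
     "S (\<lambda>w. m x y (\<lambda>z. \<phi> (z # w))) u a u2 v c v2 = - S (\<lambda>w. m y x (\<lambda>z. \<phi> (z # w))) u a u2 v c v2"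
     if "x \<in> P" "y \<in> Q" for x y u v
    unfolding eq_neg_iff_add_eq_0 shf_add[symmetric] S_add[symmetric] 
    using cm[OF that] by (simp_all add: fs_zero[OF fs_shf] fs_zero[OF fs_S])
  have hd_a: "shf (\<lambda>w. dd m D \<phi> (a # w)) u2 (v @ c # v2) =
     D a (\<lambda>z. shf (\<lambda>w. \<phi> (z # w)) u2 (v @ c # v2)) + Fst (\<lambda>f u. m a f (\<lambda>z. shf (\<lambda>w. \<phi> (z # w)) u (v @ c # v2))) u2
     + Fst (\<lambda>f w. shf (\<lambda>x. m a f (\<lambda>z. \<phi> (z # x))) u2 w) (v @ c # v2)
     + dd m D (\<lambda>u. shf (\<lambda>w. \<phi> (a # w)) u (v @ c # v2)) u2
     + ddp m D (\<lambda>v c v2. shf (\<lambda>w. \<phi> (a # w)) u2 (v @ c # v2)) v c v2" if "set v \<subseteq> Q" for v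
    using that less.prems
    by (simp add: shf_add shf_dd[OF comm_Cons] dd_append shf_Fst shf_bind[OF fs_m] shf_bind[OF fs_D])
  note simps = S_add S_Fst S_bind[OF fs_m] S_bind[OF fs_D] shf_bind[OF fs_m] shf_bind[OF fs_D] Fst_add Lst_add
    fs_add[OF fs_m] fs_add[OF fs_D] dd_add
  show ?case
  proof (cases u1; cases v1)
    assume "u1 = []" "v1 = []"
    then show ?thesis using hd_a[of "[]"] by (simp add: ddp_def algebra_simps)
  next
    fix q v assume uv: "u1 = []" "v1 = q # v"
    have IH: "S (dd m D (\<lambda>w. \<phi> (q # w))) [] a u2 v c v2 = ddp m D (\<lambda>u1 a u2. S (\<lambda>w. \<phi> (q # w)) u1 a u2 v c v2) [] a u2
     + ddp m D (\<lambda>v1 c v2. S (\<lambda>w. \<phi> (q # w)) [] a u2 v1 c v2) v c v2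
     + shf (\<lambda>x. shf (\<lambda>y. m a c (\<lambda>z. \<phi> (q # x @ z # y))) u2 v2) [] v"
      using less.hyps[of "[]" v "\<lambda>w. \<phi> (q # w)"] less.prems comm_Cons[OF less.prems(1)] by (simp add: uv)
    \<comment> \<open>\<open>q\<close> may stand on either side of \<open>a\<close>, so the products
      of this pair cancel, in contrast to those of the pair \<open>a\<close>,
      \<open>c\<close>.\<close>
    have z: "shf (\<lambda>w. m a q (\<lambda>z. \<phi> (z # w))) u2 (v @ c # v2) = - shf (\<lambda>w. m q a (\<lambda>z. \<phi> (z # w))) u2 (v @ c # v2)"
      by (rule zero(1)) (use less.prems uv in auto)
    have L: "S (dd m D \<phi>) u1 a u2 v1 c v2 = shf (\<lambda>w. dd m D \<phi> (a # w)) u2 (v1 @ c # v2)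
       + (D q (\<lambda>y. S (\<lambda>w. \<phi> (y # w)) [] a u2 v c v2)
       + (Fst (\<lambda>f v'. S (\<lambda>w. m q f (\<lambda>z. \<phi> (z # w))) [] a u2 v' c v2) v
         + shf (\<lambda>w. m q a (\<lambda>z. \<phi> (z # w))) u2 (v @ c # v2))
       + S (dd m D (\<lambda>w. \<phi> (q # w))) [] a u2 v c v2)"
      unfolding uv S.simps(2) dd.simps(2)[of m D \<phi> q] S_add S_Fst by (simp add: S_bind[OF fs_D])
    show ?thesis unfolding L using less.prems
      by (subst hd_a) (simp_all add: uv simps ddp_Cons z IH ddp_add ddp_def[of m D _ "[]" a u2] algebra_simps)
  next
    fix p u assume uv: "u1 = p # u" "v1 = []"
    have IH: "S (dd m D (\<lambda>w. \<phi> (p # w))) u a u2 [] c v2 = ddp m D (\<lambda>u1 a u2. S (\<lambda>w. \<phi> (p # w)) u1 a u2 [] c v2) u a u2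
     + ddp m D (\<lambda>v1 c v2. S (\<lambda>w. \<phi> (p # w)) u a u2 v1 c v2) [] c v2
     + shf (\<lambda>x. shf (\<lambda>y. m a c (\<lambda>z. \<phi> (p # x @ z # y))) u2 v2) u []"
      using less.hyps[of u "[]" "\<lambda>w. \<phi> (p # w)"] less.prems comm_Cons[OF less.prems(1)] by (simp add: uv)
    have L: "S (dd m D \<phi>) u1 a u2 v1 c v2 = D p (\<lambda>y. S (\<lambda>w. \<phi> (y # w)) u a u2 [] c v2)
       + (Fst (\<lambda>f u'. S (\<lambda>w. m p f (\<lambda>z. \<phi> (z # w))) u' a u2 [] c v2) u
         + (if u = [] then shf (\<lambda>w. m p a (\<lambda>z. \<phi> (z # w))) u2 (c # v2) else 0))
       + S (dd m D (\<lambda>w. \<phi> (p # w))) u a u2 [] c v2"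
      unfolding uv S.simps(3) dd.simps(2)[of m D \<phi> p] S_add S_Fst by (simp add: S_bind[OF fs_D])
    show ?thesis unfolding L using less.prems
      by (simp add: uv simps ddp_Cons IH ddp_def[of m D _ "[]" c v2] algebra_simps)
  next
    fix p u q v assume uv: "u1 = p # u" "v1 = q # v"
    have IH1: "S (dd m D (\<lambda>w. \<phi> (p # w))) u a u2 v1 c v2 = ddp m D (\<lambda>u1 a u2. S (\<lambda>w. \<phi> (p # w)) u1 a u2 v1 c v2) u a u2
     + ddp m D (\<lambda>v1 c v2. S (\<lambda>w. \<phi> (p # w)) u a u2 v1 c v2) v1 c v2
     + shf (\<lambda>x. shf (\<lambda>y. m a c (\<lambda>z. \<phi> (p # x @ z # y))) u2 v2) u v1"
      using less.hyps[of u v1 "\<lambda>w. \<phi> (p # w)"] less.prems comm_Cons[OF less.prems(1)] by (simp add: uv)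
    have IH2: "S (dd m D (\<lambda>w. \<phi> (q # w))) u1 a u2 v c v2 = ddp m D (\<lambda>u1 a u2. S (\<lambda>w. \<phi> (q # w)) u1 a u2 v c v2) u1 a u2
     + ddp m D (\<lambda>v1 c v2. S (\<lambda>w. \<phi> (q # w)) u1 a u2 v1 c v2) v c v2
     + shf (\<lambda>x. shf (\<lambda>y. m a c (\<lambda>z. \<phi> (q # x @ z # y))) u2 v2) u1 v"
      using less.hyps[of u1 v "\<lambda>w. \<phi> (q # w)"] less.prems comm_Cons[OF less.prems(1)] by (simp add: uv)
    show ?thesis using IH1 IH2 less.prems
      by (auto simp: uv simps ddp_Cons ddp_add zero(2)[of p q] algebra_simps)
  qed
qed

end

section \<open>Cyclic words: rotations and the Hochschild differential\<close>

abbreviation LD where "LD D \<equiv> dd (\<lambda>_ _ _. 0) D"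

text \<open>The norm operator N. A rotation is described by a cut of \<open>w\<close>, and the
  position of the zeroth letter \<open>a\<close> inside the rotated word is remembered.\<close>

definition rot where
  "rot \<psi> a w = spl (\<lambda>w1 w2. \<psi> w2 a w1) w"

text \<open>The terms of E: one letter to the right of the marked letter a is replaced by its differential.\<close>

definition rotE where
  "rotE D' \<psi> a w = spl (\<lambda>w1 w2. LD D' (\<lambda>r. \<psi> w2 a r) w1) w"

text \<open>The Hochschild differential of a cyclic word with marked zeroth letter a.\<close>

definition bch where
  "bch m D \<Psi> a w = D a (\<lambda>z. \<Psi> z w) + dd m D (\<Psi> a) w + Fst (\<lambda>y w'. m a y (\<lambda>z. \<Psi> z w')) w
     + Lst (\<lambda>l w'. m l a (\<lambda>z. \<Psi> z w')) w"

lemma spl_FstL: "spl (\<lambda>a b. Fst (\<lambda>y a'. F y a' b) a) w = Fst (\<lambda>y w'. spl (F y) w') w"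
  by (cases w) simp_all

lemma spl_LstR: "spl (\<lambda>a b. Lst (\<lambda>y b'. F y a b') b) w = Lst (\<lambda>y w'. spl (F y) w') w"
  by (cases w rule: rev_cases) (simp_all add: spl_snoc)

lemma spl_diff: "spl (\<lambda>a b. \<phi> a b - \<psi> a b) w = spl \<phi> w - spl \<psi> w"
  using fs_diff[OF fs_spl, of "\<lambda>(a,b). \<phi> a b" "\<lambda>(a,b). \<psi> a b" w] by simp

lemma fs_rot: "fs (\<lambda>\<phi>. rot (\<lambda>u a v. \<phi> (u, a, v)) a w)"
  unfolding rot_def by (rule fs_splI) (rule fs_point)

lemma rot_bind: "fs X \<Longrightarrow> X (\<lambda>z. rot (\<phi> z) a w) = rot (\<lambda>u a v. X (\<lambda>z. \<phi> z u a v)) a w"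
  unfolding rot_def by (rule spl_bind)

lemma rot_add: "rot (\<lambda>u a v. \<phi> u a v + \<psi> u a v) a w = rot \<phi> a w + rot \<psi> a w"
  unfolding rot_def by (rule spl_add)

lemma rot_diff: "rot (\<lambda>u a v. \<phi> u a v - \<psi> u a v) a w = rot \<phi> a w - rot \<psi> a w"
  unfolding rot_def by (rule spl_diff)

text \<open>\<open>R\<close> stands for the defect of a relation between letters, such as the
  Leibniz rule. The relation holds only on suitable test functions, since these carry the signs of
  the tags, and it is imposed at every position of a word.\<close>

definition ann where
  "ann R \<phi> \<longleftrightarrow> (\<forall>u w. R (\<lambda>z. \<phi> (u @ z # w)) = 0)"

lemma annD: "ann R \<phi> \<Longrightarrow> R (\<lambda>z. \<phi> (u @ z # w)) = 0"
  by (simp add: ann_def)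

lemma ann_Cons: "ann R \<phi> \<Longrightarrow> ann R (\<lambda>w. \<phi> (x # w))"
  unfolding ann_def
proof (intro allI)
  fix u w assume "\<forall>u w. R (\<lambda>z. \<phi> (u @ z # w)) = 0"
  from this[rule_format, of "x # u" w] show "R (\<lambda>z. \<phi> (x # u @ z # w)) = 0" by simp
qed

lemma ann_append: "ann R \<phi> \<Longrightarrow> ann R (\<lambda>w. \<phi> (x @ w))"
  unfolding ann_def
proof (intro allI)
  fix u w assume "\<forall>u w. R (\<lambda>z. \<phi> (u @ z # w)) = 0"
  from this[rule_format, of "x @ u" w] show "R (\<lambda>z. \<phi> (x @ u @ z # w)) = 0" by simp
qed

lemma ann_shf:
  assumes "fs R" "ann R \<phi>"
  shows "ann R (shf \<phi> u)"
  unfolding ann_def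
proof (intro allI)
  fix c w
  from assms(2) show "R (\<lambda>z. shf \<phi> u (c @ z # w)) = 0"
  proof (induction "length u + length c" arbitrary: u c \<phi> rule: less_induct)
    case less
    show ?case
    proof (cases u)
      case Nil
      then show ?thesis using annD[OF less.prems] by simp
    next
      case (Cons p u')
      have 1: "R (\<lambda>z. shf (\<lambda>w. \<phi> (p # w)) u' (c @ z # w)) = 0"
        by (rule less.hyps) (simp_all add: Cons ann_Cons less.prems)
      have 2: "R (\<lambda>z. shf (\<lambda>t. \<phi> (z # t)) u w) = 0"
        using annD[OF less.prems, of "[]"] by (simp add: shf_bind[OF assms(1)] fs_zero[OF fs_shf])
      show ?thesis
      proof (cases c)
        case Nil
        then show ?thesis using 1 2 by (simp add: Cons fs_add[OF assms(1)])
      next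
        case (Cons q c')
        have 3: "R (\<lambda>z. shf (\<lambda>w. \<phi> (q # w)) u (c' @ z # w)) = 0"
          by (rule less.hyps) (simp_all add: Cons ann_Cons less.prems)
        then show ?thesis using 1 Cons \<open>u = p # u'\<close> by (simp add: fs_add[OF assms(1)])
      qed
    qed
  qed
qed

lemma ann_plus: "fs R \<Longrightarrow> ann R \<phi> \<Longrightarrow> ann R \<psi> \<Longrightarrow> ann R (\<lambda>w. \<phi> w + \<psi> w)"
  unfolding ann_def using fs_add[of R] by simp

text \<open>Shuffling leaves a letter in some position of the resulting words, and there the
  relation is available. Only letters to the right of \<open>c\<close> are treated, which is where
  the homotopies differentiate.\<close>

lemma ann_S:
  assumes "fs R" "ann R \<phi>"
  shows "ann R (S \<phi> u1 a u2 v1 c)"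
  using assms(2)
proof (induction "length u1 + length v1" arbitrary: u1 v1 \<phi> rule: less_induct)
  case less
  have 1: "ann R (\<lambda>r. shf (\<lambda>w. \<phi> (a # w)) u2 (v @ c # r))" for v
    using ann_append[OF ann_shf[OF assms(1) ann_Cons[OF less.prems]], of _ _ "v @ [c]"] by simp
  have 2: "ann R (S (\<lambda>w. \<phi> (x # w)) u a u2 v c)" if "length u + length v < length u1 + length v1" for x u v
    by (rule less.hyps[OF that ann_Cons[OF less.prems]])
  show ?case
    using 1[of "[]"] 1[of v1] 2
    by (cases u1; cases v1) (auto intro!: ann_plus assms(1))
qed

context letter_ops begin

text \<open>The coderivation property: two letters that have been multiplied cannot be separated by
  a cut, and after a cut no product crosses it.\<close>

lemma spl_dd: "dd m D (spl \<psi>) w = spl (\<lambda>a b. dd m D (\<lambda>a'. \<psi> a' b) a + dd m D (\<psi> a) b) w"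
proof (induction w arbitrary: \<psi>)
  case (Cons x w)
  show ?case using Cons.IH[of "\<lambda>a. \<psi> (x # a)"]
    by (simp add: dd_add spl_add spl_FstL Fst_add spl_bind[OF fs_D] spl_bind[OF fs_m] fs_add[OF fs_D] fs_add[OF fs_m])
qed simp

lemma fs_ddp: "fs (\<lambda>\<phi>. ddp m D (\<lambda>u a v. \<phi> (u, a, v)) u a v)"
proof -
  have 1: "fs (\<lambda>\<phi>. Lst (\<lambda>l u'. m l a (\<lambda>z. \<phi> (u', z, v))) u)"
    by (rule fs_Lst) (rule fs_map[OF fs_m])
  have 2: "fs (\<lambda>\<phi>. Fst (\<lambda>f v'. m a f (\<lambda>z. \<phi> (u, z, v'))) v)"
    by (rule fs_Fst) (rule fs_map[OF fs_m])
  show ?thesis unfolding ddp_def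
    by (rule fs_plus fs_map[OF fs_dd, of "\<lambda>u'. (u', a, v)"] 1 2 fs_map[OF fs_D[of a], of "\<lambda>z. (u, z, v)"] fs_map[OF fs_dd, of "\<lambda>v'. (u, a, v')"])+
qed

lemma ddp_bind:
  assumes "fs X" shows "X (\<lambda>t. ddp m D (\<psi> t) u a v) = ddp m D (\<lambda>u a v. X (\<lambda>t. \<psi> t u a v)) u a v"
  using fs_commute[OF assms fs_ddp, of "\<lambda>t (u,a,v). \<psi> t u a v"] by simp

lemma bch_bind:
  assumes "fs X" shows "X (\<lambda>t. bch m D (\<psi> t) a w) = bch m D (\<lambda>a w. X (\<lambda>t. \<psi> t a w)) a w"
  by (simp add: bch_def fs_add[OF assms] Fst_bind[OF assms] Lst_bind[OF assms] dd_bind[OF assms]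
      fs_commute[OF assms fs_m] fs_commute[OF assms fs_D])

text \<open>In the rotated word the neighbours of the mark are the last and the first letter of
  \<open>w\<close>, exactly the letters multiplied with the zeroth one in the Hochschild
  differential. This is the relation b'N = Nb.\<close>

lemma rot_ddp: "rot (ddp m D \<psi>) a w = bch m D (rot \<psi>) a w"
  unfolding rot_def ddp_def bch_def
  by (simp add: spl_add spl_FstL spl_LstR spl_dd spl_bind[OF fs_D] spl_bind[OF fs_m] algebra_simps)

text \<open>Every letter of the cyclic word is first in one rotation and last in another, and
  removing it leaves the same rotated word in both cases.\<close>

lemma rot_cyc: "rot (\<lambda>u a v. Fst J (u @ a # v) - Lst J (u @ a # v)) a w = 0"
proof -
  have 1: "Fst J (u @ a # v) = Fst (\<lambda>x u'. J x (u' @ a # v)) u + (if u = [] then J a v else 0)" for u v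
    by (cases u) auto
  have 2: "Lst J (u @ a # v) = Lst (\<lambda>x v'. J x (u @ a # v')) v + (if v = [] then J a u else 0)" for u v
    by (cases v rule: rev_cases) (auto simp: Lst_def butlast_append)
  show ?thesis unfolding rot_def 1 2
    by (simp add: spl_diff spl_add spl_Fst_Lst spl_Nil1 spl_Nil2)
qed

end

section \<open>A second derivation acting on the letters\<close>

text \<open>\<open>D\<close> belongs to \<open>b\<close>, \<open>E\<close> to the operators of the
  connection: one of the two parts of the differential of the tensor product, or the differential
  itself in the commutation of \<open>e\<close> with \<open>b\<close>.\<close>

locale letter_ops_E = letter_ops m D for m :: "'a \<Rightarrow> 'a \<Rightarrow> ('a \<Rightarrow> 'k::comm_ring_1) \<Rightarrow> 'k" and D +
  fixes E :: "'a \<Rightarrow> ('a \<Rightarrow> 'k) \<Rightarrow> 'k" assumes fs_E: "fs (E x)"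
begin

sublocale LE: letter_ops "\<lambda>_ _ _. 0" E
  by unfold_locales (auto simp: fs_0 fs_E)

lemma LE_Fst: "LD E (Fst G) w = Fst (\<lambda>x w'. LD E (G x) w') w + Fst (\<lambda>x w'. E x (\<lambda>y. G y w')) w"
  by (cases w) (simp_all add: Fst_0)

lemma LE_snoc: "LD E \<phi> (w @ [x]) = LD E (\<lambda>w. \<phi> (w @ [x])) w + E x (\<lambda>y. \<phi> (w @ [y]))"
  by (simp add: LE.dd_append ddp_def Lst_0)

lemma LE_Lst: "LD E (Lst G) w = Lst (\<lambda>x w'. LD E (G x) w') w + Lst (\<lambda>x w'. E x (\<lambda>y. G y w')) w"
  by (cases w rule: rev_cases) (simp_all add: LE_snoc)

lemma LE_Nil: "LD E (\<lambda>r. if r = [] then c else 0) w = 0"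
  by (cases w) (simp_all add: Fst_0 fs_zero[OF fs_E] LE.dd_0)

lemma fs_rotE: "fs (\<lambda>\<phi>. rotE E (\<lambda>u a v. \<phi> (u, a, v)) a w)"
  unfolding rotE_def
proof (rule fs_splI)
  fix u v show "fs (\<lambda>\<phi>. LD E (\<lambda>r. \<phi> (v, a, r)) u)"
    by (rule fs_map[OF LE.fs_dd])
qed

lemma rotE_bind:
  assumes "fs X" shows "X (\<lambda>z. rotE E (\<phi> z) a w) = rotE E (\<lambda>u a v. X (\<lambda>z. \<phi> z u a v)) a w"
  using fs_commute[OF assms fs_rotE, of "\<lambda>t (u,a,v). \<phi> t u a v"] by simp

lemma rotE_add: "rotE E (\<lambda>u a v. \<phi> u a v + \<psi> u a v) a w = rotE E \<phi> a w + rotE E \<psi> a w"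
  by (simp add: rotE_def LE.dd_add spl_add)

lemma rotE_diff: "rotE E (\<lambda>u a v. \<phi> u a v - \<psi> u a v) a w = rotE E \<phi> a w - rotE E \<psi> a w"
  using fs_diff[OF fs_rotE, of "\<lambda>(u,a,v). \<phi> u a v" "\<lambda>(u,a,v). \<psi> u a v"] by simp

text \<open>What is needed to move \<open>E\<close> through the bar differential. \<open>E\<close>,
  \<open>D\<close> and \<open>m\<close> are odd, but with the signs in the tags this reads as a
  plain Leibniz rule and a plain commutation.\<close>

definition leib where
  "leib X \<phi> \<longleftrightarrow> (\<forall>x\<in>X. \<forall>y\<in>X. ann (\<lambda>G. m x y (\<lambda>z. E z G) - E x (\<lambda>x'. m x' y G) - E y (\<lambda>y'. m x y' G)) \<phi>)
     \<and> (\<forall>x\<in>X. ann (\<lambda>G. D x (\<lambda>y. E y G) - E x (\<lambda>y. D y G)) \<phi>)"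

lemma fs_leib:
  "fs (\<lambda>G. m x y (\<lambda>z. E z G) - E x (\<lambda>x'. m x' y G) - E y (\<lambda>y'. m x y' G))"
  "fs (\<lambda>G. D x (\<lambda>y. E y G) - E x (\<lambda>y. D y G))"
  unfolding diff_conv_add_uminus
  by (intro fs_plus fs_uminus fs_bind[OF fs_m fs_E] fs_bind[OF fs_E fs_m] fs_bind[OF fs_D fs_E] fs_bind[OF fs_E fs_D])+

lemma leib_Cons: "leib X \<phi> \<Longrightarrow> leib X (\<lambda>w. \<phi> (x # w))"
  by (simp add: leib_def ann_Cons)

lemma leib_S: "leib X \<phi> \<Longrightarrow> leib X (S \<phi> u1 a u2 v1 c)"
  unfolding leib_def by (intro conjI ballI ann_S fs_leib) blast+

text \<open>If \<open>E\<close> and the bar differential act on different letters they commute by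
  exchanging sums; if they act at the same place, \<open>leib\<close> applies.\<close>

lemma LE_dd:
  assumes "leib X \<phi>" "set w \<subseteq> X"
  shows "LD E (dd m D \<phi>) w = dd m D (LD E \<phi>) w"
  using assms
proof (induction w arbitrary: \<phi>)
  case (Cons x w)
  have 1: "m x y (\<lambda>z. E z (\<lambda>z. \<phi> (z # v))) = E x (\<lambda>x'. m x' y (\<lambda>z. \<phi> (z # v))) + E y (\<lambda>y'. m x y' (\<lambda>z. \<phi> (z # v)))"
    if "y \<in> X" for y v
  proof -
    have "ann (\<lambda>G. m x y (\<lambda>z. E z G) - E x (\<lambda>x'. m x' y G) - E y (\<lambda>y'. m x y' G)) \<phi>"
      using Cons.prems that unfolding leib_def by auto
    from annD[OF this, of "[]" v] show ?thesis by (simp add: algebra_simps)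
  qed
  have 2: "D x (\<lambda>y. E y (\<lambda>z. \<phi> (z # v))) = E x (\<lambda>y. D y (\<lambda>z. \<phi> (z # v)))" for v
  proof -
    have "ann (\<lambda>G. D x (\<lambda>y. E y G) - E x (\<lambda>y. D y G)) \<phi>"
      using Cons.prems unfolding leib_def by auto
    from annD[OF this, of "[]" v] show ?thesis by simp
  qed
  have IH: "LD E (dd m D (\<lambda>w. \<phi> (x # w))) w = dd m D (LD E (\<lambda>w. \<phi> (x # w))) w"
    by (rule Cons.IH) (use Cons.prems in \<open>auto simp: leib_Cons\<close>)
  have 3: "Fst (\<lambda>y w'. m x y (\<lambda>z. E z (\<lambda>z. \<phi> (z # w')))) w
      = Fst (\<lambda>y w'. E x (\<lambda>x'. m x' y (\<lambda>z. \<phi> (z # w')))) w + Fst (\<lambda>y w'. E y (\<lambda>y'. m x y' (\<lambda>z. \<phi> (z # w')))) w"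
    using Cons.prems by (cases w) (auto simp: 1)
  show ?case
    by (simp add: Fst_0 fs_add[OF fs_E] fs_add[OF fs_D] fs_add[OF fs_m] LE.dd_add dd_add 2 3 IH Fst_add LE_Fst
        Fst_bind[OF fs_E] dd_bind[OF fs_E] LE.dd_bind[OF fs_D] LE.dd_bind[OF fs_m])
qed simp

text \<open>\<open>E\<close> hits a letter to the right of the mark, never the mark. It therefore
  commutes with all of the differential except the product of \<open>a\<close> with the letter
  \<open>f\<close> after it: there \<open>E\<close> can act on \<open>f\<close> before the product
  but not afterwards. This excess becomes \<open>ehat\<close>.\<close>

lemma rotE_ddp:
  assumes "\<And>u. leib X (\<psi> u a)" "set w \<subseteq> X"
  shows "rotE E (ddp m D \<psi>) a w = bch m D (rotE E \<psi>) a w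
     + Fst (\<lambda>f w'. E f (\<lambda>f'. m a f' (\<lambda>z. rot \<psi> z w'))) w"
proof -
  have 1: "LD E (ddp m D \<psi> u a) v = ddp m D (\<lambda>u a. LD E (\<psi> u a)) u a v
      + Fst (\<lambda>f v'. E f (\<lambda>f'. m a f' (\<lambda>z. \<psi> u z v'))) v" if "set v \<subseteq> X" for u v
    unfolding ddp_def
    by (simp add: LE.dd_add LE_Fst LE_dd[OF assms(1) that] dd_bind[OF LE.fs_dd] Lst_bind[OF LE.fs_dd]
        LE.dd_bind[OF fs_D] LE.dd_bind[OF fs_m])
  have "rotE E (ddp m D \<psi>) a w = spl (\<lambda>v u. ddp m D (\<lambda>u a. LD E (\<psi> u a)) u a v
      + Fst (\<lambda>f v'. E f (\<lambda>f'. m a f' (\<lambda>z. \<psi> u z v'))) v) w"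
    unfolding rotE_def by (rule spl_cong) (use assms(2) in \<open>auto simp: 1\<close>)
  also have "\<dots> = rot (ddp m D (\<lambda>u a. LD E (\<psi> u a))) a w + Fst (\<lambda>f w'. E f (\<lambda>f'. m a f' (\<lambda>z. rot \<psi> z w'))) w"
    by (simp add: spl_add spl_FstL rot_def spl_bind[OF fs_E] spl_bind[OF fs_m])
  finally show ?thesis by (simp add: rot_ddp) (simp add: rot_def[abs_def] rotE_def[abs_def])
qed

end

text \<open>SR is the sum over cyclic shuffles defining Sh; SE is its variant giving the homotopies Q and P; ehat is the operator e(\<delta>) up to sign.\<close>

definition SR where
  "SR \<phi> p0 p q0 q = rot (\<lambda>p2 p0 p1. rot (S \<phi> p2 p0 p1) q0 q) p0 p"

definition SE where
  "SE E \<phi> p0 p q0 q = rot (\<lambda>p2 p0 p1. rotE E (S \<phi> p2 p0 p1) q0 q) p0 p"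

definition ehat where
  "ehat m E \<Psi> a w = Fst (\<lambda>f w'. E f (\<lambda>f'. m a f' (\<lambda>z. \<Psi> z w'))) w"

lemma rot_cong: "(\<And>u v. w = v @ u \<Longrightarrow> \<phi> u a v = \<psi> u a v) \<Longrightarrow> rot \<phi> a w = rot \<psi> a w"
  unfolding rot_def by (rule spl_cong) auto

lemma SR_fun: "(\<lambda>p0 p. SR \<phi> p0 p q0 q) = rot (\<lambda>p2 p0 p1. rot (S \<phi> p2 p0 p1) q0 q)"
  by (intro ext) (simp add: SR_def)

lemma SE_fun: "(\<lambda>p0 p. SE E \<phi> p0 p q0 q) = rot (\<lambda>p2 p0 p1. rotE E (S \<phi> p2 p0 p1) q0 q)"
  by (intro ext) (simp add: SE_def)

lemma rot_Fst_Lst: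
  assumes "fs X"
  shows "rot (\<lambda>u a v. X (\<lambda>t. Fst (\<lambda>x u'. G t x u' a v) u) - X (\<lambda>t. Lst (\<lambda>x v'. G t x u a v') v)) a w = 0"
  unfolding rot_def Fst_bind[OF assms] Lst_bind[OF assms] spl_diff by (simp add: spl_Fst_Lst)

lemma rot_Nil: "rot (\<lambda>u a v. if u = [] then g a v else 0) a w = g a w"
  unfolding rot_def by (rule spl_Nil2)

section \<open>Cyclic shuffles under the differential and under moving an end letter\<close>

context letter_ops begin

text \<open>\<open>S_dd\<close> summed over the rotations of both words: by \<open>rot_ddp\<close>
  the marked bar differentials turn into Hochschild differentials, and the product of the two zeroth
  letters remains as a wall between two independent shuffles.\<close>

lemma SR_dd:
  assumes "comm m P Q \<phi>" "set p \<subseteq> P" "p0 \<in> P" "set q \<subseteq> Q" "q0 \<in> Q"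
  shows "SR (dd m D \<phi>) p0 p q0 q = bch m D (\<lambda>p0 p. SR \<phi> p0 p q0 q) p0 p + bch m D (\<lambda>q0 q. SR \<phi> p0 p q0 q) q0 q
    + rot (\<lambda>p2 p0 p1. rot (\<lambda>q2 q0 q1. shf (\<lambda>x. shf (\<lambda>y. m p0 q0 (\<lambda>z. \<phi> (x @ z # y))) p1 q1) p2 q2) q0 q) p0 p"
proof -
  have "SR (dd m D \<phi>) p0 p q0 q = rot (\<lambda>p2 p0 p1. rot (\<lambda>q2 q0 q1. 
       ddp m D (\<lambda>u1 a u2. S \<phi> u1 a u2 q2 q0 q1) p2 p0 p1 + ddp m D (\<lambda>v1 c v2. S \<phi> p2 p0 p1 v1 c v2) q2 q0 q1
     + shf (\<lambda>x. shf (\<lambda>y. m p0 q0 (\<lambda>z. \<phi> (x @ z # y))) p1 q1) p2 q2) q0 q) p0 p"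
    unfolding SR_def by (intro rot_cong S_dd[OF assms(1)]) (use assms(2-) in auto)
  also have "\<dots> = rot (\<lambda>p2 p0 p1. rot (\<lambda>q2 q0 q1. 
       ddp m D (\<lambda>u1 a u2. S \<phi> u1 a u2 q2 q0 q1) p2 p0 p1) q0 q) p0 p 
     + rot (\<lambda>p2 p0 p1. rot (ddp m D (S \<phi> p2 p0 p1)) q0 q) p0 p
     + rot (\<lambda>p2 p0 p1. rot (\<lambda>q2 q0 q1. shf (\<lambda>x. shf (\<lambda>y. m p0 q0 (\<lambda>z. \<phi> (x @ z # y))) p1 q1) p2 q2) q0 q) p0 p"
    by (simp add: rot_add)
  also have "rot (\<lambda>p2 p0 p1. rot (\<lambda>q2 q0 q1. ddp m D (\<lambda>u1 a u2. S \<phi> u1 a u2 q2 q0 q1) p2 p0 p1) q0 q) p0 p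
     = bch m D (\<lambda>p0 p. SR \<phi> p0 p q0 q) p0 p"
  proof -
    have "rot (\<lambda>q2 q0 q1. ddp m D (\<lambda>u1 a u2. S \<phi> u1 a u2 q2 q0 q1) p2 p0 p1) q0 q = ddp m D (\<lambda>u1 a u2. rot (S \<phi> u1 a u2) q0 q) p2 p0 p1" for p2 p0 p1
      using ddp_bind[OF fs_rot, of "\<lambda>(q2,q0,q1) u1 a u2. S \<phi> u1 a u2 q2 q0 q1"] by simp
    then show ?thesis by (simp add: rot_ddp SR_fun)
  qed
  also have "rot (\<lambda>p2 p0 p1. rot (ddp m D (S \<phi> p2 p0 p1)) q0 q) p0 p = bch m D (\<lambda>q0 q. SR \<phi> p0 p q0 q) q0 q"
    unfolding rot_ddp using bch_bind[OF fs_rot, of "\<lambda>(p2,p0,p1). rot (S \<phi> p2 p0 p1)" q0 q p0 p] 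
    by (simp add: SR_def)
  finally show ?thesis .
qed

text \<open>For unmarked letters, being first in one rotation cancels against being last in another.
  Only the boundary terms survive in which \<open>p0\<close> is first or \<open>q0\<close> is last;
  they become the two summands of \<open>sh\<close> after \<open>B\<close>.\<close>

lemma SR_cyc:
  "SR (\<lambda>w. Fst J w - Lst J w) p0 p q0 q = rot (\<lambda>q2 q0 q1. shf (J p0) p (q2 @ q0 # q1)) q0 q
     - rot (\<lambda>p2 p0 p1. shf (J q0) (p2 @ p0 # p1) q) p0 p"
proof -
  have "S (\<lambda>w. Fst J w - Lst J w) p2 p0 p1 q2 q0 q1
     = (Fst (\<lambda>x p2. S (J x) p2 p0 p1 q2 q0 q1) p2 - Lst (\<lambda>x p1. S (J x) p2 p0 p1 q2 q0 q1) p1)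
       + (Fst (\<lambda>x q2. S (J x) p2 p0 p1 q2 q0 q1) q2 - Lst (\<lambda>x q1. S (J x) p2 p0 p1 q2 q0 q1) q1)
       + ((if p2 = [] then shf (J p0) p1 (q2 @ q0 # q1) else 0) - (if q1 = [] then shf (J q0) (p2 @ p0 # p1) q2 else 0))"
    for p2 p0 p1 q2 q0 q1
    by (simp add: fs_diff[OF fs_S] S_Fst S_Lst)
  then have ext: "S (\<lambda>w. Fst J w - Lst J w) = (\<lambda>p2 p0 p1 q2 q0 q1. (Fst (\<lambda>x p2. S (J x) p2 p0 p1 q2 q0 q1) p2 - Lst (\<lambda>x p1. S (J x) p2 p0 p1 q2 q0 q1) p1)
       + (Fst (\<lambda>x q2. S (J x) p2 p0 p1 q2 q0 q1) q2 - Lst (\<lambda>x q1. S (J x) p2 p0 p1 q2 q0 q1) q1)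
       + ((if p2 = [] then shf (J p0) p1 (q2 @ q0 # q1) else 0) - (if q1 = [] then shf (J q0) (p2 @ p0 # p1) q2 else 0)))"
    by (intro ext)
  have E0: "SR (\<lambda>w. Fst J w - Lst J w) p0 p q0 q = 
     rot (\<lambda>p2 p0 p1. rot (\<lambda>q2 q0 q1. Fst (\<lambda>x p2. S (J x) p2 p0 p1 q2 q0 q1) p2) q0 q
        - rot (\<lambda>q2 q0 q1. Lst (\<lambda>x p1. S (J x) p2 p0 p1 q2 q0 q1) p1) q0 q) p0 p
     + rot (\<lambda>p2 p0 p1. rot (\<lambda>q2 q0 q1. Fst (\<lambda>x q2. S (J x) p2 p0 p1 q2 q0 q1) q2 - Lst (\<lambda>x q1. S (J x) p2 p0 p1 q2 q0 q1) q1) q0 q) p0 p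
     + (rot (\<lambda>p2 p0 p1. rot (\<lambda>q2 q0 q1. if p2 = [] then shf (J p0) p1 (q2 @ q0 # q1) else 0) q0 q) p0 p
     - rot (\<lambda>p2 p0 p1. rot (\<lambda>q2 q0 q1. if q1 = [] then shf (J q0) (p2 @ p0 # p1) q2 else 0) q0 q) p0 p)"
    unfolding SR_def ext by (simp only: rot_add rot_diff)
  have E1: "rot (\<lambda>p2 p0 p1. rot (\<lambda>q2 q0 q1. Fst (\<lambda>x p2. S (J x) p2 p0 p1 q2 q0 q1) p2) q0 q
        - rot (\<lambda>q2 q0 q1. Lst (\<lambda>x p1. S (J x) p2 p0 p1 q2 q0 q1) p1) q0 q) p0 p = 0"
    using rot_Fst_Lst[OF fs_rot, of "\<lambda>(q2,q0,q1) x p2 p0 p1. S (J x) p2 p0 p1 q2 q0 q1" q0 q p0 p] by simp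
  have E2: "rot (\<lambda>q2 q0 q1. Fst (\<lambda>x q2. S (J x) p2 p0 p1 q2 q0 q1) q2 - Lst (\<lambda>x q1. S (J x) p2 p0 p1 q2 q0 q1) q1) q0 q = 0" for p2 p0 p1
    using rot_Fst_Lst[OF fs_point[of "()"], of "\<lambda>t x q2 q0 q1. S (J x) p2 p0 p1 q2 q0 q1"] by simp
  \<comment> \<open>\<open>p2 = []\<close> holds for a single rotation of the first word, so this
    sum over rotations collapses.\<close>
  have E3: "rot (\<lambda>p2 p0 p1. rot (\<lambda>q2 q0 q1. if p2 = [] then shf (J p0) p1 (q2 @ q0 # q1) else 0) q0 q) p0 p
     = rot (\<lambda>q2 q0 q1. shf (J p0) p (q2 @ q0 # q1)) q0 q"
  proof -
    have 1: "rot (\<lambda>q2 q0 q1. if p2 = [] then shf (J p0) p1 (q2 @ q0 # q1) else 0) q0 q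
       = (if p2 = [] then rot (\<lambda>q2 q0 q1. shf (J p0) p1 (q2 @ q0 # q1)) q0 q else 0)" for p2 p0 p1
      by (simp add: rot_def spl_0)
    show ?thesis unfolding 1 by (rule rot_Nil)
  qed
  have E4: "rot (\<lambda>q2 q0 q1. if q1 = [] then shf (J q0) (p2 @ p0 # p1) q2 else 0) q0 q = shf (J q0) (p2 @ p0 # p1) q" for p2 p0 p1
    unfolding rot_def by (rule spl_Nil1)
  show ?thesis unfolding E0 E1 E2 E3 E4 by (simp add: rot_def spl_0)
qed

text \<open>Rotating a shuffled word around \<open>z\<close> leaves independent shuffles on the two
  sides of \<open>z\<close>, by \<open>shf_spl\<close>. With \<open>z\<close> the product of the
  zeroth letters this recognizes the wall term of \<open>SR_dd\<close> as \<open>B\<close> after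
  \<open>sh\<close>.\<close>

lemma wall_rot:
  "shf (rot \<psi> z) p q = rot (\<lambda>p2 p0 p1. rot (\<lambda>q2 q0 q1. shf (\<lambda>x. shf (\<psi> x z) p1 q1) p2 q2) q0 q) p0 p"
proof -
  have "shf (rot \<psi> z) p q = shf (spl (\<lambda>a b. \<psi> b z a)) p q"
    by (simp add: rot_def[abs_def])
  also have "\<dots> = spl (\<lambda>p1 p2. spl (\<lambda>q1 q2. shf (\<lambda>a. shf (\<lambda>b. \<psi> b z a) p2 q2) p1 q1) q) p"
    by (rule shf_spl)
  also have "\<dots> = spl (\<lambda>p1 p2. spl (\<lambda>q1 q2. shf (\<lambda>b. shf (\<lambda>a. \<psi> b z a) p1 q1) p2 q2) q) p"
    by (subst shf_bind[OF fs_shf]) simp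
  finally show ?thesis by (simp add: rot_def)
qed

text \<open>\<open>m'\<close> is the product that forms the zeroth letter of the shuffled chain. The
  hypotheses \<open>r1\<close> to \<open>r4\<close> let the products of \<open>b\<close> at either
  end of the zeroth letter pass through it, while mixed products of bar entries cancel as in
  \<open>shf_dd\<close>. This is the commutation of \<open>sh\<close> with \<open>b\<close>.\<close>

lemma shf_bch:
  assumes c: "comm m P Q \<phi>" and "set p \<subseteq> P" "p0 \<in> P" "set q \<subseteq> Q" "q0 \<in> Q"
    and m': "\<And>x y. fs (m' x y)"
    and rD: "\<And>w. m' p0 q0 (\<lambda>z. D z (\<lambda>t. \<phi> (t # w))) = D p0 (\<lambda>x. m' x q0 (\<lambda>t. \<phi> (t # w))) + D q0 (\<lambda>x. m' p0 x (\<lambda>t. \<phi> (t # w)))"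
    and r1: "\<And>p w. p \<in> P \<Longrightarrow> m' p0 q0 (\<lambda>z. m z p (\<lambda>t. \<phi> (t # w))) = m p0 p (\<lambda>z. m' z q0 (\<lambda>t. \<phi> (t # w)))"
    and r2: "\<And>q w. q \<in> Q \<Longrightarrow> m' p0 q0 (\<lambda>z. m z q (\<lambda>t. \<phi> (t # w))) = m q0 q (\<lambda>z. m' p0 z (\<lambda>t. \<phi> (t # w)))"
    and r3: "\<And>p w. p \<in> P \<Longrightarrow> m' p0 q0 (\<lambda>z. m p z (\<lambda>t. \<phi> (t # w))) = m p p0 (\<lambda>z. m' z q0 (\<lambda>t. \<phi> (t # w)))"
    and r4: "\<And>q w. q \<in> Q \<Longrightarrow> m' p0 q0 (\<lambda>z. m q z (\<lambda>t. \<phi> (t # w))) = m q q0 (\<lambda>z. m' p0 z (\<lambda>t. \<phi> (t # w)))"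
  shows "shf (\<lambda>w. m' p0 q0 (\<lambda>z. bch m D (\<lambda>z w. \<phi> (z # w)) z w)) p q
    = bch m D (\<lambda>p0 p. shf (\<lambda>w. m' p0 q0 (\<lambda>z. \<phi> (z # w))) p q) p0 p
    + bch m D (\<lambda>q0 q. shf (\<lambda>w. m' p0 q0 (\<lambda>z. \<phi> (z # w))) p q) q0 q"
proof -
  let ?\<phi> = "\<lambda>w. m' p0 q0 (\<lambda>z. \<phi> (z # w))"
  have c': "comm m P Q ?\<phi>"
    unfolding comm_def
  proof (intro ballI allI)
    fix p q a b assume pq: "p \<in> P" "q \<in> Q"
    have "m p q (\<lambda>x. \<phi> (z # a @ x # b)) + m q p (\<lambda>x. \<phi> (z # a @ x # b)) = 0" for z
      using comm_Cons[OF c, of z] pq unfolding comm_def by blast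
    then have "m' p0 q0 (\<lambda>z. m p q (\<lambda>x. \<phi> (z # a @ x # b)) + m q p (\<lambda>x. \<phi> (z # a @ x # b))) = 0"
      by (simp add: fs_zero[OF m'])
    then show "m p q (\<lambda>x. m' p0 q0 (\<lambda>z. \<phi> (z # a @ x # b))) + m q p (\<lambda>x. m' p0 q0 (\<lambda>z. \<phi> (z # a @ x # b))) = 0"
      by (simp add: fs_add[OF m'] fs_commute[OF fs_m m'])
  qed
  have e: "m' p0 q0 (\<lambda>z. bch m D (\<lambda>z w. \<phi> (z # w)) z w)
     = D p0 (\<lambda>x. m' x q0 (\<lambda>t. \<phi> (t # w))) + D q0 (\<lambda>x. m' p0 x (\<lambda>t. \<phi> (t # w))) + dd m D ?\<phi> w
      + Fst (\<lambda>y w'. m' p0 q0 (\<lambda>z. m z y (\<lambda>t. \<phi> (t # w')))) w + Lst (\<lambda>y w'. m' p0 q0 (\<lambda>z. m y z (\<lambda>t. \<phi> (t # w')))) w" for w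
    unfolding bch_def by (simp add: fs_add[OF m'] rD dd_bind[OF m'] Fst_bind[OF m'] Lst_bind[OF m'])
  have f1: "Fst (\<lambda>y w'. shf (\<lambda>w. m' p0 q0 (\<lambda>z. m z y (\<lambda>t. \<phi> (t # w)))) w' q) p
      = Fst (\<lambda>y w'. shf (\<lambda>w. m p0 y (\<lambda>z. m' z q0 (\<lambda>t. \<phi> (t # w)))) w' q) p"
    using assms(2) by (cases p) (auto simp: r1)
  have f2: "Fst (\<lambda>y w'. shf (\<lambda>w. m' p0 q0 (\<lambda>z. m z y (\<lambda>t. \<phi> (t # w)))) p w') q
      = Fst (\<lambda>y w'. shf (\<lambda>w. m q0 y (\<lambda>z. m' p0 z (\<lambda>t. \<phi> (t # w)))) p w') q"
    using assms(4) by (cases q) (auto simp: r2)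
  have f3: "Lst (\<lambda>y w'. shf (\<lambda>w. m' p0 q0 (\<lambda>z. m y z (\<lambda>t. \<phi> (t # w)))) w' q) p
      = Lst (\<lambda>y w'. shf (\<lambda>w. m y p0 (\<lambda>z. m' z q0 (\<lambda>t. \<phi> (t # w)))) w' q) p"
    using assms(2) by (cases p rule: rev_cases) (auto simp: r3)
  have f4: "Lst (\<lambda>y w'. shf (\<lambda>w. m' p0 q0 (\<lambda>z. m y z (\<lambda>t. \<phi> (t # w)))) p w') q
      = Lst (\<lambda>y w'. shf (\<lambda>w. m y q0 (\<lambda>z. m' p0 z (\<lambda>t. \<phi> (t # w)))) p w') q"
    using assms(4) by (cases q rule: rev_cases) (auto simp: r4)
  show ?thesis unfolding e shf_add shf_Fst shf_Lst shf_dd[OF c' assms(2,4)] f1 f2 f3 f4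
    by (simp add: bch_def shf_bind[OF fs_m] shf_bind[OF fs_D])
qed

lemma bch_bar: \<comment> \<open>the relation Nb = b'N, whose cyclic part cancels\<close>
  assumes J: "\<And>x w. m o1 x (\<lambda>z. \<phi> (z # w)) = J x w" "\<And>x w. m x o1 (\<lambda>z. \<phi> (z # w)) = - J x w" "\<And>G. D o1 G = 0"
  shows "bch m D (\<lambda>z w. \<phi> (z # w)) o1 w = dd m D (\<lambda>w. \<phi> (o1 # w)) w + (Fst J w - Lst J w)"
proof -
  have "Lst (\<lambda>l w'. - J l w') w = - Lst J w" by (simp add: Lst_def)
  then show ?thesis by (simp add: bch_def J)
qed

text \<open>The unit is multiplied into both ends of the rotated word with opposite signs, and over
  all rotations these terms cancel by \<open>rot_cyc\<close>. What is left is b'N = Nb, so this is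
  the compatibility of \<open>B\<close> with \<open>b\<close>.\<close>

lemma rot_bch:
  assumes J: "\<And>x w. m o1 x (\<lambda>z. \<phi> (z # w)) = J x w" "\<And>x w. m x o1 (\<lambda>z. \<phi> (z # w)) = - J x w" "\<And>G. D o1 G = 0"
  shows "rot (\<lambda>u a v. bch m D (\<lambda>z w. \<phi> (z # w)) o1 (u @ a # v)) a w
     = bch m D (rot (\<lambda>u a v. \<phi> (o1 # u @ a # v))) a w"
  using rot_cyc[of J a w] rot_ddp[of "\<lambda>u a v. \<phi> (o1 # u @ a # v)" a w]
  by (simp add: bch_bar[OF J] rot_add dd_append)

end

section \<open>Cyclic shuffles with one differentiated letter\<close>

context letter_ops_E begin

text \<open>Dual formulation of the statement that \<open>E\<close> maps the span of
  \<open>Q\<close> into itself.\<close>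

definition E_on where
  "E_on Q \<longleftrightarrow> (\<forall>x\<in>Q. \<forall>G G'. (\<forall>y\<in>Q. G y = G' y) \<longrightarrow> E x G = E x G')"

lemma LE_cong:
  assumes "E_on Q"
  shows "set w \<subseteq> Q \<Longrightarrow> (\<And>v. set v \<subseteq> Q \<Longrightarrow> \<phi> v = \<psi> v) \<Longrightarrow> LD E \<phi> w = LD E \<psi> w"
proof (induction w arbitrary: \<phi> \<psi>)
  case (Cons x w)
  have "LD E (\<lambda>w. \<phi> (x # w)) w = LD E (\<lambda>w. \<psi> (x # w)) w"
    by (rule Cons.IH) (use Cons.prems in auto)
  moreover have "E x (\<lambda>y. \<phi> (y # w)) = E x (\<lambda>y. \<psi> (y # w))"
    using assms Cons.prems unfolding E_on_def by simp
  ultimately show ?case by (simp add: Fst_0)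
qed simp

lemma rotE_cong:
  assumes "E_on Q" "set w \<subseteq> Q" "\<And>u v. set u \<subseteq> Q \<Longrightarrow> set v \<subseteq> Q \<Longrightarrow> \<phi> u a v = \<psi> u a v"
  shows "rotE E \<phi> a w = rotE E \<psi> a w"
  unfolding rotE_def
proof (rule spl_cong)
  fix v u assume "w = v @ u"
  then show "LD E (\<phi> u a) v = LD E (\<psi> u a) v"
    using assms by (intro LE_cong) auto
qed

text \<open>The proof of \<open>SR_dd\<close> with the excess term of \<open>rotE_ddp\<close>
  carried along; summed over the shuffles it becomes \<open>Sh\<close> after
  \<open>e\<close>.\<close>

lemma SE_dd:
  assumes "comm m P Q \<phi>" "set p \<subseteq> P" "p0 \<in> P" "set q \<subseteq> Q" "q0 \<in> Q" "leib Q \<phi>" "E_on Q"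
  shows "SE E (dd m D \<phi>) p0 p q0 q = bch m D (\<lambda>p0 p. SE E \<phi> p0 p q0 q) p0 p + bch m D (\<lambda>q0 q. SE E \<phi> p0 p q0 q) q0 q
    + rot (\<lambda>p2 p0 p1. rotE E (\<lambda>q2 q0 q1. shf (\<lambda>x. shf (\<lambda>y. m p0 q0 (\<lambda>z. \<phi> (x @ z # y))) p1 q1) p2 q2) q0 q) p0 p
    + ehat m E (\<lambda>q0 q. SR \<phi> p0 p q0 q) q0 q"
proof -
  have "SE E (dd m D \<phi>) p0 p q0 q = rot (\<lambda>p2 p0 p1. rotE E (\<lambda>q2 q0 q1. 
       ddp m D (\<lambda>u1 a u2. S \<phi> u1 a u2 q2 q0 q1) p2 p0 p1 + ddp m D (\<lambda>v1 c v2. S \<phi> p2 p0 p1 v1 c v2) q2 q0 q1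
     + shf (\<lambda>x. shf (\<lambda>y. m p0 q0 (\<lambda>z. \<phi> (x @ z # y))) p1 q1) p2 q2) q0 q) p0 p"
    unfolding SE_def by (intro rot_cong rotE_cong[OF assms(7)] S_dd[OF assms(1)]) (use assms(2-) in auto)
  also have "\<dots> = rot (\<lambda>p2 p0 p1. rotE E (\<lambda>q2 q0 q1. 
       ddp m D (\<lambda>u1 a u2. S \<phi> u1 a u2 q2 q0 q1) p2 p0 p1) q0 q) p0 p 
     + rot (\<lambda>p2 p0 p1. rotE E (ddp m D (S \<phi> p2 p0 p1)) q0 q) p0 p
     + rot (\<lambda>p2 p0 p1. rotE E (\<lambda>q2 q0 q1. shf (\<lambda>x. shf (\<lambda>y. m p0 q0 (\<lambda>z. \<phi> (x @ z # y))) p1 q1) p2 q2) q0 q) p0 p"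
    by (simp add: rot_add rotE_add)
  also have "rot (\<lambda>p2 p0 p1. rotE E (\<lambda>q2 q0 q1. ddp m D (\<lambda>u1 a u2. S \<phi> u1 a u2 q2 q0 q1) p2 p0 p1) q0 q) p0 p
     = bch m D (\<lambda>p0 p. SE E \<phi> p0 p q0 q) p0 p"
  proof -
    have "rotE E (\<lambda>q2 q0 q1. ddp m D (\<lambda>u1 a u2. S \<phi> u1 a u2 q2 q0 q1) p2 p0 p1) q0 q = ddp m D (\<lambda>u1 a u2. rotE E (S \<phi> u1 a u2) q0 q) p2 p0 p1" for p2 p0 p1
      using ddp_bind[OF fs_rotE, of "\<lambda>(q2,q0,q1) u1 a u2. S \<phi> u1 a u2 q2 q0 q1"] by simp
    then show ?thesis by (simp add: rot_ddp SE_fun)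
  qed
  also have "rot (\<lambda>p2 p0 p1. rotE E (ddp m D (S \<phi> p2 p0 p1)) q0 q) p0 p = bch m D (\<lambda>q0 q. SE E \<phi> p0 p q0 q) q0 q
     + ehat m E (\<lambda>q0 q. SR \<phi> p0 p q0 q) q0 q"
  proof -
    have 1: "rotE E (ddp m D (S \<phi> p2 p0 p1)) q0 q = bch m D (rotE E (S \<phi> p2 p0 p1)) q0 q
        + Fst (\<lambda>f w'. E f (\<lambda>f'. m q0 f' (\<lambda>z. rot (S \<phi> p2 p0 p1) z w'))) q" for p2 p0 p1
      by (rule rotE_ddp) (rule leib_S[OF assms(6)] assms)+
    have 2: "rot (\<lambda>p2 p0 p1. bch m D (rotE E (S \<phi> p2 p0 p1)) q0 q) p0 p = bch m D (\<lambda>q0 q. SE E \<phi> p0 p q0 q) q0 q"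
      using bch_bind[OF fs_rot, of "\<lambda>(p2,p0,p1). rotE E (S \<phi> p2 p0 p1)" q0 q p0 p] by (simp add: SE_def)
    have 3: "rot (\<lambda>p2 p0 p1. Fst (\<lambda>f w'. E f (\<lambda>f'. m q0 f' (\<lambda>z. rot (S \<phi> p2 p0 p1) z w'))) q) p0 p
       = ehat m E (\<lambda>q0 q. SR \<phi> p0 p q0 q) q0 q"
      by (cases q) (simp_all add: ehat_def SR_def rot_bind[OF fs_E] rot_bind[OF fs_m], simp add: rot_def spl_0)
    show ?thesis by (simp add: 1 rot_add 2 3)
  qed
  finally show ?thesis by simp
qed

text \<open>As in \<open>SR_cyc\<close>, moved letters cancel between rotations, but a
  differentiated last letter has no counterpart among the first letters. These terms form the second
  summand, which becomes \<open>e\<close> after \<open>Sh\<close>.\<close>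

lemma SE_cyc:
  assumes "\<And>x G. x \<in> P \<Longrightarrow> E x G = 0" "set p \<subseteq> P" "p0 \<in> P"
  shows "SE E (\<lambda>w. Fst J w - Lst J w) p0 p q0 q = rotE E (\<lambda>q2 q0 q1. shf (J p0) p (q2 @ q0 # q1)) q0 q
     - SR (Fst (\<lambda>f w. E f (\<lambda>f'. J f' w))) p0 p q0 q"
proof -
  have "S (\<lambda>w. Fst J w - Lst J w) p2 p0 p1 q2 q0 q1
     = (Fst (\<lambda>x p2. S (J x) p2 p0 p1 q2 q0 q1) p2 - Lst (\<lambda>x p1. S (J x) p2 p0 p1 q2 q0 q1) p1)
       + (Fst (\<lambda>x q2. S (J x) p2 p0 p1 q2 q0 q1) q2 - Lst (\<lambda>x q1. S (J x) p2 p0 p1 q2 q0 q1) q1)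
       + ((if p2 = [] then shf (J p0) p1 (q2 @ q0 # q1) else 0) - (if q1 = [] then shf (J q0) (p2 @ p0 # p1) q2 else 0))"
    for p2 p0 p1 q2 q0 q1
    by (simp add: fs_diff[OF fs_S] S_Fst S_Lst)
  then have ext: "S (\<lambda>w. Fst J w - Lst J w) = (\<lambda>p2 p0 p1 q2 q0 q1. (Fst (\<lambda>x p2. S (J x) p2 p0 p1 q2 q0 q1) p2 - Lst (\<lambda>x p1. S (J x) p2 p0 p1 q2 q0 q1) p1)
       + (Fst (\<lambda>x q2. S (J x) p2 p0 p1 q2 q0 q1) q2 - Lst (\<lambda>x q1. S (J x) p2 p0 p1 q2 q0 q1) q1)
       + ((if p2 = [] then shf (J p0) p1 (q2 @ q0 # q1) else 0) - (if q1 = [] then shf (J q0) (p2 @ p0 # p1) q2 else 0)))"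
    by (intro ext)
  have E0: "SE E (\<lambda>w. Fst J w - Lst J w) p0 p q0 q = 
     rot (\<lambda>p2 p0 p1. rotE E (\<lambda>q2 q0 q1. Fst (\<lambda>x p2. S (J x) p2 p0 p1 q2 q0 q1) p2) q0 q
        - rotE E (\<lambda>q2 q0 q1. Lst (\<lambda>x p1. S (J x) p2 p0 p1 q2 q0 q1) p1) q0 q) p0 p
     + rot (\<lambda>p2 p0 p1. rotE E (\<lambda>q2 q0 q1. Fst (\<lambda>x q2. S (J x) p2 p0 p1 q2 q0 q1) q2 - Lst (\<lambda>x q1. S (J x) p2 p0 p1 q2 q0 q1) q1) q0 q) p0 p
     + (rot (\<lambda>p2 p0 p1. rotE E (\<lambda>q2 q0 q1. if p2 = [] then shf (J p0) p1 (q2 @ q0 # q1) else 0) q0 q) p0 p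
     - rot (\<lambda>p2 p0 p1. rotE E (\<lambda>q2 q0 q1. if q1 = [] then shf (J q0) (p2 @ p0 # p1) q2 else 0) q0 q) p0 p)"
    unfolding SE_def ext by (simp only: rot_add rot_diff rotE_add rotE_diff)
  have E1: "rot (\<lambda>p2 p0 p1. rotE E (\<lambda>q2 q0 q1. Fst (\<lambda>x p2. S (J x) p2 p0 p1 q2 q0 q1) p2) q0 q
        - rotE E (\<lambda>q2 q0 q1. Lst (\<lambda>x p1. S (J x) p2 p0 p1 q2 q0 q1) p1) q0 q) p0 p = 0"
    using rot_Fst_Lst[OF fs_rotE, of "\<lambda>(q2,q0,q1) x p2 p0 p1. S (J x) p2 p0 p1 q2 q0 q1" q0 q p0 p] by simp
  \<comment> \<open>The letters in front of \<open>q0\<close> are not differentiated, so the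
    cancellation leaves exactly the terms in which \<open>E\<close> has hit the last letter.\<close>
  have E2: "rotE E (\<lambda>q2 q0 q1. Fst (\<lambda>x q2. S (J x) p2 p0 p1 q2 q0 q1) q2 - Lst (\<lambda>x q1. S (J x) p2 p0 p1 q2 q0 q1) q1) q0 q
     = - spl (\<lambda>q1 q2. Fst (\<lambda>f q2. E f (\<lambda>f. S (J f) p2 p0 p1 q2 q0 q1)) q2) q" for p2 p0 p1
  proof -
    have "rotE E (\<lambda>q2 q0 q1. Fst (\<lambda>x q2. S (J x) p2 p0 p1 q2 q0 q1) q2 - Lst (\<lambda>x q1. S (J x) p2 p0 p1 q2 q0 q1) q1) q0 q
      = spl (\<lambda>q1 q2. Fst (\<lambda>x q2. LD E (\<lambda>q1. S (J x) p2 p0 p1 q2 q0 q1) q1) q2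
          - (Lst (\<lambda>x q1. LD E (\<lambda>q1. S (J x) p2 p0 p1 q2 q0 q1) q1) q1 + Lst (\<lambda>x q1. E x (\<lambda>x. S (J x) p2 p0 p1 q2 q0 q1)) q1)) q"
      unfolding rotE_def by (simp add: fs_diff[OF LE.fs_dd] LE_Lst Fst_bind[OF LE.fs_dd])
    then show ?thesis by (simp add: spl_diff spl_add spl_Fst_Lst)
  qed
  have E3: "rot (\<lambda>p2 p0 p1. rotE E (\<lambda>q2 q0 q1. if p2 = [] then shf (J p0) p1 (q2 @ q0 # q1) else 0) q0 q) p0 p
     = rotE E (\<lambda>q2 q0 q1. shf (J p0) p (q2 @ q0 # q1)) q0 q"
  proof -
    have 1: "rotE E (\<lambda>q2 q0 q1. if p2 = [] then shf (J p0) p1 (q2 @ q0 # q1) else 0) q0 q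
       = (if p2 = [] then rotE E (\<lambda>q2 q0 q1. shf (J p0) p1 (q2 @ q0 # q1)) q0 q else 0)" for p2 p0 p1
      by (simp add: rotE_def spl_0 LE.dd_0)
    show ?thesis unfolding 1 by (rule rot_Nil)
  qed
  \<comment> \<open>If nothing follows \<open>q0\<close> there is no letter for \<open>E\<close> to
    hit. This is why the differentiated factor must be the one whose zeroth letter stands on the
    right.\<close>
  have E4: "rotE E (\<lambda>q2 q0 q1. if q1 = [] then shf (J q0) (p2 @ p0 # p1) q2 else 0) q0 q = 0" for p2 p0 p1
    unfolding rotE_def by (simp add: LE_Nil spl_0)
  have E5: "rot (\<lambda>p2 p0 p1. - spl (\<lambda>q1 q2. Fst (\<lambda>f q2. E f (\<lambda>f. S (J f) p2 p0 p1 q2 q0 q1)) q2) q) p0 p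
     = - SR (Fst (\<lambda>f w. E f (\<lambda>f'. J f' w))) p0 p q0 q"
  proof -
    have "S (Fst (\<lambda>f w. E f (\<lambda>f'. J f' w))) p2 p0 p1 q2 q0 q1 = Fst (\<lambda>f q2. E f (\<lambda>f. S (J f) p2 p0 p1 q2 q0 q1)) q2"
      if "p = p1 @ p2" for p2 p1 q2 q1
    proof -
      have "Fst (\<lambda>x p2. S (\<lambda>w. E x (\<lambda>x. J x w)) p2 p0 p1 q2 q0 q1) p2 = 0"
        using that assms by (cases p2) (auto simp: fs_zero[OF fs_S])
      then show ?thesis
        using assms by (auto simp: S_Fst S_bind[OF fs_E] fs_zero[OF fs_shf])
    qed
    then have "SR (Fst (\<lambda>f w. E f (\<lambda>f'. J f' w))) p0 p q0 q = rot (\<lambda>p2 p0 p1. spl (\<lambda>q1 q2. Fst (\<lambda>f q2. E f (\<lambda>f. S (J f) p2 p0 p1 q2 q0 q1)) q2) q) p0 p"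
      unfolding SR_def by (intro rot_cong) (auto simp: rot_def)
    then show ?thesis by (simp add: rot_def spl_minus)
  qed
  show ?thesis unfolding E0 E1 E2 E3 E4 E5 by (simp add: rot_def spl_0)
qed

text \<open>\<open>E\<close> kills the letters of \<open>p\<close>, so applying it to the shuffled
  letters after \<open>z\<close> is the same as applying it to the piece of \<open>q\<close> among
  them.\<close>

lemma wall_rotE:
  assumes "\<And>x G. x \<in> set p \<Longrightarrow> E x G = 0"
  shows "shf (rotE E \<psi> z) p q = rot (\<lambda>p2 p0 p1. rotE E (\<lambda>q2 q0 q1. shf (\<lambda>x. shf (\<psi> x z) p1 q1) p2 q2) q0 q) p0 p"
proof -
  have LD0: "LD E \<phi> u = 0" if "set u \<subseteq> set p" for \<phi> u
    using that by (induction u arbitrary: \<phi>) (auto simp: Fst_0 assms)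
  have "shf (rotE E \<psi> z) p q = shf (spl (\<lambda>a b. LD E (\<psi> b z) a)) p q"
    by (simp add: rotE_def[abs_def])
  also have "\<dots> = spl (\<lambda>p1 p2. spl (\<lambda>q1 q2. shf (\<lambda>a. shf (\<lambda>b. LD E (\<psi> b z) a) p2 q2) p1 q1) q) p"
    by (rule shf_spl)
  also have "\<dots> = spl (\<lambda>p1 p2. spl (\<lambda>q1 q2. LD E (\<lambda>q1. shf (\<lambda>b. shf (\<psi> b z) p1 q1) p2 q2) q1) q) p"
  proof (intro spl_cong)
    fix p1 p2 q1 q2 assume "p = p1 @ p2"
    then have p1: "set p1 \<subseteq> set p" by auto
    have "shf (\<lambda>a. shf (\<lambda>b. LD E (\<psi> b z) a) p2 q2) p1 q1 = shf (\<lambda>b. shf (LD E (\<psi> b z)) p1 q1) p2 q2"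
      by (subst shf_bind[OF fs_shf]) simp
    also have "\<dots> = shf (\<lambda>b. LD E (\<lambda>q1. shf (\<psi> b z) p1 q1) q1) p2 q2"
      by (subst LE.shf_dd[where P=UNIV and Q=UNIV]) (simp_all add: comm_def LD0[OF p1])
    also have "\<dots> = LD E (\<lambda>q1. shf (\<lambda>b. shf (\<psi> b z) p1 q1) p2 q2) q1"
      by (rule LE.dd_bind[OF fs_shf])
    finally show "shf (\<lambda>a. shf (\<lambda>b. LD E (\<psi> b z) a) p2 q2) p1 q1 = LD E (\<lambda>q1. shf (\<lambda>b. shf (\<psi> b z) p1 q1) p2 q2) q1" .
  qed
  finally show ?thesis by (simp add: rot_def rotE_def)
qed

text \<open>\<open>ehat\<close> needs a differentiated first bar entry. If that entry comes from
  \<open>p\<close> it is killed by \<open>E\<close>, so only the first letter of \<open>q\<close>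
  contributes.\<close>

lemma shf_ehat:
  assumes m': "\<And>x y. fs (m' x y)"
    and p: "set p \<subseteq> P" "\<And>x G. x \<in> P \<Longrightarrow> E x G = 0" and q: "set q \<subseteq> Q"
    and r: "\<And>f w. f \<in> Q \<Longrightarrow> m' p0 q0 (\<lambda>z. E f (\<lambda>f. m z f (\<lambda>t. \<phi> (t # w)))) = E f (\<lambda>f. m q0 f (\<lambda>z. m' p0 z (\<lambda>t. \<phi> (t # w))))"
  shows "shf (\<lambda>w. m' p0 q0 (\<lambda>z. ehat m E (\<lambda>z w. \<phi> (z # w)) z w)) p q
     = ehat m E (\<lambda>q0 q. shf (\<lambda>w. m' p0 q0 (\<lambda>z. \<phi> (z # w))) p q) q0 q"
proof -
  have 1: "Fst (\<lambda>y w'. shf (\<lambda>w. m' p0 q0 (\<lambda>z. E y (\<lambda>f'. m z f' (\<lambda>z. \<phi> (z # w))))) w' q) p = 0"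
    using p by (cases p) (auto simp: fs_zero[OF m'] fs_zero[OF fs_shf])
  have 2: "Fst (\<lambda>y. shf (\<lambda>w. m' p0 q0 (\<lambda>z. E y (\<lambda>f'. m z f' (\<lambda>z. \<phi> (z # w))))) p) q = Fst (\<lambda>y w'. shf (\<lambda>w. E y (\<lambda>f. m q0 f (\<lambda>z. m' p0 z (\<lambda>t. \<phi> (t # w))))) p w') q"
    using q by (cases q) (auto simp: r)
  show ?thesis
    by (simp add: ehat_def Fst_bind[OF m'] shf_Fst 1 2 shf_bind[OF fs_E] shf_bind[OF fs_m])
qed

text \<open>The commutation of \<open>e\<close> with \<open>b\<close>. Terms of \<open>b\<close>
  away from the zeroth letter and its first neighbour \<open>f\<close> commute trivially;
  \<open>r1\<close> treats the differential of these two letters, \<open>r2\<close> the products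
  involving the letter after \<open>f\<close>, and \<open>r3\<close> the cyclic product with the
  last letter.\<close>

lemma ehat_bch:
  assumes m': "\<And>x y. fs (m' x y)"
   and r1: "\<And>x f w. x \<in> X \<Longrightarrow> f \<in> X \<Longrightarrow> D x (\<lambda>z. E f (\<lambda>f. m' z f (\<lambda>t. \<Psi> t w))) + D f (\<lambda>f. E f (\<lambda>f. m' x f (\<lambda>t. \<Psi> t w))) = E f (\<lambda>f. m' x f (\<lambda>z. D z (\<lambda>t. \<Psi> t w)))"
   and r2: "\<And>x f y w. x \<in> X \<Longrightarrow> f \<in> X \<Longrightarrow> y \<in> X \<Longrightarrow> E f (\<lambda>f. m' x f (\<lambda>z. m z y (\<lambda>t. \<Psi> t w))) = m f y (\<lambda>z. E z (\<lambda>z. m' x z (\<lambda>t. \<Psi> t w))) + m x f (\<lambda>z. E y (\<lambda>y. m' z y (\<lambda>t. \<Psi> t w)))"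
   and r3: "\<And>x f l w. x \<in> X \<Longrightarrow> f \<in> X \<Longrightarrow> l \<in> X \<Longrightarrow> E f (\<lambda>f. m' x f (\<lambda>z. m l z (\<lambda>t. \<Psi> t w))) = m l x (\<lambda>z. E f (\<lambda>f. m' z f (\<lambda>t. \<Psi> t w)))"
   and aw: "a \<in> X" "set w \<subseteq> X"
  shows "ehat m' E (bch m D \<Psi>) a w = bch m D (ehat m' E \<Psi>) a w"
proof (cases w)
  case Nil
  show ?thesis by (simp add: Nil ehat_def bch_def fs_zero[OF fs_D])
next
  case (Cons f w')
  let ?X = "\<lambda>G. E f (\<lambda>f. m' a f G)"
  have X: "fs ?X" by (rule fs_bind[OF fs_E m'])
  have L: "ehat m' E (bch m D \<Psi>) a w = ?X (\<lambda>z. D z (\<lambda>t. \<Psi> t w')) + dd m D (\<lambda>w. ?X (\<lambda>z. \<Psi> z w)) w'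
     + Fst (\<lambda>y w''. ?X (\<lambda>z. m z y (\<lambda>t. \<Psi> t w''))) w' + Lst (\<lambda>l w''. ?X (\<lambda>z. m l z (\<lambda>t. \<Psi> t w''))) w'"
    using fs_add[OF X] dd_bind[OF X] Fst_bind[OF X, of "\<lambda>z y v. m z y (\<lambda>t. \<Psi> t v)" w']
      Lst_bind[OF X, of "\<lambda>z y v. m y z (\<lambda>t. \<Psi> t v)" w']
    by (simp add: Cons ehat_def bch_def)
  have R: "ehat m' E \<Psi> x (f # w) = E f (\<lambda>f. m' x f (\<lambda>t. \<Psi> t w))" for x f w
    by (simp add: ehat_def)
  have F: "m a f (\<lambda>z. ehat m' E \<Psi> z w') = Fst (\<lambda>y w''. m a f (\<lambda>z. E y (\<lambda>y. m' z y (\<lambda>t. \<Psi> t w'')))) w'"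
    by (simp add: ehat_def Fst_bind[OF fs_m])
  have Ls: "Lst (\<lambda>l w''. m l a (\<lambda>z. ehat m' E \<Psi> z w'')) (f # w') = Lst (\<lambda>l w''. m l a (\<lambda>z. E f (\<lambda>f. m' z f (\<lambda>t. \<Psi> t w'')))) w'"
    by (cases "w' = []") (simp_all add: Lst_Cons R, simp add: ehat_def fs_zero[OF fs_m])
  have fX: "f \<in> X" "set w' \<subseteq> X" using aw Cons by auto
  have 2: "Fst (\<lambda>y w''. ?X (\<lambda>z. m z y (\<lambda>t. \<Psi> t w''))) w' = Fst (\<lambda>y w''. m f y (\<lambda>z. E z (\<lambda>z. m' a z (\<lambda>t. \<Psi> t w'')))
      + m a f (\<lambda>z. E y (\<lambda>y. m' z y (\<lambda>t. \<Psi> t w'')))) w'"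
    using fX aw by (cases w') (auto simp: r2)
  have 3: "Lst (\<lambda>l w''. ?X (\<lambda>z. m l z (\<lambda>t. \<Psi> t w''))) w' = Lst (\<lambda>l w''. m l a (\<lambda>z. E f (\<lambda>f. m' z f (\<lambda>t. \<Psi> t w'')))) w'"
    using fX aw by (cases w' rule: rev_cases) (auto simp: r3)
  show ?thesis unfolding L 2 3
    by (simp add: bch_def R Cons F Ls r1[OF aw(1) fX(1), symmetric] Fst_add algebra_simps)
qed

end

lemma ksgn_simps [simp]: "ksgn True = -1" "ksgn False = 1" "ksgn p * ksgn p = 1" "ksgn p * (ksgn p * x) = x"
  by (auto simp: ksgn_def)

lemma ksgn_xor: "ksgn p * ksgn q = ksgn (p \<noteq> q)"
  by (auto simp: ksgn_def)

section \<open>Permutation signs\<close>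

text \<open>The value 0 for equal tags keeps \<open>sg\<close> antisymmetric, so that the rules for
  concatenation and exchange of blocks hold for all lists.\<close>

definition sg :: "nat \<Rightarrow> nat \<Rightarrow> 'k::comm_ring_1" where
  "sg x y = (if x < y then 1 else if y < x then -1 else 0)"

primrec c1 :: "nat \<Rightarrow> nat list \<Rightarrow> 'k::comm_ring_1" where
  "c1 x [] = 1"
| "c1 x (y # t) = sg x y * c1 x t"

primrec cr :: "nat list \<Rightarrow> nat list \<Rightarrow> 'k::comm_ring_1" where
  "cr [] t = 1"
| "cr (x # s) t = c1 x t * cr s t"

text \<open>The sign of the permutation sorting a list, and 0 if the list is not distinct.\<close>

primrec psgn :: "nat list \<Rightarrow> 'k::comm_ring_1" where
  "psgn [] = 1"
| "psgn (x # s) = c1 x s * psgn s"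

lemma c1_append [simp]: "c1 x (s @ t) = c1 x s * c1 x t"
  by (induction s) (simp_all add: mult.assoc)

lemma cr_append1 [simp]: "cr (s @ s') t = cr s t * cr s' t"
  by (induction s) (simp_all add: mult.assoc)

lemma cr_append2 [simp]: "cr s (t @ t') = cr s t * cr s t'"
  by (induction s) (simp_all add: ac_simps)

lemma cr_Nil2 [simp]: "cr s [] = 1"
  by (induction s) simp_all

lemma sg_swap: "sg y x = - sg x y"
  by (auto simp: sg_def)

lemma cr_Cons2 [simp]: "cr s (y # t) = ksgn (odd (length s)) * c1 y s * cr s t"
  by (induction s) (auto simp: sg_swap[of _ y] ac_simps ksgn_def)

lemma psgn_append [simp]: "psgn (s @ t) = psgn s * psgn t * cr s t"
  by (induction s) (simp_all add: ac_simps)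

lemma cr_swap: "cr t s = ksgn (odd (length s) \<and> odd (length t)) * cr s t"
  by (induction s) (auto simp: ac_simps ksgn_def)

lemma sg_refl [simp]: "sg x x = 0"
  by (simp add: sg_def)

lemma c1_sq: "x \<notin> set s \<Longrightarrow> c1 x s * c1 x s = 1"
  by (induction s) (auto simp: sg_def)

lemma psgn_sq: "distinct s \<Longrightarrow> psgn s * psgn s = (1 :: 'k::comm_ring_1)"
proof (induction s)
  case (Cons x s)
  have "c1 x s * psgn s * (c1 x s * psgn s) = (c1 x s * c1 x s) * (psgn s * psgn s :: 'k)" by (simp add: ac_simps)
  with Cons show ?case using c1_sq[of x s, where ?'a='k] by simp
qed simp

lemma c1_less: "(\<And>y. y \<in> set s \<Longrightarrow> x < y) \<Longrightarrow> c1 x s = 1"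
  by (induction s) (auto simp: sg_def)

lemma c1_prod_mset: "c1 x s = prod_mset (image_mset (sg x) (mset s))"
  by (induction s) simp_all

lemma c1_mset: "mset s = mset t \<Longrightarrow> c1 x s = c1 x t"
  by (simp add: c1_prod_mset)

section \<open>Pairings\<close>

definition pair :: "('b \<Rightarrow> 'k::comm_ring_1) \<Rightarrow> ('b \<Rightarrow> 'k) \<Rightarrow> 'k" where
  "pair v g = (\<Sum>z\<in>vsupp v. v z * g z)"

lemma fs_pair: "fs (pair v)"
proof (cases "finite (vsupp v)")
  case True
  then show ?thesis unfolding fs_def pair_def by blast
next
  \<comment> \<open>A sum over an infinite set is 0 by convention, so the pairing is a finite
    functional in this case as well.\<close>
  case False
  then have "pair v = (\<lambda>g. 0)" by (auto simp: pair_def)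
  then show ?thesis by (simp add: fs_0)
qed

lemma pair_superset: "finite Z \<Longrightarrow> vsupp v \<subseteq> Z \<Longrightarrow> pair v g = (\<Sum>z\<in>Z. v z * g z)"
  unfolding pair_def by (rule sum.mono_neutral_left) (auto simp: vsupp_def)

lemma vsupp_bv: "vsupp (bv c :: 'b \<Rightarrow> 'k::comm_ring_1) = {c}"
  by (auto simp: vsupp_def bv_def)

lemma pair_bv [simp]: "pair (bv c) g = g c"
  by (simp add: pair_def vsupp_bv) (simp add: bv_def)

lemma pair_at: "finite (vsupp v) \<Longrightarrow> pair v (bv d) = v d"
  by (subst pair_superset[where Z="insert d (vsupp v)"]) (auto simp: bv_def vsupp_def if_distrib sum.insert_remove cong: if_cong)

lemma pair_cong: "(\<And>z. v z \<noteq> 0 \<Longrightarrow> g z = h z) \<Longrightarrow> pair v g = pair v h"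
  unfolding pair_def by (rule sum.cong) (auto simp: vsupp_def)

lemma finite_vsupp_add: fixes v w :: "'b \<Rightarrow> 'k::comm_ring_1" shows "finite (vsupp v) \<Longrightarrow> finite (vsupp w) \<Longrightarrow> finite (vsupp (\<lambda>d. v d + w d))"
  by (rule finite_subset[of _ "vsupp v \<union> vsupp w"]) (auto simp: vsupp_def)

lemma pair_add: "finite (vsupp v) \<Longrightarrow> finite (vsupp w) \<Longrightarrow> pair (\<lambda>d. v d + w d) g = pair v g + pair w g"
  by (subst (1 2 3) pair_superset[where Z="vsupp v \<union> vsupp w"]) (auto simp: vsupp_def sum.distrib distrib_right)

lemma finite_vsupp_scale: fixes v :: "'b \<Rightarrow> 'k::comm_ring_1" shows "finite (vsupp v) \<Longrightarrow> finite (vsupp (\<lambda>d. r * v d))"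
  by (rule finite_subset[of _ "vsupp v"]) (auto simp: vsupp_def)

lemma pair_scale: "finite (vsupp v) \<Longrightarrow> pair (\<lambda>d. r * v d) g = r * pair v g"
  by (subst (1 2) pair_superset[where Z="vsupp v"]) (auto simp: vsupp_def sum_distrib_left mult.assoc)

lemma finite_vsupp_minus: "finite (vsupp v) \<Longrightarrow> finite (vsupp (\<lambda>d. - v d :: 'k::comm_ring_1))"
  by (rule finite_subset[of _ "vsupp v"]) (auto simp: vsupp_def)

lemma pair_minus: "finite (vsupp v) \<Longrightarrow> pair (\<lambda>d. - v d) g = - pair v g"
  using pair_scale[of v "-1" g] by simp

lemma pair_0 [simp]: "pair (\<lambda>d. 0) g = 0"
  by (simp add: pair_def vsupp_def)

lemma finite_vsupp_sum:
  "finite I \<Longrightarrow> (\<And>i. i \<in> I \<Longrightarrow> finite (vsupp (v i))) \<Longrightarrow> finite (vsupp (\<lambda>d. \<Sum>i\<in>I. v i d))"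
  by (rule finite_subset[of _ "\<Union>i\<in>I. vsupp (v i)"]) (auto simp: vsupp_def intro: ccontr sum.neutral)

lemma pair_sum:
  assumes "finite I" "\<And>i. i \<in> I \<Longrightarrow> finite (vsupp (v i))"
  shows "pair (\<lambda>d. \<Sum>i\<in>I. v i d) g = (\<Sum>i\<in>I. pair (v i) g)"
proof -
  let ?Z = "\<Union>i\<in>I. vsupp (v i)"
  have Z: "finite ?Z" using assms by blast
  have "vsupp (\<lambda>d. \<Sum>i\<in>I. v i d) \<subseteq> ?Z" by (auto simp: vsupp_def intro: ccontr sum.neutral)
  then have "pair (\<lambda>d. \<Sum>i\<in>I. v i d) g = (\<Sum>z\<in>?Z. (\<Sum>i\<in>I. v i z) * g z)" by (rule pair_superset[OF Z])
  also have "\<dots> = (\<Sum>i\<in>I. \<Sum>z\<in>?Z. v i z * g z)" by (simp add: sum_distrib_right sum.swap[of _ I])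
  also have "\<dots> = (\<Sum>i\<in>I. pair (v i) g)"
    by (rule sum.cong[OF refl]) (use Z in \<open>auto intro!: pair_superset[symmetric]\<close>)
  finally show ?thesis .
qed

lemma finite_vsupp_lin:
  "finite (vsupp v) \<Longrightarrow> (\<And>b. finite (vsupp (T b))) \<Longrightarrow> finite (vsupp (lin T v))"
  unfolding lin_def by (intro finite_vsupp_sum finite_vsupp_scale)

lemma pair_lin:
  assumes "finite (vsupp v)" "\<And>b. finite (vsupp (T b))"
  shows "pair (lin T v) g = pair v (\<lambda>b. pair (T b) g)"
  unfolding lin_def by (subst pair_sum) (auto simp: assms finite_vsupp_scale pair_scale, simp add: pair_def)

definition fin :: "('b \<Rightarrow> 'c \<Rightarrow> 'k::zero) \<Rightarrow> bool" where
  "fin T \<longleftrightarrow> (\<forall>c. finite (vsupp (T c)))"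

text \<open>The transposed action of an operator on functions of basis vectors.\<close>

definition pr :: "('b \<Rightarrow> 'c \<Rightarrow> 'k::comm_ring_1) \<Rightarrow> ('c \<Rightarrow> 'k) \<Rightarrow> 'b \<Rightarrow> 'k" where
  "pr T f c = pair (T c) f"

lemma fin_ocomp: "fin T \<Longrightarrow> fin S' \<Longrightarrow> fin (ocomp T S')"
  by (auto simp: fin_def ocomp_def finite_vsupp_lin)

lemma pr_ocomp: "fin T \<Longrightarrow> fin S' \<Longrightarrow> pr (ocomp T S') f = pr S' (pr T f)"
  by (auto simp: fin_def ocomp_def pr_def[abs_def] pair_lin fun_eq_iff)

lemma ocomp_pr: "ocomp T S' c d = pr S' (\<lambda>c. T c d) c"
  by (simp add: ocomp_def lin_def pr_def pair_def)

lemma pr_at: "fin T \<Longrightarrow> pr T (bv d) c = T c d"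
  by (simp add: pr_def fin_def pair_at)

lemma fin_bv: "fin bv"
  by (simp add: fin_def vsupp_bv)

lemma opow_Suc: "opow T (Suc k) = ocomp T (opow T k)"
  by (simp add: opow_def)

lemma fin_opow: "fin T \<Longrightarrow> fin (opow T k)"
  by (induction k) (simp_all add: opow_Suc fin_ocomp, simp add: opow_def fin_bv)

lemma pr_opow_0: "pr (opow T 0) f = f"
  by (simp add: opow_def pr_def fun_eq_iff)

lemma pr_opow_Suc: "fin T \<Longrightarrow> pr (opow T (Suc k)) f = pr (opow T k) (pr T f)"
  by (simp add: opow_Suc pr_ocomp fin_opow)

section \<open>Tagged letters\<close>

text \<open>A letter (s, x) stands for the basis element x together with the list s of odd symbols it carries:
  its own, if the shift of x is odd, and one for every product, differential or h applied.  Koszul signs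
  then are the signs of permutations of these symbols, and the products, differentials and shuffles of
  words of tagged letters carry no further signs.\<close>

definition mC :: "('i, 'k::field_char_0) dga \<Rightarrow> nat \<Rightarrow> nat list \<times> 'i \<Rightarrow> nat list \<times> 'i \<Rightarrow> (nat list \<times> 'i \<Rightarrow> 'k) \<Rightarrow> 'k" where
  "mC A \<epsilon> x y G = - pair (dga.mult A (snd x) (snd y)) (\<lambda>z. G (fst x @ \<epsilon> # fst y, z))"

definition DC :: "('i, 'k::field_char_0) dga \<Rightarrow> nat \<Rightarrow> nat list \<times> 'i \<Rightarrow> (nat list \<times> 'i \<Rightarrow> 'k) \<Rightarrow> 'k" where
  "DC A \<epsilon> x G = pair (dif A (snd x)) (\<lambda>z. G (\<epsilon> # fst x, z))"

definition oC :: "('i, 'k::field_char_0) dga \<Rightarrow> nat \<Rightarrow> nat list \<times> 'i" where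
  "oC A \<eta> = ([\<eta>], one_idx A)"

definition tags :: "(nat list \<times> 'i) list \<Rightarrow> nat list" where
  "tags L = concat (map fst L)"

lemma tags_simps [simp]: "tags [] = []" "tags (x # L) = fst x @ tags L" "tags (L @ L') = tags L @ tags L'"
  by (simp_all add: tags_def)

definition chn :: "'i list \<Rightarrow> 'i \<times> 'i list" where
  "chn w = (hd w, tl w)"

text \<open>The value of \<open>f\<close> on the chain underlying a tagged word, times the Koszul
  sign read off from the tags. \<open>U\<close> and \<open>V\<close> are the tags standing before
  and after the word, so that an operator on one tensor factor can be described in its
  place.\<close>

definition lift :: "nat list \<Rightarrow> nat list \<Rightarrow> ('i \<times> 'i list \<Rightarrow> 'k::comm_ring_1) \<Rightarrow> (nat list \<times> 'i) list \<Rightarrow> 'k" where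
  "lift U V f L = psgn (U @ tags L @ V) * f (chn (map snd L))"

text \<open>A test function of a single letter with the rest of the word frozen; by
  \<open>lift_loc\<close> relations between letters have to be checked only on functions of this
  form.\<close>

definition loc :: "nat list \<Rightarrow> nat list \<Rightarrow> ('i \<Rightarrow> 'k::comm_ring_1) \<Rightarrow> nat list \<times> 'i \<Rightarrow> 'k" where
  "loc U V g x = psgn (U @ fst x @ V) * g (snd x)"

lemma lift_loc: "lift U V f (u @ x # w) = loc (U @ tags u) (tags w @ V) (\<lambda>x. f (chn (map snd u @ x # map snd w))) x"
  by (simp add: lift_def loc_def)

lemma fs_mC: "fs (mC A \<epsilon> x y)"
  unfolding mC_def by (intro fs_uminus fs_map[OF fs_pair, where g="\<lambda>z. (fst x @ \<epsilon> # fst y, z)"])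

lemma fs_DC: "fs (DC A \<epsilon> x)"
  unfolding DC_def by (rule fs_map[OF fs_pair, where g="\<lambda>z. (\<epsilon> # fst x, z)"])

lemma letter_ops_C: "letter_ops (mC A \<epsilon>) (DC A' \<epsilon>')"
  by unfold_locales (rule fs_mC fs_DC)+

lemma letter_ops_E_C: "letter_ops_E (mC A \<epsilon>) (DC A' \<epsilon>') (DC A'' \<epsilon>'')"
  by unfold_locales (rule fs_mC fs_DC)+

lemma DC_loc: "DC A \<epsilon> x (loc U V g) = loc (U @ [\<epsilon>]) V (\<lambda>z. pair (dif A z) g) x"
  using fs_scale[OF fs_pair] by (simp add: DC_def loc_def)

lemma mC_loc: "mC A \<epsilon> x y (loc U V g) = loc U (\<epsilon> # fst y @ V) (\<lambda>x. - pair (dga.mult A x (snd y)) g) x"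
  using fs_scale[OF fs_pair] by (simp add: mC_def loc_def)

lemma mC_loc2: "mC A \<epsilon> x y (loc U V g) = loc (U @ fst x @ [\<epsilon>]) V (\<lambda>y. - pair (dga.mult A (snd x) y) g) y"
  using fs_scale[OF fs_pair] by (simp add: mC_def loc_def)


lemma DC_abs: "(\<lambda>x. DC A \<epsilon> x (loc U V g)) = loc (U @ [\<epsilon>]) V (\<lambda>z. pair (dif A z) g)"
  by (rule ext) (rule DC_loc)

lemma mC_abs1: "(\<lambda>x. mC A \<epsilon> x y (loc U V g)) = loc U (\<epsilon> # fst y @ V) (\<lambda>x. - pair (dga.mult A x (snd y)) g)"
  by (rule ext) (rule mC_loc)

lemma mC_abs2: "(\<lambda>y. mC A \<epsilon> x y (loc U V g)) = loc (U @ fst x @ [\<epsilon>]) V (\<lambda>y. - pair (dga.mult A (snd x) y) g)"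
  by (rule ext) (rule mC_loc2)

lemmas loc_simps = DC_loc mC_loc DC_abs mC_abs1 mC_abs2

section \<open>dg algebras acting on functions\<close>

text \<open>The part of \<open>is_dga\<close> concerning unit, parities and finiteness. It is this
  notion that is verified for the tensor product and for its variants with one of the two
  differentials dropped.\<close>

definition gda :: "('i, 'k::field_char_0) dga \<Rightarrow> bool" where
  "gda A \<longleftrightarrow> par A (one_idx A) = False
   \<and> (\<forall>i j. finite (vsupp (dga.mult A i j)))
   \<and> (\<forall>i. finite (vsupp (dif A i)))
   \<and> (\<forall>i j l. dga.mult A i j l \<noteq> 0 \<longrightarrow> par A l = (par A i \<noteq> par A j))
   \<and> (\<forall>i l. dif A i l \<noteq> 0 \<longrightarrow> par A l = (\<not> par A i))
   \<and> (\<forall>j. dga.mult A (one_idx A) j = bv j \<and> dga.mult A j (one_idx A) = bv j)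
   \<and> dif A (one_idx A) = (\<lambda>_. 0)"

text \<open>The number of tags has the parity of the letter in \<Pi>A. Products and differentials
  preserve this, because each contributes one tag.\<close>

definition adm :: "('i, 'k::field_char_0) dga \<Rightarrow> nat list \<times> 'i \<Rightarrow> bool" where
  "adm A x \<longleftrightarrow> odd (length (fst x)) = (\<not> par A (snd x))"

lemma pair_nested:
  assumes "finite (vsupp v)" "finite (vsupp w)" "\<And>b. finite (vsupp (T b))" "\<And>b. finite (vsupp (T' b))"
    "\<And>q. (\<Sum>p\<in>vsupp v. v p * T p q) = (\<Sum>p\<in>vsupp w. w p * T' p q)"
  shows "pair v (\<lambda>p. pair (T p) g) = pair w (\<lambda>p. pair (T' p) g)"
proof -
  have "lin T v = lin T' w" using assms(5) by (auto simp: lin_def)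
  then show ?thesis using pair_lin[of v T g] pair_lin[of w T' g] assms by simp
qed

lemma dga_assoc:
  assumes "is_dga A"
  shows "pair (dga.mult A i j) (\<lambda>p. pair (dga.mult A p l) g) = pair (dga.mult A j l) (\<lambda>p. pair (dga.mult A i p) g)"
  by (rule pair_nested) (use assms in \<open>auto simp: is_dga_def\<close>)

lemma dga_dd:
  assumes "is_dga A"
  shows "pair (dif A i) (\<lambda>p. pair (dif A p) g) = 0"
proof -
  have "pair (dif A i) (\<lambda>p. pair (dif A p) g) = pair (\<lambda>_. 0) (\<lambda>p. pair (dif A p) g)"
    by (rule pair_nested) (use assms in \<open>auto simp: is_dga_def vsupp_def\<close>)
  then show ?thesis by simp
qed

lemma dga_leibniz:
  assumes "is_dga A"
  shows "pair (dga.mult A i j) (\<lambda>p. pair (dif A p) g)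
    = pair (dif A i) (\<lambda>p. pair (dga.mult A p j) g) + ksgn (par A i) * pair (dif A j) (\<lambda>p. pair (dga.mult A i p) g)"
proof -
  have f: "finite (vsupp (dif A i))" "finite (vsupp (dga.mult A i j))" for i j
    using assms by (auto simp: is_dga_def)
  have f2: "finite (vsupp (lin T (dif A i)))" if "\<And>b. finite (vsupp (T b))" for i and T :: "'a \<Rightarrow> 'a \<Rightarrow> 'b"
    by (rule finite_vsupp_lin) (use f that in auto)
  have "lin (dif A) (dga.mult A i j) = (\<lambda>q. lin (\<lambda>p. dga.mult A p j) (dif A i) q + ksgn (par A i) * lin (dga.mult A i) (dif A j) q)"
    using assms unfolding lin_def is_dga_def by (intro ext) blast
  then have "pair (lin (dif A) (dga.mult A i j)) g
    = pair (\<lambda>q. lin (\<lambda>p. dga.mult A p j) (dif A i) q + ksgn (par A i) * lin (dga.mult A i) (dif A j) q) g" by simp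
  then show ?thesis
    by (simp add: pair_lin f pair_add f2 finite_vsupp_scale pair_scale)
qed

lemma is_dga_gda:
  assumes "is_dga A" shows "gda A"
proof -
  have u: "dga.mult A (one_idx A) j = bv j" "dga.mult A j (one_idx A) = bv j" "par A (one_idx A) = False" "finite (vsupp (dif A j))" for j
    using assms by (auto simp: is_dga_def)
  \<comment> \<open>The Leibniz rule for 1 1 = 1 gives d 1 = d 1 + d 1, hence d 1 = 0.\<close>
  have "pair (dif A (one_idx A)) g = pair (dif A (one_idx A)) g + pair (dif A (one_idx A)) g" for g
    using dga_leibniz[OF assms, of "one_idx A" "one_idx A" g] by (simp add: u)
  then have "dif A (one_idx A) l = 0" for l
    using pair_at[OF u(4), of "one_idx A" l] by (metis add_cancel_left_left)
  then show ?thesis using assms by (auto simp: gda_def is_dga_def)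
qed

lemma gdaD:
  assumes "gda A"
  shows "\<not> par A (one_idx A)" "finite (vsupp (dga.mult A i j))" "finite (vsupp (dif A i))"
    "dga.mult A i j l \<noteq> 0 \<Longrightarrow> par A l = (par A i \<noteq> par A j)" "dif A i l \<noteq> 0 \<Longrightarrow> par A l = (\<not> par A i)"
    "dga.mult A (one_idx A) j = bv j" "dga.mult A j (one_idx A) = bv j" "dif A (one_idx A) = (\<lambda>_. 0)"
  using assms by (auto simp: gda_def)

lemma gda_no_dif: "gda A \<Longrightarrow> gda (A\<lparr>dif := \<lambda>_ _. 0\<rparr>)"
  by (auto simp: gda_def vsupp_def)

lemma tensor_sel [simp]:
  "one_idx (dga_tensor A B) = (one_idx A, one_idx B)" "par (dga_tensor A B) (i, j) = (par A i \<noteq> par B j)"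
  by (simp_all add: dga_tensor_def)

lemma pair_prod:
  fixes a :: "'a \<Rightarrow> 'k::comm_ring_1"
  assumes "finite (vsupp a)" "finite (vsupp b)"
  shows "finite (vsupp (\<lambda>(l, l2). c * a l * b l2))"
    "pair (\<lambda>(l, l2). c * a l * b l2) g = c * pair a (\<lambda>l. pair b (\<lambda>l2. g (l, l2)))"
proof -
  have sub: "vsupp (\<lambda>(l, l2). c * a l * b l2) \<subseteq> vsupp a \<times> vsupp b"
    by (auto simp: vsupp_def)
  have f: "finite (vsupp a \<times> vsupp b)" using assms by simp
  show "finite (vsupp (\<lambda>(l, l2). c * a l * b l2))" by (rule finite_subset[OF sub f])
  show "pair (\<lambda>(l, l2). c * a l * b l2) g = c * pair a (\<lambda>l. pair b (\<lambda>l2. g (l, l2)))"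
    unfolding pair_superset[OF f sub]
    by (simp add: pair_def sum.cartesian_product sum_distrib_left sum_distrib_right mult.assoc split_def)
qed

lemma tensor_mult:
  assumes "gda A" "gda B"
  shows "finite (vsupp (dga.mult (dga_tensor A B) x y))"
    "pair (dga.mult (dga_tensor A B) (i, j) (i2, j2)) g
       = ksgn (par B j \<and> par A i2) * pair (dga.mult A i i2) (\<lambda>l. pair (dga.mult B j j2) (\<lambda>l2. g (l, l2)))"
proof -
  obtain i j i2 j2 where xy: "x = (i, j)" "y = (i2, j2)" by (cases x; cases y)
  show "finite (vsupp (dga.mult (dga_tensor A B) x y))"
    using pair_prod(1)[of "dga.mult A i i2" "dga.mult B j j2"] assms by (simp add: xy dga_tensor_def gdaD)
next
  show "pair (dga.mult (dga_tensor A B) (i, j) (i2, j2)) g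
       = ksgn (par B j \<and> par A i2) * pair (dga.mult A i i2) (\<lambda>l. pair (dga.mult B j j2) (\<lambda>l2. g (l, l2)))"
    using pair_prod(2)[of "dga.mult A i i2" "dga.mult B j j2" _ g] assms by (simp add: dga_tensor_def gdaD)
qed

lemma tensor_dif:
  assumes "gda A" "gda B"
  shows "finite (vsupp (dif (dga_tensor A B) x))"
    "pair (dif (dga_tensor A B) (i, j)) g = pair (dif A i) (\<lambda>l. g (l, j)) + ksgn (par A i) * pair (dif B j) (\<lambda>l2. g (i, l2))"
proof -
  have e: "dif (dga_tensor A B) (i, j) = (\<lambda>z. (\<lambda>(l, l2). 1 * dif A i l * bv j l2) z + (\<lambda>(l, l2). ksgn (par A i) * bv i l * dif B j l2) z)" for i j
    by (auto simp: dga_tensor_def bv_def fun_eq_iff)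
  have f: "finite (vsupp (bv x))" "finite (vsupp (dif A i))" "finite (vsupp (dif B j))" for x :: 'z and i j
    using assms by (auto simp: vsupp_bv gdaD)
  obtain i j where x: "x = (i, j)" by (cases x)
  show "finite (vsupp (dif (dga_tensor A B) x))"
    unfolding x e by (intro finite_vsupp_add pair_prod f)
next
  have f: "finite (vsupp (dif A i))" "finite (vsupp (dif B j))" for i j
    using assms by (auto simp: gdaD)
  have e: "dif (dga_tensor A B) (i, j) = (\<lambda>z. (\<lambda>(l, l2). 1 * dif A i l * bv j l2) z + (\<lambda>(l, l2). ksgn (par A i) * bv i l * dif B j l2) z)"
    by (auto simp: dga_tensor_def bv_def fun_eq_iff)
  have b: "finite (vsupp (bv i))" "finite (vsupp (bv j))" by (simp_all add: vsupp_bv)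
  show "pair (dif (dga_tensor A B) (i, j)) g = pair (dif A i) (\<lambda>l. g (l, j)) + ksgn (par A i) * pair (dif B j) (\<lambda>l2. g (i, l2))"
    unfolding e pair_add[OF pair_prod(1)[OF f(1) b(2)] pair_prod(1)[OF b(1) f(2)]]
      pair_prod(2)[OF f(1) b(2)] pair_prod(2)[OF b(1) f(2)] by simp
qed

lemma gda_tensor:
  assumes "gda A" "gda B" shows "gda (dga_tensor A B)"
proof -
  have 1: "dif (dga_tensor A B) (one_idx A, one_idx B) = (\<lambda>_. 0)"
    using assms by (auto simp: dga_tensor_def gdaD fun_eq_iff)
  have 2: "dga.mult (dga_tensor A B) (one_idx A, one_idx B) j = bv j" "dga.mult (dga_tensor A B) j (one_idx A, one_idx B) = bv j" for j
    using assms by (cases j; auto simp: dga_tensor_def gdaD fun_eq_iff bv_def)+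
  have 3: "dga.mult (dga_tensor A B) i j l \<noteq> 0 \<Longrightarrow> par (dga_tensor A B) l = (par (dga_tensor A B) i \<noteq> par (dga_tensor A B) j)" for i j l
    using assms gdaD(4)[OF assms(1)] gdaD(4)[OF assms(2)] by (cases i; cases j; cases l; fastforce simp: dga_tensor_def)
  have 4: "dif (dga_tensor A B) i l \<noteq> 0 \<Longrightarrow> par (dga_tensor A B) l = (\<not> par (dga_tensor A B) i)" for i l
  proof -
    have z: "dif A a a = 0" "dif B b b = 0" for a b
      using gdaD(5)[OF assms(1), of a a] gdaD(5)[OF assms(2), of b b] by auto
    show "dif (dga_tensor A B) i l \<noteq> 0 \<Longrightarrow> par (dga_tensor A B) l = (\<not> par (dga_tensor A B) i)"
      using gdaD(5)[OF assms(1)] gdaD(5)[OF assms(2)]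
      by (cases i; cases l) (auto simp: dga_tensor_def z split: if_splits)
  qed
  show ?thesis
    unfolding gda_def using 1 2 3 4 assms by (auto simp: tensor_mult tensor_dif gdaD)
qed


section \<open>Relations between tagged letters\<close>

definition iA :: "('j, 'k) dga \<Rightarrow> nat list \<times> 'i \<Rightarrow> nat list \<times> 'i \<times> 'j" where
  "iA B x = (fst x, (snd x, one_idx B))"

definition iB :: "('i, 'k) dga \<Rightarrow> nat list \<times> 'j \<Rightarrow> nat list \<times> 'i \<times> 'j" where
  "iB A x = (fst x, (one_idx A, snd x))"

lemma iAB_sel [simp]: "fst (iA B x) = fst x" "snd (iA B x) = (snd x, one_idx B)" "fst (iB A y) = fst y" "snd (iB A y) = (one_idx A, snd y)"
  by (simp_all add: iA_def iB_def)

text \<open>The tensor product with only d' or only d'' as its differential: e', E' and e'', E'' are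
  the operators \<open>edel\<close> and \<open>Ebig\<close> formed with these.\<close>

definition cA where "cA A B = dga_tensor A (B\<lparr>dif := \<lambda>_ _. 0\<rparr>)"
definition cB where "cB A B = dga_tensor (A\<lparr>dif := \<lambda>_ _. 0\<rparr>) B"

text \<open>The pair consisting of the product tag and the tag of the unit passes the tags of
  \<open>x\<close> without a sign, but arrives in the opposite order.\<close>

lemma rel_unit:
  assumes "gda A"
  shows "mC A \<epsilon> x (oC A \<eta>) (loc U V g) = - mC A \<epsilon> (oC A \<eta>) x (loc U V g)" "DC A \<epsilon> (oC A \<eta>) G = 0"
  using sg_swap[of \<epsilon> \<eta>, where ?'a='b] 
  by (simp_all add: mC_loc loc_def oC_def DC_def gdaD[OF assms] ac_simps)

text \<open>The sign of the Leibniz rule is the sign of moving the tag of the differential past the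
  letter \<open>x\<close> and the tag of the product, so it disappears for tagged letters.\<close>

lemma dga_rel_leib:
  fixes X :: "('x, 'k::field_char_0) dga"
  assumes "is_dga X" "adm X x"
  shows "mC X \<epsilon> x y (\<lambda>z. DC X \<epsilon>' z (loc U V g))
     = DC X \<epsilon>' x (\<lambda>x'. mC X \<epsilon> x' y (loc U V g)) + DC X \<epsilon>' y (\<lambda>y'. mC X \<epsilon> x y' (loc U V g))"
    "DC X \<epsilon> x (\<lambda>y. DC X \<epsilon>' y (loc U V g)) = 0"
proof -
  have 1: "psgn (U @ fst x @ \<epsilon> # \<epsilon>' # fst y @ V) = (ksgn (par X (snd x)) * psgn (U @ \<epsilon>' # fst x @ \<epsilon> # fst y @ V) :: 'k)" for \<epsilon> \<epsilon>'
    using assms(2) by (cases "par X (snd x)") (simp_all add: adm_def sg_swap[of \<epsilon> \<epsilon>'] ac_simps)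
  note simps = mC_def DC_def loc_def fs_minus[OF fs_pair] fs_scale[OF fs_pair] 1 dga_leibniz[OF assms(1)] dga_dd[OF assms(1)]
  note del = psgn_append psgn.simps
  show "mC X \<epsilon> x y (\<lambda>z. DC X \<epsilon>' z (loc U V g))
     = DC X \<epsilon>' x (\<lambda>x'. mC X \<epsilon> x' y (loc U V g)) + DC X \<epsilon>' y (\<lambda>y'. mC X \<epsilon> x y' (loc U V g))"
    by (simp add: simps del: del) (simp add: algebra_simps del: del)
  show "DC X \<epsilon> x (\<lambda>y. DC X \<epsilon>' y (loc U V g)) = 0"
    by (simp add: simps del: del)
qed


text \<open>Product tags stand between the letters they join, so both bracketings give the same list
  of tags when each product keeps its tag. Exchanging the two product tags costs a sign, which gives
  the second relation.\<close>

lemma dga_rel_assoc: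
  fixes X :: "('x, 'k::field_char_0) dga"
  assumes "is_dga X"
  shows "mC X \<eta> x y (\<lambda>w. mC X \<epsilon> w z (loc U V g)) = mC X \<epsilon> y z (\<lambda>w. mC X \<eta> x w (loc U V g))"
    "mC X \<eta> x y (\<lambda>w. mC X \<epsilon> w z (loc U V g)) = - mC X \<epsilon> x y (\<lambda>w. mC X \<eta> w z (loc U V g))"
proof -
  note simps = mC_def loc_def fs_minus[OF fs_pair] fs_scale[OF fs_pair] dga_assoc[OF assms]
  show "mC X \<eta> x y (\<lambda>w. mC X \<epsilon> w z (loc U V g)) = mC X \<epsilon> y z (\<lambda>w. mC X \<eta> x w (loc U V g))"
    by (simp add: simps del: psgn_append psgn.simps)
  have "psgn (U @ fst x @ \<eta> # fst y @ \<epsilon> # fst z @ V) = (- psgn (U @ fst x @ \<epsilon> # fst y @ \<eta> # fst z @ V) :: 'k)"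
    by (simp add: sg_swap[of \<epsilon> \<eta>] ac_simps)
  then show "mC X \<eta> x y (\<lambda>w. mC X \<epsilon> w z (loc U V g)) = - mC X \<epsilon> x y (\<lambda>w. mC X \<eta> w z (loc U V g))"
    by (simp add: simps del: psgn_append psgn.simps)
qed

lemma DC_on: "(\<And>y. dif X (snd x) (snd y) \<noteq> 0 \<Longrightarrow> fst y = \<epsilon> # fst x \<Longrightarrow> G y = H y) \<Longrightarrow> DC X \<epsilon> x G = DC X \<epsilon> x H"
  unfolding DC_def by (rule pair_cong) auto

lemma adm_DC: "gda X \<Longrightarrow> adm X x \<Longrightarrow> dif X (snd x) (snd y) \<noteq> 0 \<Longrightarrow> fst y = \<epsilon> # fst x \<Longrightarrow> adm X y"
  using gdaD(5)[of X "snd x" "snd y"] by (auto simp: adm_def)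

lemma adm_mC: "gda X \<Longrightarrow> adm X x \<Longrightarrow> adm X y \<Longrightarrow> dga.mult X (snd x) (snd y) z \<noteq> 0 \<Longrightarrow> adm X (fst x @ \<epsilon> # fst y, z)"
  using gdaD(4)[of X "snd x" "snd y" z] by (auto simp: adm_def)

text \<open>The hypotheses of \<open>ehat_bch\<close> in a dg algebra. The first follows from the
  Leibniz rule and d d = 0; in the second the term with \<open>y\<close> differentiated cancels
  because the two product tags appear in opposite order.\<close>

lemma dga_rel_ehat:
  fixes X :: "('x, 'k::field_char_0) dga"
  assumes X: "is_dga X" and "adm X x" "adm X f"
  shows "DC X \<epsilon> x (\<lambda>z. DC X \<epsilon>' f (\<lambda>f. mC X \<eta> z f (loc U V g))) + DC X \<epsilon> f (\<lambda>f. DC X \<epsilon>' f (\<lambda>f. mC X \<eta> x f (loc U V g)))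
      = DC X \<epsilon>' f (\<lambda>f. mC X \<eta> x f (\<lambda>z. DC X \<epsilon> z (loc U V g)))"
   "DC X \<epsilon>' f (\<lambda>f. mC X \<eta> x f (\<lambda>z. mC X \<epsilon> z y (loc U V g))) = mC X \<epsilon> f y (\<lambda>z. DC X \<epsilon>' z (\<lambda>z. mC X \<eta> x z (loc U V g)))
      + mC X \<epsilon> x f (\<lambda>z. DC X \<epsilon>' y (\<lambda>y. mC X \<eta> z y (loc U V g)))"
   "DC X \<epsilon>' f (\<lambda>f. mC X \<eta> x f (\<lambda>z. mC X \<epsilon> l z (loc U V g))) = mC X \<epsilon> l x (\<lambda>z. DC X \<epsilon>' f (\<lambda>f. mC X \<eta> z f (loc U V g)))"
proof -
  have 0: "DC X a f (\<lambda>f. DC X b f (\<lambda>f. mC X \<eta> x f (loc U V g))) = 0" for a b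
    unfolding mC_abs2 using dga_rel_leib(2)[OF X assms(3)] .
  have "DC X \<epsilon>' f (\<lambda>f. mC X \<eta> x f (\<lambda>z. DC X \<epsilon> z (loc U V g)))
     = DC X \<epsilon>' f (\<lambda>f. DC X \<epsilon> x (\<lambda>x'. mC X \<eta> x' f (loc U V g)) + DC X \<epsilon> f (\<lambda>f'. mC X \<eta> x f' (loc U V g)))"
    by (simp add: dga_rel_leib(1)[OF X assms(2)])
  then show "DC X \<epsilon> x (\<lambda>z. DC X \<epsilon>' f (\<lambda>f. mC X \<eta> z f (loc U V g))) + DC X \<epsilon> f (\<lambda>f. DC X \<epsilon>' f (\<lambda>f. mC X \<eta> x f (loc U V g)))
      = DC X \<epsilon>' f (\<lambda>f. mC X \<eta> x f (\<lambda>z. DC X \<epsilon> z (loc U V g)))"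
    by (simp add: fs_add[OF fs_DC] 0 fs_commute[OF fs_DC[of X \<epsilon> x] fs_DC])
  have 1: "mC X \<epsilon> f y (\<lambda>z. DC X \<epsilon>' z (\<lambda>z. mC X \<eta> x z (loc U V g)))
     = DC X \<epsilon>' f (\<lambda>f. mC X \<epsilon> f y (\<lambda>z. mC X \<eta> x z (loc U V g))) + DC X \<epsilon>' y (\<lambda>y. mC X \<epsilon> f y (\<lambda>z. mC X \<eta> x z (loc U V g)))"
    unfolding mC_abs2[of _ _ x] by (rule dga_rel_leib(1)[OF X assms(3)])
  have 2: "mC X \<epsilon> x f (\<lambda>z. DC X \<epsilon>' y (\<lambda>y. mC X \<eta> z y (loc U V g))) = - DC X \<epsilon>' y (\<lambda>y. mC X \<epsilon> f y (\<lambda>z. mC X \<eta> x z (loc U V g)))"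
    by (simp add: fs_commute[OF fs_mC fs_DC] dga_rel_assoc(1)[OF X, symmetric] dga_rel_assoc(2)[OF X, of \<eta> _ _ \<epsilon>] fs_minus[OF fs_DC])
  show "DC X \<epsilon>' f (\<lambda>f. mC X \<eta> x f (\<lambda>z. mC X \<epsilon> z y (loc U V g))) = mC X \<epsilon> f y (\<lambda>z. DC X \<epsilon>' z (\<lambda>z. mC X \<eta> x z (loc U V g)))
      + mC X \<epsilon> x f (\<lambda>z. DC X \<epsilon>' y (\<lambda>y. mC X \<eta> z y (loc U V g)))"
    unfolding 1 2 by (simp add: dga_rel_assoc(1)[OF X])
  show "DC X \<epsilon>' f (\<lambda>f. mC X \<eta> x f (\<lambda>z. mC X \<epsilon> l z (loc U V g))) = mC X \<epsilon> l x (\<lambda>z. DC X \<epsilon>' f (\<lambda>f. mC X \<eta> z f (loc U V g)))"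
    by (simp add: fs_commute[OF fs_mC fs_DC] dga_rel_assoc(1)[OF X])
qed

section \<open>Relations between letters of the two tensor factors\<close>

context
  fixes A :: "('i, 'k::field_char_0) dga" and B :: "('j, 'k) dga"
  assumes dA: "is_dga A" and dB: "is_dga B"
begin

private lemma gA: "gda A" and gB: "gda B"
  using is_dga_gda dA dB by auto

private lemma sel_no_dif: "par (A\<lparr>dif := \<lambda>_ _. 0\<rparr>) = par A" "par (B\<lparr>dif := \<lambda>_ _. 0\<rparr>) = par B"
  "dga.mult (A\<lparr>dif := \<lambda>_ _. 0\<rparr>) = dga.mult A" "dga.mult (B\<lparr>dif := \<lambda>_ _. 0\<rparr>) = dga.mult B"
  "one_idx (A\<lparr>dif := \<lambda>_ _. 0\<rparr>) = one_idx A" "one_idx (B\<lparr>dif := \<lambda>_ _. 0\<rparr>) = one_idx B"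
  "dif (A\<lparr>dif := \<lambda>_ _. 0\<rparr>) = (\<lambda>_ _. 0)" "dif (B\<lparr>dif := \<lambda>_ _. 0\<rparr>) = (\<lambda>_ _. 0)"
  by simp_all

lemma pair_cA: "pair (dif (cA A B) x) g = pair (dif A (fst x)) (\<lambda>l. g (l, snd x))"
  using tensor_dif(2)[OF gA gda_no_dif[OF gB], of "fst x" "snd x" g] by (simp add: cA_def)

lemma pair_cB: "pair (dif (cB A B) x) g = ksgn (par A (fst x)) * pair (dif B (snd x)) (\<lambda>l. g (fst x, l))"
  using tensor_dif(2)[OF gda_no_dif[OF gA] gB, of "fst x" "snd x" g] by (simp add: cB_def)

private lemmas C_simps = loc_simps tensor_mult(2)[OF gA gB] tensor_dif(2)[OF gA gB] gdaD[OF gA] gdaD[OF gB] pair_cA pair_cB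

lemma DC_split: "DC (dga_tensor A B) \<epsilon> x G = DC (cA A B) \<epsilon> x G + DC (cB A B) \<epsilon> x G"
  by (cases x; cases "snd x") (simp add: DC_def C_simps)

lemma mC_AB: "mC (dga_tensor A B) \<eta> (iA B p) (iB A q) G = - G (fst p @ \<eta> # fst q, (snd p, snd q))"
  by (simp add: mC_def C_simps)

lemma mC_iA: "mC (dga_tensor A B) \<epsilon> (iA B x) (iA B y) G = mC A \<epsilon> x y (\<lambda>z. G (iA B z))"
  by (simp add: mC_def C_simps iA_def)

lemma mC_iB: "mC (dga_tensor A B) \<epsilon> (iB A x) (iB A y) G = mC B \<epsilon> x y (\<lambda>z. G (iB A z))"
  by (simp add: mC_def C_simps iB_def)

lemma DC_iA: "DC (dga_tensor A B) \<epsilon> (iA B x) G = DC A \<epsilon> x (\<lambda>z. G (iA B z))"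
   "DC (cA A B) \<epsilon> (iA B x) G = DC A \<epsilon> x (\<lambda>z. G (iA B z))" "DC (cB A B) \<epsilon> (iA B x) G = 0"
  by (simp_all add: DC_def C_simps iA_def)

lemma DC_iB: "DC (dga_tensor A B) \<epsilon> (iB A x) G = DC B \<epsilon> x (\<lambda>z. G (iB A z))"
   "DC (cB A B) \<epsilon> (iB A x) G = DC B \<epsilon> x (\<lambda>z. G (iB A z))" "DC (cA A B) \<epsilon> (iB A x) G = 0"
  by (simp_all add: DC_def C_simps iB_def)

text \<open>Exchanging the letters in the tensor product costs (-1)^{|p||q|}. Exchanging their tags
  around the product tag costs the same sign times -1, because each letter is shifted. Hence the
  cancellation.\<close>

lemma rel_comm:
  assumes "adm A p" "adm B q"
  shows "mC (dga_tensor A B) \<epsilon> (iA B p) (iB A q) (loc U V g) + mC (dga_tensor A B) \<epsilon> (iB A q) (iA B p) (loc U V g) = 0"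
  using assms by (cases "par A (snd p)"; cases "par B (snd q)")
   (simp_all add: C_simps loc_def cr_swap[of "fst p" "fst q"] adm_def)

lemma rel_D:
  assumes "adm A p" "adm B q"
  shows "mC (dga_tensor A B) \<eta> (iA B p) (iB A q) (\<lambda>z. DC (dga_tensor A B) \<epsilon> z (loc U V g))
    = DC (dga_tensor A B) \<epsilon> (iA B p) (\<lambda>x. mC (dga_tensor A B) \<eta> x (iB A q) (loc U V g))
     + DC (dga_tensor A B) \<epsilon> (iB A q) (\<lambda>x. mC (dga_tensor A B) \<eta> (iA B p) x (loc U V g))"
proof -
  have 1: "DC A \<epsilon> p (\<lambda>z. - loc U V g (fst z @ \<eta> # fst q, snd z, snd q))
     = - (psgn (U @ \<epsilon> # fst p @ \<eta> # fst q @ V) * pair (dif A (snd p)) (\<lambda>z. g (z, snd q)))"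
    "DC B \<epsilon> q (\<lambda>z. - loc U V g (fst p @ \<eta> # fst z, snd p, snd z))
     = - (psgn (U @ fst p @ \<eta> # \<epsilon> # fst q @ V) * pair (dif B (snd q)) (\<lambda>z. g (snd p, z)))"
    by (simp_all only: DC_def loc_def fs_minus[OF fs_pair] fs_scale[OF fs_pair] fst_conv snd_conv append_assoc append_Cons)
  have 2: "psgn (U @ fst p @ \<eta> # \<epsilon> # fst q @ V) = (ksgn (par A (snd p)) * psgn (U @ \<epsilon> # fst p @ \<eta> # fst q @ V) :: 'k)"
    using assms by (cases "par A (snd p)") (simp_all add: adm_def sg_swap[of \<epsilon> \<eta>] ac_simps)
  show ?thesis unfolding DC_iA DC_iB mC_AB 1 2
    by (simp only: DC_loc loc_def fst_conv snd_conv append_assoc append_Cons append_Nil tensor_dif(2)[OF gA gB]) (simp add: algebra_simps del: psgn_append psgn.simps)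
qed

text \<open>Multiplication by a letter of one factor passes through the product
  \<open>a'_0 \<otimes> a''_0\<close>. Where the tags have to be rearranged, the resulting sign is
  the one in the multiplication of the tensor product.\<close>

lemma rel_mult:
  assumes "adm A p" "adm B q" "adm A p'" "adm B q'"
  shows "mC (dga_tensor A B) \<eta> (iA B p) (iB A q) (\<lambda>z. mC (dga_tensor A B) \<epsilon> z (iA B p') (loc U V g))
    = mC (dga_tensor A B) \<epsilon> (iA B p) (iA B p') (\<lambda>z. mC (dga_tensor A B) \<eta> z (iB A q) (loc U V g))"
   "mC (dga_tensor A B) \<eta> (iA B p) (iB A q) (\<lambda>z. mC (dga_tensor A B) \<epsilon> z (iB A q') (loc U V g))
    = mC (dga_tensor A B) \<epsilon> (iB A q) (iB A q') (\<lambda>z. mC (dga_tensor A B) \<eta> (iA B p) z (loc U V g))"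
   "mC (dga_tensor A B) \<eta> (iA B p) (iB A q) (\<lambda>z. mC (dga_tensor A B) \<epsilon> (iA B p') z (loc U V g))
    = mC (dga_tensor A B) \<epsilon> (iA B p') (iA B p) (\<lambda>z. mC (dga_tensor A B) \<eta> z (iB A q) (loc U V g))"
   "mC (dga_tensor A B) \<eta> (iA B p) (iB A q) (\<lambda>z. mC (dga_tensor A B) \<epsilon> (iB A q') z (loc U V g))
    = mC (dga_tensor A B) \<epsilon> (iB A q') (iB A q) (\<lambda>z. mC (dga_tensor A B) \<eta> (iA B p) z (loc U V g))"
proof -
  have 1: "psgn (U @ (fst p @ \<eta> # fst q) @ \<epsilon> # fst p' @ V) * ksgn (par B (snd q) \<and> par A (snd p')) = (psgn (U @ fst p @ \<epsilon> # fst p' @ \<eta> # fst q @ V) :: 'k)"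
    using assms by (cases "par B (snd q)"; cases "par A (snd p')") (simp_all add: adm_def sg_swap[of \<epsilon> \<eta>] cr_swap[of "fst p'" "fst q"] ac_simps)
  have 2: "psgn (U @ fst q' @ \<epsilon> # fst p @ \<eta> # fst q @ V) * ksgn (par B (snd q') \<and> par A (snd p)) = (psgn (U @ fst p @ \<eta> # fst q' @ \<epsilon> # fst q @ V) :: 'k)"
    using assms by (cases "par B (snd q')"; cases "par A (snd p)") (simp_all add: adm_def sg_swap[of \<epsilon> \<eta>] cr_swap[of "fst p" "fst q'"] ac_simps)
  note simps = mC_def loc_def fs_minus[OF fs_pair] fs_scale[OF fs_pair] tensor_mult(2)[OF gA gB] gdaD[OF gA] gdaD[OF gB]
  note del = psgn_append psgn.simps
  show "mC (dga_tensor A B) \<eta> (iA B p) (iB A q) (\<lambda>z. mC (dga_tensor A B) \<epsilon> z (iA B p') (loc U V g))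
    = mC (dga_tensor A B) \<epsilon> (iA B p) (iA B p') (\<lambda>z. mC (dga_tensor A B) \<eta> z (iB A q) (loc U V g))"
    using 1 unfolding mC_iA mC_iB mC_AB by (simp add: simps del: del)
  show "mC (dga_tensor A B) \<eta> (iA B p) (iB A q) (\<lambda>z. mC (dga_tensor A B) \<epsilon> z (iB A q') (loc U V g))
    = mC (dga_tensor A B) \<epsilon> (iB A q) (iB A q') (\<lambda>z. mC (dga_tensor A B) \<eta> (iA B p) z (loc U V g))"
    unfolding mC_iA mC_iB mC_AB by (simp add: simps del: del)
  show "mC (dga_tensor A B) \<eta> (iA B p) (iB A q) (\<lambda>z. mC (dga_tensor A B) \<epsilon> (iA B p') z (loc U V g))
    = mC (dga_tensor A B) \<epsilon> (iA B p') (iA B p) (\<lambda>z. mC (dga_tensor A B) \<eta> z (iB A q) (loc U V g))"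
    unfolding mC_iA mC_iB mC_AB by (simp add: simps del: del)
  show "mC (dga_tensor A B) \<eta> (iA B p) (iB A q) (\<lambda>z. mC (dga_tensor A B) \<epsilon> (iB A q') z (loc U V g))
    = mC (dga_tensor A B) \<epsilon> (iB A q') (iB A q) (\<lambda>z. mC (dga_tensor A B) \<eta> (iA B p) z (loc U V g))"
    using 2 unfolding mC_iA mC_iB mC_AB by (simp add: simps del: del)
qed

lemma loc_iA: "(\<lambda>z. loc U V g (iA B z)) = loc U V (\<lambda>x. g (x, one_idx B))"
  by (simp add: loc_def fun_eq_iff)

lemma loc_iB: "(\<lambda>z. loc U V g (iB A z)) = loc U V (\<lambda>x. g (one_idx A, x))"
  by (simp add: loc_def fun_eq_iff)

lemma rel_leib_B:
  assumes "adm B x"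
  shows "mC (dga_tensor A B) \<epsilon> (iB A x) (iB A y) (\<lambda>z. DC (cB A B) \<epsilon>' z (loc U V g))
     = DC (cB A B) \<epsilon>' (iB A x) (\<lambda>x'. mC (dga_tensor A B) \<epsilon> x' (iB A y) (loc U V g))
     + DC (cB A B) \<epsilon>' (iB A y) (\<lambda>y'. mC (dga_tensor A B) \<epsilon> (iB A x) y' (loc U V g))"
   "DC (dga_tensor A B) \<epsilon> (iB A x) (\<lambda>y. DC (cB A B) \<epsilon>' y (loc U V g)) = 0"
   "DC (cB A B) \<epsilon>' (iB A x) (\<lambda>y. DC (dga_tensor A B) \<epsilon> y (loc U V g)) = 0"
  unfolding DC_iB mC_iB loc_iB by (rule dga_rel_leib[OF dB assms])+

lemma rel_leib_A:
  assumes "adm A x"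
  shows "mC (dga_tensor A B) \<epsilon> (iA B x) (iA B y) (\<lambda>z. DC (cA A B) \<epsilon>' z (loc U V g))
     = DC (cA A B) \<epsilon>' (iA B x) (\<lambda>x'. mC (dga_tensor A B) \<epsilon> x' (iA B y) (loc U V g))
     + DC (cA A B) \<epsilon>' (iA B y) (\<lambda>y'. mC (dga_tensor A B) \<epsilon> (iA B x) y' (loc U V g))"
   "DC (dga_tensor A B) \<epsilon> (iA B x) (\<lambda>y. DC (cA A B) \<epsilon>' y (loc U V g)) = 0"
   "DC (cA A B) \<epsilon>' (iA B x) (\<lambda>y. DC (dga_tensor A B) \<epsilon> y (loc U V g)) = 0"
  unfolding DC_iA mC_iA loc_iA by (rule dga_rel_leib[OF dA assms])+

lemma rel_ehat_B:
  assumes "adm A p" "adm B q" "adm B f"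
  shows "mC (dga_tensor A B) \<eta> (iA B p) (iB A q) (\<lambda>z. DC (cB A B) \<epsilon>' (iB A f) (\<lambda>f. mC (dga_tensor A B) \<epsilon> z f (loc U V g)))
    = DC (cB A B) \<epsilon>' (iB A f) (\<lambda>f. mC (dga_tensor A B) \<epsilon> (iB A q) f (\<lambda>z. mC (dga_tensor A B) \<eta> (iA B p) z (loc U V g)))"
  unfolding fs_commute[OF fs_mC fs_DC] unfolding DC_iB
  by (rule DC_on) (rule rel_mult(2)[OF assms(1,2)], rule assms, rule adm_DC[OF gB assms(3)])

lemma rel_ehat_A:
  assumes "adm A p" "adm B q" "adm A f"
  shows "mC (dga_tensor A B) \<eta> (iA B p) (iB A q) (\<lambda>z. DC (cA A B) \<epsilon>' (iA B f) (\<lambda>f. mC (dga_tensor A B) \<epsilon> z f (loc U V g)))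
    = DC (cA A B) \<epsilon>' (iA B f) (\<lambda>f. mC (dga_tensor A B) \<epsilon> (iA B p) f (\<lambda>z. mC (dga_tensor A B) \<eta> z (iB A q) (loc U V g)))"
  unfolding fs_commute[OF fs_mC fs_DC] unfolding DC_iA
  by (rule DC_on) (rule rel_mult(1)[OF assms(1,2) adm_DC[OF gA assms(3)] assms(2)])

end

lemma finD: "fin T \<Longrightarrow> finite (vsupp (T c))"
  by (simp add: fin_def)

lemma fin_plus: "fin T \<Longrightarrow> fin T' \<Longrightarrow> fin (\<lambda>c d. T c d + T' c d :: 'k::comm_ring_1)"
  unfolding fin_def using finite_vsupp_add by blast

lemma pr_plus: "fin T \<Longrightarrow> fin T' \<Longrightarrow> pr (\<lambda>c d. T c d + T' c d) f c = pr T f c + pr T' f c"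
  unfolding pr_def by (intro pair_add finD)

lemma fin_uminus: "fin T \<Longrightarrow> fin (\<lambda>c d. - T c d :: 'k::comm_ring_1)"
  unfolding fin_def using finite_vsupp_minus by blast

lemma pr_uminus: "fin T \<Longrightarrow> pr (\<lambda>c d. - T c d) f c = - pr T f c"
  unfolding pr_def by (intro pair_minus finD)

lemma fin_sum: "(\<And>i. fin (T i)) \<Longrightarrow> (\<And>c. finite (I c)) \<Longrightarrow> fin (\<lambda>c d. \<Sum>i\<in>I c. T i c d :: 'k::comm_ring_1)"
  unfolding fin_def by (intro allI finite_vsupp_sum) auto

lemma pr_sum: "(\<And>i. fin (T i)) \<Longrightarrow> (\<And>c. finite (I c)) \<Longrightarrow> pr (\<lambda>c d. \<Sum>i\<in>I c. T i c d) f c = (\<Sum>i\<in>I c. pr (T i) f c)"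
  unfolding pr_def by (intro pair_sum finD)

section \<open>The operators on tagged words\<close>

abbreviation admL :: "('i, 'k::field_char_0) dga \<Rightarrow> (nat list \<times> 'i) list \<Rightarrow> bool" where
  "admL A L \<equiv> \<forall>x\<in>set L. adm A x"

text \<open>The sign of moving an operator symbol with tag \<epsilon> from the front to its position in the word.\<close>

definition kap :: "nat list \<Rightarrow> nat list \<Rightarrow> nat \<Rightarrow> (nat list \<times> 'i) list \<Rightarrow> 'k::comm_ring_1" where
  "kap U V \<epsilon> L = ksgn (odd (length U)) * c1 \<epsilon> (U @ tags L @ V)"

definition rotl :: "'a list \<Rightarrow> 'a list" where
  "rotl L = last L # butlast L"

lemma tags_rotate: "mset (tags (rotate i L)) = mset (tags L)"
  by (induction i) (auto simp: rotate_Suc, metis (no_types, opaque_lifting) append.right_neutral append_Cons append_Nil list.exhaust mset_append rotate1.simps tags_simps union_commute)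

lemma kap_rotate: "kap U V \<epsilon> (rotate i L) = kap U V \<epsilon> L"
  by (simp add: kap_def c1_mset[OF tags_rotate])

lemma rotl_pow: "length u = i \<Longrightarrow> (rotl ^^ i) (w @ u) = u @ w"
proof (induction i arbitrary: u w)
  case (Suc i)
  then obtain v x where u: "u = v @ [x]" by (cases u rule: rev_cases) auto
  have "(rotl ^^ Suc i) (w @ u) = (rotl ^^ i) (rotl (w @ u))" by (simp add: funpow_swap1)
  also have "rotl (w @ u) = (x # w) @ v" by (simp add: rotl_def u butlast_append)
  also have "(rotl ^^ i) ((x # w) @ v) = v @ x # w" using Suc.IH[of v "x # w"] Suc.prems u by simp
  finally show ?case by (simp add: u)
qed simp

lemma chn_Cons [simp]: "chn (x # w) = (x, w)"
  by (simp add: chn_def)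

lemma odd_tags: "admL A w \<Longrightarrow> odd (length (tags w)) = odd (pisum A (map snd w))"
  by (induction w) (auto simp: adm_def pisum_def)

lemma pr_tau: "pr (tau A) f (a, w) = (if w = [] then f (a, w) else ksgn (\<not> par A a \<and> odd (pisum A w)) * f (hd w, tl w @ [a]))"
  by (simp add: pr_def tau_def vsc_def pair_scale vsupp_bv)

lemma pr_tauinv: "pr (tauinv A) f (a, w) = (if w = [] then f (a, w)
    else ksgn (\<not> par A (last w) \<and> odd (pisum A (a # butlast w))) * f (last w, a # butlast w))"
  by (simp add: pr_def tauinv_def vsc_def pair_scale vsupp_bv)

lemma fin_tau: "fin (tau A)" "fin (tauinv A)"
  by (auto simp: fin_def tau_def tauinv_def vsc_def vsupp_bv finite_vsupp_scale)

lemma psgn_swap: "psgn (U @ s @ t @ V) = ksgn (odd (length s) \<and> odd (length t)) * psgn (U @ t @ s @ V)"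
  by (simp add: cr_swap[of s t] ac_simps)

text \<open>The sign in the definition of \<open>tau\<close> is the sign of moving the tags of the
  first letter behind all others, so on tagged words \<open>tau\<close> is a plain rotation.\<close>

lemma lift_tau:
  assumes "admL A L" "L \<noteq> []"
  shows "lift U V (pr (tau A) f) L = lift U V f (rotate1 L)"
proof -
  obtain x w where L: "L = x # w" using assms by (cases L) auto
  show ?thesis
  proof (cases w)
    case Nil then show ?thesis by (simp add: L lift_def pr_tau)
  next
    case (Cons y w')
    have o: "odd (length (tags w)) = odd (pisum A (map snd w))" "odd (length (fst x)) = (\<not> par A (snd x))"
      using assms odd_tags[of w A] by (auto simp: L adm_def)
    have "map snd w = snd y # map snd w'" by (simp add: Cons)
    then have 1: "lift U V (pr (tau A) f) L = psgn (U @ fst x @ tags w @ V) * (ksgn (odd (length (fst x)) \<and> odd (length (tags w))) * f (snd y, map snd w' @ [snd x]))"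
      unfolding o by (simp add: L lift_def pr_tau)
    have "lift U V (pr (tau A) f) L = psgn (U @ tags w @ fst x @ V) * f (snd y, map snd w' @ [snd x])"
      unfolding 1 psgn_swap[of U "fst x" "tags w" V] by (simp add: ac_simps del: psgn_append)
    then show ?thesis by (simp add: L lift_def Cons del: psgn_append)
  qed
qed

lemma lift_tauinv:
  assumes "admL A L" "L \<noteq> []"
  shows "lift U V (pr (tauinv A) f) L = lift U V f (rotl L)"
proof -
  obtain x w where L: "L = x # w" using assms by (cases L) auto
  show ?thesis
  proof (cases w rule: rev_cases)
    case Nil then show ?thesis by (simp add: L lift_def pr_tauinv rotl_def)
  next
    case (snoc w' y)
    have o: "odd (length (tags (x # w'))) = odd (pisum A (snd x # map snd w'))" "odd (length (fst y)) = (\<not> par A (snd y))"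
      using assms odd_tags[of "x # w'" A] by (auto simp: L snoc adm_def)
    have 1: "lift U V (pr (tauinv A) f) L = psgn (U @ tags (x # w') @ fst y @ V) * (ksgn (odd (length (tags (x # w'))) \<and> odd (length (fst y))) * f (snd y, snd x # map snd w'))"
      unfolding o by (simp add: L lift_def pr_tauinv snoc butlast_append conj_commute del: psgn_append)
    have "lift U V (pr (tauinv A) f) L = psgn (U @ fst y @ tags (x # w') @ V) * f (snd y, snd x # map snd w')"
      unfolding 1 psgn_swap[of U "tags (x # w')" "fst y" V] by (simp add: ac_simps del: psgn_append)
    then show ?thesis by (simp add: L lift_def snoc rotl_def butlast_append del: psgn_append)
  qed
qed

lemma lift_opow_tau:
  assumes "admL A L" "L \<noteq> []"
  shows "lift U V (pr (opow (tau A) i) f) L = lift U V f (rotate i L)"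
proof (induction i arbitrary: f)
  case (Suc i)
  then show ?case using assms by (simp add: pr_opow_Suc fin_tau lift_tau rotate_Suc)
qed (simp add: pr_opow_0)

lemma set_rotl: "L \<noteq> [] \<Longrightarrow> set (rotl L) = set L"
  unfolding rotl_def by (cases L rule: rev_cases) auto

lemma rotl_pow_set: "L \<noteq> [] \<Longrightarrow> set ((rotl ^^ i) L) = set L \<and> (rotl ^^ i) L \<noteq> []"
proof (induction i)
  case (Suc i)
  have "rotl M \<noteq> []" for M :: "'a list" by (simp add: rotl_def)
  with Suc show ?case by (simp add: set_rotl)
qed simp

lemma lift_opow_tauinv:
  assumes "admL A L" "L \<noteq> []"
  shows "lift U V (pr (opow (tauinv A) i) f) L = lift U V f ((rotl ^^ i) L)"
proof (induction i arbitrary: f)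
  case (Suc i)
  have "lift U V (pr (opow (tauinv A) (Suc i)) f) L = lift U V (pr (tauinv A) f) ((rotl ^^ i) L)"
    by (simp add: pr_opow_Suc fin_tau Suc)
  also have "\<dots> = lift U V f (rotl ((rotl ^^ i) L))"
    using assms rotl_pow_set[of L i] by (intro lift_tauinv[where A=A]) auto
  finally show ?case by simp
qed (simp add: pr_opow_0)

lemma pair_fst_restrict:
  fixes v :: "'b \<Rightarrow> 'k::comm_ring_1" and r :: 'c
  assumes "finite (vsupp v)"
  shows "finite (vsupp (\<lambda>d. if snd d = r then v (fst d) else 0))"
    "pair (\<lambda>d. if snd d = r then v (fst d) else 0) f = pair v (\<lambda>z. f (z, r))"
proof -
  have e: "(\<lambda>d. if snd d = r then v (fst d) else 0) = (\<lambda>(l, l2). 1 * v l * bv r l2)"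
    by (auto simp: bv_def fun_eq_iff)
  have b: "finite (vsupp (bv r :: 'c \<Rightarrow> 'k))" by (simp add: vsupp_bv)
  show "finite (vsupp (\<lambda>d. if snd d = r then v (fst d) else 0))"
    unfolding e by (rule pair_prod(1)[OF assms b])
  show "pair (\<lambda>d. if snd d = r then v (fst d) else 0) f = pair v (\<lambda>z. f (z, r))"
    unfolding e by (subst pair_prod(2)[OF assms b]) simp
qed

lemma bch_dd: "bch m D (\<lambda>a w. \<phi> (a # w)) a w = dd m D \<phi> (a # w) + Lst (\<lambda>l w'. m l a (\<lambda>z. \<phi> (z # w'))) w"
  by (simp add: bch_def)

text \<open>The recursion in position form, to be matched with the sums over \<open>i\<close> in the
  definition of \<open>b\<close>.\<close>

lemma dd_sum:
  "dd m D \<phi> w = (\<Sum>i<length w. D (w ! i) (\<lambda>z. \<phi> (take i w @ z # drop (Suc i) w)))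
     + (\<Sum>i<length w - 1. m (w ! i) (w ! Suc i) (\<lambda>z. \<phi> (take i w @ z # drop (Suc (Suc i)) w)))"
proof (induction w arbitrary: \<phi>)
  case (Cons x w)
  show ?case
  proof (cases w)
    case (Cons y w')
    show ?thesis
      using Cons.IH[of "\<lambda>w. \<phi> (x # w)"] unfolding Cons
      by (simp del: dd.simps sum.lessThan_Suc add: dd.simps(2)[of _ _ _ x] sum.lessThan_Suc_shift algebra_simps)
  qed simp
qed simp

definition nrm :: "('i, 'k::field_char_0) dga \<Rightarrow> ('i \<times> 'i list \<Rightarrow> 'k) \<Rightarrow> bool" where
  "nrm X f \<longleftrightarrow> (\<forall>c. \<not> normal X c \<longrightarrow> f c = 0)"

lemma nrm_lift: "nrm A f \<Longrightarrow> snd t = one_idx A \<Longrightarrow> t \<in> set (tl L) \<Longrightarrow> lift U V f L = 0"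
  by (cases L) (auto simp: nrm_def normal_def lift_def rev_image_eqI)

lemma spl_sum: "spl \<psi> w = (\<Sum>k\<le>length w. \<psi> (take k w) (drop k w))"
  by (induction w arbitrary: \<psi>) (simp_all add: sum.atMost_Suc_shift del: sum.atMost_Suc)

lemma rotate_Suc_Cons: "k < length w \<Longrightarrow> rotate (Suc k) (a # w) = drop k w @ a # take k w"
  by (simp add: rotate_drop_take del: rotate_Suc)

lemma rot_sum: "(\<Sum>i\<in>{0..length w}. \<phi> (rotate i (a # w))) = rot (\<lambda>u a v. \<phi> (u @ a # v)) a w"
proof -
  have "(\<Sum>i\<in>{0..length w}. \<phi> (rotate i (a # w))) = \<phi> (a # w) + (\<Sum>k<length w. \<phi> (rotate (Suc k) (a # w)))"
    unfolding atLeast0AtMost lessThan_Suc_atMost[symmetric] sum.lessThan_Suc_shift by simp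
  also have "(\<Sum>k<length w. \<phi> (rotate (Suc k) (a # w))) = (\<Sum>k<length w. \<phi> (drop k w @ a # take k w))"
    by (rule sum.cong) (auto simp only: rotate_Suc_Cons lessThan_iff)
  finally show ?thesis unfolding rot_def spl_sum lessThan_Suc_atMost[symmetric] by (simp add: add.commute)
qed

definition low :: "nat \<Rightarrow> nat list \<Rightarrow> bool" where
  "low \<epsilon> s \<longleftrightarrow> (\<forall>t\<in>set s. \<epsilon> < t)"

lemma low_trans: "low \<epsilon>' s \<Longrightarrow> \<epsilon> < \<epsilon>' \<Longrightarrow> set s' \<subseteq> insert \<epsilon>' (set s) \<Longrightarrow> low \<epsilon> s'"
  unfolding low_def
proof
  fix t assume *: "\<forall>t\<in>set s. \<epsilon>' < t" "\<epsilon> < \<epsilon>'" "set s' \<subseteq> insert \<epsilon>' (set s)" "t \<in> set s'"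
  then have "t = \<epsilon>' \<or> \<epsilon>' < t" by auto
  with *(2) show "\<epsilon> < t" by auto
qed

lemma ksgn_cancel: "ksgn p * x = y \<Longrightarrow> x = ksgn p * (y :: 'k::comm_ring_1)"
  by (cases p) auto

text \<open>A tag below all others creates no inversion when inserted into a word; only the length
  of the prefix \<open>U\<close> is left.\<close>

lemma kap_low: "low \<epsilon> (U @ tags L @ V) \<Longrightarrow> kap U V \<epsilon> L = ksgn (odd (length U))"
  unfolding kap_def low_def by (subst c1_less) auto

lemma LD_sum: "LD D \<phi> w = (\<Sum>i<length w. D (w ! i) (\<lambda>z. \<phi> (take i w @ z # drop (Suc i) w)))"
  by (simp add: dd_sum)

context
  fixes A :: "('i, 'k::field_char_0) dga"
  assumes gA: "gda A"
begin

lemma fin_delta0: "fin (delta0 A)"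
  unfolding fin_def delta0_def by (intro allI pair_fst_restrict(1) gdaD(3)[OF gA])

lemma pr_delta0: "pr (delta0 A) f (a, w) = pair (dif A a) (\<lambda>z. f (z, w))"
  unfolding pr_def delta0_def fst_conv snd_conv by (rule pair_fst_restrict(2)[OF gdaD(3)[OF gA]])

lemma mu0_Cons: "mu0 A (a, x # w) = (\<lambda>d. if snd d = w then ksgn (par A a) * dga.mult A a x (fst d) else 0)"
  unfolding mu0_def fst_conv snd_conv by (simp only: list.case)

lemma fin_mu0: "fin (mu0 A)"
  unfolding fin_def
proof
  fix c :: "'i \<times> 'i list"
  show "finite (vsupp (mu0 A c))"
  proof (cases "snd c")
    case Nil
    then show ?thesis by (simp add: mu0_def vsupp_def)
  next
    case (Cons x w)
    then obtain a where c: "c = (a, x # w)" by (cases c) auto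
    show ?thesis unfolding c mu0_Cons
      by (rule pair_fst_restrict(1)[OF finite_vsupp_scale[OF gdaD(2)[OF gA]]])
  qed
qed

lemma pr_mu0: "pr (mu0 A) f (a, []) = 0" "pr (mu0 A) f (a, x # w) = ksgn (par A a) * pair (dga.mult A a x) (\<lambda>z. f (z, w))"
proof -
  show "pr (mu0 A) f (a, []) = 0" by (simp add: pr_def mu0_def)
  show "pr (mu0 A) f (a, x # w) = ksgn (par A a) * pair (dga.mult A a x) (\<lambda>z. f (z, w))"
    unfolding pr_def mu0_Cons pair_fst_restrict(2)[OF finite_vsupp_scale[OF gdaD(2)[OF gA]], of w "ksgn (par A a)" a x f]
    by (rule pair_scale[OF gdaD(2)[OF gA]])
qed

lemma fin_hop: "fin (hop A)"
  by (simp add: fin_def hop_def vsupp_bv)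

lemma pr_hop: "pr (hop A) f (a, w) = f (one_idx A, a # w)"
  by (simp add: pr_def hop_def)

lemma fin_deltai: "fin (deltai A i)" and fin_mui: "fin (mui A i)"
  unfolding deltai_def mui_def by (intro fin_ocomp fin_opow fin_tau fin_delta0 fin_mu0)+

lemma pr_deltai: "pr (deltai A i) f = pr (opow (tau A) i) (pr (delta0 A) (pr (opow (tauinv A) i) f))"
  unfolding deltai_def by (simp add: pr_ocomp fin_ocomp fin_opow fin_tau fin_delta0)

lemma pr_mui: "pr (mui A i) f = pr (opow (tau A) i) (pr (mu0 A) (pr (opow (tauinv A) i) f))"
  unfolding mui_def by (simp add: pr_ocomp fin_ocomp fin_opow fin_tau fin_mu0)

lemma lift_delta0:
  "kap U V \<epsilon> (x # w) * lift U V (pr (delta0 A) f) (x # w) = DC A \<epsilon> x (\<lambda>z. lift U V f (z # w))"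
  by (simp add: DC_def lift_def kap_def pr_delta0 fs_scale[OF fs_pair] del: psgn_append psgn.simps)
     (simp add: ac_simps)

text \<open>The sign (-1)^{|a_0|} of \<open>mu0\<close> and the sign of moving the tag \<epsilon>
  past the letter \<open>x\<close> multiply to -1. This is the origin of the minus sign in
  \<open>mC\<close>.\<close>

lemma lift_mu0:
  assumes "adm A x"
  shows "kap U V \<epsilon> (x # y # w) * lift U V (pr (mu0 A) f) (x # y # w) = mC A \<epsilon> x y (\<lambda>z. lift U V f (z # w))"
proof -
  let ?P = "pair (dga.mult A (snd x) (snd y)) (\<lambda>z. f (z, map snd w))"
  have L: "lift U V (pr (mu0 A) f) (x # y # w) = psgn (U @ fst x @ fst y @ tags w @ V) * (ksgn (par A (snd x)) * ?P)"
    by (simp add: lift_def pr_mu0 del: psgn_append)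
  have R: "mC A \<epsilon> x y (\<lambda>z. lift U V f (z # w)) = - (psgn (U @ fst x @ \<epsilon> # fst y @ tags w @ V) * ?P)"
    by (simp add: lift_def mC_def fs_scale[OF fs_pair] del: psgn_append psgn.simps)
  show ?thesis unfolding L R using assms
    by (cases "par A (snd x)"; cases "odd (length U)"; simp add: adm_def kap_def ac_simps)
qed

lemma lift_hop:
  "L \<noteq> [] \<Longrightarrow> kap U V \<epsilon> L * lift U V (pr (hop A) f) L = lift U V f (oC A \<epsilon> # L)"
  by (cases L) (simp_all add: oC_def lift_def kap_def pr_hop ac_simps)

lemma DC_adm: "adm A x \<Longrightarrow> (\<And>y. adm A y \<Longrightarrow> fst y = \<epsilon> # fst x \<Longrightarrow> G y = H y) \<Longrightarrow> DC A \<epsilon> x G = DC A \<epsilon> x H"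
  by (rule DC_on) (use adm_DC[OF gA] in blast)

lemma mC_adm: "adm A x \<Longrightarrow> adm A y \<Longrightarrow> (\<And>z. adm A z \<Longrightarrow> fst z = fst x @ \<epsilon> # fst y \<Longrightarrow> G z = H z) \<Longrightarrow> mC A \<epsilon> x y G = mC A \<epsilon> x y H"
proof -
  assume *: "adm A x" "adm A y" "\<And>z. adm A z \<Longrightarrow> fst z = fst x @ \<epsilon> # fst y \<Longrightarrow> G z = H z"
  have "pair (dga.mult A (snd x) (snd y)) (\<lambda>z. G (fst x @ \<epsilon> # fst y, z)) = pair (dga.mult A (snd x) (snd y)) (\<lambda>z. H (fst x @ \<epsilon> # fst y, z))"
  proof (rule pair_cong)
    fix z assume "dga.mult A (snd x) (snd y) z \<noteq> 0"
    then show "G (fst x @ \<epsilon> # fst y, z) = H (fst x @ \<epsilon> # fst y, z)"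
      using *(3)[of "(fst x @ \<epsilon> # fst y, z)"] adm_mC[OF gA *(1,2), of z \<epsilon>] by simp
  qed
  then show "mC A \<epsilon> x y G = mC A \<epsilon> x y H" by (simp add: mC_def)
qed

text \<open>\<open>kap\<close> depends only on the multiset of tags and is therefore unchanged by
  rotations; so conjugation by \<open>tau\<close> merely transports the action from the zeroth
  position to position \<open>i\<close>.\<close>

lemma lift_deltai:
  assumes "admL A (u @ x # w)" "length u = i"
  shows "kap U V \<epsilon> (u @ x # w) * lift U V (pr (deltai A i) f) (u @ x # w) = DC A \<epsilon> x (\<lambda>z. lift U V f (u @ z # w))"
proof -
  have r: "rotate i (u @ x # w) = x # w @ u"
    using rotate_append[of u "x # w"] assms(2) by simp
  have k: "kap U V \<epsilon> (x # w @ u) = (kap U V \<epsilon> (u @ x # w) :: 'k)"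
    using kap_rotate[of U V \<epsilon> i "u @ x # w", where ?'a='k] by (simp only: r)
  have "kap U V \<epsilon> (u @ x # w) * lift U V (pr (deltai A i) f) (u @ x # w)
     = kap U V \<epsilon> (x # w @ u) * lift U V (pr (delta0 A) (pr (opow (tauinv A) i) f)) (x # w @ u)"
    unfolding pr_deltai k[symmetric] using lift_opow_tau[OF assms(1), of U V i] by (simp add: r)
  also have "\<dots> = DC A \<epsilon> x (\<lambda>z. lift U V (pr (opow (tauinv A) i) f) (z # w @ u))" by (rule lift_delta0)
  also have "\<dots> = DC A \<epsilon> x (\<lambda>z. lift U V f (u @ z # w))"
  proof (rule DC_adm)
    fix y assume "adm A y"
    then have "admL A (y # w @ u)" using assms by auto
    then show "lift U V (pr (opow (tauinv A) i) f) (y # w @ u) = lift U V f (u @ y # w)"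
      using rotl_pow[OF assms(2), of "y # w"] lift_opow_tauinv[where A=A and L="y # w @ u"] by simp
  qed (use assms in auto)
  finally show ?thesis .
qed

lemma lift_mui:
  assumes "admL A (u @ x # y # w)" "length u = i"
  shows "kap U V \<epsilon> (u @ x # y # w) * lift U V (pr (mui A i) f) (u @ x # y # w) = mC A \<epsilon> x y (\<lambda>z. lift U V f (u @ z # w))"
proof -
  have r: "rotate i (u @ x # y # w) = x # y # w @ u"
    using rotate_append[of u "x # y # w"] assms(2) by simp
  have k: "kap U V \<epsilon> (x # y # w @ u) = (kap U V \<epsilon> (u @ x # y # w) :: 'k)"
    using kap_rotate[of U V \<epsilon> i "u @ x # y # w", where ?'a='k] by (simp only: r)
  have "kap U V \<epsilon> (u @ x # y # w) * lift U V (pr (mui A i) f) (u @ x # y # w)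
     = kap U V \<epsilon> (x # y # w @ u) * lift U V (pr (mu0 A) (pr (opow (tauinv A) i) f)) (x # y # w @ u)"
    unfolding pr_mui k[symmetric] using lift_opow_tau[OF assms(1), of U V i] by (simp add: r)
  also have "\<dots> = mC A \<epsilon> x y (\<lambda>z. lift U V (pr (opow (tauinv A) i) f) (z # w @ u))"
    by (rule lift_mu0) (use assms in auto)
  also have "\<dots> = mC A \<epsilon> x y (\<lambda>z. lift U V f (u @ z # w))"
  proof (rule mC_adm)
    fix z assume "adm A z"
    then have "admL A (z # w @ u)" using assms by auto
    then show "lift U V (pr (opow (tauinv A) i) f) (z # w @ u) = lift U V f (u @ z # w)"
      using rotl_pow[OF assms(2), of "z # w"] lift_opow_tauinv[where A=A and L="z # w @ u"] by simp
  qed (use assms in auto)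
  finally show ?thesis .
qed

text \<open>For the largest index the rotation puts the last letter in front of the zeroth one. The
  word is shorter by one letter after the product, and the full inverse rotation returns it to
  itself.\<close>

lemma lift_mui_last:
  assumes "admL A (x # w @ [l])" "length w + 1 = i"
  shows "kap U V \<epsilon> (x # w @ [l]) * lift U V (pr (mui A i) f) (x # w @ [l]) = mC A \<epsilon> l x (\<lambda>z. lift U V f (z # w))"
proof -
  have r: "rotate i (x # w @ [l]) = l # x # w"
    using rotate_append[of "x # w" "[l]"] by (simp add: assms(2)[symmetric])
  have k: "kap U V \<epsilon> (l # x # w) = (kap U V \<epsilon> (x # w @ [l]) :: 'k)"
    using kap_rotate[of U V \<epsilon> i "x # w @ [l]", where ?'a='k] by (simp only: r)
  have "kap U V \<epsilon> (x # w @ [l]) * lift U V (pr (mui A i) f) (x # w @ [l])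
     = kap U V \<epsilon> (l # x # w) * lift U V (pr (mu0 A) (pr (opow (tauinv A) i) f)) (l # x # w)"
    unfolding pr_mui k[symmetric] using lift_opow_tau[OF assms(1), of U V i] by (simp add: r)
  also have "\<dots> = mC A \<epsilon> l x (\<lambda>z. lift U V (pr (opow (tauinv A) i) f) (z # w))"
    by (rule lift_mu0) (use assms in auto)
  also have "\<dots> = mC A \<epsilon> l x (\<lambda>z. lift U V f (z # w))"
  proof (rule mC_adm)
    fix z assume "adm A z"
    then have "admL A (z # w)" using assms by auto
    then show "lift U V (pr (opow (tauinv A) i) f) (z # w) = lift U V f (z # w)"
      using rotl_pow[of "z # w" i "[]"] assms(2) lift_opow_tauinv[where A=A and L="z # w"] by simp
  qed (use assms in auto)
  finally show ?thesis .
qed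

text \<open>The test function is met only on admissible words carrying exactly one further tag.
  Recording the multiset of tags is what later determines the sign of a second operator.\<close>

lemma dd_cong:
  "admL A w \<Longrightarrow> (\<And>W. admL A W \<Longrightarrow> mset (tags W) = add_mset \<epsilon> (mset (tags w)) \<Longrightarrow> F W = G W) \<Longrightarrow>
    dd (mC A \<epsilon>) (DC A \<epsilon>) F w = dd (mC A \<epsilon>) (DC A \<epsilon>) G w"
proof (induction w arbitrary: F G)
  case (Cons x w)
  have 1: "DC A \<epsilon> x (\<lambda>y. F (y # w)) = DC A \<epsilon> x (\<lambda>y. G (y # w))"
    by (rule DC_adm) (use Cons.prems in auto)
  have 2: "Fst (\<lambda>y w'. mC A \<epsilon> x y (\<lambda>z. F (z # w'))) w = Fst (\<lambda>y w'. mC A \<epsilon> x y (\<lambda>z. G (z # w'))) w"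
  proof (cases w)
    case (Cons y w')
    show ?thesis unfolding Cons Fst_simps
      by (rule mC_adm) (use Cons.prems Cons in \<open>auto intro!: Cons.prems\<close>)
  qed simp
  have 3: "dd (mC A \<epsilon>) (DC A \<epsilon>) (\<lambda>w. F (x # w)) w = dd (mC A \<epsilon>) (DC A \<epsilon>) (\<lambda>w. G (x # w)) w"
    by (rule Cons.IH) (use Cons.prems in auto)
  show ?case by (simp add: 1 2 3)
qed simp

lemma bch_cong:
  assumes "admL A (a # w)" "\<And>W. admL A W \<Longrightarrow> W \<noteq> [] \<Longrightarrow> mset (tags W) = add_mset \<epsilon> (mset (tags (a # w))) \<Longrightarrow> F W = G W"
  shows "bch (mC A \<epsilon>) (DC A \<epsilon>) (\<lambda>a w. F (a # w)) a w = bch (mC A \<epsilon>) (DC A \<epsilon>) (\<lambda>a w. G (a # w)) a w"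
proof -
  have 1: "DC A \<epsilon> a (\<lambda>y. F (y # w)) = DC A \<epsilon> a (\<lambda>y. G (y # w))"
    by (rule DC_adm) (use assms in auto)
  have 2: "Fst (\<lambda>y w'. mC A \<epsilon> a y (\<lambda>z. F (z # w'))) w = Fst (\<lambda>y w'. mC A \<epsilon> a y (\<lambda>z. G (z # w'))) w"
  proof (cases w)
    case (Cons y w')
    show ?thesis unfolding Cons Fst_simps
      by (rule mC_adm) (use assms Cons in \<open>auto intro!: assms(2)\<close>)
  qed simp
  have 3: "dd (mC A \<epsilon>) (DC A \<epsilon>) (\<lambda>w. F (a # w)) w = dd (mC A \<epsilon>) (DC A \<epsilon>) (\<lambda>w. G (a # w)) w"
    by (rule dd_cong) (use assms in auto)
  have 4: "Lst (\<lambda>l w'. mC A \<epsilon> l a (\<lambda>z. F (z # w'))) w = Lst (\<lambda>l w'. mC A \<epsilon> l a (\<lambda>z. G (z # w'))) w"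
  proof (cases w rule: rev_cases)
    case (snoc w' l)
    show ?thesis unfolding snoc Lst_simps
      by (rule mC_adm) (use assms snoc in \<open>auto intro!: assms(2)\<close>)
  qed simp
  show ?thesis by (simp add: bch_def 1 2 3 4)
qed

lemma hoch_b_eq: "hoch_b A = (\<lambda>c d. \<Sum>i\<in>{0..length (snd c)}. deltai A i c d + mui A i c d)"
  by (intro ext) (simp add: hoch_b_def)

lemma fin_hoch_b: "fin (hoch_b A)"
  unfolding hoch_b_eq by (intro fin_sum fin_plus fin_deltai fin_mui finite_atLeastAtMost)

lemma pr_hoch_b: "pr (hoch_b A) f c = (\<Sum>i\<in>{0..length (snd c)}. pr (deltai A i) f c + pr (mui A i) f c)"
  unfolding hoch_b_eq
  by (subst pr_sum[where T="\<lambda>i c d. deltai A i c d + mui A i c d"]) (simp_all add: fin_plus pr_plus fin_deltai fin_mui)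

text \<open>The differentials at all positions and the products at all positions but the last form
  the bar differential of the whole word; the remaining product is the cyclic one.\<close>

lemma lift_hoch_b:
  assumes "admL A (a # w)"
  shows "kap U V \<epsilon> (a # w) * lift U V (pr (hoch_b A) f) (a # w) = bch (mC A \<epsilon>) (DC A \<epsilon>) (\<lambda>a w. lift U V f (a # w)) a w"
proof -
  let ?L = "a # w" and ?n = "length w" and ?k = "kap U V \<epsilon> (a # w) :: 'k"
  have d: "?k * lift U V (pr (deltai A i) f) ?L = DC A \<epsilon> (?L ! i) (\<lambda>z. lift U V f (take i ?L @ z # drop (Suc i) ?L))" if "i < length ?L" for i
  proof -
    have L: "?L = take i ?L @ ?L ! i # drop (Suc i) ?L" using id_take_nth_drop[OF that] .
    show ?thesis using lift_deltai[of "take i ?L" "?L ! i" "drop (Suc i) ?L" i] that assms unfolding L[symmetric] by simp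
  qed
  have u: "?k * lift U V (pr (mui A i) f) ?L = mC A \<epsilon> (?L ! i) (?L ! Suc i) (\<lambda>z. lift U V f (take i ?L @ z # drop (Suc (Suc i)) ?L))" if "i < ?n" for i
  proof -
    have L: "?L = take i ?L @ ?L ! i # ?L ! Suc i # drop (Suc (Suc i)) ?L"
      using id_take_nth_drop[of i ?L] Cons_nth_drop_Suc[of "Suc i" ?L] that by simp
    show ?thesis using lift_mui[of "take i ?L" "?L ! i" "?L ! Suc i" "drop (Suc (Suc i)) ?L" i] that assms unfolding L[symmetric] by simp
  qed
  have l: "?k * lift U V (pr (mui A ?n) f) ?L = Lst (\<lambda>l w'. mC A \<epsilon> l a (\<lambda>z. lift U V f (z # w'))) w"
  proof (cases w rule: rev_cases)
    case Nil
    then show ?thesis by (simp add: pr_mui pr_opow_0 lift_def pr_mu0)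
  next
    case (snoc w' l)
    show ?thesis using lift_mui_last[of a w' l ?n] assms by (simp add: snoc)
  qed
  have "?k * lift U V (pr (hoch_b A) f) ?L = (\<Sum>i\<in>{0..?n}. ?k * lift U V (pr (deltai A i) f) ?L + ?k * lift U V (pr (mui A i) f) ?L)"
    by (simp add: lift_def pr_hoch_b sum_distrib_left algebra_simps del: psgn_append psgn.simps)
  also have "\<dots> = (\<Sum>i<length ?L. ?k * lift U V (pr (deltai A i) f) ?L) + (\<Sum>i<Suc ?n. ?k * lift U V (pr (mui A i) f) ?L)"
    by (simp only: sum.distrib atLeast0AtMost lessThan_Suc_atMost length_Cons)
  also have "\<dots> = dd (mC A \<epsilon>) (DC A \<epsilon>) (lift U V f) ?L + Lst (\<lambda>l w'. mC A \<epsilon> l a (\<lambda>z. lift U V f (z # w'))) w"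
  proof -
    have "(\<Sum>i<length ?L. ?k * lift U V (pr (deltai A i) f) ?L) = (\<Sum>i<length ?L. DC A \<epsilon> (?L ! i) (\<lambda>z. lift U V f (take i ?L @ z # drop (Suc i) ?L)))"
      by (intro sum.cong) (auto simp only: d lessThan_iff)
    moreover have "(\<Sum>i<?n. ?k * lift U V (pr (mui A i) f) ?L) = (\<Sum>i<?n. mC A \<epsilon> (?L ! i) (?L ! Suc i) (\<lambda>z. lift U V f (take i ?L @ z # drop (Suc (Suc i)) ?L)))"
      by (intro sum.cong) (auto simp only: u lessThan_iff)
    ultimately show ?thesis
      unfolding dd_sum sum.lessThan_Suc[of _ ?n] l by simp
  qed
  finally show ?thesis by (simp add: bch_dd del: dd.simps)
qed

lemma Nop_eq: "Nop A = (\<lambda>c d. \<Sum>i\<in>{0..length (snd c)}. opow (tau A) i c d)"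
  by (intro ext) (simp add: Nop_def)

lemma fin_Nop: "fin (Nop A)"
  unfolding Nop_eq by (intro fin_sum fin_opow fin_tau finite_atLeastAtMost)

lemma pr_Nop: "pr (Nop A) f c = (\<Sum>i\<in>{0..length (snd c)}. pr (opow (tau A) i) f c)"
  unfolding Nop_eq by (intro pr_sum fin_opow fin_tau finite_atLeastAtMost)

lemma fin_1_tauinv: "fin (\<lambda>c d. bv c d - tauinv A c d)"
  using fin_plus[OF fin_bv fin_uminus[OF fin_tau(2)]] by simp

lemma pr_1_tauinv: "pr (\<lambda>c d. bv c d - tauinv A c d) f c = f c - pr (tauinv A) f c"
  using pr_plus[OF fin_bv fin_uminus[OF fin_tau(2)], of A f c] pr_uminus[OF fin_tau(2), of A f c] by (simp add: pr_def)

lemma fin_Bop: "fin (Bop A)"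
  unfolding Bop_def by (intro fin_ocomp fin_1_tauinv fin_hop fin_Nop)

lemma pr_Bop: "pr (Bop A) f = pr (Nop A) (pr (hop A) (pr (\<lambda>c d. bv c d - tauinv A c d) f))"
  unfolding Bop_def by (simp add: pr_ocomp fin_ocomp fin_1_tauinv fin_hop fin_Nop)

lemma lift_Bop:
  assumes "admL A (a # w)" "nrm A f"
  shows "kap U V \<epsilon> (a # w) * lift U V (pr (Bop A) f) (a # w) = rot (\<lambda>u a v. lift U V f (oC A \<epsilon> # u @ a # v)) a w"
proof -
  let ?L = "a # w" and ?g = "pr (\<lambda>c d. bv c d - tauinv A c d) f" and ?k = "kap U V \<epsilon> (a # w) :: 'k"
  \<comment> \<open>Of the factor \<open>1 - tauinv\<close> only 1 survives: \<open>tauinv\<close>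
    moves the unit inserted by \<open>h\<close> into a bar entry, where the normalized function
    vanishes.\<close>
  have 1: "lift U V ?g (oC A \<epsilon> # L) = lift U V f (oC A \<epsilon> # L)" if "admL A L" "L \<noteq> []" for L
  proof -
    have "lift U V ?g (oC A \<epsilon> # L) = lift U V f (oC A \<epsilon> # L) - lift U V (pr (tauinv A) f) (oC A \<epsilon> # L)"
      by (simp add: lift_def pr_1_tauinv right_diff_distrib)
    also have "lift U V (pr (tauinv A) f) (oC A \<epsilon> # L) = lift U V f (rotl (oC A \<epsilon> # L))"
      by (rule lift_tauinv) (use that gdaD(1)[OF gA] in \<open>auto simp: adm_def oC_def\<close>)
    also have "\<dots> = 0" using nrm_lift[OF assms(2), of "oC A \<epsilon>" "rotl (oC A \<epsilon> # L)" U V] that by (simp add: rotl_def oC_def)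
    finally show ?thesis by simp
  qed
  have "?k * lift U V (pr (Bop A) f) ?L = (\<Sum>i\<in>{0..length w}. ?k * lift U V (pr (opow (tau A) i) (pr (hop A) ?g)) ?L)"
    by (simp add: lift_def pr_Bop pr_Nop sum_distrib_left del: psgn_append psgn.simps)
  also have "\<dots> = (\<Sum>i\<in>{0..length w}. lift U V f (oC A \<epsilon> # rotate i ?L))"
  proof (rule sum.cong)
    fix i
    have "?k * lift U V (pr (opow (tau A) i) (pr (hop A) ?g)) ?L = kap U V \<epsilon> (rotate i ?L) * lift U V (pr (hop A) ?g) (rotate i ?L)"
      unfolding kap_rotate using lift_opow_tau[OF assms(1), of U V i] by simp
    also have "\<dots> = lift U V f (oC A \<epsilon> # rotate i ?L)"
      by (subst lift_hop) (use 1[of "rotate i ?L"] assms in auto)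
    finally show "?k * lift U V (pr (opow (tau A) i) (pr (hop A) ?g)) ?L = lift U V f (oC A \<epsilon> # rotate i ?L)" .
  qed simp
  also have "\<dots> = rot (\<lambda>u a v. lift U V f (oC A \<epsilon> # u @ a # v)) a w" by (rule rot_sum)
  finally show ?thesis .
qed

text \<open>The differential acts first and receives \<epsilon>', which is below all tags present;
  the product receives the still smaller \<epsilon>. Both then cost only the sign of
  \<open>U\<close>, and these two signs cancel.\<close>

lemma lift_edel:
  assumes "admL A (a # w)" "low \<epsilon>' (U @ tags (a # w) @ V)" "\<epsilon> < \<epsilon>'"
  shows "lift U V (pr (edel A) f) (a # w) = - ehat (mC A \<epsilon>) (DC A \<epsilon>') (\<lambda>a w. lift U V f (a # w)) a w"
proof -
  have p: "pr (edel A) f c = - pr (deltai A 1) (pr (mui A 0) f) c" for c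
    unfolding edel_def by (simp add: pr_uminus pr_ocomp fin_ocomp fin_mui fin_deltai)
  show ?thesis
  proof (cases w)
    case Nil
    have "lift U V (pr (deltai A 1) (pr (mui A 0) f)) [a] = 0"
      by (simp add: lift_def pr_deltai pr_opow_Suc[of _ 0, simplified] fin_tau pr_opow_0 pr_tau pr_delta0 pr_tauinv pr_mui pr_mu0 fs_zero[OF fs_pair])
    then show ?thesis by (simp add: Nil lift_def p ehat_def)
  next
    case (Cons x w')
    have k: "kap U V \<epsilon>' (a # w) = (ksgn (odd (length U)) :: 'k)" by (rule kap_low[OF assms(2)])
    have "ksgn (odd (length U)) * lift U V (pr (deltai A 1) (pr (mui A 0) f)) (a # w) = DC A \<epsilon>' x (\<lambda>z. lift U V (pr (mui A 0) f) (a # z # w'))"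
      using lift_deltai[of "[a]" x w' 1 U V \<epsilon>' "pr (mui A 0) f"] assms(1) k by (simp add: Cons)
    also have "\<dots> = DC A \<epsilon>' x (\<lambda>z. ksgn (odd (length U)) * mC A \<epsilon> a z (\<lambda>t. lift U V f (t # w')))"
    proof (rule DC_adm)
      fix z assume z: "adm A z" "fst z = \<epsilon>' # fst x"
      have "kap U V \<epsilon> (a # z # w') = (ksgn (odd (length U)) :: 'k)"
        by (rule kap_low, rule low_trans[OF assms(2,3)]) (use z in \<open>auto simp: Cons\<close>)
      then show "lift U V (pr (mui A 0) f) (a # z # w') = ksgn (odd (length U)) * mC A \<epsilon> a z (\<lambda>t. lift U V f (t # w'))"
        using lift_mui[of "[]" a z w' 0 U V \<epsilon> f] z assms(1) by (intro ksgn_cancel) (simp add: Cons)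
    qed (use assms in \<open>simp add: Cons\<close>)
    also have "\<dots> = ksgn (odd (length U)) * DC A \<epsilon>' x (\<lambda>z. mC A \<epsilon> a z (\<lambda>t. lift U V f (t # w')))"
      by (rule fs_scale[OF fs_DC])
    finally have "lift U V (pr (deltai A 1) (pr (mui A 0) f)) (a # w) = DC A \<epsilon>' x (\<lambda>z. mC A \<epsilon> a z (\<lambda>t. lift U V f (t # w')))"
      by (metis ksgn_simps(4))
    then show ?thesis by (simp add: Cons lift_def p ehat_def)
  qed
qed

lemma lift_Ebig:
  assumes "admL A (a # w)" "low \<epsilon>' (U @ tags (a # w) @ V)" "\<epsilon> < \<epsilon>'"
  shows "lift U V (pr (Ebig A) f) (a # w) = - rotE (DC A \<epsilon>') (\<lambda>u a v. lift U V f (oC A \<epsilon> # u @ a # v)) a w"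
proof -
  let ?n = "length w" and ?s = "ksgn (odd (length U)) :: 'k"
  have fo: "fin (ocomp (hop A) (ocomp (opow (tauinv A) j) (deltai A i)))" for i j
    by (intro fin_ocomp fin_hop fin_opow fin_tau fin_deltai)
  have e: "Ebig A = (\<lambda>c d. - (\<Sum>i\<in>{1..length (snd c)}. \<Sum>j\<in>{0..length (snd c) - i}.
       ocomp (hop A) (ocomp (opow (tauinv A) j) (deltai A i)) c d))"
    by (intro ext) (simp add: Ebig_def)
  have p: "pr (Ebig A) f c = - (\<Sum>i\<in>{1..length (snd c)}. \<Sum>j\<in>{0..length (snd c) - i}. pr (deltai A i) (pr (opow (tauinv A) j) (pr (hop A) f)) c)" for c
  proof -
    have g: "pr (ocomp (hop A) (ocomp (opow (tauinv A) j) (deltai A i))) f c = pr (deltai A i) (pr (opow (tauinv A) j) (pr (hop A) f)) c" for i j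
      by (simp add: pr_ocomp fin_ocomp fin_hop fin_opow fin_tau fin_deltai)
    have s: "pr (\<lambda>c d. \<Sum>j\<in>{0..length (snd c) - i}. ocomp (hop A) (ocomp (opow (tauinv A) j) (deltai A i)) c d) f c
      = (\<Sum>j\<in>{0..length (snd c) - i}. pr (deltai A i) (pr (opow (tauinv A) j) (pr (hop A) f)) c)" for i
      unfolding g[symmetric] by (intro pr_sum fo finite_atLeastAtMost)
    have fs: "fin (\<lambda>c d. \<Sum>j\<in>{0..length (snd c) - i}. ocomp (hop A) (ocomp (opow (tauinv A) j) (deltai A i)) c d)" for i
      by (intro fin_sum fo finite_atLeastAtMost)
    show ?thesis unfolding e s[symmetric]
      by (subst pr_uminus, intro fin_sum fs finite_atLeastAtMost, subst pr_sum[where T="\<lambda>i c d. \<Sum>j\<in>{0..length (snd c) - i}. ocomp (hop A) (ocomp (opow (tauinv A) j) (deltai A i)) c d"])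
         (simp_all add: fs)
  qed
  have t: "lift U V (pr (deltai A (Suc i)) (pr (opow (tauinv A) j) (pr (hop A) f))) (a # w)
     = DC A \<epsilon>' (w ! i) (\<lambda>z. lift U V f (oC A \<epsilon> # drop (?n - j) w @ a # take i (take (?n - j) w) @ z # drop (Suc i) (take (?n - j) w)))"
     if "i < ?n - j" "j \<le> ?n" for i j
  proof -
    have i: "i < ?n" using that by simp
    have w: "w = take i w @ w ! i # drop (Suc i) w" using id_take_nth_drop[OF i] .
    have ww: "take i w @ z # drop (Suc i) w = (take i (take (?n - j) w) @ z # drop (Suc i) (take (?n - j) w)) @ drop (?n - j) w" for z
    proof -
      have "drop (Suc i) w = drop (Suc i) (take (?n - j) w @ drop (?n - j) w)" by simp
      also have "\<dots> = drop (Suc i) (take (?n - j) w) @ drop (?n - j) w"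
        unfolding drop_append using that by simp
      finally show ?thesis using that by (simp add: min_def)
    qed
    have k: "kap U V \<epsilon>' (a # w) = ?s" by (rule kap_low[OF assms(2)])
    have "?s * lift U V (pr (deltai A (Suc i)) (pr (opow (tauinv A) j) (pr (hop A) f))) (a # w)
      = DC A \<epsilon>' (w ! i) (\<lambda>z. lift U V (pr (opow (tauinv A) j) (pr (hop A) f)) (a # take i w @ z # drop (Suc i) w))"
      using lift_deltai[of "a # take i w" "w ! i" "drop (Suc i) w" "Suc i" U V \<epsilon>' "pr (opow (tauinv A) j) (pr (hop A) f)"] assms(1) i k
      by (simp add: w[symmetric])
    also have "\<dots> = DC A \<epsilon>' (w ! i) (\<lambda>z. ?s * lift U V f (oC A \<epsilon> # drop (?n - j) w @ a # take i (take (?n - j) w) @ z # drop (Suc i) (take (?n - j) w)))"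
    proof (rule DC_adm)
      fix z assume z: "adm A z" "fst z = \<epsilon>' # fst (w ! i)"
      let ?M = "drop (?n - j) w @ a # take i (take (?n - j) w) @ z # drop (Suc i) (take (?n - j) w)"
      have aL: "admL A (a # take i w @ z # drop (Suc i) w)"
        using assms(1) z by (auto dest: in_set_takeD in_set_dropD)
      have "lift U V (pr (opow (tauinv A) j) (pr (hop A) f)) (a # take i w @ z # drop (Suc i) w)
        = lift U V (pr (hop A) f) ((rotl ^^ j) (a # take i w @ z # drop (Suc i) w))"
        by (rule lift_opow_tauinv[OF aL]) simp
      also have "(rotl ^^ j) (a # take i w @ z # drop (Suc i) w) = ?M"
        using rotl_pow[of "drop (?n - j) w" j "a # take i (take (?n - j) w) @ z # drop (Suc i) (take (?n - j) w)"] that unfolding ww by simp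
      also have "lift U V (pr (hop A) f) ?M = ?s * lift U V f (oC A \<epsilon> # ?M)"
      proof -
        have sub: "set (tags M) \<subseteq> insert \<epsilon>' (set (tags (a # w)))" if "M = ?M" for M
          using i z nth_mem[OF i] that by (auto simp: tags_def dest: in_set_takeD in_set_dropD)
        have "low \<epsilon> (U @ tags M @ V)" if "M = ?M" for M
          by (rule low_trans[OF assms(2,3)]) (use sub[OF that] in auto)
        then have "kap U V \<epsilon> ?M = ?s"
          by (intro kap_low) blast
        then show ?thesis using lift_hop[of ?M U V \<epsilon> f] by (metis append_is_Nil_conv ksgn_simps(4) list.simps(3))
      qed
      finally show "lift U V (pr (opow (tauinv A) j) (pr (hop A) f)) (a # take i w @ z # drop (Suc i) w) = ?s * lift U V f (oC A \<epsilon> # ?M)" .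
    qed (use assms i in auto)
    also have "\<dots> = ?s * DC A \<epsilon>' (w ! i) (\<lambda>z. lift U V f (oC A \<epsilon> # drop (?n - j) w @ a # take i (take (?n - j) w) @ z # drop (Suc i) (take (?n - j) w)))"
      by (rule fs_scale[OF fs_DC])
    finally show ?thesis by (metis ksgn_simps(4))
  qed
  let ?F = "\<lambda>i j. DC A \<epsilon>' (w ! i) (\<lambda>z. lift U V f (oC A \<epsilon> # drop (?n - j) w @ a # take i (take (?n - j) w) @ z # drop (Suc i) (take (?n - j) w)))"
  have "lift U V (pr (Ebig A) f) (a # w) = - (\<Sum>i\<in>{1..?n}. \<Sum>j\<in>{0..?n - i}. lift U V (pr (deltai A i) (pr (opow (tauinv A) j) (pr (hop A) f))) (a # w))"
    by (simp add: lift_def p sum_distrib_left del: psgn_append psgn.simps)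
  also have "(\<Sum>i\<in>{1..?n}. \<Sum>j\<in>{0..?n - i}. lift U V (pr (deltai A i) (pr (opow (tauinv A) j) (pr (hop A) f))) (a # w))
     = (\<Sum>(i,j)\<in>Sigma {1..?n} (\<lambda>i. {0..?n - i}). ?F (i - 1) j)"
    unfolding sum.Sigma[OF finite_atLeastAtMost ballI[OF finite_atLeastAtMost]]
  proof (rule sum.cong)
    fix x assume "x \<in> Sigma {1..?n} (\<lambda>i. {0..?n - i})"
    then obtain i j where x: "x = (Suc i, j)" "i < ?n - j" "j \<le> ?n" by (cases x; cases "fst x") auto
    show "(case x of (i, j) \<Rightarrow> lift U V (pr (deltai A i) (pr (opow (tauinv A) j) (pr (hop A) f))) (a # w)) = (case x of (i, j) \<Rightarrow> ?F (i - 1) j)"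
      using t[OF x(2,3)] by (simp add: x(1))
  qed simp
  \<comment> \<open>\<open>k\<close> is the position of the cut: the last \<open>j\<close> letters
    are brought in front of the zeroth one, and the condition on \<open>j\<close> says that the
    differentiated letter is among the remaining \<open>k = n - j\<close>.\<close>
  also have "\<dots> = (\<Sum>(k,i)\<in>Sigma {..?n} (\<lambda>k. {..<k}). ?F i (?n - k))"
    by (rule sum.reindex_bij_witness[of _ "\<lambda>(k,i). (Suc i, ?n - k)" "\<lambda>(i,j). (?n - j, i - 1)"]) auto
  also have "\<dots> = (\<Sum>k\<le>?n. \<Sum>i<k. ?F i (?n - k))"
    by (subst sum.Sigma) auto
  also have "\<dots> = rotE (DC A \<epsilon>') (\<lambda>u a v. lift U V f (oC A \<epsilon> # u @ a # v)) a w"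
    unfolding rotE_def spl_sum LD_sum by (intro sum.cong) auto
  finally show ?thesis .
qed

end

section \<open>Shuffles\<close>

lemma c1_count: "x \<notin> set l \<Longrightarrow> c1 x l = ksgn (odd (length (filter (\<lambda>y. y < x) l)))"
  by (induction l) (auto simp: sg_def ksgn_def)

definition ctag :: "(nat \<Rightarrow> bool) \<Rightarrow> nat \<Rightarrow> nat list" where
  "ctag pp t = (if pp t then [t] else [])"

lemma concat_ctag: "concat (map (ctag pp) p) = filter pp p"
  by (induction p) (auto simp: ctag_def)

text \<open>The entries of odd parity are tagged by themselves, the others are left untagged; then
  inversions starting at the first entry are counted by \<open>c1\<close>.\<close>

lemma ksign_psgn:
  assumes "distinct p"
  shows "ksgn (ksign pp p) = (psgn (concat (map (ctag pp) p)) :: 'k::comm_ring_1)"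
  using assms
proof (induction p)
  case Nil
  show ?case by (simp add: ksign_def)
next
  case (Cons x p)
  let ?I = "\<lambda>p. {(a, b). a < b \<and> b < length p \<and> p ! b < p ! a \<and> pp (p ! a) \<and> pp (p ! b)}"
  let ?J = "{b. b < length p \<and> (p ! b < x \<and> pp (p ! b))}"
  have fin: "finite (?I p)" for p :: "nat list"
    by (rule finite_subset[of _ "{..<length p} \<times> {..<length p}"]) auto
  have split: "?I (x # p) = (\<lambda>(a, b). (Suc a, Suc b)) ` ?I p \<union> (if pp x then (\<lambda>b. (0, Suc b)) ` ?J else {})"
  proof (intro equalityI subsetI)
    fix c assume "c \<in> ?I (x # p)"
    then show "c \<in> (\<lambda>(a, b). (Suc a, Suc b)) ` ?I p \<union> (if pp x then (\<lambda>b. (0, Suc b)) ` ?J else {})"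
      by (cases c; cases "fst c"; cases "snd c") (auto simp: image_iff)
  next
    fix c assume "c \<in> (\<lambda>(a, b). (Suc a, Suc b)) ` ?I p \<union> (if pp x then (\<lambda>b. (0, Suc b)) ` ?J else {})"
    then show "c \<in> ?I (x # p)" by (auto split: if_splits)
  qed
  have "card (?I (x # p)) = card (?I p) + (if pp x then card ?J else 0)"
    unfolding split by (subst card_Un_disjoint) (auto simp: fin card_image inj_on_def)
  also have "card ?J = length (filter (\<lambda>y. y < x) (filter pp p))"
    by (simp add: length_filter_conv_card conj_commute)
  finally have card: "card (?I (x # p)) = card (?I p) + (if pp x then length (filter (\<lambda>y. y < x) (filter pp p)) else 0)" .
  have IH: "ksgn (odd (card (?I p))) = (psgn (filter pp p) :: 'k)"
    using Cons by (simp add: ksign_def concat_ctag)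
  have "ksgn (odd (a + b)) = (ksgn (odd a) * ksgn (odd b) :: 'k)" for a b :: nat by (auto simp: ksgn_def)
  moreover have "x \<notin> set (filter pp p)" using Cons by simp
  ultimately show ?case
    unfolding ksign_def concat_ctag card by (cases "pp x") (simp_all add: IH c1_count[of x "filter pp p"] mult.commute del: filter_filter)
qed

lemma sum_shuffles:
  "set u \<inter> set v = {} \<Longrightarrow> sum K (List.shuffles u v) = shf K u v"
proof (induction "length u + length v" arbitrary: u v K rule: less_induct)
  case less
  show ?case
  proof (cases u; cases v)
    fix x u' y v' assume u: "u = x # u'" and v: "v = y # v'"
    have "sum K (List.shuffles u v) = sum K ((#) x ` List.shuffles u' v) + sum K ((#) y ` List.shuffles u v')"
      using less.prems unfolding u v List.shuffles.simps
      by (subst sum.union_disjoint) auto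
    also have "sum K ((#) x ` List.shuffles u' v) = shf (\<lambda>w. K (x # w)) u' v"
      by (subst sum.reindex) (use less u in auto)
    also have "sum K ((#) y ` List.shuffles u v') = shf (\<lambda>w. K (y # w)) u v'"
      by (subst sum.reindex) (use less v in auto)
    finally show ?thesis by (simp add: u v)
  qed auto
qed

lemma distinct_shuffles:
  assumes "p \<in> List.shuffles u v" "distinct u" "distinct v" "set u \<inter> set v = {}"
  shows "distinct p"
proof -
  have "mset p = mset (u @ v)" using mset_shuffles[OF assms(1)] by simp
  then show ?thesis using mset_eq_imp_distinct_iff[of p "u @ v"] assms by auto
qed

lemma shuffles_filter:
  assumes "p \<in> List.shuffles u v" "\<And>x. x \<in> set u \<Longrightarrow> P x" "\<And>x. x \<in> set v \<Longrightarrow> \<not> P x"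
  shows "filter P p = u" "filter (\<lambda>x. \<not> P x) p = v"
proof -
  have "filter P p \<in> filter P ` List.shuffles u v" "filter (\<lambda>x. \<not> P x) p \<in> filter (\<lambda>x. \<not> P x) ` List.shuffles u v"
    using assms(1) by auto
  moreover have "filter P u = u" "filter P v = []" "filter (\<lambda>x. \<not> P x) u = []" "filter (\<lambda>x. \<not> P x) v = v"
    using assms by (auto simp: filter_id_conv filter_empty_conv)
  ultimately show "filter P p = u" "filter (\<lambda>x. \<not> P x) p = v"
    by (auto simp: filter_shuffles)
qed

lemma shuffles_eq: "Defs.shuffles n m = List.shuffles [0..<n] [n..<n + m]"
proof (intro equalityI subsetI)
  fix p assume "p \<in> Defs.shuffles n m"
  then have p: "distinct p" "set p = {0..<n + m}" "sorted (filter (\<lambda>t. t < n) p)" "sorted (filter (\<lambda>t. n \<le> t) p)"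
    by (auto simp: Defs.shuffles_def is_perm_def)
  have "filter (\<lambda>t. t < n) p = [0..<n]"
    by (rule sorted_distinct_set_unique) (use p in auto)
  moreover have "filter (\<lambda>t. \<not> t < n) p = [n..<n + m]"
    by (rule sorted_distinct_set_unique) (use p in \<open>auto simp: not_less\<close>)
  ultimately show "p \<in> List.shuffles [0..<n] [n..<n + m]"
    using partition_in_shuffles[of p "\<lambda>t. t < n"] by simp
next
  fix p assume p: "p \<in> List.shuffles [0..<n] [n..<n + m]"
  have f: "filter (\<lambda>t. t < n) p = [0..<n]" "filter (\<lambda>t. \<not> t < n) p = [n..<n + m]"
    by (rule shuffles_filter[OF p]; simp)+
  have "distinct p" "set p = {0..<n + m}"
    using distinct_shuffles[OF p] set_shuffles[OF p] by auto
  then show "p \<in> Defs.shuffles n m"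
    using f by (simp add: Defs.shuffles_def is_perm_def not_less)
qed

text \<open>A recursive form of the order condition in \<open>cshuffles\<close>, fitting the
  recursion of \<open>S\<close>.\<close>

primrec bef :: "'a \<Rightarrow> 'a \<Rightarrow> 'a list \<Rightarrow> bool" where
  "bef a c [] = False"
| "bef a c (x # p) = (x = a \<and> c \<in> set p \<or> bef a c p)"

lemma bef_iff: "bef a c p \<longleftrightarrow> (\<exists>i j. i < j \<and> j < length p \<and> p ! i = a \<and> p ! j = c)"
proof (induction p)
  case (Cons x p)
  show ?case
  proof
    assume "bef a c (x # p)"
    then consider "x = a" "c \<in> set p" | "bef a c p" by auto
    then show "\<exists>i j. i < j \<and> j < length (x # p) \<and> (x # p) ! i = a \<and> (x # p) ! j = c"
    proof cases
      case 1
      then obtain j where "j < length p" "p ! j = c" by (auto simp: in_set_conv_nth)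
      then show ?thesis using \<open>x = a\<close> by (intro exI[of _ 0] exI[of _ "Suc j"]) auto
    next
      case 2
      then obtain i j where "i < j" "j < length p" "p ! i = a" "p ! j = c" using Cons by auto
      then show ?thesis by (intro exI[of _ "Suc i"] exI[of _ "Suc j"]) auto
    qed
  next
    assume "\<exists>i j. i < j \<and> j < length (x # p) \<and> (x # p) ! i = a \<and> (x # p) ! j = c"
    then obtain i j where ij: "i < j" "j < length (x # p)" "(x # p) ! i = a" "(x # p) ! j = c" by blast
    then show "bef a c (x # p)"
      by (cases i; cases j) (auto simp: Cons)
  qed
qed simp

lemma bef_set: "bef a c p \<Longrightarrow> a \<in> set p \<and> c \<in> set p"
  by (induction p) auto

lemma S_shuffles:
  assumes "distinct (u1 @ a # u2)" "distinct (v1 @ c # v2)" "set (u1 @ a # u2) \<inter> set (v1 @ c # v2) = {}"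
  shows "S K u1 a u2 v1 c v2 = sum K {p \<in> List.shuffles (u1 @ a # u2) (v1 @ c # v2). bef a c p}"
  using assms
proof (induction "length u1 + length v1" arbitrary: u1 v1 K rule: less_induct)
  case less
  have im: "sum K ((#) x ` X) = sum (\<lambda>w. K (x # w)) X" for x X and K :: "'a list \<Rightarrow> 'b"
    by (subst sum.reindex) auto
  have a: "sum (\<lambda>w. K (a # w)) {p \<in> List.shuffles u2 (v1 @ c # v2). bef a c (a # p)} = shf (\<lambda>w. K (a # w)) u2 (v1 @ c # v2)" if "u1 = []"
  proof -
    have "{p \<in> List.shuffles u2 (v1 @ c # v2). bef a c (a # p)} = List.shuffles u2 (v1 @ c # v2)"
      by (auto dest: set_shuffles)
    moreover have "set u2 \<inter> set (v1 @ c # v2) = {}" using less.prems by auto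
    ultimately show ?thesis by (simp only: sum_shuffles)
  qed
  have cons: "{p \<in> (#) x ` X \<union> (#) y ` Y. bef a c p} = (#) x ` {p \<in> X. bef a c (x # p)} \<union> (#) y ` {p \<in> Y. bef a c (y # p)}" for x y X Y
    by auto
  have uni: "sum K ((#) x ` X \<union> (#) y ` Y) = sum K ((#) x ` X) + sum K ((#) y ` Y)"
    if "x \<noteq> y" "finite X" "finite Y" for x y X Y and K :: "'a list \<Rightarrow> 'b"
    by (rule sum.union_disjoint) (use that in auto)
  have fi: "finite {p \<in> List.shuffles u v. Q p}" for u v :: "'a list" and Q by simp
  have ca: "c \<noteq> a" using less.prems by auto
  show ?case
  proof (cases u1; cases v1)
    assume uv: "u1 = []" "v1 = []"
    have e: "{p \<in> List.shuffles (a # u2) v2. bef a c (c # p)} = {}"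
      using less.prems ca bef_set[of a c] set_shuffles[of _ "a # u2" v2] by (fastforce simp: uv)
    show ?thesis using a less.prems ca
      unfolding uv append.simps S.simps List.shuffles.simps cons e by (simp add: uv im del: bef.simps)
  next
    fix q v assume uv: "u1 = []" "v1 = q # v"
    have "{p \<in> List.shuffles (a # u2) (v @ c # v2). bef a c (q # p)} = {p \<in> List.shuffles (a # u2) (v @ c # v2). bef a c p}"
      using less.prems by (auto simp: uv)
    moreover have "q \<noteq> a" using less.prems by (auto simp: uv)
    ultimately show ?thesis using a less.prems less.hyps[of "[]" v "\<lambda>w. K (q # w)"]
      unfolding uv append.simps S.simps List.shuffles.simps cons by (subst uni) (simp_all add: uv im del: bef.simps)
  next
    fix p u assume uv: "u1 = p # u" "v1 = []"
    have e: "{w \<in> List.shuffles u1' v2. bef a c (c # w)} = {}" if "u1' = p # u @ a # u2" for u1'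
      using less.prems ca bef_set[of a c] set_shuffles[of _ u1' v2] that by (fastforce simp: uv)
    have "{w \<in> List.shuffles (u @ a # u2) (c # v2). bef a c (p # w)} = {w \<in> List.shuffles (u @ a # u2) (c # v2). bef a c w}"
      using less.prems by (auto simp: uv)
    moreover have "c \<noteq> p" using less.prems by (auto simp: uv)
    ultimately show ?thesis using less.prems less.hyps[of u "[]" "\<lambda>w. K (p # w)"]
      unfolding uv append.simps S.simps List.shuffles.simps cons by (subst uni) (simp_all add: uv im e del: bef.simps)
  next
    fix p u q v assume uv: "u1 = p # u" "v1 = q # v"
    have "{w \<in> List.shuffles (u @ a # u2) (q # v @ c # v2). bef a c (p # w)} = {w \<in> List.shuffles (u @ a # u2) (q # v @ c # v2). bef a c w}"
      "{w \<in> List.shuffles (p # u @ a # u2) (v @ c # v2). bef a c (q # w)} = {w \<in> List.shuffles (p # u @ a # u2) (v @ c # v2). bef a c w}"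
      using less.prems by (auto simp: uv)
    moreover have "q \<noteq> p" using less.prems by (auto simp: uv)
    ultimately show ?thesis using less.prems less.hyps[of u v1 "\<lambda>w. K (p # w)"] less.hyps[of u1 v "\<lambda>w. K (q # w)"]
      unfolding uv append.simps S.simps List.shuffles.simps cons by (subst uni) (simp_all add: uv im del: bef.simps)
  qed
qed

lemma rotate_filter_uniq:
  assumes "distinct u" "k < length u" "l < length u" "rotate k u = rotate l u"
  shows "k = l"
proof -
  have "u \<noteq> []" using assms by auto
  then have "rotate i u ! 0 = u ! i" if "i < length u" for i
    using nth_rotate[of 0 u i] that by simp
  from this[OF assms(2)] this[OF assms(3)] have "u ! k = u ! l" by (simp add: assms(4))
  then show ?thesis using nth_eq_iff_index_eq[OF assms(1-3)] by simp
qed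

text \<open>The rotation amounts can be taken below the word lengths. They are then determined by
  the permutation, because a word without repetitions has pairwise different rotations; so the
  existential quantifiers turn into a disjoint union.\<close>

lemma sum_cshuffles:
  "sum K (cshuffles n m) = SR K 0 [1..<Suc n] (Suc n) [Suc (Suc n)..<n + m + 2]"
proof -
  let ?u = "[0..<Suc n]" and ?v = "[Suc n..<n + m + 2]"
  let ?X = "\<lambda>k l. {p \<in> List.shuffles (rotate k ?u) (rotate l ?v). bef 0 (Suc n) p}"
  let ?T = "\<lambda>x y. sum K {p \<in> List.shuffles x y. bef 0 (Suc n) p}"
  have u: "?u = 0 # [1..<Suc n]" using upt_conv_Cons[of 0 "Suc n"] by simp
  have v: "?v = Suc n # [Suc (Suc n)..<n + m + 2]" by (rule upt_conv_Cons) simp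
  have fil: "filter (\<lambda>t. t \<le> n) p = rotate k ?u \<and> filter (\<lambda>t. n < t) p = rotate l ?v"
    if "p \<in> List.shuffles (rotate k ?u) (rotate l ?v)" for p k l
  proof -
    have "filter (\<lambda>t. t \<le> n) p = rotate k ?u" by (rule shuffles_filter(1)[OF that]) auto
    moreover have "filter (\<lambda>t. \<not> t \<le> n) p = rotate l ?v" by (rule shuffles_filter(2)[OF that]) auto
    ultimately show ?thesis by (simp only: not_le)
  qed
  have eq: "cshuffles n m = (\<Union>k\<in>{0..n}. \<Union>l\<in>{0..m}. ?X k l)"
  proof (intro equalityI subsetI)
    fix p assume "p \<in> cshuffles n m"
    then obtain k l where p: "filter (\<lambda>t. t \<le> n) p = rotate k ?u" "filter (\<lambda>t. n < t) p = rotate l ?v" "bef 0 (Suc n) p"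
      unfolding cshuffles_def bef_iff by blast
    have "rotate k ?u = rotate (k mod Suc n) ?u" "rotate l ?v = rotate (l mod Suc m) ?v"
      using rotate_conv_mod[of k ?u] rotate_conv_mod[of l ?v] by simp_all
    then have "p \<in> ?X (k mod Suc n) (l mod Suc m)"
      using partition_in_shuffles[of p "\<lambda>t. t \<le> n"] p by (simp add: not_le)
    moreover have "k mod Suc n \<in> {0..n}" "l mod Suc m \<in> {0..m}" by (simp_all add: mod_Suc_le_divisor)
    ultimately show "p \<in> (\<Union>k\<in>{0..n}. \<Union>l\<in>{0..m}. ?X k l)" by blast
  next
    fix p assume "p \<in> (\<Union>k\<in>{0..n}. \<Union>l\<in>{0..m}. ?X k l)"
    then obtain k l where p: "p \<in> List.shuffles (rotate k ?u) (rotate l ?v)" "bef 0 (Suc n) p" by blast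
    have "distinct p"
    proof (rule distinct_shuffles[OF p(1)])
      show "set (rotate k ?u) \<inter> set (rotate l ?v) = {}"
      proof (rule equals0I)
        fix x assume "x \<in> set (rotate k ?u) \<inter> set (rotate l ?v)"
        then have "x < Suc n" "Suc n \<le> x" by (simp_all only: Int_iff set_rotate set_upt atLeastLessThan_iff)
        then show False by simp
      qed
    qed (simp_all only: distinct_rotate distinct_upt)
    moreover have "set p = {0..<n + m + 2}"
      using set_shuffles[OF p(1)] unfolding set_rotate set_upt by auto
    ultimately show "p \<in> cshuffles n m"
      unfolding cshuffles_def is_perm_def bef_iff[symmetric] mem_Collect_eq
      using fil[OF p(1)] p(2) by (intro conjI exI[of _ k] exI[of _ l]) (simp_all only: bef_iff)
  qed
  have inner: "sum K (\<Union>l\<in>{0..m}. ?X k l) = (\<Sum>l\<in>{0..m}. ?T (rotate k ?u) (rotate l ?v))" for k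
  proof (rule sum.UNION_disjoint)
    show "\<forall>i\<in>{0..m}. \<forall>j\<in>{0..m}. i \<noteq> j \<longrightarrow> ?X k i \<inter> ?X k j = {}"
    proof (intro ballI impI, rule ccontr)
      fix i j assume ij: "i \<in> {0..m}" "j \<in> {0..m}" "i \<noteq> j" "?X k i \<inter> ?X k j \<noteq> {}"
      then obtain p where "p \<in> ?X k i" "p \<in> ?X k j" by blast
      then have "rotate i ?v = rotate j ?v" using fil[of p k i] fil[of p k j] by (simp del: upt_Suc)
      then show False using rotate_filter_uniq[of ?v i j] ij(1-3) by (simp del: upt_Suc)
    qed
  qed auto
  have "sum K (cshuffles n m) = (\<Sum>k\<in>{0..n}. sum K (\<Union>l\<in>{0..m}. ?X k l))"
    unfolding eq
  proof (rule sum.UNION_disjoint)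
    show "\<forall>i\<in>{0..n}. \<forall>j\<in>{0..n}. i \<noteq> j \<longrightarrow> (\<Union>l\<in>{0..m}. ?X i l) \<inter> (\<Union>l\<in>{0..m}. ?X j l) = {}"
    proof (intro ballI impI, rule ccontr)
      fix i j assume ij: "i \<in> {0..n}" "j \<in> {0..n}" "i \<noteq> j" "(\<Union>l\<in>{0..m}. ?X i l) \<inter> (\<Union>l\<in>{0..m}. ?X j l) \<noteq> {}"
      then obtain p l l' where "p \<in> ?X i l" "p \<in> ?X j l'" by blast
      then have "rotate i ?u = rotate j ?u" using fil[of p i l] fil[of p j l'] by (simp del: upt_Suc)
      then show False using rotate_filter_uniq[of ?u i j] ij(1-3) by (simp del: upt_Suc)
    qed
  qed auto
  also have "\<dots> = (\<Sum>k\<in>{0..n}. \<Sum>l\<in>{0..m}. ?T (rotate k ?u) (rotate l ?v))" unfolding inner ..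
  also have "\<dots> = (\<Sum>k\<in>{0..length [1..<Suc n]}. \<Sum>l\<in>{0..length [Suc (Suc n)..<n + m + 2]}. ?T (rotate k (0 # [1..<Suc n])) (rotate l (Suc n # [Suc (Suc n)..<n + m + 2])))"
    unfolding u[symmetric] v[symmetric] length_upt by simp
  also have "\<dots> = rot (\<lambda>a b c. rot (\<lambda>a' b' c'. ?T (a @ b # c) (a' @ b' # c')) (Suc n) [Suc (Suc n)..<n + m + 2]) 0 [1..<Suc n]"
  proof -
    have "(\<Sum>l\<in>{0..length [Suc (Suc n)..<n + m + 2]}. ?T x (rotate l (Suc n # [Suc (Suc n)..<n + m + 2])))
       = rot (\<lambda>a' b' c'. ?T x (a' @ b' # c')) (Suc n) [Suc (Suc n)..<n + m + 2]" for x
      by (rule rot_sum)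
    then show ?thesis
      using rot_sum[where \<phi>="\<lambda>x. rot (\<lambda>a' b' c'. ?T x (a' @ b' # c')) (Suc n) [Suc (Suc n)..<n + m + 2]" and w="[1..<Suc n]" and a=0] by (simp only:)
  qed
  also have "\<dots> = SR K 0 [1..<Suc n] (Suc n) [Suc (Suc n)..<n + m + 2]"
    unfolding SR_def
  proof (intro rot_cong)
    fix a c a' c' assume w: "[1..<Suc n] = c @ a" "[Suc (Suc n)..<n + m + 2] = c' @ a'"
    have d: "distinct (c @ a)" "distinct (c' @ a')" "set (c @ a) = {1..<Suc n}" "set (c' @ a') = {Suc (Suc n)..<n + m + 2}"
      unfolding w[symmetric] by (simp_all only: distinct_upt set_upt)
    have "distinct (a @ 0 # c)" "distinct (a' @ Suc n # c')" "set (a @ 0 # c) \<inter> set (a' @ Suc n # c') = {}"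
    proof -
      have "0 \<notin> set (c @ a)" "Suc n \<notin> set (c @ a)" "0 \<notin> set (c' @ a')" "Suc n \<notin> set (c' @ a')" "set (c @ a) \<inter> set (c' @ a') = {}"
        unfolding d by auto
      then show "distinct (a @ 0 # c)" "distinct (a' @ Suc n # c')" "set (a @ 0 # c) \<inter> set (a' @ Suc n # c') = {}"
        using d(1,2) by auto
    qed
    then show "?T (a @ 0 # c) (a' @ Suc n # c') = S K a 0 c a' (Suc n) c'"
      by (rule S_shuffles[symmetric])
  qed
  finally show ?thesis .
qed

lemma odd_concat: "(\<And>x. x \<in> set w \<Longrightarrow> odd (length (s x)) = odd (length (s' x))) \<Longrightarrow>
   odd (length (concat (map s w))) = odd (length (concat (map s' w)))"
  by (induction w) auto

text \<open>The sign of a rearrangement depends only on the parities of the moved letters. For two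
  taggings with equal parities the product of the two signs is therefore the same for all
  rearrangements.\<close>

lemma psgn_equi:
  fixes s s' :: "'a \<Rightarrow> nat list"
  assumes "mset W = mset W'" "\<And>x. x \<in> set W \<Longrightarrow> odd (length (s x)) = odd (length (s' x))"
  shows "psgn (U @ concat (map s W)) * psgn (U' @ concat (map s' W))
       = (psgn (U @ concat (map s W')) * psgn (U' @ concat (map s' W')) :: 'k::comm_ring_1)"
  using assms
proof (induction W' arbitrary: W U U')
  case (Cons x W1)
  have "x \<in> set W" using Cons.prems(1) by (metis list.set_intros(1) set_mset_mset)
  then obtain u w where W: "W = u @ x # w" by (auto simp: in_set_conv_decomp)
  have m: "mset (u @ w) = mset W1" using Cons.prems(1) by (simp add: W)
  have o: "odd (length (concat (map s u))) = odd (length (concat (map s' u)))" "odd (length (s x)) = odd (length (s' x))"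
    by (rule odd_concat, rule Cons.prems(2), simp add: W) (rule Cons.prems(2), simp add: W)
  have "psgn (U @ concat (map s W)) * psgn (U' @ concat (map s' W))
     = psgn (U @ concat (map s u) @ s x @ concat (map s w)) * (psgn (U' @ concat (map s' u) @ s' x @ concat (map s' w)) :: 'k)"
    by (simp add: W del: psgn_append)
  also have "\<dots> = psgn (U @ s x @ concat (map s u) @ concat (map s w)) * psgn (U' @ s' x @ concat (map s' u) @ concat (map s' w))"
    unfolding psgn_swap[of U "concat (map s u)"] psgn_swap[of U' "concat (map s' u)"] o
    by (simp add: ac_simps del: psgn_append)
  also have "\<dots> = psgn ((U @ s x) @ concat (map s (u @ w))) * psgn ((U' @ s' x) @ concat (map s' (u @ w)))"
    by (simp del: psgn_append)
  also have "\<dots> = psgn ((U @ s x) @ concat (map s W1)) * psgn ((U' @ s' x) @ concat (map s' W1))"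
    by (rule Cons.IH[OF m]) (use Cons.prems(2) W in auto)
  finally show ?case by (simp del: psgn_append)
qed simp

text \<open>The tag 2 separates the two factors; the tags 0 and 1 are left to the operators.\<close>

definition lift2 :: "('i \<times> 'i list \<Rightarrow> 'j \<times> 'j list \<Rightarrow> 'k::comm_ring_1) \<Rightarrow> (nat list \<times> 'i) list \<Rightarrow> (nat list \<times> 'j) list \<Rightarrow> 'k" where
  "lift2 f L1 L2 = psgn (tags L1 @ 2 # tags L2) * f (chn (map snd L1)) (chn (map snd L2))"

text \<open>Comparison by \<open>psgn_equi\<close> of an arbitrary tagging with the one of
  \<open>ksign_psgn\<close>, whose sign is the inversion count.\<close>

lemma ksign_idx:
  fixes s :: "nat \<Rightarrow> nat list"
  assumes "mset p = mset [0..<N]" "\<And>t. t < N \<Longrightarrow> odd (length (s t)) = pp t"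
  shows "psgn (U @ concat (map s p)) = (ksgn (ksign pp p) * psgn (U @ concat (map s [0..<N])) :: 'k::comm_ring_1)"
proof -
  have d: "distinct p" "distinct (filter pp p)"
    using mset_eq_imp_distinct_iff[OF assms(1)] by simp_all
  have st: "set p = {0..<N}" using assms(1) by (metis set_mset_mset set_upt)
  have "psgn (U @ concat (map s p)) * psgn ([] @ concat (map (ctag pp) p))
    = (psgn (U @ concat (map s [0..<N])) * psgn ([] @ concat (map (ctag pp) [0..<N])) :: 'k)"
    by (rule psgn_equi[OF assms(1)]) (use assms(2) st in \<open>auto simp: ctag_def\<close>)
  moreover have "psgn (filter pp [0..<N]) = (1 :: 'k)"
  proof -
    have "psgn l = (1 :: 'k)" if "sorted l" "distinct l" for l
      using that
    proof (induction l)
      case (Cons a l)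
      then have "c1 a l = (1 :: 'k)" by (intro c1_less) (auto simp: order.strict_iff_order)
      then show ?case using Cons by simp
    qed simp
    then show ?thesis by (simp add: sorted_wrt_filter)
  qed
  ultimately have "psgn (U @ concat (map s p)) * ksgn (ksign pp p) = (psgn (U @ concat (map s [0..<N])) :: 'k)"
    unfolding ksign_psgn[OF d(1)] by (simp add: concat_ctag del: psgn_append)
  then show ?thesis by (metis ksgn_simps(4) mult.commute)
qed

lemma SR_map: "SR (\<lambda>w. \<phi> (map g w)) p0 p q0 q = SR \<phi> (g p0) (map g p) (g q0) (map g q)"
proof -
  have "SR (\<lambda>w. \<phi> (map g w)) p0 p q0 q = spl (\<lambda>p1 p2. spl (\<lambda>q1 q2. S \<phi> (map g p2) (g p0) (map g p1) (map g q2) (g q0) (map g q1)) q) p"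
    by (simp add: SR_def rot_def S_map)
  also have "\<dots> = spl (\<lambda>p1 p2. spl (\<lambda>q1 q2. S \<phi> (map g p2) (g p0) (map g p1) q2 (g q0) q1) (map g q)) p"
    by (subst spl_map[where \<phi>="\<lambda>q1 q2. S \<phi> _ _ _ q2 _ q1"]) simp
  also have "\<dots> = SR \<phi> (g p0) (map g p) (g q0) (map g q)"
    by (subst spl_map[where \<phi>="\<lambda>p1 p2. spl (\<lambda>q1 q2. S \<phi> p2 _ p1 q2 _ q1) _"]) (simp add: SR_def rot_def)
  finally show ?thesis .
qed

lemma map_append_upt:
  "map (\<lambda>t. if t < length p then F (p ! t) else H (q ! (t - length p))) [0..<length p] = map F p"
  "map (\<lambda>t. if t < length p then F (p ! t) else H (q ! (t - length p))) [length p..<length p + length q] = map H q"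
  by (auto intro: nth_equalityI)

section \<open>The operators \<open>sh\<close> and \<open>Sh\<close> on tagged words\<close>

context
  fixes A :: "('i, 'k::field_char_0) dga" and B :: "('j, 'k) dga"
  assumes gA: "gda A" and gB: "gda B"
begin

lemma sh_eq: "sh A B = (\<lambda>c d. \<Sum>p\<in>Defs.shuffles (length (snd (fst c))) (length (snd (snd c))).
    ksgn ((par B (fst (snd c)) \<and> odd (pisum A (snd (fst c)))) \<noteq> ksign (\<lambda>t. if t < length (snd (fst c)) then \<not> par A (snd (fst c) ! t) else \<not> par B (snd (snd c) ! (t - length (snd (fst c))))) p)
    * bv ((fst (fst c), fst (snd c)), map (\<lambda>t. if t < length (snd (fst c)) then (snd (fst c) ! t, one_idx B) else (one_idx A, snd (snd c) ! (t - length (snd (fst c))))) p) d)"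
  by (intro ext) (simp add: sh_def Let_def)

lemma finite_sum_bv: "finite I \<Longrightarrow> finite (vsupp (\<lambda>d. \<Sum>p\<in>I. c p * bv (e p) d :: 'k))"
  "finite I \<Longrightarrow> pair (\<lambda>d. \<Sum>p\<in>I. c p * bv (e p) d :: 'k) f = (\<Sum>p\<in>I. c p * f (e p))"
  using finite_vsupp_sum[of I "\<lambda>p d. c p * bv (e p) d"] pair_sum[of I "\<lambda>p d. c p * bv (e p) d" f]
  by (simp_all add: finite_vsupp_scale vsupp_bv pair_scale)

lemma finite_shuffles: "finite (Defs.shuffles n m)"
  by (simp add: shuffles_eq)

lemma finite_cshuffles: "finite (cshuffles n m)"
proof (rule finite_subset)
  show "cshuffles n m \<subseteq> {p. set p \<subseteq> {0..<n + m + 2} \<and> length p = n + m + 2}"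
    by (auto simp: cshuffles_def is_perm_def dest: distinct_card)
qed (rule finite_lists_length_eq, simp)

lemma fin_sh: "fin (sh A B)"
  unfolding sh_eq fin_def by (intro allI finite_sum_bv finite_shuffles)

lemma pr_sh: "pr (sh A B) f ((i0, is), (j0, js)) = (\<Sum>p\<in>Defs.shuffles (length is) (length js).
    ksgn ((par B j0 \<and> odd (pisum A is)) \<noteq> ksign (\<lambda>t. if t < length is then \<not> par A (is ! t) else \<not> par B (js ! (t - length is))) p)
    * f ((i0, j0), map (\<lambda>t. if t < length is then (is ! t, one_idx B) else (one_idx A, js ! (t - length is))) p))"
  unfolding pr_def sh_eq fst_conv snd_conv by (rule finite_sum_bv(2)[OF finite_shuffles])

text \<open>The separator ends up inside the zeroth letter, between its two factors. Moving it
  together with the tags of \<open>q0\<close>, a block of the parity of a''_0, past the bar entries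
  of the first chain produces the sign in the definition of \<open>sh\<close>.\<close>

lemma lift2_sh:
  assumes "admL A (p0 # p)" "admL B (q0 # q)"
  shows "lift2 (\<lambda>c1 c2. pr (sh A B) f (c1, c2)) (p0 # p) (q0 # q)
     = shf (\<lambda>w. lift [] [] f ((fst p0 @ 2 # fst q0, (snd p0, snd q0)) # w)) (map (iA B) p) (map (iB A) q)"
proof -
  let ?n = "length p" and ?m = "length q"
  let ?l = "\<lambda>t. if t < ?n then iA B (p ! t) else iB A (q ! (t - ?n))"
  let ?E = "\<lambda>t. if t < ?n then (map snd p ! t, one_idx B) else (one_idx A, map snd q ! (t - ?n))"
  let ?pp = "\<lambda>t. if t < ?n then \<not> par A (map snd p ! t) else \<not> par B (map snd q ! (t - ?n))"
  let ?st = "par B (snd q0) \<and> odd (pisum A (map snd p))"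
  let ?t0 = "(fst p0 @ 2 # fst q0, (snd p0, snd q0))"
  have adm: "\<forall>x\<in>set p. adm A x" "\<forall>x\<in>set q. adm B x" "adm B q0" using assms by auto
  have L: "lift2 (\<lambda>c1 c2. pr (sh A B) f (c1, c2)) (p0 # p) (q0 # q)
     = (\<Sum>\<pi>\<in>Defs.shuffles ?n ?m. psgn (tags (p0 # p) @ 2 # tags (q0 # q)) * ksgn (?st \<noteq> ksign ?pp \<pi>) * f ((snd p0, snd q0), map ?E \<pi>))"
    unfolding lift2_def list.map chn_Cons pr_sh length_map sum_distrib_left mult.assoc ..
  have R: "shf (\<lambda>w. lift [] [] f (?t0 # w)) (map (iA B) p) (map (iB A) q)
     = (\<Sum>\<pi>\<in>Defs.shuffles ?n ?m. lift [] [] f (?t0 # map ?l \<pi>))"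
    using shf_map[of "\<lambda>w. lift [] [] f (?t0 # w)" ?l "[0..<?n]" "[?n..<?n + ?m]"]
    unfolding map_append_upt shuffles_eq by (subst sum_shuffles) auto
  have t: "psgn (tags (p0 # p) @ 2 # tags (q0 # q)) * ksgn (?st \<noteq> ksign ?pp \<pi>) * f ((snd p0, snd q0), map ?E \<pi>)
      = lift [] [] f (?t0 # map ?l \<pi>)" if "\<pi> \<in> Defs.shuffles ?n ?m" for \<pi>
  proof -
    have ms: "mset \<pi> = mset [0..<?n + ?m]"
      using mset_shuffles[OF that[unfolded shuffles_eq]] upt_add_eq_append[of 0 ?n ?m] by (simp only: mset_append le0)
    then have sp: "set \<pi> = {0..<?n + ?m}" by (metis set_mset_mset set_upt)
    have m: "map snd (map ?l \<pi>) = map ?E \<pi>" using sp by auto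
    have "psgn (fst ?t0 @ concat (map (fst \<circ> ?l) \<pi>)) = (ksgn (ksign ?pp \<pi>) * psgn (fst ?t0 @ concat (map (fst \<circ> ?l) [0..<?n + ?m])) :: 'k)"
      by (rule ksign_idx[OF ms]) (use adm in \<open>auto simp: adm_def\<close>)
    also have "concat (map (fst \<circ> ?l) [0..<?n + ?m]) = tags (map ?l [0..<?n]) @ tags (map ?l [?n..<?n + ?m])"
      by (simp add: tags_def upt_add_eq_append[of 0 ?n ?m])
    also have "\<dots> = tags p @ tags q"
      unfolding map_append_upt by (simp add: tags_def comp_def)
    also have "psgn (fst ?t0 @ tags p @ tags q) = (ksgn ?st * psgn (tags (p0 # p) @ 2 # tags (q0 # q)) :: 'k)"
    proof -
      have "odd (length (tags p)) = odd (pisum A (map snd p))" using odd_tags adm by blast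
      moreover have "odd (length (2 # fst q0)) = par B (snd q0)" using adm(3) by (auto simp: adm_def)
      ultimately show ?thesis
        using psgn_swap[of "fst p0" "2 # fst q0" "tags p" "tags q", where ?'a='k] by (simp add: conj_commute del: psgn_append)
    qed
    finally have "psgn (fst ?t0 @ concat (map (fst \<circ> ?l) \<pi>)) = (psgn (tags (p0 # p) @ 2 # tags (q0 # q)) * ksgn (?st \<noteq> ksign ?pp \<pi>) :: 'k)"
      unfolding ksgn_xor[symmetric] by (simp only: ac_simps)
    moreover have "lift [] [] f (?t0 # map ?l \<pi>) = psgn (fst ?t0 @ concat (map (fst \<circ> ?l) \<pi>)) * f ((snd p0, snd q0), map snd (map ?l \<pi>))"
      by (simp add: lift_def tags_def comp_def del: psgn_append)
    ultimately show ?thesis unfolding m by (simp only:)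
  qed
  show ?thesis unfolding L R by (rule sum.cong[OF refl t])
qed

lemma Sh_eq: "Sh A B = (\<lambda>c d. \<Sum>p\<in>cshuffles (length (snd (fst c))) (length (snd (snd c))).
    ksgn ((par A (fst (fst c)) \<noteq> odd (pisum A (snd (fst c)))) \<noteq> ksign (\<lambda>t. if t \<le> length (snd (fst c)) then \<not> par A ((fst (fst c) # snd (fst c)) ! t)
       else \<not> par B ((fst (snd c) # snd (snd c)) ! (t - Suc (length (snd (fst c)))))) p)
    * bv ((one_idx A, one_idx B), map (\<lambda>t. if t \<le> length (snd (fst c)) then ((fst (fst c) # snd (fst c)) ! t, one_idx B)
       else (one_idx A, (fst (snd c) # snd (snd c)) ! (t - Suc (length (snd (fst c)))))) p) d)"
  by (intro ext) (simp add: Sh_def Let_def)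

lemma fin_Sh: "fin (Sh A B)"
  unfolding Sh_eq fin_def by (intro allI finite_sum_bv finite_cshuffles)

lemma pr_Sh: "pr (Sh A B) f ((i0, is), (j0, js)) = (\<Sum>p\<in>cshuffles (length is) (length js).
    ksgn ((par A i0 \<noteq> odd (pisum A is)) \<noteq> ksign (\<lambda>t. if t \<le> length is then \<not> par A ((i0 # is) ! t) else \<not> par B ((j0 # js) ! (t - Suc (length is)))) p)
    * f ((one_idx A, one_idx B), map (\<lambda>t. if t \<le> length is then ((i0 # is) ! t, one_idx B) else (one_idx A, (j0 # js) ! (t - Suc (length is)))) p))"
  unfolding pr_def Sh_eq fst_conv snd_conv by (rule finite_sum_bv(2)[OF finite_cshuffles])

text \<open>The separator moves to the front and becomes the tag of the new unit. It passes all
  letters of the first chain including the shifted a'_0, whereas the sign in \<open>Sh\<close>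
  counts a'_0 unshifted; hence the minus.\<close>

lemma lift2_Sh:
  assumes "admL A (p0 # p)" "admL B (q0 # q)"
  shows "lift2 (\<lambda>c1 c2. pr (Sh A B) f (c1, c2)) (p0 # p) (q0 # q)
     = - SR (\<lambda>w. lift [] [] f (oC (dga_tensor A B) 2 # w)) (iA B p0) (map (iA B) p) (iB A q0) (map (iB A) q)"
proof -
  let ?n = "length p" and ?m = "length q"
  let ?l = "\<lambda>t. if t \<le> ?n then iA B ((p0 # p) ! t) else iB A ((q0 # q) ! (t - Suc ?n))"
  let ?E = "\<lambda>t. if t \<le> ?n then ((snd p0 # map snd p) ! t, one_idx B) else (one_idx A, (snd q0 # map snd q) ! (t - Suc ?n))"
  let ?pp = "\<lambda>t. if t \<le> ?n then \<not> par A ((snd p0 # map snd p) ! t) else \<not> par B ((snd q0 # map snd q) ! (t - Suc ?n))"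
  let ?st = "par A (snd p0) \<noteq> odd (pisum A (map snd p))"
  let ?o = "oC (dga_tensor A B) 2" and ?N = "?n + ?m + 2"
  have nthA: "(snd p0 # map snd p) ! t = snd ((p0 # p) ! t)" if "t \<le> ?n" for t
    using that by (cases t) auto
  have nthB: "(snd q0 # map snd q) ! t = snd ((q0 # q) ! t)" if "t \<le> ?m" for t
    using that by (cases t) auto
  have admA: "adm A ((p0 # p) ! t)" if "t \<le> ?n" for t using assms(1) nth_mem[of t "p0 # p"] that by auto
  have admB: "adm B ((q0 # q) ! t)" if "t \<le> ?m" for t using assms(2) nth_mem[of t "q0 # q"] that by auto
  have L: "lift2 (\<lambda>c1 c2. pr (Sh A B) f (c1, c2)) (p0 # p) (q0 # q)
     = (\<Sum>\<pi>\<in>cshuffles ?n ?m. psgn (tags (p0 # p) @ 2 # tags (q0 # q)) * ksgn (?st \<noteq> ksign ?pp \<pi>) * f ((one_idx A, one_idx B), map ?E \<pi>))"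
    unfolding lift2_def list.map chn_Cons pr_Sh length_map sum_distrib_left mult.assoc ..
  have m1: "map ?l [1..<Suc ?n] = map (iA B) p"
    by (rule nth_equalityI) (auto simp del: upt_Suc)
  have m2: "map ?l [Suc (Suc ?n)..<?N] = map (iB A) q"
    by (rule nth_equalityI) (auto simp del: upt_Suc)
  have R: "SR (\<lambda>w. lift [] [] f (?o # w)) (iA B p0) (map (iA B) p) (iB A q0) (map (iB A) q)
     = (\<Sum>\<pi>\<in>cshuffles ?n ?m. lift [] [] f (?o # map ?l \<pi>))"
    using SR_map[of "\<lambda>w. lift [] [] f (?o # w)" ?l 0 "[1..<Suc ?n]" "Suc ?n" "[Suc (Suc ?n)..<?N]"]
    unfolding m1 m2 sum_cshuffles by simp
  have t: "psgn (tags (p0 # p) @ 2 # tags (q0 # q)) * ksgn (?st \<noteq> ksign ?pp \<pi>) * f ((one_idx A, one_idx B), map ?E \<pi>)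
      = - lift [] [] f (?o # map ?l \<pi>)" if "\<pi> \<in> cshuffles ?n ?m" for \<pi>
  proof -
    have d: "distinct \<pi>" "set \<pi> = {0..<?N}" using that by (auto simp: cshuffles_def is_perm_def)
    have ms: "mset \<pi> = mset [0..<?N]"
      using mset_set_set[OF d(1)] mset_set_set[OF distinct_upt, of 0 ?N] unfolding d(2) set_upt by (simp only:)
    have m: "map snd (map ?l \<pi>) = map ?E \<pi>"
      unfolding map_map
    proof (rule map_cong[OF refl])
      fix t assume "t \<in> set \<pi>"
      then have "t - Suc ?n \<le> ?m" unfolding d by auto
      then show "(snd \<circ> ?l) t = ?E t" by (simp add: nthA nthB del: nth_Cons_Suc)
    qed
    have "psgn ([2] @ concat (map (fst \<circ> ?l) \<pi>)) = (ksgn (ksign ?pp \<pi>) * psgn ([2] @ concat (map (fst \<circ> ?l) [0..<?N])) :: 'k)"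
    proof (rule ksign_idx[OF ms])
      fix t assume "t < ?N"
      then have "t - Suc ?n \<le> ?m" by auto
      then show "odd (length ((fst \<circ> ?l) t)) = ?pp t" using admA[of t] admB[of "t - Suc ?n"] by (simp add: nthA nthB adm_def)
    qed
    also have "concat (map (fst \<circ> ?l) [0..<?N]) = tags (map ?l [0..<?N])"
      by (simp only: tags_def map_map)
    also have "[0..<?N] = 0 # [1..<Suc ?n] @ Suc ?n # [Suc (Suc ?n)..<?N]"
      using upt_conv_Cons[of 0 ?N] upt_add_eq_append[of 1 "Suc ?n" "Suc ?m"] upt_conv_Cons[of "Suc ?n" ?N] by (simp del: upt_Suc)
    also have "tags (map ?l (0 # [1..<Suc ?n] @ Suc ?n # [Suc (Suc ?n)..<?N])) = tags (p0 # p) @ tags (q0 # q)"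
      unfolding list.map map_append m1 m2 by (simp add: tags_def comp_def)
    also have "psgn ([2] @ tags (p0 # p) @ tags (q0 # q)) = (- ksgn ?st * psgn (tags (p0 # p) @ 2 # tags (q0 # q)) :: 'k)"
    proof -
      have "odd (length (tags (p0 # p))) = (\<not> ?st)"
        using odd_tags[of p A] assms(1) by (auto simp: adm_def)
      moreover have "ksgn (\<not> ?st) = (- ksgn ?st :: 'k)" by (auto simp: ksgn_def)
      ultimately show ?thesis
        using psgn_swap[of "[]" "[2]" "tags (p0 # p)" "tags (q0 # q)", where ?'a='k] by (simp del: psgn_append psgn.simps tags_simps)
    qed
    finally have "psgn ([2] @ concat (map (fst \<circ> ?l) \<pi>)) = - (psgn (tags (p0 # p) @ 2 # tags (q0 # q)) * ksgn (?st \<noteq> ksign ?pp \<pi>) :: 'k)"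
      unfolding ksgn_xor[symmetric] by (simp only: mult_minus_left mult_minus_right ac_simps)
    moreover have "lift [] [] f (?o # map ?l \<pi>) = psgn ([2] @ concat (map (fst \<circ> ?l) \<pi>)) * f ((one_idx A, one_idx B), map snd (map ?l \<pi>))"
      unfolding lift_def tags_def list.map chn_Cons by (simp add: oC_def del: psgn_append psgn.simps if_image_distrib)
    ultimately show ?thesis unfolding m by (simp only: mult_minus_left minus_minus)
  qed
  show ?thesis unfolding L R sum_negf[symmetric] by (rule sum.cong[OF refl t])
qed

end

section \<open>Compatibility with maps of letters\<close>

lemma dd_map:
  assumes "\<And>x y G. m (g x) (g y) G = m' x y (\<lambda>z. G (g z))" "\<And>x G. D (g x) G = D' x (\<lambda>z. G (g z))"
  shows "dd m D \<phi> (map g w) = dd m' D' (\<lambda>w. \<phi> (map g w)) w"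
proof (induction w arbitrary: \<phi>)
  case (Cons x w)
  have "Fst (\<lambda>y w'. m (g x) y (\<lambda>z. \<phi> (z # w'))) (map g w) = Fst (\<lambda>y w'. m' x y (\<lambda>z. \<phi> (g z # map g w'))) w"
    by (cases w) (simp_all add: assms)
  then show ?case using Cons[of "\<lambda>w. \<phi> (g x # w)"] by (simp add: assms)
qed simp

lemma bch_map:
  assumes "\<And>x y G. m (g x) (g y) G = m' x y (\<lambda>z. G (g z))" "\<And>x G. D (g x) G = D' x (\<lambda>z. G (g z))"
  shows "bch m D \<Psi> (g a) (map g w) = bch m' D' (\<lambda>a w. \<Psi> (g a) (map g w)) a w"
proof -
  have "Lst (\<lambda>l w'. m l (g a) (\<lambda>z. \<Psi> z w')) (map g w) = Lst (\<lambda>l w'. m' l a (\<lambda>z. \<Psi> (g z) (map g w'))) w"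
    by (cases w rule: rev_cases) (simp_all add: assms)
  moreover have "Fst (\<lambda>y w'. m (g a) y (\<lambda>z. \<Psi> z w')) (map g w) = Fst (\<lambda>y w'. m' a y (\<lambda>z. \<Psi> (g z) (map g w'))) w"
    by (cases w) (simp_all add: assms)
  ultimately show ?thesis by (simp add: bch_def assms(2) dd_map[where g=g and m=m and m'=m' and D=D and D'=D', OF assms])
qed

lemma ehat_map:
  assumes "\<And>x y G. m (g x) (g y) G = m' x y (\<lambda>z. G (g z))" "\<And>x G. E (g x) G = E' x (\<lambda>z. G (g z))"
  shows "ehat m E \<Psi> (g a) (map g w) = ehat m' E' (\<lambda>a w. \<Psi> (g a) (map g w)) a w"
  by (cases w) (simp_all add: ehat_def assms)

lemma rot_map: "rot \<psi> (g a) (map g w) = rot (\<lambda>u a v. \<psi> (map g u) (g a) (map g v)) a w"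
  unfolding rot_def by (subst spl_map[symmetric]) simp

lemma rotE_map:
  assumes "\<And>x G. E (g x) G = E' x (\<lambda>z. G (g z))"
  shows "rotE E \<psi> (g a) (map g w) = rotE E' (\<lambda>u a v. \<psi> (map g u) (g a) (map g v)) a w"
  unfolding rotE_def by (subst spl_map[symmetric]) (simp add: dd_map[where g=g and m="\<lambda>_ _ _. 0" and m'="\<lambda>_ _ _. 0" and D=E and D'=E'] assms)

lemma SE_map:
  assumes "\<And>x G. E (g x) G = E' x (\<lambda>z. G (g z))"
  shows "SE E \<phi> (g p0) (map g p) (g q0) (map g q) = SE E' (\<lambda>w. \<phi> (map g w)) p0 p q0 q"
proof -
  have e: "S (\<lambda>w. \<phi> (map g w)) = (\<lambda>u1 a u2 v1 c v2. S \<phi> (map g u1) (g a) (map g u2) (map g v1) (g c) (map g v2))"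
    by (intro ext) (rule S_map)
  show ?thesis unfolding SE_def rot_map rotE_map[where g=g and E=E and E'=E', OF assms] e ..
qed

lemma spl_scale: "spl (\<lambda>a b. c * \<psi> a b) w = c * spl \<psi> w"
  using fs_scale[OF fs_spl, of c "\<lambda>(a,b). \<psi> a b" w] by simp

text \<open>\<open>R x z\<close> says which letters \<open>E\<close> can produce from
  \<open>x\<close>. A constant ratio of the test functions on all words that occur carries over to
  the sums; this serves to compare two taggings.\<close>

lemma SE_scale:
  assumes "\<And>x. fs (E x)" and on: "\<And>x G G'. (\<And>z. R x z \<Longrightarrow> G z = G' z) \<Longrightarrow> E x G = E x G'"
    and K: "\<And>u x z v W. q = u @ x # v \<Longrightarrow> R x z \<Longrightarrow> mset W = mset (p0 # p @ q0 # u @ z # v) \<Longrightarrow> K W = \<sigma> * K' W"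
  shows "SE E K p0 p q0 q = \<sigma> * SE E K' p0 p q0 q"
proof -
  have LD: "(\<And>u x z v. w = u @ x # v \<Longrightarrow> R x z \<Longrightarrow> F (u @ z # v) = \<sigma> * F' (u @ z # v)) \<Longrightarrow> LD E F w = \<sigma> * LD E F' w" for w F F'
  proof (induction w arbitrary: F F')
    case (Cons x w)
    have "E x (\<lambda>z. F (z # w)) = E x (\<lambda>z. \<sigma> * F' (z # w))"
      by (rule on) (use Cons.prems[of "[]"] in auto)
    moreover have "LD E (\<lambda>w. F (x # w)) w = \<sigma> * LD E (\<lambda>w. F' (x # w)) w"
      by (rule Cons.IH) (use Cons.prems[of "x # _"] in auto)
    ultimately show ?case by (simp add: fs_scale[OF assms(1)] Fst_0 distrib_left)
  qed simp
  have "SE E K p0 p q0 q = spl (\<lambda>p1 p2. spl (\<lambda>q1 q2. LD E (\<lambda>r. S K p2 p0 p1 q2 q0 r) q1) q) p"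
    by (simp add: SE_def rot_def rotE_def)
  also have "\<dots> = spl (\<lambda>p1 p2. spl (\<lambda>q1 q2. \<sigma> * LD E (\<lambda>r. S K' p2 p0 p1 q2 q0 r) q1) q) p"
  proof (intro spl_cong LD)
    fix p1 p2 q1 q2 u x z v assume w: "p = p1 @ p2" "q = q1 @ q2" "q1 = u @ x # v" "R x z"
    have "S K p2 p0 p1 q2 q0 (u @ z # v) = S (\<lambda>W. \<sigma> * K' W) p2 p0 p1 q2 q0 (u @ z # v)"
    proof (rule S_cong)
      fix W assume W: "mset W = mset p2 + {#p0#} + mset p1 + mset q2 + {#q0#} + mset (u @ z # v)"
      show "K W = \<sigma> * K' W"
        by (rule K[of u x "v @ q2" z]) (use w W in auto)
    qed
    then show "S K p2 p0 p1 q2 q0 (u @ z # v) = \<sigma> * S K' p2 p0 p1 q2 q0 (u @ z # v)"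
      by (simp add: fs_scale[OF fs_S])
  qed
  finally show ?thesis by (simp add: spl_scale SE_def rot_def rotE_def)
qed

lemma fs_SE:
  assumes "\<And>x. fs (E x)" shows "fs (\<lambda>\<phi>. SE E \<phi> p0 p q0 q)"
proof -
  interpret letter_ops "\<lambda>_ _ _. 0" E by unfold_locales (auto simp: fs_0 assms)
  show ?thesis unfolding SE_def rot_def rotE_def
    by (intro fs_splI fs_bind[OF fs_dd] fs_S)
qed

section \<open>The homotopy\<close>

text \<open>Letters with two lists of tags at once, so that both taggings are differentiated in
  parallel.\<close>

definition D3 :: "('i, 'k::field_char_0) dga \<Rightarrow> nat \<Rightarrow> nat list \<times> nat list \<times> 'i \<Rightarrow> (nat list \<times> nat list \<times> 'i \<Rightarrow> 'k) \<Rightarrow> 'k" where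
  "D3 X \<epsilon> x G = pair (dif X (snd (snd x))) (\<lambda>z. G (\<epsilon> # fst x, \<epsilon> # fst (snd x), z))"

definition tg1 :: "nat list \<times> nat list \<times> 'i \<Rightarrow> nat list \<times> 'i" where "tg1 x = (fst x, snd (snd x))"
definition tg2 :: "nat list \<times> nat list \<times> 'i \<Rightarrow> nat list \<times> 'i" where "tg2 x = (fst (snd x), snd (snd x))"

lemma tg_sel [simp]: "fst (tg1 x) = fst x" "snd (tg1 x) = snd (snd x)" "fst (tg2 x) = fst (snd x)" "snd (tg2 x) = snd (snd x)"
  by (simp_all add: tg1_def tg2_def)

lemma mset_concat_map: "mset W = mset W' \<Longrightarrow> mset (concat (map s W)) = mset (concat (map s W'))"
proof -
  have "mset (concat (map s W)) = \<Sum>\<^sub># (image_mset (\<lambda>x. mset (s x)) (mset W))" for W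
    by (induction W) simp_all
  then show "mset W = mset W' \<Longrightarrow> mset (concat (map s W)) = mset (concat (map s W'))" by simp
qed

lemma tags_tg: "tags (map tg1 W) = concat (map fst W)" "tags (map tg2 W) = concat (map (\<lambda>x. fst (snd x)) W)"
  by (simp_all add: tags_def comp_def)

text \<open>The differential inserts its tag 1 at the same place in both taggings, so by
  \<open>psgn_equi\<close> the product of the two signs is constant on all words that occur. The
  constant is evaluated by removing the tag 1 again.\<close>

lemma SE_retag:
  fixes tt uu :: "nat list \<times> nat list \<times> 'i" and t u and X Y :: "('i, 'k::field_char_0) dga"
  defines "b \<equiv> tt # t @ uu # u"
  assumes m: "\<And>x. x \<in> set b \<Longrightarrow> odd (length (fst x)) = odd (length (fst (snd x)))"
    and d: "distinct (1 # 2 # tags (map tg2 b))"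
  shows "SE (DC X 1) (\<lambda>w. lift [] [] f (oC Y 2 # w)) (tg1 tt) (map tg1 t) (tg1 uu) (map tg1 u)
    = c1 1 (2 # tags (map tg1 b)) * c1 1 (2 # tags (map tg2 b)) * (psgn (2 # tags (map tg1 b)) * psgn (2 # tags (map tg2 b)))
      * SE (DC X 1) (\<lambda>w. lift [] [] f (oC Y 2 # w)) (tg2 tt) (map tg2 t) (tg2 uu) (map tg2 u)"
    (is "?L = ?\<sigma> * ?R")
proof -
  have fsD: "fs (D3 X 1 x)" for x
    unfolding D3_def by (rule fs_map[OF fs_pair, where g="\<lambda>z. (1 # fst x, 1 # fst (snd x), z)"])
  have "?L = SE (D3 X 1) (\<lambda>w. lift [] [] f (oC Y 2 # map tg1 w)) tt t uu u"
    by (rule SE_map) (simp add: DC_def D3_def tg1_def)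
  also have "\<dots> = ?\<sigma> * SE (D3 X 1) (\<lambda>w. lift [] [] f (oC Y 2 # map tg2 w)) tt t uu u"
  proof (rule SE_scale[where R="\<lambda>x z. fst z = 1 # fst x \<and> fst (snd z) = 1 # fst (snd x)"])
    fix a x z v W assume *: "u = a @ x # v" "fst z = 1 # fst x \<and> fst (snd z) = 1 # fst (snd x)" "mset W = mset (tt # t @ uu # a @ z # v)"
    let ?pre = "tt # t @ uu # a" and ?T1 = "\<lambda>W. concat (map fst W)" and ?T2 = "\<lambda>W. concat (map (\<lambda>x. fst (snd x)) W)"
    have b: "b = ?pre @ x # v" by (simp add: b_def *)
    have "psgn ([2] @ ?T1 W) * psgn ([2] @ ?T2 W) = (psgn ([2] @ ?T1 (tt # t @ uu # a @ z # v)) * psgn ([2] @ ?T2 (tt # t @ uu # a @ z # v)) :: 'k)"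
    proof (rule psgn_equi[OF *(3)])
      fix y assume "y \<in> set W"
      then have "y \<in> set (tt # t @ uu # a @ z # v)" using *(3) by (metis set_mset_mset)
      then have "y = z \<or> y \<in> set b" by (auto simp: b)
      moreover have "x \<in> set b" by (simp add: b)
      ultimately show "odd (length (fst y)) = odd (length (fst (snd y)))" using m[of y] m[of x] *(2) by auto
    qed
    also have "\<dots> = ?\<sigma>"
    proof -
      have o: "odd (length (?T1 ?pre)) = odd (length (?T2 ?pre))"
        by (rule odd_concat) (use m b in auto)
      \<comment> \<open>Takes the tag 1 out of its position. The sign depending on that position is
        the same for both taggings by \<open>o\<close>, so it squares to 1.\<close>
      have e: "psgn (2 # U @ (1 # s) @ V) = (ksgn (odd (Suc (length U))) * c1 1 (2 # U @ s @ V) * psgn (2 # U @ s @ V) :: 'k)" for U s V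
        using psgn_swap[of "[]" "2 # U" "[1]" "s @ V", where ?'a='k] unfolding append_Cons append_Nil psgn.simps(2)[of 1 "2 # U @ s @ V"] by (simp del: psgn_append psgn.simps c1.simps c1_append add: mult.assoc)
      have 1: "psgn ([2] @ ?T1 (tt # t @ uu # a @ z # v)) = (ksgn (odd (Suc (length (?T1 ?pre)))) * c1 1 (2 # tags (map tg1 b)) * psgn (2 # tags (map tg1 b)) :: 'k)"
        using e[of "?T1 ?pre" "fst x" "?T1 v"] unfolding tags_tg b using *(2) by (simp del: psgn_append psgn.simps c1.simps c1_append)
      have 2: "psgn ([2] @ ?T2 (tt # t @ uu # a @ z # v)) = (ksgn (odd (Suc (length (?T2 ?pre)))) * c1 1 (2 # tags (map tg2 b)) * psgn (2 # tags (map tg2 b)) :: 'k)"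
        using e[of "?T2 ?pre" "fst (snd x)" "?T2 v"] unfolding tags_tg b using *(2) by (simp del: psgn_append psgn.simps c1.simps c1_append)
      have k: "ksgn (odd (Suc (length (?T1 ?pre)))) = (ksgn (odd (Suc (length (?T2 ?pre)))) :: 'k)" using o by simp
      have "(k * x1 * y1) * (k * x2 * y2) = (k * k) * (x1 * x2 * (y1 * y2) :: 'k)" for k x1 x2 y1 y2 by (simp only: ac_simps)
      then show ?thesis unfolding 1 2 k by (simp only: ksgn_simps mult_1)
    qed
    finally have s: "psgn (2 # ?T1 W) * psgn (2 # ?T2 W) = ?\<sigma>" by simp
    have "mset (?T2 W) = mset (?T2 (tt # t @ uu # a @ z # v))" by (rule mset_concat_map[OF *(3)])
    also have "\<dots> = add_mset 1 (mset (tags (map tg2 b)))"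
      unfolding tags_tg b using *(2) by simp
    finally have "mset (2 # ?T2 W) = mset (1 # 2 # tags (map tg2 b))" by simp
    then have "distinct (2 # ?T2 W)" using d mset_eq_imp_distinct_iff by blast
    then have sq: "psgn (2 # ?T2 W) * psgn (2 # ?T2 W) = (1 :: 'k)" by (rule psgn_sq)
    have l: "lift [] [] f (oC Y 2 # map tg1 W) = psgn (2 # ?T1 W) * f (one_idx Y, map (\<lambda>x. snd (snd x)) W)"
      "lift [] [] f (oC Y 2 # map tg2 W) = psgn (2 # ?T2 W) * f (one_idx Y, map (\<lambda>x. snd (snd x)) W)"
      by (simp_all add: lift_def oC_def tags_def comp_def del: psgn_append psgn.simps)
    have gen: "x1 * y = (x1 * x2) * (x2 * y)" if "x2 * x2 = 1" for x1 x2 y :: 'k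
    proof -
      have "(x1 * x2) * (x2 * y) = x1 * (x2 * x2) * y" by (simp only: ac_simps)
      then show ?thesis using that by simp
    qed
    show "lift [] [] f (oC Y 2 # map tg1 W) = ?\<sigma> * lift [] [] f (oC Y 2 # map tg2 W)"
      unfolding l s[symmetric] by (rule gen[OF sq])
  qed (rule fsD, simp add: D3_def)
  also have "SE (D3 X 1) (\<lambda>w. lift [] [] f (oC Y 2 # map tg2 w)) tt t uu u = ?R"
    by (rule SE_map[symmetric]) (simp add: DC_def D3_def tg2_def)
  finally show ?thesis .
qed

text \<open>A tagging of a word by consecutive numbers; it fixes the global sign in the definition of the homotopies.\<close>

definition ctl :: "('i, 'k::field_char_0) dga \<Rightarrow> nat \<Rightarrow> 'i list \<Rightarrow> (nat list \<times> 'i) list" where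
  "ctl X k w = map (\<lambda>(t, i). (if par X i then [] else [t], i)) (enumerate k w)"

lemma ctl_simps [simp]: "ctl X k [] = []" "ctl X k (i # w) = (if par X i then [] else [k], i) # ctl X (Suc k) w"
  by (simp_all add: ctl_def)

lemma map_snd_ctl [simp]: "map snd (ctl X k w) = w"
  by (induction w arbitrary: k) auto

lemma adm_ctl: "admL X (ctl X k w)"
  by (induction w arbitrary: k) (auto simp: adm_def)

lemma set_tags_ctl: "set (tags (ctl X k w)) \<subseteq> {k..<k + length w}"
proof (induction w arbitrary: k)
  case (Cons i w)
  have "set (tags (ctl X (Suc k) w)) \<subseteq> {k..<k + length (i # w)}" using Cons[of "Suc k"] by auto
  then show ?case by auto
qed simp

lemma distinct_tags_ctl: "distinct (tags (ctl X k w))"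
proof (induction w arbitrary: k)
  case (Cons i w)
  then show ?case using set_tags_ctl[of X "Suc k" w] by fastforce
qed simp

text \<open>The homotopy Q. The tags 3, 4, ... run through both chains, leaving 0, 1 and 2 free;
  with the prefactor \<open>psgn\<close> the value does not depend on this choice, as
  \<open>lift2_H\<close> shows.\<close>

definition HQ :: "('i, 'k::field_char_0) dga \<Rightarrow> ('j, 'k) dga \<Rightarrow> (('i \<times> 'j) \<times> ('i \<times> 'j) list \<Rightarrow> 'k) \<Rightarrow> 'i \<times> 'i list \<Rightarrow> 'j \<times> 'j list \<Rightarrow> 'k" where
  "HQ A B f x y = (let L1 = ctl A 3 (fst x # snd x); L2 = ctl B (4 + length (snd x)) (fst y # snd y)
    in psgn (tags L1 @ 2 # tags L2) * SE (DC (cB A B) 1) (\<lambda>w. lift [] [] f (oC (dga_tensor A B) 2 # w))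
      (iA B (hd L1)) (map (iA B) (tl L1)) (iB A (hd L2)) (map (iB A) (tl L2)))"

text \<open>The homotopy P: the words of the two factors are exchanged in \<open>SE\<close>, but the
  prefactor still orders the tags of the first chain before those of the second.\<close>

definition HP :: "('i, 'k::field_char_0) dga \<Rightarrow> ('j, 'k) dga \<Rightarrow> (('i \<times> 'j) \<times> ('i \<times> 'j) list \<Rightarrow> 'k) \<Rightarrow> 'i \<times> 'i list \<Rightarrow> 'j \<times> 'j list \<Rightarrow> 'k" where
  "HP A B f x y = (let L1 = ctl A 3 (fst x # snd x); L2 = ctl B (4 + length (snd x)) (fst y # snd y)
    in psgn (tags L1 @ 2 # tags L2) * SE (DC (cA A B) 1) (\<lambda>w. lift [] [] f (oC (dga_tensor A B) 2 # w))
      (iB A (hd L2)) (map (iB A) (tl L2)) (iA B (hd L1)) (map (iA B) (tl L1)))"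

definition z3 :: "(nat list \<times> 'i) list \<Rightarrow> (nat list \<times> 'i) list \<Rightarrow> (nat list \<times> nat list \<times> 'i) list" where
  "z3 L M = map (\<lambda>(x, y). (fst x, fst y, snd x)) (zip L M)"

lemma z3_Cons [simp]: "z3 (x # L) (y # M) = (fst x, fst y, snd x) # z3 L M"
  by (simp add: z3_def)

lemma map_z3:
  assumes "map snd L = map snd M" shows "map tg1 (z3 L M) = L" "map tg2 (z3 L M) = M"
proof -
  have "length L = length M" using assms by (metis length_map)
  then show "map tg1 (z3 L M) = L" "map tg2 (z3 L M) = M"
    using assms by (induction L M rule: list_induct2) (auto simp: z3_def tg1_def tg2_def prod_eq_iff)
qed

lemma adm_iAB: "gda A \<Longrightarrow> gda B \<Longrightarrow> adm A x \<Longrightarrow> adm (dga_tensor A B) (iA B x)"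
   "gda A \<Longrightarrow> gda B \<Longrightarrow> adm B y \<Longrightarrow> adm (dga_tensor A B) (iB A y)"
  by (auto simp: adm_def gda_def)

lemma SE_retag2:
  fixes X Y :: "('x, 'k::field_char_0) dga"
  assumes "map snd L = map snd L'" "map snd M = map snd M'" "admL Y (L @ M)" "admL Y (L' @ M')" "L \<noteq> []" "M \<noteq> []"
    "distinct (1 # 2 # tags (L' @ M'))"
  shows "SE (DC X 1) (\<lambda>w. lift [] [] f (oC Y 2 # w)) (hd L) (tl L) (hd M) (tl M)
    = c1 1 (2 # tags (L @ M)) * c1 1 (2 # tags (L' @ M')) * (psgn (2 # tags (L @ M)) * psgn (2 # tags (L' @ M')))
      * SE (DC X 1) (\<lambda>w. lift [] [] f (oC Y 2 # w)) (hd L') (tl L') (hd M') (tl M')"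
proof -
  have ne: "L' \<noteq> []" "M' \<noteq> []" using assms by auto
  then obtain l L1 where e1: "L = l # L1" using assms(5) by (cases L) auto
  obtain l' L1' where e2: "L' = l' # L1'" using ne by (cases L') auto
  obtain k M1 where e3: "M = k # M1" using assms(6) by (cases M) auto
  obtain k' M1' where e4: "M' = k' # M1'" using ne by (cases M') auto
  note e = e1 e2 e3 e4
  let ?LL = "z3 L1 L1'" and ?MM = "z3 M1 M1'" and ?xx = "(fst l, fst l', snd l)" and ?yy = "(fst k, fst k', snd k)"
  have g: "tg1 ?xx = l" "tg2 ?xx = l'" "tg1 ?yy = k" "tg2 ?yy = k'" using assms(1,2) by (auto simp: e tg1_def tg2_def prod_eq_iff)
  have mm: "map tg1 ?LL = L1" "map tg2 ?LL = L1'" "map tg1 ?MM = M1" "map tg2 ?MM = M1'" using assms(1,2) by (auto simp: e map_z3)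
  let ?b = "?xx # ?LL @ ?yy # ?MM"
  have b: "map tg1 ?b = L @ M" "map tg2 ?b = L' @ M'" by (simp_all only: list.map map_append g mm) (simp_all add: e)
  have "odd (length (fst x)) = odd (length (fst (snd x)))" if "x \<in> set ?b" for x
  proof -
    have "adm Y (tg1 x)" "adm Y (tg2 x)"
      using that assms(3,4) unfolding b[symmetric] set_map by blast+
    then show ?thesis by (simp add: adm_def)
  qed
  from SE_retag[where tt="?xx" and t="?LL" and uu="?yy" and u="?MM" and X=X and f=f and Y=Y, OF this, unfolded b g mm, OF _ assms(7)]
  show ?thesis by (simp only: e list.sel)
qed

context
  fixes A :: "('i, 'k::field_char_0) dga" and B :: "('j, 'k) dga"
  assumes gA: "gda A" and gB: "gda B"
begin

lemma ctl_facts: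
  assumes "L1 = ctl A 3 (i # is)" "L2 = ctl B (4 + length is) (j # js)"
  shows "distinct (1 # 2 # tags L1 @ tags L2)" "\<And>x. x \<le> 2 \<Longrightarrow> low x (tags L1 @ tags L2)" 
proof -
  have s: "set (tags L1) \<subseteq> {3..<4 + length is}" "set (tags L2) \<subseteq> {4 + length is..<5 + length is + length js}"
    using set_tags_ctl[of A 3 "i # is"] set_tags_ctl[of B "4 + length is" "j # js"] assms by (auto simp del: ctl_simps)
  have d: "distinct (tags L1)" "distinct (tags L2)" using assms distinct_tags_ctl by blast+
  have "{3..<4 + length is} \<inter> {4 + length is..<5 + length is + length js} = {}" by auto
  then have di: "set (tags L1) \<inter> set (tags L2) = {}" using s by blast
  have "set (tags L1 @ tags L2) \<subseteq> {3..}" using s by auto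
  then have g: "3 \<le> t" if "t \<in> set (tags L1 @ tags L2)" for t using that by (meson atLeast_iff subset_iff)
  have "x < t" if "x \<le> 2" "t \<in> set (tags L1 @ tags L2)" for x t using g[OF that(2)] that(1) by simp
  then show "\<And>x. x \<le> 2 \<Longrightarrow> low x (tags L1 @ tags L2)" unfolding low_def by blast
  have "1 \<notin> set (tags L1 @ tags L2)" "2 \<notin> set (tags L1 @ tags L2)" using g[of 1] g[of 2] by linarith+
  then show "distinct (1 # 2 # tags L1 @ tags L2)" using di d by (simp only: distinct.simps distinct_append list.set set_append) simp
qed

text \<open>Frees the homotopies from their special tagging. The factor \<open>c1 1\<close> is the
  sign of inserting the tag of the differential; it matters because after an application of
  \<open>b\<close> the words contain the smaller tag 0.\<close>

lemma lift2_H: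
  assumes L: "admL A (p0 # p)" "admL B (q0 # q)"
  shows "c1 1 (tags (p0 # p) @ 2 # tags (q0 # q)) * lift2 (HQ A B f) (p0 # p) (q0 # q)
     = SE (DC (cB A B) 1) (\<lambda>w. lift [] [] f (oC (dga_tensor A B) 2 # w)) (iA B p0) (map (iA B) p) (iB A q0) (map (iB A) q)"
   "c1 1 (tags (p0 # p) @ 2 # tags (q0 # q)) * lift2 (HP A B f) (p0 # p) (q0 # q)
     = SE (DC (cA A B) 1) (\<lambda>w. lift [] [] f (oC (dga_tensor A B) 2 # w)) (iB A q0) (map (iB A) q) (iA B p0) (map (iA B) p)"
proof -
  let ?C = "dga_tensor A B"
  define L M L' M' where "L = p0 # p" and "M = q0 # q" and L': "L' = ctl A 3 (snd p0 # map snd p)"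
    and M': "M' = ctl B (4 + length (map snd p)) (snd q0 # map snd q)"
  note del = psgn_append psgn.simps c1.simps c1_append ctl_simps
  have tg: "tags (map (iA B) X) = tags X" "tags (map (iB A) Y) = tags Y" for X Y by (simp_all add: tags_def comp_def)
  note f = ctl_facts[OF L' M']
  have d: "distinct (1 # 2 # tags L' @ tags M')" "distinct (1 # 2 # tags M' @ tags L')" using f(1) by auto
  have lo: "c1 1 (2 # tags L' @ tags M') = (1 :: 'k)" "c1 1 (2 # tags M' @ tags L') = (1 :: 'k)"
    using f(2)[of 1] unfolding low_def by (auto intro!: c1_less simp del: del)
  have adm: "admL A L" "admL B M" "admL A L'" "admL B M'" using L adm_ctl by (auto simp: L_def M_def L' M' simp del: ctl_simps)
  have sn: "map snd L = map snd L'" "map snd M = map snd M'" by (simp_all add: L_def M_def L' M' del: ctl_simps)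
  have ne: "L \<noteq> []" "M \<noteq> []" "L' \<noteq> []" "M' \<noteq> []" by (simp_all add: L_def M_def L' M')
  have o: "odd (length (tags L)) = odd (length (tags L'))" "odd (length (tags M)) = odd (length (tags M'))"
    using odd_tags[OF adm(1)] odd_tags[OF adm(3)] odd_tags[OF adm(2)] odd_tags[OF adm(4)] sn by simp_all
  have s1: "psgn (2 # tags X @ tags Y) = (ksgn (odd (length (tags X))) * psgn (tags X @ 2 # tags Y) :: 'k)" for X :: "(nat list \<times> 'i) list" and Y :: "(nat list \<times> 'j) list"
    using psgn_swap[of "[]" "[2]" "tags X" "tags Y", where ?'a='k] by (simp del: del)
  have s2: "psgn (2 # tags Y @ tags X) = (ksgn (odd (length (tags X)) \<and> odd (length (tags Y))) * ksgn (odd (length (tags X))) * psgn (tags X @ 2 # tags Y) :: 'k)" for X :: "(nat list \<times> 'i) list" and Y :: "(nat list \<times> 'j) list"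
    using psgn_swap[of "[2]" "tags Y" "tags X" "[]", where ?'a='k] s1[of X Y] by (simp add: conj_commute mult.assoc del: del)
  have c1c: "c1 1 (2 # tags L @ tags M) = (c1 1 (tags L @ 2 # tags M) :: 'k)" "c1 1 (2 # tags M @ tags L) = (c1 1 (tags L @ 2 # tags M) :: 'k)"
    by (rule c1_mset, simp add: ac_simps)+
  have kk: "(k * x) * (k * y) = x * (y :: 'k)" if "k * k = 1" for k x y :: 'k
  proof -
    have "(k * x) * (k * y) = (k * k) * (x * y)" by (simp only: ac_simps)
    then show ?thesis using that by simp
  qed
  have p1: "psgn (2 # tags L @ tags M) * psgn (2 # tags L' @ tags M') = (psgn (tags L @ 2 # tags M) * psgn (tags L' @ 2 # tags M') :: 'k)"
    unfolding s1 o by (rule kk) simp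
  have p2: "psgn (2 # tags M @ tags L) * psgn (2 # tags M' @ tags L') = (psgn (tags L @ 2 # tags M) * psgn (tags L' @ 2 # tags M') :: 'k)"
    unfolding s2 o by (rule kk) (simp add: ksgn_def)
  have h: "hd (map g X) = g (hd X)" "tl (map g X) = map g (tl X)" if "X \<noteq> []" for g :: "'a \<Rightarrow> 'b" and X
    using that by (simp_all add: hd_map map_tl)
  have c: "chn (map snd L) = (snd p0, map snd p)" "chn (map snd M) = (snd q0, map snd q)" by (simp_all add: L_def M_def)
  have sA: "map snd (map (iA B) L) = map snd (map (iA B) L')" "map snd (map (iB A) M) = map snd (map (iB A) M')"
    using arg_cong[OF sn(1), of "map (\<lambda>i. (i, one_idx B))"] arg_cong[OF sn(2), of "map (\<lambda>i. (one_idx A, i))"] by (simp_all add: comp_def)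
  have aA: "admL ?C (map (iA B) X)" if "admL A X" for X using that adm_iAB(1)[OF gA gB] by auto
  have aB: "admL ?C (map (iB A) X)" if "admL B X" for X using that adm_iAB(2)[OF gA gB] by auto
  have a: "admL ?C (map (iA B) L @ map (iB A) M)" "admL ?C (map (iA B) L' @ map (iB A) M')"
     "admL ?C (map (iB A) M @ map (iA B) L)" "admL ?C (map (iB A) M' @ map (iA B) L')"
    using aA[OF adm(1)] aA[OF adm(3)] aB[OF adm(2)] aB[OF adm(4)] unfolding set_append ball_Un by blast+
  have e1: "SE (DC (cB A B) 1) (\<lambda>w. lift [] [] f (oC ?C 2 # w)) (hd (map (iA B) L)) (tl (map (iA B) L)) (hd (map (iB A) M)) (tl (map (iB A) M))
     = c1 1 (2 # tags (map (iA B) L @ map (iB A) M)) * c1 1 (2 # tags (map (iA B) L' @ map (iB A) M'))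
       * (psgn (2 # tags (map (iA B) L @ map (iB A) M)) * psgn (2 # tags (map (iA B) L' @ map (iB A) M')))
      * SE (DC (cB A B) 1) (\<lambda>w. lift [] [] f (oC ?C 2 # w)) (hd (map (iA B) L')) (tl (map (iA B) L')) (hd (map (iB A) M')) (tl (map (iB A) M'))"
    by (rule SE_retag2[OF sA a(1,2)]) (use ne d in \<open>simp_all only: tags_simps tg map_is_Nil_conv not_False_eq_True\<close>)
  have e2: "SE (DC (cA A B) 1) (\<lambda>w. lift [] [] f (oC ?C 2 # w)) (hd (map (iB A) M)) (tl (map (iB A) M)) (hd (map (iA B) L)) (tl (map (iA B) L))
     = c1 1 (2 # tags (map (iB A) M @ map (iA B) L)) * c1 1 (2 # tags (map (iB A) M' @ map (iA B) L'))
       * (psgn (2 # tags (map (iB A) M @ map (iA B) L)) * psgn (2 # tags (map (iB A) M' @ map (iA B) L')))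
      * SE (DC (cA A B) 1) (\<lambda>w. lift [] [] f (oC ?C 2 # w)) (hd (map (iB A) M')) (tl (map (iB A) M')) (hd (map (iA B) L')) (tl (map (iA B) L'))"
    by (rule SE_retag2[OF sA(2,1) a(3,4)]) (use ne d in \<open>simp_all only: tags_simps tg map_is_Nil_conv not_False_eq_True\<close>)
  have HL: "hd L = p0" "tl L = p" "hd M = q0" "tl M = q" by (simp_all add: L_def M_def)
  show "c1 1 (tags (p0 # p) @ 2 # tags (q0 # q)) * lift2 (HQ A B f) (p0 # p) (q0 # q)
     = SE (DC (cB A B) 1) (\<lambda>w. lift [] [] f (oC (dga_tensor A B) 2 # w)) (iA B p0) (map (iA B) p) (iB A q0) (map (iB A) q)"
    using e1[unfolded tags_simps(3) tg lo c1c p1 h[OF ne(1)] h[OF ne(2)] h[OF ne(3)] h[OF ne(4)] HL]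
    unfolding L_def[symmetric] M_def[symmetric] lift2_def c HQ_def fst_conv snd_conv Let_def L'[symmetric] M'[symmetric]
    by (simp only: ac_simps mult_1_right mult_1_left)
  show "c1 1 (tags (p0 # p) @ 2 # tags (q0 # q)) * lift2 (HP A B f) (p0 # p) (q0 # q)
     = SE (DC (cA A B) 1) (\<lambda>w. lift [] [] f (oC (dga_tensor A B) 2 # w)) (iB A q0) (map (iB A) q) (iA B p0) (map (iA B) p)"
    using e2[unfolded tags_simps(3) tg lo c1c p2 h[OF ne(1)] h[OF ne(2)] h[OF ne(3)] h[OF ne(4)] HL]
    unfolding L_def[symmetric] M_def[symmetric] lift2_def c HP_def fst_conv snd_conv Let_def L'[symmetric] M'[symmetric]
    by (simp only: ac_simps mult_1_right mult_1_left)
qed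

end

section \<open>Operators on pairs of chains\<close>

lemma sq_cancel: "p * p = 1 \<Longrightarrow> p * a = p * b \<Longrightarrow> a = (b :: 'k::comm_ring_1)"
  by (metis mult.assoc mult_1)

text \<open>Evaluation on basis vectors recovers a matrix from a finite functional; this turns the
  homotopies, which are defined on test functions, back into operators.\<close>

lemma fs_matrix:
  assumes "fs X" shows "finite (vsupp (\<lambda>d. X (bv d)))" "pair (\<lambda>d. X (bv d)) f = X f"
proof -
  obtain Z c where Z: "finite Z" "\<And>G. X G = (\<Sum>z\<in>Z. c z * G z)" by (rule fsE[OF assms]) blast
  have e: "X (bv d) = (if d \<in> Z then c d else 0)" for d
    by (simp add: Z bv_def if_distrib[of "\<lambda>x. _ * x"] sum.delta[OF Z(1)] cong: if_cong)
  show "finite (vsupp (\<lambda>d. X (bv d)))"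
    by (rule finite_subset[OF _ Z(1)]) (auto simp: vsupp_def e)
  have "pair (\<lambda>d. X (bv d)) f = (\<Sum>z\<in>Z. X (bv z) * f z)"
    by (rule pair_superset[OF Z(1)]) (auto simp: vsupp_def e)
  also have "\<dots> = X f" unfolding Z(2)[of f] by (rule sum.cong) (auto simp: e)
  finally show "pair (\<lambda>d. X (bv d)) f = X f" .
qed

lemma pair_snd_restrict:
  fixes v :: "'b \<Rightarrow> 'k::comm_ring_1" and r :: 'c
  assumes "finite (vsupp v)"
  shows "finite (vsupp (\<lambda>d. if fst d = r then v (snd d) else 0))"
    "pair (\<lambda>d. if fst d = r then v (snd d) else 0) f = pair v (\<lambda>z. f (r, z))"
proof -
  have f: "finite (Pair r ` vsupp v)" using assms by simp
  have s: "vsupp (\<lambda>d. if fst d = r then v (snd d) else 0) \<subseteq> Pair r ` vsupp v"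
    by (auto simp: vsupp_def image_iff split: if_splits)
  show "finite (vsupp (\<lambda>d. if fst d = r then v (snd d) else 0))" using s f by (rule finite_subset)
  show "pair (\<lambda>d. if fst d = r then v (snd d) else 0) f = pair v (\<lambda>z. f (r, z))"
    by (subst pair_superset[OF f s], subst sum.reindex) (auto simp: inj_on_def pair_def)
qed

definition act1 :: "('a \<Rightarrow> 'a \<Rightarrow> 'k::comm_ring_1) \<Rightarrow> ('a \<Rightarrow> 'b \<Rightarrow> 'k) \<Rightarrow> 'a \<Rightarrow> 'b \<Rightarrow> 'k" where
  "act1 T g x y = pr T (\<lambda>x'. g x' y) x"

definition act2 :: "('i, 'k::field_char_0) dga \<Rightarrow> bool \<Rightarrow> ('b \<Rightarrow> 'b \<Rightarrow> 'k) \<Rightarrow> ('i \<times> 'i list \<Rightarrow> 'b \<Rightarrow> 'k) \<Rightarrow> 'i \<times> 'i list \<Rightarrow> 'b \<Rightarrow> 'k" where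
  "act2 A s T g x y = ksgn (s \<and> cpar A x) * pr T (g x) y"

lemma ten1_eq: "ten1 T (x, y) = (\<lambda>d. if snd d = y then T x (fst d) else 0)"
  by (auto simp: ten1_def)

lemma ten2_eq: "ten2 A s T (x, y) = (\<lambda>d. if fst d = x then ksgn (s \<and> cpar A x) * T y (snd d) else 0)"
  by (auto simp: ten2_def)

lemma fin_pairI: "(\<And>x y. finite (vsupp (T (x, y)))) \<Longrightarrow> fin T"
  by (auto simp: fin_def)

lemma fin_ten1: "fin T \<Longrightarrow> fin (ten1 T)"
  by (rule fin_pairI, unfold ten1_eq, rule pair_fst_restrict, rule finD)

lemma fin_ten2: "fin T \<Longrightarrow> fin (ten2 A s T)"
proof (rule fin_pairI)
  fix x y assume "fin T"
  then show "finite (vsupp (ten2 A s T (x, y)))" unfolding ten2_eq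
    by (intro pair_snd_restrict[where v="\<lambda>d. ksgn (s \<and> cpar A x) * T y d"] finite_vsupp_scale finD)
qed

lemma pr_ten1: "fin T \<Longrightarrow> pr (ten1 T) (case_prod g) (x, y) = act1 T g x y"
  unfolding pr_def[of "ten1 T"] ten1_eq act1_def by (subst pair_fst_restrict[OF finD]) (simp_all add: pr_def)

lemma pr_ten2: "fin T \<Longrightarrow> pr (ten2 A s T) (case_prod g) (x, y) = act2 A s T g x y"
  unfolding pr_def[of "ten2 A s T"] ten2_eq act2_def
  by (subst pair_snd_restrict(2)[where v="\<lambda>d. ksgn (s \<and> cpar A x) * T y d"]) (simp_all add: pr_def finite_vsupp_scale finD pair_scale)

text \<open>The zeroth letter counts unshifted in \<open>cpar\<close> but shifted in the tags, hence
  \<open>even\<close> instead of \<open>odd\<close>.\<close>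

lemma cpar_tags: "admL A L \<Longrightarrow> L \<noteq> [] \<Longrightarrow> cpar A (chn (map snd L)) = even (length (tags L))"
  using odd_tags[of L A] by (cases L) (auto simp: cpar_def pisum_def)

lemma lift2_act1: "lift2 (act1 T g) L M = lift [] (2 # tags M) (pr T (\<lambda>x. g x (chn (map snd M)))) L"
  by (simp add: lift2_def lift_def act1_def del: psgn_append psgn.simps)

lemma lift2_act2:
  "admL A L \<Longrightarrow> L \<noteq> [] \<Longrightarrow> lift2 (act2 A s T g) L M = ksgn (s \<and> even (length (tags L))) * lift (tags L @ [2]) [] (pr T (g (chn (map snd L)))) M"
  by (simp add: lift2_def lift_def act2_def cpar_tags ac_simps del: psgn_append psgn.simps)

lemma lift_lift2:
  "lift [] (2 # tags M) (\<lambda>x. g x (chn (map snd M))) L = lift2 g L M"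
  "lift (tags L @ [2]) [] (g (chn (map snd L))) M = lift2 g L M"
  by (simp_all add: lift2_def lift_def del: psgn_append psgn.simps)

definition nrm2 :: "('i, 'k::field_char_0) dga \<Rightarrow> ('j, 'k) dga \<Rightarrow> ('i \<times> 'i list \<Rightarrow> 'j \<times> 'j list \<Rightarrow> 'k) \<Rightarrow> bool" where
  "nrm2 A B g \<longleftrightarrow> (\<forall>y. nrm A (\<lambda>x. g x y)) \<and> (\<forall>x. nrm B (g x))"

lemma kap1: "kap [] (2 # tags M) \<epsilon> L = c1 \<epsilon> (tags L @ 2 # tags M)"
  by (simp add: kap_def)

text \<open>The prefix consists of the tags of \<open>L\<close> and the separator, and its parity is
  that of the chain \<open>L\<close>. So the sign of \<open>1 \<otimes> Y\<close> for odd
  \<open>Y\<close> is the sign of passing the prefix.\<close>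

lemma kap2: "admL A L \<Longrightarrow> ksgn (even (length (tags L))) * (c1 \<epsilon> (tags L @ 2 # tags M)) = kap (tags L @ [2]) [] \<epsilon> M"
  by (simp add: kap_def)

context
  fixes A :: "('i, 'k::field_char_0) dga" and B :: "('j, 'k) dga"
  assumes gA: "gda A" and gB: "gda B"
begin

lemma lift2_b:
  assumes "admL A (a # w)" "admL B (c # v)"
  shows "c1 \<epsilon> (tags (a # w) @ 2 # tags (c # v)) * lift2 (\<lambda>x y. act1 (hoch_b A) g x y + act2 A True (hoch_b B) g x y) (a # w) (c # v)
    = bch (mC A \<epsilon>) (DC A \<epsilon>) (\<lambda>a w. lift2 g (a # w) (c # v)) a w + bch (mC B \<epsilon>) (DC B \<epsilon>) (\<lambda>c v. lift2 g (a # w) (c # v)) c v"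
proof -
  note del = psgn_append psgn.simps c1.simps c1_append tags_simps
  let ?L = "a # w" and ?M = "c # v"
  have s: "lift2 (\<lambda>x y. act1 (hoch_b A) g x y + act2 A True (hoch_b B) g x y) ?L ?M = lift2 (act1 (hoch_b A) g) ?L ?M + lift2 (act2 A True (hoch_b B) g) ?L ?M"
    by (simp add: lift2_def algebra_simps del: del)
  have 1: "c1 \<epsilon> (tags ?L @ 2 # tags ?M) * lift2 (act1 (hoch_b A) g) ?L ?M = bch (mC A \<epsilon>) (DC A \<epsilon>) (\<lambda>a w. lift2 g (a # w) ?M) a w"
    unfolding lift2_act1 kap1[symmetric] lift_hoch_b[OF gA assms(1)] lift_lift2 ..
  have 2: "c1 \<epsilon> (tags ?L @ 2 # tags ?M) * lift2 (act2 A True (hoch_b B) g) ?L ?M = bch (mC B \<epsilon>) (DC B \<epsilon>) (\<lambda>c v. lift2 g ?L (c # v)) c v"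
    unfolding lift2_act2[OF assms(1) list.simps(3)]
    using lift_hoch_b[OF gB assms(2), of "tags ?L @ [2]" "[]" \<epsilon> "g (chn (map snd ?L))"] unfolding lift_lift2 kap2[OF assms(1), symmetric]
    by (simp add: ac_simps del: del)
  show ?thesis unfolding s distrib_left 1 2 ..
qed

lemma lift2_B1:
  assumes "admL A (a # w)" "nrm2 A B g"
  shows "c1 \<epsilon> (tags (a # w) @ 2 # tags M) * lift2 (act1 (Bop A) g) (a # w) M = rot (\<lambda>u a v. lift2 g (oC A \<epsilon> # u @ a # v) M) a w"
proof -
  have "nrm A (\<lambda>x. g x (chn (map snd M)))" using assms(2) unfolding nrm2_def by blast
  from lift_Bop[OF gA assms(1) this] show ?thesis unfolding lift2_act1 kap1[symmetric] by (simp only: lift_lift2)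
qed

lemma lift2_B2:
  assumes "admL A L" "L \<noteq> []" "admL B (c # v)" "nrm2 A B g"
  shows "c1 \<epsilon> (tags L @ 2 # tags (c # v)) * lift2 (act2 A True (Bop B) g) L (c # v) = rot (\<lambda>u c v. lift2 g L (oC B \<epsilon> # u @ c # v)) c v"
proof -
  note del = psgn_append psgn.simps c1.simps c1_append tags_simps
  have "nrm B (g (chn (map snd L)))" using assms(4) unfolding nrm2_def by blast
  from lift_Bop[OF gB assms(3) this, of "tags L @ [2]" "[]" \<epsilon>] show ?thesis
    unfolding lift2_act2[OF assms(1,2)] lift_lift2 kap2[OF assms(1), symmetric] by (simp add: ac_simps del: del)
qed

lemma lift2_e1:
  assumes "admL A (a # w)" "low 1 (tags (a # w) @ 2 # tags M)"
  shows "lift2 (act1 (edel A) g) (a # w) M = - ehat (mC A 0) (DC A 1) (\<lambda>a w. lift2 g (a # w) M) a w"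
  unfolding lift2_act1 by (subst lift_edel[OF gA assms(1)]) (use assms(2) in \<open>simp_all add: lift_lift2\<close>)

lemma lift2_e2:
  assumes "admL A L" "L \<noteq> []" "admL B (c # v)" "low 1 (tags L @ 2 # tags (c # v))"
  shows "lift2 (act2 A False (edel B) g) L (c # v) = - ehat (mC B 0) (DC B 1) (\<lambda>c v. lift2 g L (c # v)) c v"
  unfolding lift2_act2[OF assms(1,2)] by (subst lift_edel[OF gB assms(3)]) (use assms(4) in \<open>simp_all add: lift_lift2\<close>)

lemma lift2_E1:
  assumes "admL A (a # w)" "low 1 (tags (a # w) @ 2 # tags M)"
  shows "lift2 (act1 (Ebig A) g) (a # w) M = - rotE (DC A 1) (\<lambda>u a v. lift2 g (oC A 0 # u @ a # v) M) a w"
  unfolding lift2_act1 by (subst lift_Ebig[OF gA assms(1)]) (use assms(2) in \<open>simp_all add: lift_lift2\<close>)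

lemma lift2_E2:
  assumes "admL A L" "L \<noteq> []" "admL B (c # v)" "low 1 (tags L @ 2 # tags (c # v))"
  shows "lift2 (act2 A False (Ebig B) g) L (c # v) = - rotE (DC B 1) (\<lambda>u c v. lift2 g L (oC B 0 # u @ c # v)) c v"
  unfolding lift2_act2[OF assms(1,2)] by (subst lift_Ebig[OF gB assms(3)]) (use assms(4) in \<open>simp_all add: lift_lift2\<close>)

text \<open>The tags of the chosen words are distinct, so their sign squares to 1 and can be
  cancelled. They are also at least 3, which provides the condition \<open>low 1\<close>. All
  identities between operators are checked on tagged words through this rule.\<close>

lemma lift2_at:
  fixes F G :: "'i \<times> 'i list \<Rightarrow> 'j \<times> 'j list \<Rightarrow> 'k"
  assumes "\<And>p0 p q0 q. admL A (p0 # p) \<Longrightarrow> admL B (q0 # q) \<Longrightarrow> low 1 (tags (p0 # p) @ 2 # tags (q0 # q))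
    \<Longrightarrow> chn (map snd (p0 # p)) = x \<Longrightarrow> chn (map snd (q0 # q)) = y \<Longrightarrow> lift2 F (p0 # p) (q0 # q) = lift2 G (p0 # p) (q0 # q)"
  shows "F x y = G x y"
proof -
  obtain i "is" j js where xy: "x = (i, is)" "y = (j, js)" by (cases x, cases y)
  define L M where L: "L = ctl A 3 (i # is)" and M: "M = ctl B (4 + length is) (j # js)"
  note f = ctl_facts[OF gA gB L M]
  have a: "admL A L" "admL B M" unfolding L M by (rule adm_ctl)+
  obtain p0 p q0 q where e: "L = p0 # p" "M = q0 # q" by (simp add: L M)
  have lo: "low 1 (tags L @ 2 # tags M)" using f(2)[of 1] by (auto simp: low_def)
  have c: "chn (map snd L) = x" "chn (map snd M) = y" by (simp_all add: L M xy)
  have "lift2 F L M = lift2 G L M" unfolding e by (rule assms[OF a(1)[unfolded e] a(2)[unfolded e] lo[unfolded e] c(1)[unfolded e] c(2)[unfolded e]])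
  then have E: "psgn (tags L @ 2 # tags M) * F x y = psgn (tags L @ 2 # tags M) * G x y" using c by (simp add: lift2_def del: psgn_append psgn.simps)
  have "distinct (tags L @ 2 # tags M)" using f(1) by auto
  then have "psgn (tags L @ 2 # tags M) * psgn (tags L @ 2 # tags M) = (1 :: 'k)" by (rule psgn_sq)
  then show "F x y = G x y" using E by (rule sq_cancel)
qed

lemma lift2_eqI:
  fixes F G :: "'i \<times> 'i list \<Rightarrow> 'j \<times> 'j list \<Rightarrow> 'k"
  assumes "\<And>p0 p q0 q. admL A (p0 # p) \<Longrightarrow> admL B (q0 # q) \<Longrightarrow> low 1 (tags (p0 # p) @ 2 # tags (q0 # q))
    \<Longrightarrow> lift2 F (p0 # p) (q0 # q) = lift2 G (p0 # p) (q0 # q)"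
  shows "F = G"
  by (rule ext, rule ext, rule lift2_at, rule assms)

end

section \<open>Parity and normalization of the operators\<close>

text \<open>\<open>T\<close> has parity \<open>s\<close> on normalized chains, in dual form: the
  value at \<open>c\<close> depends only on the values of a normalized function at chains of parity
  \<open>s + |c|\<close>.\<close>

definition ndeg :: "('i, 'k::field_char_0) dga \<Rightarrow> bool \<Rightarrow> ('i \<times> 'i list \<Rightarrow> 'i \<times> 'i list \<Rightarrow> 'k) \<Rightarrow> bool" where
  "ndeg A s T \<longleftrightarrow> (\<forall>f c. nrm A f \<longrightarrow> (\<forall>d. cpar A d = (s \<noteq> cpar A c) \<longrightarrow> f d = 0) \<longrightarrow> pr T f c = 0)"

lemma fs_pr: "fs (\<lambda>f. pr T f c)"
  unfolding pr_def by (rule fs_pair)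

lemma ndeg_ksgn:
  assumes "ndeg A s T" "nrm A f"
  shows "pr T (\<lambda>x'. ksgn (t \<and> cpar A x') * f x') x = ksgn (t \<and> (s \<noteq> cpar A x)) * pr T f x"
proof -
  let ?d = "\<lambda>x'. ksgn (t \<and> cpar A x') * f x' - ksgn (t \<and> (s \<noteq> cpar A x)) * f x'"
  have "nrm A ?d" using assms(2) by (auto simp: nrm_def)
  moreover have "\<forall>d. cpar A d = (s \<noteq> cpar A x) \<longrightarrow> ?d d = 0" by auto
  ultimately have "pr T ?d x = 0" using assms(1) unfolding ndeg_def by blast
  then show ?thesis unfolding fs_diff[OF fs_pr] fs_scale[OF fs_pr] by simp
qed

text \<open>The sign inside \<open>act2\<close> is evaluated at the chain produced by
  \<open>T\<close>, whose parity is shifted by \<open>s\<close>; the difference is the Koszul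
  sign.\<close>

lemma act_commute:
  assumes "ndeg A s T" "nrm2 A B g"
  shows "act1 T (act2 A t S' g) x y = ksgn (t \<and> s) * act2 A t S' (act1 T g) x y"
proof -
  have n: "nrm A (\<lambda>x'. pr S' (g x') y)"
    unfolding nrm_def
  proof (intro allI impI)
    fix c assume "\<not> normal A c"
    then have "g c y' = 0" for y' using assms(2) unfolding nrm2_def nrm_def by blast
    then show "pr S' (g c) y = 0" by (simp add: pr_def pair_def)
  qed
  show ?thesis unfolding act1_def act2_def ndeg_ksgn[OF assms(1) n] fs_commute[OF fs_pr fs_pr, of T]
    by (cases t; cases s; cases "cpar A x") simp_all
qed


lemma (in letter_ops) bch_0: "bch m D (\<lambda>_ _. 0) a w = 0"
  by (simp add: bch_def fs_zero[OF fs_D] fs_zero[OF fs_m] dd_0 Fst_0 Lst_0)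

lemma rot_0: "rot (\<lambda>_ _ _. 0) a w = 0"
  by (simp add: rot_def spl_0)

lemma lift_par:
  assumes "admL A W" "W \<noteq> []" "\<forall>d. cpar A d = t \<longrightarrow> f d = 0" "t = even (length (tags W))"
  shows "lift U V f W = 0"
proof -
  have "f (chn (map snd W)) = 0" using cpar_tags[OF assms(1,2)] assms(3,4) by blast
  then show ?thesis by (simp add: lift_def)
qed

lemma lift_eq0I:
  fixes A :: "('i, 'k::field_char_0) dga"
  assumes "\<And>a w. admL A (a # w) \<Longrightarrow> chn (map snd (a # w)) = c \<Longrightarrow> low 2 (tags (a # w)) \<Longrightarrow> lift [] [] F (a # w) = 0"
  shows "F c = (0 :: 'k)"
proof -
  obtain i "is" where c: "c = (i, is)" by (cases c)
  define L where L: "L = ctl A 3 (i # is)"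
  then obtain a w where aw: "L = a # w" by simp
  have ch: "chn (map snd L) = c" by (simp add: L c)
  have lo: "low 2 (tags L)" using set_tags_ctl[of A 3 "i # is"] unfolding low_def L by (auto simp del: ctl_simps)
  have "lift [] [] F L = 0" using assms[of a w] ch lo adm_ctl[of A 3 "i # is"] unfolding aw[symmetric] L by blast
  then have "psgn (tags L) * F c = 0" using ch by (simp add: lift_def)
  moreover have "psgn (tags L) * psgn (tags L) = (1 :: 'k)" unfolding L by (rule psgn_sq[OF distinct_tags_ctl])
  ultimately show ?thesis using sq_cancel[of "psgn (tags L)" "F c" 0] by simp
qed

lemma nrmI_lift:
  fixes A :: "('i, 'k::field_char_0) dga"
  assumes "\<And>a w. admL A (a # w) \<Longrightarrow> low 2 (tags (a # w)) \<Longrightarrow> one_idx A \<in> snd ` set w \<Longrightarrow> lift [] [] F (a # w) = 0"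
  shows "nrm A F"
  unfolding nrm_def
proof (intro allI impI)
  fix c assume n: "\<not> normal A c"
  show "F c = 0"
  proof (rule lift_eq0I)
    fix a w assume *: "admL A (a # w)" "chn (map snd (a # w)) = c" "low 2 (tags (a # w))"
    then have "one_idx A \<in> snd ` set w" using n by (auto simp: normal_def)
    then show "lift [] [] F (a # w) = 0" using assms * by blast
  qed
qed

lemma lift_unit: "nrm A f \<Longrightarrow> one_idx A \<in> snd ` set (tl L) \<Longrightarrow> lift U V f L = 0"
  using nrm_lift by fastforce

lemma lowD: "low 2 s \<Longrightarrow> low 1 s" "low 2 s \<Longrightarrow> c1 0 s = 1" "low 2 s \<Longrightarrow> c1 1 s = 1"
  by (force simp: low_def intro: c1_less)+

context
  fixes A :: "('i, 'k::field_char_0) dga"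
  assumes gA: "gda A"
begin

lemma ndeg_b: "ndeg A True (hoch_b A)"
  unfolding ndeg_def
proof (intro allI impI)
  fix f :: "'i \<times> 'i list \<Rightarrow> 'k" and c assume f: "\<forall>d. cpar A d = (True \<noteq> cpar A c) \<longrightarrow> f d = 0"
  show "pr (hoch_b A) f c = 0"
  proof (rule lift_eq0I)
    fix a w assume *: "admL A (a # w)" "chn (map snd (a # w)) = c" "low 2 (tags (a # w))"
    have c: "cpar A c = even (length (tags (a # w)))" using cpar_tags[OF *(1)] *(2) by simp
    have "kap [] [] 0 (a # w) * lift [] [] (pr (hoch_b A) f) (a # w) = bch (mC A 0) (DC A 0) (\<lambda>a w. (\<lambda>_. 0) (a # w)) a w"
      unfolding lift_hoch_b[OF gA *(1)]
    proof (rule bch_cong[OF gA *(1)])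
      fix W assume W: "admL A W" "W \<noteq> []" "mset (tags W) = add_mset 0 (mset (tags (a # w)))"
      have "length (tags W) = Suc (length (tags (a # w)))" using arg_cong[OF W(3), of size] by simp
      then show "lift [] [] f W = 0" by (intro lift_par[OF W(1,2) f]) (simp add: c del: tags_simps)
    qed
    then show "lift [] [] (pr (hoch_b A) f) (a # w) = 0"
      by (simp add: kap_def lowD[OF *(3)] letter_ops.bch_0[OF letter_ops_C] del: tags_simps)
  qed
qed

lemma ndeg_B: "ndeg A True (Bop A)"
  unfolding ndeg_def
proof (intro allI impI)
  fix f :: "'i \<times> 'i list \<Rightarrow> 'k" and c assume n: "nrm A f" and f: "\<forall>d. cpar A d = (True \<noteq> cpar A c) \<longrightarrow> f d = 0"
  show "pr (Bop A) f c = 0"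
  proof (rule lift_eq0I)
    fix a w assume *: "admL A (a # w)" "chn (map snd (a # w)) = c" "low 2 (tags (a # w))"
    have c: "cpar A c = even (length (tags (a # w)))" using cpar_tags[OF *(1)] *(2) by simp
    have "kap [] [] 0 (a # w) * lift [] [] (pr (Bop A) f) (a # w) = rot (\<lambda>_ _ _. 0) a w"
      unfolding lift_Bop[OF gA *(1) n]
    proof (rule rot_cong)
      fix u v assume w: "w = v @ u"
      have "admL A (oC A 0 # u @ a # v)" using *(1) gdaD(1)[OF gA] by (auto simp: w adm_def oC_def)
      then show "lift [] [] f (oC A 0 # u @ a # v) = 0" by (rule lift_par[OF _ _ f]) (auto simp: c w oC_def)
    qed
    then show "lift [] [] (pr (Bop A) f) (a # w) = 0"
      by (simp add: kap_def lowD[OF *(3)] rot_0 del: tags_simps)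
  qed
qed

lemma ehat_cong:
  assumes "admL A (a # w)" "\<And>W. admL A W \<Longrightarrow> W \<noteq> [] \<Longrightarrow> mset (tags W) = add_mset \<epsilon> (add_mset \<epsilon>' (mset (tags (a # w)))) \<Longrightarrow> F W = G W"
  shows "ehat (mC A \<epsilon>) (DC A \<epsilon>') (\<lambda>a w. F (a # w)) a w = ehat (mC A \<epsilon>) (DC A \<epsilon>') (\<lambda>a w. G (a # w)) a w"
proof (cases w)
  case (Cons x v)
  show ?thesis unfolding ehat_def Cons Fst_simps
  proof (rule DC_adm[OF gA])
    show "adm A x" using assms(1) Cons by simp
    fix y assume y: "adm A y" "fst y = \<epsilon>' # fst x"
    show "mC A \<epsilon> a y (\<lambda>z. F (z # v)) = mC A \<epsilon> a y (\<lambda>z. G (z # v))"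
    proof (rule mC_adm[OF gA _ y(1)])
      show "adm A a" using assms(1) by simp
      fix z assume z: "adm A z" "fst z = fst a @ \<epsilon> # fst y"
      show "F (z # v) = G (z # v)" by (rule assms(2)) (use assms(1) Cons y z in auto)
    qed
  qed
qed (simp add: ehat_def)

lemma ehat_0: "ehat (mC A \<epsilon>) (DC A \<epsilon>') (\<lambda>_ _. 0) a w = 0"
  by (simp add: ehat_def fs_zero[OF fs_DC] fs_zero[OF fs_mC] Fst_0)

lemma ndeg_e: "ndeg A False (edel A)"
  unfolding ndeg_def
proof (intro allI impI)
  fix f :: "'i \<times> 'i list \<Rightarrow> 'k" and c assume f: "\<forall>d. cpar A d = (False \<noteq> cpar A c) \<longrightarrow> f d = 0"
  show "pr (edel A) f c = 0"
  proof (rule lift_eq0I)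
    fix a w assume *: "admL A (a # w)" "chn (map snd (a # w)) = c" "low 2 (tags (a # w))"
    have c: "cpar A c = even (length (tags (a # w)))" using cpar_tags[OF *(1)] *(2) by simp
    have "ehat (mC A 0) (DC A 1) (\<lambda>a w. lift [] [] f (a # w)) a w = ehat (mC A 0) (DC A 1) (\<lambda>a w. (\<lambda>_. 0) (a # w)) a w"
    proof (rule ehat_cong[OF *(1)])
      fix W assume W: "admL A W" "W \<noteq> []" "mset (tags W) = add_mset 0 (add_mset 1 (mset (tags (a # w))))"
      have "length (tags W) = Suc (Suc (length (tags (a # w))))" using arg_cong[OF W(3), of size] by simp
      then show "lift [] [] f W = 0" by (intro lift_par[OF W(1,2) f]) (simp add: c del: tags_simps)
    qed
    then show "lift [] [] (pr (edel A) f) (a # w) = 0"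
      using lift_edel[OF gA *(1), of 1 "[]" "[]" 0 f] lowD(1)[OF *(3)] by (simp add: ehat_0 del: tags_simps)
  qed
qed

lemma DC_unit: "snd x = one_idx A \<Longrightarrow> DC A \<epsilon> x G = 0"
  by (simp add: DC_def gdaD[OF gA])

text \<open>A unit among the bar entries is lost only when it is multiplied with one of its
  neighbours, and these two products cancel; also d 1 = 0. The neighbours are cyclic: for the first
  or last bar entry one of them is the zeroth letter, hence the case distinctions on
  \<open>u\<close> and \<open>v\<close>.\<close>

lemma nrm_b:
  assumes "nrm A f" shows "nrm A (pr (hoch_b A) f)"
proof (rule nrmI_lift)
  fix a w assume *: "admL A (a # w)" "low 2 (tags (a # w))" "one_idx A \<in> snd ` set w"
  obtain t where t: "t \<in> set w" "snd t = one_idx A" using *(3) by auto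
  obtain u v where "w = u @ t # v" using split_list[OF t(1)] by blast
  then obtain s where w: "w = u @ (s, one_idx A) # v" using t(2) by (cases t) simp
  let ?o = "(s, one_idx A)" and ?m = "mC A 0" and ?l = "lift [] [] f"
  have os: "odd (length s)" using *(1) gdaD(1)[OF gA] by (auto simp: w adm_def)
  have z: "?l (x # W) = 0" if "?o \<in> set W" for x W by (rule lift_unit[OF assms]) (use that in force)
  have 1: "bch ?m (DC A 0) (\<lambda>a w. ?l (a # w)) a w
    = Lst (\<lambda>l u'. ?m l ?o (\<lambda>z. ?l (a # u' @ z # v))) u + Fst (\<lambda>x v'. ?m ?o x (\<lambda>z. ?l (a # u @ z # v'))) v
     + Fst (\<lambda>y w'. ?m a y (\<lambda>z. ?l (z # w'))) (u @ ?o # v) + Lst (\<lambda>l w'. ?m l a (\<lambda>z. ?l (z # w'))) (u @ ?o # v)"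
    unfolding bch_def w letter_ops.dd_append[OF letter_ops_C] ddp_def
    by (simp add: z DC_unit fs_zero[OF fs_DC] letter_ops.dd_0[OF letter_ops_C])
  have mo: "?m l ?o G = - G (fst l @ 0 # s, snd l)" "?m ?o l G = - G (s @ 0 # fst l, snd l)" for l G
    by (simp_all add: mC_def gdaD[OF gA])
  \<comment> \<open>The unit carries an odd number of tags, so the product tag before them and after
    them gives opposite signs: the products with the left and the right neighbour cancel.\<close>
  have p1: "psgn (X @ 0 # s @ Y) = (- psgn (X @ s @ 0 # Y) :: 'k)" for X Y
    using psgn_swap[of X "[0]" s Y, where ?'a='k] os by (simp del: psgn_append psgn.simps)
  have p1s: "psgn (X @ 0 # s) = (- psgn (X @ s @ [0]) :: 'k)" "psgn (X @ X' @ X'' @ 0 # s) = (- psgn (X @ X' @ X'' @ s @ [0]) :: 'k)"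
     "psgn (X @ X' @ X'' @ 0 # s @ Y) = (- psgn (X @ X' @ X'' @ s @ 0 # Y) :: 'k)" for X X' X'' Y
    using p1[of X "[]"] p1[of "X @ X' @ X''" "[]"] p1[of "X @ X' @ X''" Y] by (simp_all del: psgn_append psgn.simps)
  have p2: "psgn (s @ 0 # X) = (psgn (X @ s @ [0]) :: 'k)" for X
    using psgn_swap[of "[]" "s @ [0]" X "[]", where ?'a='k] os by (simp del: psgn_append psgn.simps)
  have "bch ?m (DC A 0) (\<lambda>a w. ?l (a # w)) a w = 0"
  proof (cases u rule: rev_cases)
    case Nil
    show ?thesis
    proof (cases v rule: rev_cases)
      case Nil': Nil
      show ?thesis unfolding 1 Nil Nil' by (simp add: Lst_Cons mo lift_def p1s p2 del: psgn_append psgn.simps)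
    next
      case (snoc v' y)
      have "v \<noteq> []" using snoc by simp
      then obtain x v'' where v: "v = x # v''" unfolding neq_Nil_conv by blast
      have "Lst (\<lambda>l w'. ?m l a (\<lambda>z. ?l (z # w'))) (u @ ?o # v) = 0"
        unfolding Nil snoc append_Nil append_Cons[symmetric] Lst_simps by (simp add: z fs_zero[OF fs_mC])
      then show ?thesis unfolding 1 unfolding Nil v by (simp add: mo lift_def p1 del: psgn_append psgn.simps)
    qed
  next
    case (snoc u' l)
    have "u \<noteq> []" using snoc by simp
    then obtain y u'' where u: "u = y # u''" unfolding neq_Nil_conv by blast
    have f: "Fst (\<lambda>y w'. ?m a y (\<lambda>z. ?l (z # w'))) (u @ ?o # v) = 0" by (simp add: u z fs_zero[OF fs_mC])
    show ?thesis
    proof (cases v rule: rev_cases)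
      case Nil
      show ?thesis unfolding 1 f unfolding snoc Nil
        by (simp add: Lst_append Lst_Cons mo lift_def p1s p2 del: psgn_append psgn.simps)
    next
      case (snoc v' t)
      have "v \<noteq> []" using snoc by simp
      then obtain x v'' where v: "v = x # v''" unfolding neq_Nil_conv by blast
      have "Lst (\<lambda>l w'. ?m l a (\<lambda>z. ?l (z # w'))) (u @ ?o # v) = 0"
        unfolding snoc append_Cons[symmetric] append_assoc[symmetric] Lst_simps by (simp add: z fs_zero[OF fs_mC])
      then show ?thesis unfolding 1 f unfolding \<open>u = u' @ [l]\<close> v by (simp add: mo lift_def p1 p1s del: psgn_append psgn.simps)
    qed
  qed
  then show "lift [] [] (pr (hoch_b A) f) (a # w) = 0"
    using lift_hoch_b[OF gA *(1), of "[]" "[]" 0 f] by (simp add: kap_def lowD[OF *(2)] del: tags_simps)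
qed

lemma nrm_B:
  assumes "nrm A f" shows "nrm A (pr (Bop A) f)"
proof (rule nrmI_lift)
  fix a w assume *: "admL A (a # w)" "low 2 (tags (a # w))" "one_idx A \<in> snd ` set w"
  have "kap [] [] 0 (a # w) * lift [] [] (pr (Bop A) f) (a # w) = rot (\<lambda>_ _ _. 0) a w"
    unfolding lift_Bop[OF gA *(1) assms] by (rule rot_cong, rule lift_unit[OF assms]) (use *(3) in auto)
  then show "lift [] [] (pr (Bop A) f) (a # w) = 0"
    by (simp add: kap_def lowD[OF *(2)] rot_0 del: tags_simps)
qed

lemma nrm_e:
  assumes "nrm A f" shows "nrm A (pr (edel A) f)"
proof (rule nrmI_lift)
  fix a w assume *: "admL A (a # w)" "low 2 (tags (a # w))" "one_idx A \<in> snd ` set w"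
  then obtain x v where w: "w = x # v" by (cases w) auto
  have "ehat (mC A 0) (DC A 1) (\<lambda>a w. lift [] [] f (a # w)) a w = 0"
  proof (cases "snd x = one_idx A")
    case True then show ?thesis by (simp add: ehat_def w DC_unit)
  next
    case False
    then have "lift [] [] f (z # v) = 0" for z by (intro lift_unit[OF assms]) (use *(3) w in auto)
    then show ?thesis by (simp add: ehat_def w fs_zero[OF fs_DC] fs_zero[OF fs_mC])
  qed
  then show "lift [] [] (pr (edel A) f) (a # w) = 0"
    using lift_edel[OF gA *(1), of 1 "[]" "[]" 0 f] lowD(1)[OF *(2)] by (simp del: tags_simps)
qed

text \<open>\<open>U\<close> records a unit among the letters already passed. As d 1 = 0, the
  derivation never replaces a unit by something else.\<close>

lemma LD_unit:
  assumes "\<And>v. U \<or> one_idx A \<in> snd ` set v \<Longrightarrow> \<phi> v = 0" "U \<or> one_idx A \<in> snd ` set w"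
  shows "LD (DC A \<epsilon>) \<phi> w = 0"
  using assms
proof (induction w arbitrary: U \<phi>)
  case (Cons x w)
  have 1: "DC A \<epsilon> x (\<lambda>y. \<phi> (y # w)) = 0"
  proof (cases "snd x = one_idx A")
    case False
    then have "U \<or> one_idx A \<in> snd ` set (y # w)" for y using Cons.prems(2) by auto
    then have "\<phi> (y # w) = 0" for y by (rule Cons.prems(1))
    then show ?thesis by (simp add: fs_zero[OF fs_DC])
  qed (simp add: DC_unit)
  have "LD (DC A \<epsilon>) (\<lambda>w. \<phi> (x # w)) w = 0"
  proof (rule Cons.IH[where U="U \<or> snd x = one_idx A"])
    show "\<phi> (x # v) = 0" if "(U \<or> snd x = one_idx A) \<or> one_idx A \<in> snd ` set v" for v
      by (rule Cons.prems(1)) (use that in auto)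
    show "(U \<or> snd x = one_idx A) \<or> one_idx A \<in> snd ` set w" using Cons.prems(2) by auto
  qed
  with 1 show ?case by (simp add: Fst_0)
qed simp

lemma nrm_E:
  assumes "nrm A f" shows "nrm A (pr (Ebig A) f)"
proof (rule nrmI_lift)
  fix a w assume *: "admL A (a # w)" "low 2 (tags (a # w))" "one_idx A \<in> snd ` set w"
  have "rotE (DC A 1) (\<lambda>u a v. lift [] [] f (oC A 0 # u @ a # v)) a w = spl (\<lambda>_ _. 0) w"
    unfolding rotE_def
  proof (rule spl_cong)
    fix w1 w2 assume w: "w = w1 @ w2"
    show "LD (DC A 1) (\<lambda>r. lift [] [] f (oC A 0 # w2 @ a # r)) w1 = 0"
      by (rule LD_unit[where U="one_idx A \<in> snd ` set w2"], rule lift_unit[OF assms]) (use *(3) w in auto)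
  qed
  then show "lift [] [] (pr (Ebig A) f) (a # w) = 0"
    using lift_Ebig[OF gA *(1), of 1 "[]" "[]" 0 f] lowD(1)[OF *(2)] by (simp add: spl_0 del: tags_simps)
qed

end

section \<open>Identities between the operators\<close>

text \<open>One of the two marked letters comes first. This splits the unrestricted cyclic shuffles
  of Z into those of \<open>Sh\<close> and the complementary ones occurring with P.\<close>

lemma S_all: "S \<phi> u1 a u2 v1 c v2 + S \<phi> v1 c v2 u1 a u2 = shf \<phi> (u1 @ a # u2) (v1 @ c # v2)"
proof (induction \<phi> u1 a u2 v1 c v2 rule: S.induct)
  case (1 \<phi> a u2 c v2)
  show ?case by (simp add: shf_commute[of _ v2])
next
  case (2 \<phi> a u2 q v1 c v2)
  have "shf \<phi> ([] @ a # u2) ((q # v1) @ c # v2) = shf (\<lambda>w. \<phi> (a # w)) u2 (q # v1 @ c # v2) + shf (\<lambda>w. \<phi> (q # w)) ([] @ a # u2) (v1 @ c # v2)" by simp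
  then show ?case unfolding 2[symmetric] by (cases v1) (simp_all add: add.assoc)
next
  case (3 \<phi> p u1 a u2 c v2)
  have "shf \<phi> ((p # u1) @ a # u2) ([] @ c # v2) = shf (\<lambda>w. \<phi> (c # w)) v2 (p # u1 @ a # u2) + shf (\<lambda>w. \<phi> (p # w)) (u1 @ a # u2) ([] @ c # v2)"
    by (simp add: shf_commute[of _ v2] add.commute)
  then show ?case unfolding 3[symmetric] by simp
next
  case (4 \<phi> p u1 a u2 q v1 c v2)
  have "shf \<phi> ((p # u1) @ a # u2) ((q # v1) @ c # v2) = shf (\<lambda>w. \<phi> (p # w)) (u1 @ a # u2) ((q # v1) @ c # v2) + shf (\<lambda>w. \<phi> (q # w)) ((p # u1) @ a # u2) (v1 @ c # v2)" by simp
  then show ?case unfolding 4[symmetric] by (simp add: algebra_simps)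
qed

lemma SR_all: "SR \<phi> p0 p q0 q + SR \<phi> q0 q p0 p
    = rot (\<lambda>p2 p0 p1. rot (\<lambda>q2 q0 q1. shf \<phi> (p2 @ p0 # p1) (q2 @ q0 # q1)) q0 q) p0 p"
proof -
  have "SR \<phi> q0 q p0 p = rot (\<lambda>p2 p0 p1. rot (\<lambda>q2 q0 q1. S \<phi> q2 q0 q1 p2 p0 p1) q0 q) p0 p"
    unfolding SR_def rot_def
    by (rule spl_bind[OF fs_spl, where \<phi>="\<lambda>t w1 w2. S \<phi> (snd t) q0 (fst t) w2 p0 w1", unfolded fst_conv snd_conv])
  then show ?thesis unfolding S_all[symmetric] rot_add SR_def by simp
qed

lemma SR_cong: "(\<And>W. mset W = mset (p0 # p @ q0 # q) \<Longrightarrow> \<phi> W = \<psi> W) \<Longrightarrow> SR \<phi> p0 p q0 q = SR \<psi> p0 p q0 q"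
  unfolding SR_def by (rule rot_cong, rule rot_cong, rule S_cong) (simp add: ac_simps)

lemma fs_SR: "fs (\<lambda>\<phi>. SR \<phi> p0 p q0 q)"
  unfolding SR_def rot_def by (intro fs_splI fs_S)

lemma SE_DC_cong:
  assumes "\<And>u x z v W. q = u @ x # v \<Longrightarrow> dif X (snd x) (snd z) \<noteq> 0 \<Longrightarrow> fst z = \<epsilon> # fst x \<Longrightarrow> mset W = mset (p0 # p @ q0 # u @ z # v) \<Longrightarrow> K W = K' W"
  shows "SE (DC X \<epsilon>) K p0 p q0 q = SE (DC X \<epsilon>) K' p0 p q0 q"
  using SE_scale[where E="DC X \<epsilon>" and R="\<lambda>x z. dif X (snd x) (snd z) \<noteq> 0 \<and> fst z = \<epsilon> # fst x" and \<sigma>=1 and K=K and K'=K' and q=q and p=p and ?p0.0=p0 and ?q0.0=q0, OF fs_DC]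
  by (metis (mono_tags, lifting) DC_on assms mult_1)

lemma tags_mset: "mset W = mset W' \<Longrightarrow> mset (tags W) = mset (tags W')"
  unfolding tags_def by (rule mset_concat_map)

lemma lift_is_loc: "(\<lambda>z. lift U V f (u @ z # w)) = loc (U @ tags u) (tags w @ V) (\<lambda>x. f (chn (map snd u @ x # map snd w)))"
  by (rule ext) (rule lift_loc)

lemma lift2_lin:
  "lift2 (\<lambda>x y. g x y + h x y) L M = lift2 g L M + lift2 h L M"
  "lift2 (\<lambda>x y. g x y - h x y) L M = lift2 g L M - lift2 h L M"
  "lift2 (\<lambda>x y. - g x y) L M = - lift2 g L M"
  by (simp_all add: lift2_def algebra_simps del: psgn_append psgn.simps)

definition shF where "shF A B f x y = pr (sh A B) f (x, y)"
definition ShF where "ShF A B f x y = pr (Sh A B) f (x, y)"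
definition btot where "btot A B g x y = act1 (hoch_b A) g x y + act2 A True (hoch_b B) g x y"

lemma rotE_cong': "(\<And>u v. \<phi> u a v = \<psi> u a v) \<Longrightarrow> rotE E \<phi> a w = rotE E \<psi> a w"
  by (simp add: rotE_def)

lemma bch_minus: "bch (mC X \<epsilon>) (DC X \<epsilon>) (\<lambda>a w. - \<Psi> a w) a w = - bch (mC X \<epsilon>) (DC X \<epsilon>) \<Psi> a w"
  using letter_ops.bch_bind[OF letter_ops_C fs_uminus[OF fs_point], where \<psi>="\<lambda>_. \<Psi>", symmetric] .

lemma ehat_minus: "ehat (mC X \<epsilon>) (DC Y \<epsilon>') (\<lambda>a w. - \<Psi> a w) a w = - ehat (mC X \<epsilon>) (DC Y \<epsilon>') \<Psi> a w"
  by (cases w) (simp_all add: ehat_def fs_minus[OF fs_mC] fs_minus[OF fs_DC])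

lemma rot_minus: "rot (\<lambda>u a v. - \<psi> u a v) a w = - rot \<psi> a w"
  by (simp add: rot_def spl_minus)

lemma rotE_minus: "rotE (DC X \<epsilon>) (\<lambda>u a v. - \<psi> u a v) a w = - rotE (DC X \<epsilon>) \<psi> a w"
  using letter_ops_E.rotE_bind[OF letter_ops_E_C fs_uminus[OF fs_point], where \<phi>="\<lambda>_. \<psi>", symmetric] .

lemma low_simps [simp]: "low \<epsilon> [] = True" "low \<epsilon> (x # s) = (\<epsilon> < x \<and> low \<epsilon> s)" "low \<epsilon> (s @ t) = (low \<epsilon> s \<and> low \<epsilon> t)"
  by (auto simp: low_def)

lemma low_01: "low 1 s \<Longrightarrow> low 0 s"
  by (auto simp: low_def)

lemma low_c1: "low \<epsilon> s \<Longrightarrow> c1 \<epsilon> s = 1"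
  by (rule c1_less) (auto simp: low_def)

lemma tags_map [simp]: "tags (map (iA B) X) = tags X" "tags (map (iB A) Y) = tags Y"
  by (simp_all add: tags_def comp_def)

section \<open>The tensor product of two dg algebras\<close>

context
  fixes A :: "('i, 'k::field_char_0) dga" and B :: "('j, 'k) dga"
  assumes dA: "is_dga A" and dB: "is_dga B"
begin

abbreviation "CC \<equiv> dga_tensor A B"
text \<open>Convention for tags: 0 for \<open>b\<close>, for the unit inserted by \<open>B\<close>
  or \<open>E\<close> and for the product in \<open>e\<close>; 1 for the differential inside
  \<open>e\<close> and \<open>E\<close>.\<close>

abbreviation "mm \<equiv> mC CC 0"
abbreviation "dD \<equiv> DC CC 0"
abbreviation "eA \<equiv> DC (cA A B) 1"
abbreviation "eB \<equiv> DC (cB A B) 1"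

lemma gdA: "gda A" and gdB: "gda B" and gdC: "gda CC" and gcA: "gda (cA A B)" and gcB: "gda (cB A B)"
  by (simp_all add: is_dga_gda dA dB gda_tensor gda_no_dif cA_def cB_def)

lemma adm_c: "adm (cA A B) x = adm CC x" "adm (cB A B) x = adm CC x"
  by (cases x, cases "snd x", simp add: adm_def cA_def cB_def)+

lemma mC_c: "mC (cA A B) = mC CC" "mC (cB A B) = mC CC" "oC (cA A B) = oC CC" "oC (cB A B) = oC CC" "nrm (cA A B) = nrm CC" "nrm (cB A B) = nrm CC"
  by (simp_all add: fun_eq_iff mC_def cA_def cB_def dga_tensor_def oC_def nrm_def normal_def)

lemma adm_i: "adm A p \<Longrightarrow> adm CC (iA B p)" "adm B q \<Longrightarrow> adm CC (iB A q)"
  using adm_iAB[OF gdA gdB] by blast+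

text \<open>\<open>g\<close> is evaluated on words to which \<open>b\<close> has already added the
  tag 0. The minus sign in the hypothesis has three uses: for \<open>sh\<close> it comes from
  \<open>mC\<close>, for \<open>Sh\<close> from \<open>lift2_Sh\<close>, for the homotopies from the
  order of the tags 0 and 1.\<close>

lemma lift2_btot:
  assumes "admL A (p0 # p)" "admL B (q0 # q)" "low 0 (tags (p0 # p) @ 2 # tags (q0 # q))"
    and g: "\<And>p0' p' q0' q'. admL A (p0' # p') \<Longrightarrow> admL B (q0' # q') \<Longrightarrow>
       mset (tags (p0' # p') @ tags (q0' # q')) = add_mset 0 (mset (tags (p0 # p) @ tags (q0 # q))) \<Longrightarrow>
       lift2 g (p0' # p') (q0' # q') = - G (iA B p0') (map (iA B) p') (iB A q0') (map (iB A) q')"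
  shows "lift2 (btot A B g) (p0 # p) (q0 # q) = - (bch mm dD (\<lambda>a w. G a w (iB A q0) (map (iB A) q)) (iA B p0) (map (iA B) p)
    + bch mm dD (\<lambda>a w. G (iA B p0) (map (iA B) p) a w) (iB A q0) (map (iB A) q))"
proof -
  have "lift2 (btot A B g) (p0 # p) (q0 # q) = c1 0 (tags (p0 # p) @ 2 # tags (q0 # q)) * lift2 (\<lambda>x y. act1 (hoch_b A) g x y + act2 A True (hoch_b B) g x y) (p0 # p) (q0 # q)"
    unfolding low_c1[OF assms(3)] btot_def[abs_def] by simp
  also have "\<dots> = bch (mC A 0) (DC A 0) (\<lambda>a w. lift2 g (a # w) (q0 # q)) p0 p + bch (mC B 0) (DC B 0) (\<lambda>a w. lift2 g (p0 # p) (a # w)) q0 q"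
    by (rule lift2_b[OF gdA gdB assms(1,2)])
  also have "bch (mC A 0) (DC A 0) (\<lambda>a w. lift2 g (a # w) (q0 # q)) p0 p = bch (mC A 0) (DC A 0) (\<lambda>a w. (\<lambda>W. - G (iA B (hd W)) (map (iA B) (tl W)) (iB A q0) (map (iB A) q)) (a # w)) p0 p"
  proof (rule bch_cong[OF gdA assms(1)])
    fix W assume W: "admL A W" "W \<noteq> []" "mset (tags W) = add_mset 0 (mset (tags (p0 # p)))"
    obtain w W' where e: "W = w # W'" using W(2) by (cases W) auto
    show "lift2 g W (q0 # q) = - G (iA B (hd W)) (map (iA B) (tl W)) (iB A q0) (map (iB A) q)"
      unfolding e list.sel by (rule g) (use W assms(2) e in \<open>simp_all del: tags_simps add: tags_simps(3)\<close>)
  qed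
  also have "\<dots> = - bch mm dD (\<lambda>a w. G a w (iB A q0) (map (iB A) q)) (iA B p0) (map (iA B) p)"
    unfolding list.sel bch_minus by (rule arg_cong[where f=uminus], rule bch_map[symmetric]) (rule mC_iA[OF dA dB] DC_iA(1)[OF dA dB])+
  also have "bch (mC B 0) (DC B 0) (\<lambda>a w. lift2 g (p0 # p) (a # w)) q0 q = bch (mC B 0) (DC B 0) (\<lambda>a w. (\<lambda>W. - G (iA B p0) (map (iA B) p) (iB A (hd W)) (map (iB A) (tl W))) (a # w)) q0 q"
  proof (rule bch_cong[OF gdB assms(2)])
    fix W assume W: "admL B W" "W \<noteq> []" "mset (tags W) = add_mset 0 (mset (tags (q0 # q)))"
    obtain w W' where e: "W = w # W'" using W(2) by (cases W) auto
    show "lift2 g (p0 # p) W = - G (iA B p0) (map (iA B) p) (iB A (hd W)) (map (iB A) (tl W))"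
      unfolding e list.sel by (rule g) (use W assms(1) e in \<open>simp_all del: tags_simps add: tags_simps(3)\<close>)
  qed
  also have "\<dots> = - bch mm dD (\<lambda>a w. G (iA B p0) (map (iA B) p) a w) (iB A q0) (map (iB A) q)"
    unfolding list.sel bch_minus by (rule arg_cong[where f=uminus], rule bch_map[symmetric]) (rule mC_iB[OF dA dB] DC_iB(1)[OF dA dB])+
  finally show ?thesis by simp
qed

lemma lift2_sh':
  assumes "admL A (p0 # p)" "admL B (q0 # q)"
  shows "lift2 (shF A B f) (p0 # p) (q0 # q)
     = - shf (\<lambda>w. mC CC 2 (iA B p0) (iB A q0) (\<lambda>z. lift [] [] f (z # w))) (map (iA B) p) (map (iB A) q)"
  using lift2_sh[OF gdA gdB assms, of f] unfolding shF_def[abs_def] mC_AB[OF dA dB] fs_minus[OF fs_shf] by simp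

text \<open>If the zeroth letter of one factor is a unit inserted by \<open>B\<close>, the shuffled
  chain starts with the other zeroth letter, written here as a product with the unit to match the
  boundary terms of \<open>SR_cyc\<close>. The signs differ because the tag 0 stands after the
  separator in one case and before it in the other.\<close>

lemma sh_o:
  assumes "admL A (p0 # p)" "admL B (q0 # q)"
  shows "lift2 (shF A B f) (p0 # p) (oC B 0 # q) = - shf (\<lambda>w. mm (oC CC 2) (iA B p0) (\<lambda>z. lift [] [] f (z # w))) (map (iA B) p) (map (iB A) q)"
    "lift2 (shF A B f) (oC A 0 # p) (q0 # q) = shf (\<lambda>w. mm (oC CC 2) (iB A q0) (\<lambda>z. lift [] [] f (z # w))) (map (iA B) p) (map (iB A) q)"
proof -
  have o: "adm B (oC B 0)" "adm A (oC A 0)" by (simp_all add: adm_def oC_def gdaD[OF gdA] gdaD[OF gdB])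
  have m: "mm (oC CC 2) x (\<lambda>z. lift [] [] f (z # w)) = - (psgn (2 # 0 # fst x @ tags w) * f (snd x, map snd w))" for x w
    by (simp add: mC_def oC_def gdaD[OF gdC, simplified] lift_def del: psgn_append psgn.simps)
  have p1: "psgn (s @ 2 # 0 # t) = (psgn (2 # 0 # s @ t) :: 'k)" "psgn (0 # 2 # t) = (- psgn (2 # 0 # t) :: 'k)" for s t
    using psgn_swap[of "[]" s "[2, 0]" t, where ?'a='k] psgn_swap[of "[]" "[0]" "[2]" t, where ?'a='k] by (simp_all del: psgn_append psgn.simps)
  show "lift2 (shF A B f) (p0 # p) (oC B 0 # q) = - shf (\<lambda>w. mm (oC CC 2) (iA B p0) (\<lambda>z. lift [] [] f (z # w))) (map (iA B) p) (map (iB A) q)"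
    unfolding shF_def[abs_def] lift2_sh[OF gdA gdB assms(1), of "oC B 0" q, OF _ ] m
    apply (subst lift2_sh[OF gdA gdB assms(1)]) using assms(2) o apply simp
    by (simp add: lift_def oC_def p1 fs_minus[OF fs_shf] del: psgn_append psgn.simps)
  show "lift2 (shF A B f) (oC A 0 # p) (q0 # q) = shf (\<lambda>w. mm (oC CC 2) (iB A q0) (\<lambda>z. lift [] [] f (z # w))) (map (iA B) p) (map (iB A) q)"
    unfolding shF_def[abs_def] m
    apply (subst lift2_sh[OF gdA gdB _ assms(2)]) using assms(1) o apply simp
    by (simp add: lift_def oC_def p1 del: psgn_append psgn.simps)
qed

definition PA where "PA = iA B ` {p. adm A p}"
definition QB where "QB = iB A ` {q. adm B q}"

lemma PQ: "admL A p \<Longrightarrow> set (map (iA B) p) \<subseteq> PA" "adm A p0 \<Longrightarrow> iA B p0 \<in> PA" "admL B q \<Longrightarrow> set (map (iB A) q) \<subseteq> QB" "adm B q0 \<Longrightarrow> iB A q0 \<in> QB"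
  by (auto simp: PA_def QB_def)

lemma comm_PQ: "comm (mC CC \<epsilon>) PA QB (lift U V f)"
  unfolding comm_def PA_def QB_def lift_is_loc using rel_comm[OF dA dB] by blast

lemma comm_QP: "comm (mC CC \<epsilon>) QB PA (lift U V f)"
  using comm_PQ[of \<epsilon> U V f] unfolding comm_def by (metis add.commute)

lemma J_unit: "mC CC \<epsilon> x (oC CC \<eta>) (\<lambda>z. lift U V f (z # w)) = - mC CC \<epsilon> (oC CC \<eta>) x (\<lambda>z. lift U V f (z # w))"
  using rel_unit(1)[OF gdC, of \<epsilon> x \<eta> "U @ tags []" "tags w @ V"] lift_is_loc[of U V f "[]" w] by simp

lemma J_unit': "gda X \<Longrightarrow> mC X \<epsilon> x (oC X \<eta>) (\<lambda>z. lift U V f (z # w)) = - mC X \<epsilon> (oC X \<eta>) x (\<lambda>z. lift U V f (z # w))"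
  using rel_unit(1)[of X \<epsilon> x \<eta> "U @ tags []" "tags w @ V"] lift_is_loc[of U V f "[]" w] by simp

lemma lift_b_o:
  assumes "admL CC w" "low 0 (tags w)"
  shows "lift [] [] (pr (hoch_b CC) f) (oC CC 2 # w) = dd mm dD (\<lambda>w. lift [] [] f (oC CC 2 # w)) w
    + (Fst (\<lambda>x w. mm (oC CC 2) x (\<lambda>z. lift [] [] f (z # w))) w - Lst (\<lambda>x w. mm (oC CC 2) x (\<lambda>z. lift [] [] f (z # w))) w)"
proof -
  have a: "admL CC (oC CC 2 # w)" using assms(1) gdaD(1)[OF gdC] by (auto simp: adm_def oC_def)
  have k: "kap [] [] 0 (oC CC 2 # w) = (1 :: 'k)" using assms(2) low_c1[of 0 "2 # tags w"] by (simp add: kap_def oC_def)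
  show ?thesis
    using lift_hoch_b[OF gdC a, of "[]" "[]" 0 f] unfolding k letter_ops.bch_bar[OF letter_ops_C refl J_unit rel_unit(2)[OF gdC]] by simp
qed

text \<open>In \<open>b\<close> after \<open>Sh\<close> the unit carries the separator and the
  product the tag 0; in \<open>B\<close> after \<open>sh\<close> it is the other way round.
  Exchanging the tags 0 and 2 compensates the minus sign of \<open>mC\<close>.\<close>

lemma wall_m:
  "mm (iA B p0) (iB A q0) (\<lambda>z. lift [] [] f (oC CC 2 # x @ z # y)) = lift [] [] f (oC CC 0 # x @ (fst p0 @ 2 # fst q0, (snd p0, snd q0)) # y)"
  unfolding mC_AB[OF dA dB]
proof -
  have "psgn (2 # X @ s @ 0 # t) = (- psgn (0 # X @ s @ 2 # t) :: 'k)" for X s t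
    using psgn_swap[of "[]" "2 # X @ s" "[0]" t, where ?'a='k] psgn_swap[of "[]" "0 # X @ s" "[2]" t, where ?'a='k] psgn_swap[of "[]" "[2]" "[0]" "X @ s @ t", where ?'a='k]
    by (simp del: psgn_append psgn.simps)
  then show "- lift [] [] f (oC CC 2 # x @ (fst p0 @ 0 # fst q0, (snd p0, snd q0)) # y) = lift [] [] f (oC CC 0 # x @ (fst p0 @ 2 # fst q0, (snd p0, snd q0)) # y)"
    by (simp add: lift_def oC_def del: psgn_append psgn.simps)
qed

lemma shf_sh_cong:
  assumes "admL A (p0 # p)" "admL B (q0 # q)" "low 1 (tags (p0 # p) @ 2 # tags (q0 # q))"
    and "\<And>w. admL CC ((fst p0 @ 2 # fst q0, (snd p0, snd q0)) # w) \<Longrightarrow> low 1 (tags ((fst p0 @ 2 # fst q0, (snd p0, snd q0)) # w)) \<Longrightarrow>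
      length (tags ((fst p0 @ 2 # fst q0, (snd p0, snd q0)) # w)) = Suc (length (tags (p0 # p)) + length (tags (q0 # q))) \<Longrightarrow> length w = length p + length q \<Longrightarrow> \<phi> w = \<psi> w"
  shows "shf \<phi> (map (iA B) p) (map (iB A) q) = shf \<psi> (map (iA B) p) (map (iB A) q)"
proof (rule shf_cong, rule assms(4))
  fix w assume w: "mset w = mset (map (iA B) p) + mset (map (iB A) q)"
  have "set w = set (map (iA B) p @ map (iB A) q)" using w by (metis mset_append set_mset_mset)
  then have a: "admL CC w" using assms(1,2) adm_i by auto
  have "set (tags w) = set (tags p @ tags q)"
    using tags_mset[of w "map (iA B) p @ map (iB A) q"] w by (metis mset_append set_mset_mset tags_map tags_simps(3))
  then have l: "low 1 (tags w)" using assms(3) by (auto simp: low_def)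
  have "adm CC (fst p0 @ 2 # fst q0, (snd p0, snd q0))" using assms(1,2) by (auto simp: adm_def)
  with a show "admL CC ((fst p0 @ 2 # fst q0, (snd p0, snd q0)) # w)" by auto
  show "low 1 (tags ((fst p0 @ 2 # fst q0, (snd p0, snd q0)) # w))" using l assms(3) by auto
  have "length (tags w) = length (tags p) + length (tags q)"
    using arg_cong[OF tags_mset[of w "map (iA B) p @ map (iB A) q"], of size] w by simp
  then show "length (tags ((fst p0 @ 2 # fst q0, (snd p0, snd q0)) # w)) = Suc (length (tags (p0 # p)) + length (tags (q0 # q)))" by simp
  show "length w = length p + length q" using arg_cong[OF w, of size] by simp
qed


lemma lift_is_loc0: "(\<lambda>z. lift U V f (z # w)) = loc U (tags w @ V) (\<lambda>x. f (chn (x # map snd w)))"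
  using lift_is_loc[of U V f "[]" w] by simp

lemma sh_word:
  "shf (\<lambda>w. mC CC 2 (iA B p0) (iB A q0) (\<lambda>z. \<Psi> z w)) u v = - shf (\<lambda>w. \<Psi> (fst p0 @ 2 # fst q0, (snd p0, snd q0)) w) u v"
  unfolding mC_AB[OF dA dB] by (rule fs_minus[OF fs_shf])

lemma lift2_shF:
  assumes "admL A (p0 # p)" "admL B (q0 # q)"
  shows "lift2 (shF A B f) (p0 # p) (q0 # q) = shf (\<lambda>w. lift [] [] f ((fst p0 @ 2 # fst q0, (snd p0, snd q0)) # w)) (map (iA B) p) (map (iB A) q)"
  unfolding shF_def[abs_def] by (rule lift2_sh[OF gdA gdB assms])

lemma lift2_ShF:
  assumes "admL A (p0 # p)" "admL B (q0 # q)"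
  shows "lift2 (ShF A B f) (p0 # p) (q0 # q) = - SR (\<lambda>w. lift [] [] f (oC CC 2 # w)) (iA B p0) (map (iA B) p) (iB A q0) (map (iB A) q)"
  unfolding ShF_def[abs_def] by (rule lift2_Sh[OF gdA gdB assms])

section \<open>The chain map identities\<close>

lemma b_sh: "shF A B (pr (hoch_b CC) f) = btot A B (shF A B f)"
proof (rule lift2_eqI[OF gdA gdB])
  fix p0 p q0 q assume adm: "admL A (p0 # p)" "admL B (q0 # q)" and low: "low 1 (tags (p0 # p) @ 2 # tags (q0 # q))"
  let ?X = "iA B p0" and ?P = "map (iA B) p" and ?Y = "iB A q0" and ?Q = "map (iB A) q"
  let ?G = "\<lambda>P0 P Q0 Q. shf (\<lambda>w. mC CC 2 P0 Q0 (\<lambda>z. lift [] [] f (z # w))) P Q"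
  have a: "adm A p0" "adm B q0" using adm by auto
  have "lift2 (shF A B (pr (hoch_b CC) f)) (p0 # p) (q0 # q)
      = shf (\<lambda>w. bch mm dD (\<lambda>a w. lift [] [] f (a # w)) (fst p0 @ 2 # fst q0, (snd p0, snd q0)) w) ?P ?Q"
    unfolding lift2_shF[OF adm]
  proof (rule shf_sh_cong[OF adm low])
    fix w let ?L = "(fst p0 @ 2 # fst q0, (snd p0, snd q0))"
    assume w: "admL CC (?L # w)" "low 1 (tags (?L # w))"
    have "kap [] [] 0 (?L # w) = (1 :: 'k)" using low_c1[OF low_01[OF w(2)]] by (simp add: kap_def del: tags_simps)
    then show "lift [] [] (pr (hoch_b CC) f) (?L # w) = bch mm dD (\<lambda>a w. lift [] [] f (a # w)) ?L w"
      using lift_hoch_b[OF gdC w(1), of "[]" "[]" 0 f] by simp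
  qed
  also have "\<dots> = - shf (\<lambda>w. mC CC 2 ?X ?Y (\<lambda>z. bch mm dD (\<lambda>z w. lift [] [] f (z # w)) z w)) ?P ?Q"
    unfolding sh_word by simp
  also have "shf (\<lambda>w. mC CC 2 ?X ?Y (\<lambda>z. bch mm dD (\<lambda>z w. lift [] [] f (z # w)) z w)) ?P ?Q
     = bch mm dD (\<lambda>p0 p. ?G p0 p ?Y ?Q) ?X ?P + bch mm dD (\<lambda>q0 q. ?G ?X ?P q0 q) ?Y ?Q"
  proof (rule letter_ops.shf_bch[OF letter_ops_C comm_PQ])
    show "set ?P \<subseteq> PA" "?X \<in> PA" "set ?Q \<subseteq> QB" "?Y \<in> QB" using adm PQ by (simp_all del: set_map)
    show "fs (mC CC 2 x y)" for x y by (rule fs_mC)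
    fix w x
    show "mC CC 2 ?X ?Y (\<lambda>z. dD z (\<lambda>t. lift [] [] f (t # w))) = dD ?X (\<lambda>x. mC CC 2 x ?Y (\<lambda>t. lift [] [] f (t # w))) + dD ?Y (\<lambda>x. mC CC 2 ?X x (\<lambda>t. lift [] [] f (t # w)))"
      unfolding lift_is_loc0 by (rule rel_D[OF dA dB a])
    show "mC CC 2 ?X ?Y (\<lambda>z. mm z x (\<lambda>t. lift [] [] f (t # w))) = mm ?X x (\<lambda>z. mC CC 2 z ?Y (\<lambda>t. lift [] [] f (t # w)))"
       "mC CC 2 ?X ?Y (\<lambda>z. mm x z (\<lambda>t. lift [] [] f (t # w))) = mm x ?X (\<lambda>z. mC CC 2 z ?Y (\<lambda>t. lift [] [] f (t # w)))" if "x \<in> PA"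
      using that rel_mult(1,3)[OF dA dB a _ a(2)] unfolding lift_is_loc0 PA_def by blast+
    show "mC CC 2 ?X ?Y (\<lambda>z. mm z x (\<lambda>t. lift [] [] f (t # w))) = mm ?Y x (\<lambda>z. mC CC 2 ?X z (\<lambda>t. lift [] [] f (t # w)))"
       "mC CC 2 ?X ?Y (\<lambda>z. mm x z (\<lambda>t. lift [] [] f (t # w))) = mm x ?Y (\<lambda>z. mC CC 2 ?X z (\<lambda>t. lift [] [] f (t # w)))" if "x \<in> QB"
      using that rel_mult(2,4)[OF dA dB a a(1)] unfolding lift_is_loc0 QB_def by blast+
  qed
  also have "- (bch mm dD (\<lambda>p0 p. ?G p0 p ?Y ?Q) ?X ?P + bch mm dD (\<lambda>q0 q. ?G ?X ?P q0 q) ?Y ?Q)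
      = lift2 (btot A B (shF A B f)) (p0 # p) (q0 # q)"
    by (rule lift2_btot[OF adm low_01[OF low], symmetric, where G="?G"]) (rule lift2_sh')
  finally show "lift2 (shF A B (pr (hoch_b CC) f)) (p0 # p) (q0 # q) = lift2 (btot A B (shF A B f)) (p0 # p) (q0 # q)" .
qed

lemma SR_word_cong:
  assumes "admL A (p0 # p)" "admL B (q0 # q)" "low 1 (tags (p0 # p) @ 2 # tags (q0 # q))"
    and "\<And>w. admL CC w \<Longrightarrow> low 1 (tags w) \<Longrightarrow> \<phi> w = \<psi> w"
  shows "SR \<phi> (iA B p0) (map (iA B) p) (iB A q0) (map (iB A) q) = SR \<psi> (iA B p0) (map (iA B) p) (iB A q0) (map (iB A) q)"
     "SR \<phi> (iB A q0) (map (iB A) q) (iA B p0) (map (iA B) p) = SR \<psi> (iB A q0) (map (iB A) q) (iA B p0) (map (iA B) p)"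
proof -
  have *: "\<phi> w = \<psi> w" if "mset w = mset (map (iA B) (p0 # p) @ map (iB A) (q0 # q))" for w
  proof (rule assms(4))
    have "set w = set (map (iA B) (p0 # p) @ map (iB A) (q0 # q))" using that by (metis set_mset_mset)
    then show "admL CC w" using assms(1,2) adm_i by auto
    have "set (tags w) = set (tags (map (iA B) (p0 # p) @ map (iB A) (q0 # q)))" using tags_mset[OF that] by (metis set_mset_mset)
    then show "low 1 (tags w)" using assms(3) unfolding low_def by (simp only: tags_simps(3) tags_map) auto
  qed
  show "SR \<phi> (iA B p0) (map (iA B) p) (iB A q0) (map (iB A) q) = SR \<psi> (iA B p0) (map (iA B) p) (iB A q0) (map (iB A) q)"
    "SR \<phi> (iB A q0) (map (iB A) q) (iA B p0) (map (iA B) p) = SR \<psi> (iB A q0) (map (iB A) q) (iA B p0) (map (iA B) p)"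
    by (rule SR_cong, rule *, simp add: ac_simps)+
qed

lemma snd_i: "snd ` set (map (iA B) p) = (\<lambda>i. (i, one_idx B)) ` snd ` set p" "snd ` set (map (iB A) q) = (\<lambda>j. (one_idx A, j)) ` snd ` set q"
  by (simp_all add: image_comp comp_def)

lemma nrm2I:
  fixes g :: "'i \<times> 'i list \<Rightarrow> 'j \<times> 'j list \<Rightarrow> 'k"
  assumes "\<And>p0 p q0 q. admL A (p0 # p) \<Longrightarrow> admL B (q0 # q) \<Longrightarrow> low 1 (tags (p0 # p) @ 2 # tags (q0 # q))
    \<Longrightarrow> one_idx A \<in> snd ` set p \<or> one_idx B \<in> snd ` set q \<Longrightarrow> lift2 g (p0 # p) (q0 # q) = 0"
  shows "nrm2 A B g"
proof -
  have "g x y = 0" if "one_idx A \<in> set (snd x) \<or> one_idx B \<in> set (snd y)" for x y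
  proof (rule lift2_at[OF gdA gdB, where G="\<lambda>_ _. 0"])
    fix p0 p q0 q assume *: "admL A (p0 # p)" "admL B (q0 # q)" "low 1 (tags (p0 # p) @ 2 # tags (q0 # q))"
      "chn (map snd (p0 # p)) = x" "chn (map snd (q0 # q)) = y"
    then have "one_idx A \<in> snd ` set p \<or> one_idx B \<in> snd ` set q" using that by auto
    from assms[OF *(1-3) this] show "lift2 g (p0 # p) (q0 # q) = lift2 (\<lambda>_ _. 0) (p0 # p) (q0 # q)" by (simp add: lift2_def)
  qed
  then show ?thesis by (auto simp: nrm2_def nrm_def normal_def)
qed

text \<open>Here a unit as zeroth letter counts too. Functions of this kind arise from
  \<open>Sh\<close> and from the homotopies, which make bar entries out of all letters;
  \<open>B\<close> and \<open>E\<close>, whose results start with a unit, annihilate them.\<close>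

definition "bar g \<longleftrightarrow> (\<forall>x y. one_idx A \<in> insert (fst x) (set (snd x)) \<or> one_idx B \<in> insert (fst y) (set (snd y)) \<longrightarrow> g x y = (0 :: 'k))"

lemma barI:
  assumes "\<And>p0 p q0 q. admL A (p0 # p) \<Longrightarrow> admL B (q0 # q) \<Longrightarrow> low 1 (tags (p0 # p) @ 2 # tags (q0 # q))
    \<Longrightarrow> (one_idx A, one_idx B) \<in> snd ` set (map (iA B) (p0 # p) @ map (iB A) (q0 # q)) \<Longrightarrow> lift2 g (p0 # p) (q0 # q) = 0"
  shows "bar g"
  unfolding bar_def
proof (intro allI impI)
  fix x y assume xy: "one_idx A \<in> insert (fst x) (set (snd x)) \<or> one_idx B \<in> insert (fst y) (set (snd y))"
  show "g x y = 0"
  proof (rule lift2_at[OF gdA gdB, where G="\<lambda>_ _. 0"])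
    fix p0 p q0 q assume *: "admL A (p0 # p)" "admL B (q0 # q)" "low 1 (tags (p0 # p) @ 2 # tags (q0 # q))"
      "chn (map snd (p0 # p)) = x" "chn (map snd (q0 # q)) = y"
    have "one_idx A \<in> snd ` set (p0 # p) \<or> one_idx B \<in> snd ` set (q0 # q)" using xy *(4,5) by auto
    then have "(one_idx A, one_idx B) \<in> snd ` set (map (iA B) (p0 # p) @ map (iB A) (q0 # q))"
      unfolding set_append image_Un snd_i by blast
    from assms[OF *(1-3) this] show "lift2 g (p0 # p) (q0 # q) = lift2 (\<lambda>_ _. 0) (p0 # p) (q0 # q)" by (simp add: lift2_def)
  qed
qed

lemma bar_nrm2: "bar g \<Longrightarrow> nrm2 A B g"
  unfolding bar_def nrm2_def nrm_def normal_def by auto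

lemma nrm2_sh: assumes "nrm CC f" shows "nrm2 A B (shF A B f)"
proof (rule nrm2I)
  fix p0 p q0 q assume *: "admL A (p0 # p)" "admL B (q0 # q)" "one_idx A \<in> snd ` set p \<or> one_idx B \<in> snd ` set q"
  then have u: "(one_idx A, one_idx B) \<in> snd ` set (map (iA B) p @ map (iB A) q)" unfolding set_append image_Un snd_i by blast
  have "shf (\<lambda>w. lift [] [] f ((fst p0 @ 2 # fst q0, (snd p0, snd q0)) # w)) (map (iA B) p) (map (iB A) q) = shf (\<lambda>_. 0) (map (iA B) p) (map (iB A) q)"
  proof (rule shf_cong)
    fix w assume w: "mset w = mset (map (iA B) p) + mset (map (iB A) q)"
    have "set w = set (map (iA B) p @ map (iB A) q)" using w by (metis mset_append set_mset_mset)
    then show "lift [] [] f ((fst p0 @ 2 # fst q0, (snd p0, snd q0)) # w) = 0" by (intro lift_unit[OF assms]) (use u in simp)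
  qed
  then show "lift2 (shF A B f) (p0 # p) (q0 # q) = 0" unfolding lift2_shF[OF *(1,2)] fs_zero[OF fs_shf] .
qed

lemma bar_Sh: assumes "nrm CC f" shows "bar (ShF A B f)"
proof (rule barI)
  fix p0 p q0 q assume *: "admL A (p0 # p)" "admL B (q0 # q)"
    and u: "(one_idx A, one_idx B) \<in> snd ` set (map (iA B) (p0 # p) @ map (iB A) (q0 # q))"
  have "SR (\<lambda>w. lift [] [] f (oC CC 2 # w)) (iA B p0) (map (iA B) p) (iB A q0) (map (iB A) q) = SR (\<lambda>_. 0) (iA B p0) (map (iA B) p) (iB A q0) (map (iB A) q)"
  proof (rule SR_cong)
    fix w assume "mset w = mset (iA B p0 # map (iA B) p @ iB A q0 # map (iB A) q)"
    then have "set w = set (map (iA B) (p0 # p) @ map (iB A) (q0 # q))" by (metis append_Cons list.simps(9) set_mset_mset)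
    then show "lift [] [] f (oC CC 2 # w) = 0" by (intro lift_unit[OF assms]) (use u in \<open>simp del: set_append set_map list.map\<close>)
  qed
  then show "lift2 (ShF A B f) (p0 # p) (q0 # q) = 0" unfolding lift2_ShF[OF *(1,2)] fs_zero[OF fs_SR] by simp
qed

lemma SE_unit:
  assumes n: "nrm CC f" and X: "dif X (one_idx A, one_idx B) = (\<lambda>_. 0)" and u: "(one_idx A, one_idx B) \<in> snd ` set (p0 # p @ q0 # q)"
  shows "SE (DC X \<epsilon>) (\<lambda>w. lift [] [] f (oC CC 2 # w)) p0 p q0 q = 0"
proof -
  have "SE (DC X \<epsilon>) (\<lambda>w. lift [] [] f (oC CC 2 # w)) p0 p q0 q = SE (DC X \<epsilon>) (\<lambda>_. 0) p0 p q0 q"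
  proof (rule SE_DC_cong)
    fix u x z v W assume *: "q = u @ x # v" "dif X (snd x) (snd z) \<noteq> 0" "mset W = mset (p0 # p @ q0 # u @ z # v)"
    have "snd x \<noteq> (one_idx A, one_idx B)" using *(2) X by auto
    moreover have "set W = set (p0 # p @ q0 # u @ z # v)" using *(3) by (metis set_mset_mset)
    ultimately have "(one_idx A, one_idx B) \<in> snd ` set W" using u *(1) by auto
    then show "lift [] [] f (oC CC 2 # W) = 0" by (intro lift_unit[OF n]) simp
  qed
  then show ?thesis by (simp add: fs_zero[OF fs_SE[OF fs_DC]])
qed

lemma bar_H:
  assumes n: "nrm CC f" shows "bar (HQ A B f)" "bar (HP A B f)"
proof -
  have d: "dif (cB A B) (one_idx A, one_idx B) = (\<lambda>_. 0)" "dif (cA A B) (one_idx A, one_idx B) = (\<lambda>_. 0)"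
    using gdaD(8)[OF gcB] gdaD(8)[OF gcA] by (simp_all add: cA_def cB_def)
  show "bar (HQ A B f)"
  proof (rule barI)
    fix p0 p q0 q assume *: "admL A (p0 # p)" "admL B (q0 # q)" "low 1 (tags (p0 # p) @ 2 # tags (q0 # q))"
      and u: "(one_idx A, one_idx B) \<in> snd ` set (map (iA B) (p0 # p) @ map (iB A) (q0 # q))"
    show "lift2 (HQ A B f) (p0 # p) (q0 # q) = 0"
      using lift2_H(1)[OF gdA gdB *(1,2), of f] SE_unit[OF n d(1), of "iA B p0" "map (iA B) p" "iB A q0" "map (iB A) q" 1] u unfolding low_c1[OF *(3)] by simp
  qed
  show "bar (HP A B f)"
  proof (rule barI)
    fix p0 p q0 q assume *: "admL A (p0 # p)" "admL B (q0 # q)" "low 1 (tags (p0 # p) @ 2 # tags (q0 # q))"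
      and u: "(one_idx A, one_idx B) \<in> snd ` set (map (iA B) (p0 # p) @ map (iB A) (q0 # q))"
    show "lift2 (HP A B f) (p0 # p) (q0 # q) = 0"
      using lift2_H(2)[OF gdA gdB *(1,2), of f] SE_unit[OF n d(2), of "iB A q0" "map (iB A) q" "iA B p0" "map (iA B) p" 1] u unfolding low_c1[OF *(3)] by auto
  qed
qed

abbreviation "JJ f \<equiv> \<lambda>x w. mm (oC CC 2) x (\<lambda>z. lift [] [] f (z # w))"
abbreviation "LL p0 q0 \<equiv> (fst p0 @ 2 # fst q0, (snd p0, snd q0))"

lemma lift2_B_sh:
  assumes n: "nrm CC f" and adm: "admL A (p0 # p)" "admL B (q0 # q)" and low: "low 1 (tags (p0 # p) @ 2 # tags (q0 # q))"
  shows "lift2 (act1 (Bop A) (shF A B f)) (p0 # p) (q0 # q)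
      = rot (\<lambda>u a v. shf (JJ f (iB A q0)) (u @ a # v) (map (iB A) q)) (iA B p0) (map (iA B) p)"
    "lift2 (act2 A True (Bop B) (shF A B f)) (p0 # p) (q0 # q)
      = - rot (\<lambda>u a v. shf (JJ f (iA B p0)) (map (iA B) p) (u @ a # v)) (iB A q0) (map (iB A) q)"
    "lift2 (shF A B (pr (Bop CC) f)) (p0 # p) (q0 # q)
      = shf (\<lambda>w. rot (\<lambda>u a v. lift [] [] f (oC CC 0 # u @ a # v)) (LL p0 q0) w) (map (iA B) p) (map (iB A) q)"
proof -
  note k = low_c1[OF low_01[OF low]]
  have "lift2 (act1 (Bop A) (shF A B f)) (p0 # p) (q0 # q) = rot (\<lambda>u a v. lift2 (shF A B f) (oC A 0 # u @ a # v) (q0 # q)) p0 p"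
    using lift2_B1[OF gdA gdB adm(1) nrm2_sh[OF n], of 0 "q0 # q"] unfolding k by simp
  also have "\<dots> = rot (\<lambda>u a v. shf (JJ f (iB A q0)) (map (iA B) u @ iA B a # map (iA B) v) (map (iB A) q)) p0 p"
  proof (rule rot_cong)
    fix u v assume "p = v @ u"
    then have "admL A ((u @ p0 # v) @ p0 # p)" using adm(1) by auto
    then have "admL A (p0 # u @ p0 # v)" by auto
    from sh_o(2)[OF this adm(2)] show "lift2 (shF A B f) (oC A 0 # u @ p0 # v) (q0 # q) = shf (JJ f (iB A q0)) (map (iA B) u @ iA B p0 # map (iA B) v) (map (iB A) q)" by simp
  qed
  finally show "lift2 (act1 (Bop A) (shF A B f)) (p0 # p) (q0 # q)
      = rot (\<lambda>u a v. shf (JJ f (iB A q0)) (u @ a # v) (map (iB A) q)) (iA B p0) (map (iA B) p)"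
    unfolding rot_map .
  have "lift2 (act2 A True (Bop B) (shF A B f)) (p0 # p) (q0 # q) = rot (\<lambda>u a v. lift2 (shF A B f) (p0 # p) (oC B 0 # u @ a # v)) q0 q"
    using lift2_B2[OF gdA gdB adm(1) _ adm(2) nrm2_sh[OF n], of 0] unfolding k by simp
  also have "\<dots> = rot (\<lambda>u a v. - shf (JJ f (iA B p0)) (map (iA B) p) (map (iB A) u @ iB A a # map (iB A) v)) q0 q"
  proof (rule rot_cong)
    fix u v assume "q = v @ u"
    then have "admL B ((u @ q0 # v) @ q0 # q)" using adm(2) by auto
    then have "admL B (q0 # u @ q0 # v)" by auto
    from sh_o(1)[OF adm(1) this] show "lift2 (shF A B f) (p0 # p) (oC B 0 # u @ q0 # v) = - shf (JJ f (iA B p0)) (map (iA B) p) (map (iB A) u @ iB A q0 # map (iB A) v)" by simp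
  qed
  finally show "lift2 (act2 A True (Bop B) (shF A B f)) (p0 # p) (q0 # q)
      = - rot (\<lambda>u a v. shf (JJ f (iA B p0)) (map (iA B) p) (u @ a # v)) (iB A q0) (map (iB A) q)"
    unfolding rot_map rot_minus .
  show "lift2 (shF A B (pr (Bop CC) f)) (p0 # p) (q0 # q)
      = shf (\<lambda>w. rot (\<lambda>u a v. lift [] [] f (oC CC 0 # u @ a # v)) (LL p0 q0) w) (map (iA B) p) (map (iB A) q)"
    unfolding lift2_shF[OF adm]
  proof (rule shf_sh_cong[OF adm low])
    fix w assume w: "admL CC (LL p0 q0 # w)" "low 1 (tags (LL p0 q0 # w))"
    have "kap [] [] 0 (LL p0 q0 # w) = (1 :: 'k)" using low_c1[OF low_01[OF w(2)]] by (simp add: kap_def del: tags_simps)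
    then show "lift [] [] (pr (Bop CC) f) (LL p0 q0 # w) = rot (\<lambda>u a v. lift [] [] f (oC CC 0 # u @ a # v)) (LL p0 q0) w"
      using lift_Bop[OF gdC w(1) n, of "[]" "[]" 0] by simp
  qed
qed

definition "Btot g x y = act1 (Bop A) g x y + act2 A True (Bop B) g x y"

text \<open>The wall term of \<open>SR_dd\<close> is \<open>B\<close> after \<open>sh\<close>, and
  the two boundary terms of \<open>SR_cyc\<close> are \<open>sh\<close> after the two parts of
  \<open>B\<close>.\<close>

lemma b_Sh:
  assumes n: "nrm CC f"
  shows "ShF A B (pr (hoch_b CC) f) x y + shF A B (pr (Bop CC) f) x y = Btot (shF A B f) x y + btot A B (ShF A B f) x y"
proof -
  have "(\<lambda>x y. ShF A B (pr (hoch_b CC) f) x y + shF A B (pr (Bop CC) f) x y) = (\<lambda>x y. Btot (shF A B f) x y + btot A B (ShF A B f) x y)"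
  proof (rule lift2_eqI[OF gdA gdB])
    fix p0 p q0 q assume adm: "admL A (p0 # p)" "admL B (q0 # q)" and low: "low 1 (tags (p0 # p) @ 2 # tags (q0 # q))"
    let ?X = "iA B p0" and ?P = "map (iA B) p" and ?Y = "iB A q0" and ?Q = "map (iB A) q"
    let ?\<phi> = "\<lambda>w. lift [] [] f (oC CC 2 # w)"
    have a: "adm A p0" "adm B q0" "admL A p" "admL B q" using adm by auto
    have 1: "SR (\<lambda>w. lift [] [] (pr (hoch_b CC) f) (oC CC 2 # w)) ?X ?P ?Y ?Q
       = SR (\<lambda>w. dd mm dD ?\<phi> w + (Fst (JJ f) w - Lst (JJ f) w)) ?X ?P ?Y ?Q"
      by (rule SR_word_cong(1)[OF adm low], rule lift_b_o) (simp_all add: low_01)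
    have 2: "SR (dd mm dD ?\<phi>) ?X ?P ?Y ?Q = bch mm dD (\<lambda>p0 p. SR ?\<phi> p0 p ?Y ?Q) ?X ?P + bch mm dD (\<lambda>q0 q. SR ?\<phi> ?X ?P q0 q) ?Y ?Q
      + rot (\<lambda>p2 p0 p1. rot (\<lambda>q2 q0 q1. shf (\<lambda>x. shf (\<lambda>y. mm p0 q0 (\<lambda>z. ?\<phi> (x @ z # y))) p1 q1) p2 q2) ?Y ?Q) ?X ?P"
      by (rule letter_ops.SR_dd[OF letter_ops_C comm_Cons[OF comm_PQ]]) (use a PQ in auto)
    have 3: "rot (\<lambda>p2 p0 p1. rot (\<lambda>q2 q0 q1. shf (\<lambda>x. shf (\<lambda>y. mm p0 q0 (\<lambda>z. ?\<phi> (x @ z # y))) p1 q1) p2 q2) ?Y ?Q) ?X ?P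
        = lift2 (shF A B (pr (Bop CC) f)) (p0 # p) (q0 # q)"
    proof -
      have "rot (\<lambda>p2 p0 p1. rot (\<lambda>q2 q0 q1. shf (\<lambda>x. shf (\<lambda>y. mm p0 q0 (\<lambda>z. ?\<phi> (x @ z # y))) p1 q1) p2 q2) ?Y ?Q) ?X ?P
        = rot (\<lambda>p2 _ p1. rot (\<lambda>q2 _ q1. shf (\<lambda>x. shf (\<lambda>y. lift [] [] f (oC CC 0 # x @ LL p0 q0 # y)) p1 q1) p2 q2) ?Y ?Q) ?X ?P"
        by (rule rot_cong, rule rot_cong) (simp only: wall_m)
      also have "\<dots> = shf (rot (\<lambda>u a v. lift [] [] f (oC CC 0 # u @ a # v)) (LL p0 q0)) ?P ?Q"
        by (rule letter_ops.wall_rot[OF letter_ops_C, symmetric])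
      finally show ?thesis unfolding lift2_B_sh(3)[OF n adm low] .
    qed
    have 4: "SR (\<lambda>w. Fst (JJ f) w - Lst (JJ f) w) ?X ?P ?Y ?Q
        = - lift2 (act2 A True (Bop B) (shF A B f)) (p0 # p) (q0 # q) - lift2 (act1 (Bop A) (shF A B f)) (p0 # p) (q0 # q)"
      unfolding letter_ops.SR_cyc[OF letter_ops_C[of "dga_tensor A B" 0 "dga_tensor A B" 0]] lift2_B_sh(1,2)[OF n adm low] by simp
    have 5: "lift2 (btot A B (ShF A B f)) (p0 # p) (q0 # q) = - (bch mm dD (\<lambda>p0 p. SR ?\<phi> p0 p ?Y ?Q) ?X ?P + bch mm dD (\<lambda>q0 q. SR ?\<phi> ?X ?P q0 q) ?Y ?Q)"
      by (rule lift2_btot[OF adm low_01[OF low], where G="SR ?\<phi>"]) (rule lift2_ShF)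
    show "lift2 (\<lambda>x y. ShF A B (pr (hoch_b CC) f) x y + shF A B (pr (Bop CC) f) x y) (p0 # p) (q0 # q)
      = lift2 (\<lambda>x y. Btot (shF A B f) x y + btot A B (ShF A B f) x y) (p0 # p) (q0 # q)"
      unfolding lift2_lin Btot_def lift2_ShF[OF adm] 1 fs_add[OF fs_SR] 2 3 4 5 by simp
  qed
  then show ?thesis by (rule fun_cong[THEN fun_cong, of "\<lambda>x y. ShF A B (pr (hoch_b CC) f) x y + shF A B (pr (Bop CC) f) x y", simplified])
qed


lemma nrm2_act1: assumes T: "\<And>f. nrm A f \<Longrightarrow> nrm A (pr T f)" and g: "nrm2 A B g" shows "nrm2 A B (act1 T g)"
proof -
  have "act1 T g x y = 0" if "\<not> normal B y" for x y
  proof -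
    have "(\<lambda>x'. g x' y) = (\<lambda>_. 0)" by (rule ext) (use g that in \<open>unfold nrm2_def nrm_def, blast\<close>)
    then show ?thesis by (simp add: act1_def fs_zero[OF fs_pr])
  qed
  then show ?thesis using T g unfolding nrm2_def by (auto simp: nrm_def[of B] act1_def)
qed

lemma nrm2_act2: assumes T: "\<And>f. nrm B f \<Longrightarrow> nrm B (pr T f)" and g: "nrm2 A B g" shows "nrm2 A B (act2 A s T g)"
proof -
  have 1: "act2 A s T g x y = 0" if "\<not> normal A x" for x y
  proof -
    have "g x = (\<lambda>_. 0)" by (rule ext) (use g that in \<open>unfold nrm2_def nrm_def, blast\<close>)
    then show ?thesis by (simp add: act2_def fs_zero[OF fs_pr])
  qed
  have "nrm B (act2 A s T g x)" for x
    using T[of "g x"] g unfolding nrm2_def nrm_def by (simp add: act2_def)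
  then show ?thesis using 1 unfolding nrm2_def by (auto simp: nrm_def[of A])
qed

definition "ZZ f = act2 A True (Bop B) (act1 (Bop A) (shF A B f))"

text \<open>Each \<open>B\<close> inserts a unit and rotates its chain, the two units merge into
  one, and the rotated words are shuffled freely. \<open>SR_all\<close> sorts the result by the
  order of the two zeroth letters.\<close>

lemma lift2_Z:
  assumes n: "nrm CC f" and adm: "admL A (p0 # p)" "admL B (q0 # q)"
  shows "lift2 (ZZ f) (p0 # p) (q0 # q) = - (SR (\<lambda>w. lift [] [] f (oC CC 2 # w)) (iA B p0) (map (iA B) p) (iB A q0) (map (iB A) q)
    + SR (\<lambda>w. lift [] [] f (oC CC 2 # w)) (iB A q0) (map (iB A) q) (iA B p0) (map (iA B) p))"
proof -
  note del = psgn_append psgn.simps c1.simps c1_append tags_simps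
  let ?T = "tags (p0 # p) @ 2 # tags (q0 # q)" and ?\<phi> = "\<lambda>w. lift [] [] f (oC CC 2 # w)"
  \<comment> \<open>Arbitrary fresh tags for the units of the two operators \<open>B\<close>: their
    factors \<open>c1\<close> square to 1 and are cancelled in the end.\<close>
  obtain t where t: "t \<notin> set ?T" using ex_new_if_finite[OF infinite_UNIV_nat finite_set] by blast
  obtain s where s: "s \<notin> set (t # ?T)" using ex_new_if_finite[OF infinite_UNIV_nat finite_set] by blast
  let ?k = "c1 s (t # ?T) * c1 t ?T :: 'k"
  have sq: "c1 t ?T * c1 t ?T = (1 :: 'k)" "c1 s (t # ?T) * c1 s (t # ?T) = (1 :: 'k)" using c1_sq[OF t] c1_sq[OF s] by blast+
  have word: "lift [] [] f (([s] @ 2 # [t], (one_idx A, one_idx B)) # w) = - ?k * ?\<phi> w"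
    if "mset (tags w) = mset (tags (p0 # p) @ tags (q0 # q))" for w
  proof -
    have 1: "c1 s (2 # t # tags w) = (c1 s (t # ?T) :: 'k)" "c1 t (2 # tags w) = (c1 t ?T :: 'k)"
      by (rule c1_mset, simp add: that del: tags_simps)+
    have "psgn (s # 2 # t # tags w) = c1 s (2 # t # tags w) * (- c1 t (2 # tags w) * psgn (2 # tags w) :: 'k)"
      by (simp add: sg_swap[of 2 t])
    then show ?thesis unfolding 1 by (simp add: lift_def oC_def del: del) (simp only: tags_simps fst_conv append_Cons append_Nil mult.assoc mult_minus_left)
  qed
  have sh: "lift2 (shF A B f) (oC A s # u @ p0 # v) (oC B t # u' @ q0 # v') = - ?k * shf ?\<phi> (map (iA B) u @ iA B p0 # map (iA B) v) (map (iB A) u' @ iB A q0 # map (iB A) v')"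
    if "p = v @ u" "q = v' @ u'" for u v u' v'
  proof -
    have a: "admL A (oC A s # u @ p0 # v)" "admL B (oC B t # u' @ q0 # v')"
      using adm that gdaD(1)[OF gdA] gdaD(1)[OF gdB] by (auto simp: adm_def oC_def)
    have "lift2 (shF A B f) (oC A s # u @ p0 # v) (oC B t # u' @ q0 # v') = shf (\<lambda>w. lift [] [] f (([s] @ 2 # [t], (one_idx A, one_idx B)) # w)) (map (iA B) (u @ p0 # v)) (map (iB A) (u' @ q0 # v'))"
      unfolding lift2_shF[OF a] by (simp add: oC_def)
    also have "\<dots> = shf (\<lambda>w. - ?k * ?\<phi> w) (map (iA B) (u @ p0 # v)) (map (iB A) (u' @ q0 # v'))"
    proof (rule shf_cong, rule word)
      fix w assume "mset w = mset (map (iA B) (u @ p0 # v)) + mset (map (iB A) (u' @ q0 # v'))"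
      then have "mset w = mset (map (iA B) (p0 # p) @ map (iB A) (q0 # q))" using that by (simp add: ac_simps)
      from tags_mset[OF this] show "mset (tags w) = mset (tags (p0 # p) @ tags (q0 # q))" unfolding tags_simps(3) tags_map .
    qed
    also have "\<dots> = - ?k * shf ?\<phi> (map (iA B) (u @ p0 # v)) (map (iB A) (u' @ q0 # v'))"
      by (rule fs_scale[OF fs_shf])
    finally show ?thesis by simp
  qed
  let ?R = "rot (\<lambda>u c v. rot (\<lambda>u' a v'. shf ?\<phi> (map (iA B) u' @ iA B a # map (iA B) v') (map (iB A) u @ iB A c # map (iB A) v)) p0 p) q0 q"
  have B1: "lift2 (act1 (Bop A) (shF A B f)) (p0 # p) (oC B t # u @ q0 # v)
      = - c1 t ?T * rot (\<lambda>u' a v'. shf ?\<phi> (map (iA B) u' @ iA B a # map (iA B) v') (map (iB A) u @ iB A q0 # map (iB A) v)) p0 p"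
    if q: "q = v @ u" for u v
  proof -
    have m: "c1 s (tags (p0 # p) @ 2 # tags (oC B t # u @ q0 # v)) = (c1 s (t # ?T) :: 'k)"
      by (rule c1_mset) (simp add: q oC_def)
    have "c1 s (t # ?T) * lift2 (act1 (Bop A) (shF A B f)) (p0 # p) (oC B t # u @ q0 # v)
       = rot (\<lambda>u' a v'. lift2 (shF A B f) (oC A s # u' @ a # v') (oC B t # u @ q0 # v)) p0 p"
      using lift2_B1[OF gdA gdB adm(1) nrm2_sh[OF n], of s "oC B t # u @ q0 # v"] unfolding m .
    also have "\<dots> = rot (\<lambda>u' a v'. - ?k * shf ?\<phi> (map (iA B) u' @ iA B a # map (iA B) v') (map (iB A) u @ iB A q0 # map (iB A) v)) p0 p"
      by (rule rot_cong) (simp only: sh q)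
    also have "\<dots> = c1 s (t # ?T) * (- c1 t ?T * rot (\<lambda>u' a v'. shf ?\<phi> (map (iA B) u' @ iA B a # map (iA B) v') (map (iB A) u @ iB A q0 # map (iB A) v)) p0 p)"
      unfolding rot_def spl_scale by (simp only: mult.assoc mult_minus_left mult_minus_right)
    finally show ?thesis by (rule sq_cancel[OF sq(2)])
  qed
  have "c1 t ?T * lift2 (ZZ f) (p0 # p) (q0 # q) = rot (\<lambda>u c v. lift2 (act1 (Bop A) (shF A B f)) (p0 # p) (oC B t # u @ c # v)) q0 q"
    unfolding ZZ_def by (rule lift2_B2[OF gdA gdB adm(1) _ adm(2)]) (simp_all add: nrm2_act1 nrm_B[OF gdA] nrm2_sh[OF n])
  also have "\<dots> = rot (\<lambda>u c v. - c1 t ?T * rot (\<lambda>u' a v'. shf ?\<phi> (map (iA B) u' @ iA B a # map (iA B) v') (map (iB A) u @ iB A c # map (iB A) v)) p0 p) q0 q"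
    by (rule rot_cong) (rule B1)
  also have "\<dots> = c1 t ?T * - ?R"
    unfolding rot_def[of _ q0] spl_scale by simp
  finally have Z: "lift2 (ZZ f) (p0 # p) (q0 # q) = - ?R" by (rule sq_cancel[OF sq(1)])
  have "?R = SR ?\<phi> (iB A q0) (map (iB A) q) (iA B p0) (map (iA B) p) + SR ?\<phi> (iA B p0) (map (iA B) p) (iB A q0) (map (iB A) q)"
    unfolding SR_all rot_map by (simp add: shf_commute)
  then show ?thesis unfolding Z by (simp add: add.commute)
qed


section \<open>Splitting the connection along the two differentials\<close>

lemma LD_split: "LD (DC CC \<epsilon>) \<phi> w = LD (DC (cA A B) \<epsilon>) \<phi> w + LD (DC (cB A B) \<epsilon>) \<phi> w"
  by (induction w arbitrary: \<phi>) (simp_all add: DC_split[OF dA dB] Fst_0)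

lemma edel_split: "pr (edel CC) f c = pr (edel (cA A B)) f c + pr (edel (cB A B)) f c"
proof -
  have "pr (edel CC) f c - pr (edel (cA A B)) f c - pr (edel (cB A B)) f c = 0"
  proof (rule lift_eq0I[where A="CC"])
    fix a w assume *: "admL CC (a # w)" "low 2 (tags (a # w))"
    have l: "low 1 ([] @ tags (a # w) @ [])" using lowD(1)[OF *(2)] by simp
    have "ehat mm (DC CC 1) \<Psi> a w = ehat mm eA \<Psi> a w + ehat mm eB \<Psi> a w" for \<Psi>
      by (cases w) (simp_all add: ehat_def DC_split[OF dA dB])
    then have "lift [] [] (pr (edel CC) f) (a # w) = lift [] [] (pr (edel (cA A B)) f) (a # w) + lift [] [] (pr (edel (cB A B)) f) (a # w)"
      using lift_edel[OF gdC *(1) l, of 0 f] lift_edel[OF gcA _ l, of 0 f] lift_edel[OF gcB _ l, of 0 f] *(1) unfolding mC_c adm_c by simp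
    then show "lift [] [] (\<lambda>c. pr (edel CC) f c - pr (edel (cA A B)) f c - pr (edel (cB A B)) f c) (a # w) = 0"
      by (simp add: lift_def algebra_simps del: psgn_append psgn.simps tags_simps)
  qed
  then show ?thesis by (simp add: algebra_simps)
qed

lemma Ebig_split: "pr (Ebig CC) f c = pr (Ebig (cA A B)) f c + pr (Ebig (cB A B)) f c"
proof -
  have "pr (Ebig CC) f c - pr (Ebig (cA A B)) f c - pr (Ebig (cB A B)) f c = 0"
  proof (rule lift_eq0I[where A="CC"])
    fix a w assume *: "admL CC (a # w)" "low 2 (tags (a # w))"
    have l: "low 1 ([] @ tags (a # w) @ [])" using lowD(1)[OF *(2)] by simp
    have "rotE (DC CC 1) \<psi> a w = rotE eA \<psi> a w + rotE eB \<psi> a w" for \<psi>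
      by (simp add: rotE_def LD_split spl_add)
    then have "lift [] [] (pr (Ebig CC) f) (a # w) = lift [] [] (pr (Ebig (cA A B)) f) (a # w) + lift [] [] (pr (Ebig (cB A B)) f) (a # w)"
      using lift_Ebig[OF gdC *(1) l, of 0 f] lift_Ebig[OF gcA _ l, of 0 f] lift_Ebig[OF gcB _ l, of 0 f] *(1) unfolding mC_c adm_c by simp
    then show "lift [] [] (\<lambda>c. pr (Ebig CC) f c - pr (Ebig (cA A B)) f c - pr (Ebig (cB A B)) f c) (a # w) = 0"
      by (simp add: lift_def algebra_simps del: psgn_append psgn.simps tags_simps)
  qed
  then show ?thesis by (simp add: algebra_simps)
qed

lemma lift2_e_map:
  assumes adm: "admL A (p0 # p)" "admL B (q0 # q)" and low: "low 1 (tags (p0 # p) @ 2 # tags (q0 # q))"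
  shows "(\<And>q0' q'. admL B (q0' # q') \<Longrightarrow> lift2 g (p0 # p) (q0' # q') = - G (iB A q0') (map (iB A) q')) \<Longrightarrow>
      lift2 (act2 A False (edel B) g) (p0 # p) (q0 # q) = ehat mm eB G (iB A q0) (map (iB A) q)"
    "(\<And>p0' p'. admL A (p0' # p') \<Longrightarrow> lift2 g (p0' # p') (q0 # q) = - G (iA B p0') (map (iA B) p')) \<Longrightarrow>
      lift2 (act1 (edel A) g) (p0 # p) (q0 # q) = ehat mm eA G (iA B p0) (map (iA B) p)"
proof -
  assume g: "\<And>q0' q'. admL B (q0' # q') \<Longrightarrow> lift2 g (p0 # p) (q0' # q') = - G (iB A q0') (map (iB A) q')"
  have "ehat (mC B 0) (DC B 1) (\<lambda>c v. lift2 g (p0 # p) (c # v)) q0 q = ehat (mC B 0) (DC B 1) (\<lambda>c v. (\<lambda>W. - G (iB A (hd W)) (map (iB A) (tl W))) (c # v)) q0 q"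
  proof (rule ehat_cong[OF gdB adm(2)])
    fix W assume W: "admL B W" "W \<noteq> []"
    obtain w W' where e: "W = w # W'" using W(2) by (cases W) auto
    show "lift2 g (p0 # p) W = - G (iB A (hd W)) (map (iB A) (tl W))" using g[OF W(1)[unfolded e]] by (simp add: e)
  qed
  then show "lift2 (act2 A False (edel B) g) (p0 # p) (q0 # q) = ehat mm eB G (iB A q0) (map (iB A) q)"
    unfolding lift2_e2[OF gdA gdB adm(1) list.simps(3) adm(2) low] list.sel ehat_minus
    using ehat_map[where g="iB A" and m="mm" and m'="mC B 0" and E="eB" and E'="DC B 1" and \<Psi>=G and a=q0 and w=q, OF mC_iB[OF dA dB] DC_iB(2)[OF dA dB]] by simp
next
  assume g: "\<And>p0' p'. admL A (p0' # p') \<Longrightarrow> lift2 g (p0' # p') (q0 # q) = - G (iA B p0') (map (iA B) p')"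
  have "ehat (mC A 0) (DC A 1) (\<lambda>c v. lift2 g (c # v) (q0 # q)) p0 p = ehat (mC A 0) (DC A 1) (\<lambda>c v. (\<lambda>W. - G (iA B (hd W)) (map (iA B) (tl W))) (c # v)) p0 p"
  proof (rule ehat_cong[OF gdA adm(1)])
    fix W assume W: "admL A W" "W \<noteq> []"
    obtain w W' where e: "W = w # W'" using W(2) by (cases W) auto
    show "lift2 g W (q0 # q) = - G (iA B (hd W)) (map (iA B) (tl W))" using g[OF W(1)[unfolded e]] by (simp add: e)
  qed
  then show "lift2 (act1 (edel A) g) (p0 # p) (q0 # q) = ehat mm eA G (iA B p0) (map (iA B) p)"
    unfolding lift2_e1[OF gdA gdB adm(1) low] list.sel ehat_minus
    using ehat_map[where g="iA B" and m="mm" and m'="mC A 0" and E="eA" and E'="DC A 1" and \<Psi>=G and a=p0 and w=p, OF mC_iA[OF dA dB] DC_iA(2)[OF dA dB]] by simp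
qed

lemma lift2_sh_e:
  assumes adm: "admL A (p0 # p)" "admL B (q0 # q)" and low: "low 1 (tags (p0 # p) @ 2 # tags (q0 # q))"
    and X: "gda X" "adm X = adm CC" "mC X = mC CC"
  shows "lift2 (shF A B (pr (edel X) f)) (p0 # p) (q0 # q) = shf (\<lambda>w. mC CC 2 (iA B p0) (iB A q0) (\<lambda>z. ehat mm (DC X 1) (\<lambda>z w. lift [] [] f (z # w)) z w)) (map (iA B) p) (map (iB A) q)"
  unfolding sh_word lift2_shF[OF adm] fs_minus[OF fs_shf, symmetric]
proof (rule shf_sh_cong[OF adm low])
  fix w assume w: "admL CC (LL p0 q0 # w)" "low 1 (tags (LL p0 q0 # w))"
  have l: "low 1 ([] @ tags (LL p0 q0 # w) @ [])" using w(2) by (simp del: tags_simps)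
  show "lift [] [] (pr (edel X) f) (LL p0 q0 # w) = - ehat mm (DC X 1) (\<lambda>z w. lift [] [] f (z # w)) (LL p0 q0) w"
    using lift_edel[OF X(1) _ l, of 0 f] w(1) unfolding X(2,3) by simp
qed

lemma adm_c': "adm (cA A B) = adm CC" "adm (cB A B) = adm CC"
  by (rule ext, rule adm_c)+

text \<open>After shuffling, the first bar entry may come from either factor, but d'' kills the
  letters of the first factor and d' those of the second.\<close>

lemma e_sh: "shF A B (pr (edel (cB A B)) f) = act2 A False (edel B) (shF A B f)"
   "shF A B (pr (edel (cA A B)) f) = act1 (edel A) (shF A B f)"
proof -
  show "shF A B (pr (edel (cB A B)) f) = act2 A False (edel B) (shF A B f)"
  proof (rule lift2_eqI[OF gdA gdB])
    fix p0 p q0 q assume adm: "admL A (p0 # p)" "admL B (q0 # q)" and low: "low 1 (tags (p0 # p) @ 2 # tags (q0 # q))"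
    let ?X = "iA B p0" and ?P = "map (iA B) p" and ?Y = "iB A q0" and ?Q = "map (iB A) q"
    let ?G = "\<lambda>q0 q. shf (\<lambda>w. mC CC 2 ?X q0 (\<lambda>z. lift [] [] f (z # w))) ?P q"
    have "lift2 (shF A B (pr (edel (cB A B)) f)) (p0 # p) (q0 # q) = ehat mm eB ?G ?Y ?Q"
      unfolding lift2_sh_e[OF adm low gcB adm_c'(2) mC_c(2)]
    proof (rule letter_ops_E.shf_ehat[OF letter_ops_E_C fs_mC])
      show "set ?P \<subseteq> PA" "set ?Q \<subseteq> QB" using adm PQ by (simp_all del: set_map)
      show "DC (cB A B) 1 x G = 0" if "x \<in> PA" for x G using that DC_iA(3)[OF dA dB] by (auto simp: PA_def)
      show "mC CC 2 ?X ?Y (\<lambda>z. eB x (\<lambda>f'. mm z f' (\<lambda>t. lift [] [] f (t # w)))) = eB x (\<lambda>f'. mm ?Y f' (\<lambda>z. mC CC 2 ?X z (\<lambda>t. lift [] [] f (t # w))))"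
        if "x \<in> QB" for x w
      proof -
        have a: "adm A p0" "adm B q0" using adm by auto
        show ?thesis using that rel_ehat_B[OF dA dB a] unfolding lift_is_loc0 QB_def by blast
      qed
    qed
    also have "\<dots> = lift2 (act2 A False (edel B) (shF A B f)) (p0 # p) (q0 # q)"
      by (rule lift2_e_map(1)[OF adm low, symmetric]) (rule lift2_sh'[OF adm(1)])
    finally show "lift2 (shF A B (pr (edel (cB A B)) f)) (p0 # p) (q0 # q) = lift2 (act2 A False (edel B) (shF A B f)) (p0 # p) (q0 # q)" .
  qed
  show "shF A B (pr (edel (cA A B)) f) = act1 (edel A) (shF A B f)"
  proof (rule lift2_eqI[OF gdA gdB])
    fix p0 p q0 q assume adm: "admL A (p0 # p)" "admL B (q0 # q)" and low: "low 1 (tags (p0 # p) @ 2 # tags (q0 # q))"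
    let ?X = "iA B p0" and ?P = "map (iA B) p" and ?Y = "iB A q0" and ?Q = "map (iB A) q"
    let ?G = "\<lambda>p0 p. shf (\<lambda>w. mC CC 2 p0 ?Y (\<lambda>z. lift [] [] f (z # w))) ?Q p"
    have "lift2 (shF A B (pr (edel (cA A B)) f)) (p0 # p) (q0 # q) = ehat mm eA ?G ?X ?P"
      unfolding lift2_sh_e[OF adm low gcA adm_c'(1) mC_c(1)] shf_commute[of _ ?P ?Q]
    proof (rule letter_ops_E.shf_ehat[OF letter_ops_E_C, where m'="\<lambda>x y. mC CC 2 y x", OF fs_mC])
      show "set ?P \<subseteq> PA" "set ?Q \<subseteq> QB" using adm PQ by (simp_all del: set_map)
      show "DC (cA A B) 1 x G = 0" if "x \<in> QB" for x G using that DC_iB(3)[OF dA dB] by (auto simp: QB_def)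
      show "mC CC 2 ?X ?Y (\<lambda>z. eA x (\<lambda>f'. mm z f' (\<lambda>t. lift [] [] f (t # w)))) = eA x (\<lambda>f'. mm ?X f' (\<lambda>z. mC CC 2 z ?Y (\<lambda>t. lift [] [] f (t # w))))"
        if "x \<in> PA" for x w
      proof -
        have a: "adm A p0" "adm B q0" using adm by auto
        show ?thesis using that rel_ehat_A[OF dA dB a] unfolding lift_is_loc0 PA_def by blast
      qed
    qed
    also have "\<dots> = lift2 (act1 (edel A) (shF A B f)) (p0 # p) (q0 # q)"
      by (rule lift2_e_map(2)[OF adm low, symmetric], subst shf_commute) (rule lift2_sh'[OF _ adm(2)])
    finally show "lift2 (shF A B (pr (edel (cA A B)) f)) (p0 # p) (q0 # q) = lift2 (act1 (edel A) (shF A B f)) (p0 # p) (q0 # q)" .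
  qed
qed

lemma E_on_adm: "gda X \<Longrightarrow> letter_ops_E.E_on (DC X \<epsilon>) {x. adm X x}"
  unfolding letter_ops_E.E_on_def[OF letter_ops_E_C] by (auto intro: DC_adm)

lemma lift2_E_sh:
  assumes adm: "admL A (p0 # p)" "admL B (q0 # q)" and low: "low 1 (tags (p0 # p) @ 2 # tags (q0 # q))"
  shows "lift2 (act1 (Ebig A) (shF A B f)) (p0 # p) (q0 # q)
      = - rotE eA (\<lambda>u a v. shf (JJ f (iB A q0)) (u @ a # v) (map (iB A) q)) (iA B p0) (map (iA B) p)"
    "lift2 (act2 A False (Ebig B) (shF A B f)) (p0 # p) (q0 # q)
      = rotE eB (\<lambda>u a v. shf (JJ f (iA B p0)) (map (iA B) p) (u @ a # v)) (iB A q0) (map (iB A) q)"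
    "gda X \<Longrightarrow> adm X = adm CC \<Longrightarrow> oC X = oC CC \<Longrightarrow> lift2 (shF A B (pr (Ebig X) f)) (p0 # p) (q0 # q)
      = - shf (rotE (DC X 1) (\<lambda>u a v. lift [] [] f (oC CC 0 # u @ a # v)) (LL p0 q0)) (map (iA B) p) (map (iB A) q)"
proof -
  have "rotE (DC A 1) (\<lambda>u a v. lift2 (shF A B f) (oC A 0 # u @ a # v) (q0 # q)) p0 p
    = rotE (DC A 1) (\<lambda>u a v. shf (JJ f (iB A q0)) (map (iA B) u @ iA B a # map (iA B) v) (map (iB A) q)) p0 p"
  proof (rule letter_ops_E.rotE_cong[OF letter_ops_E_C E_on_adm[OF gdA]])
    show "set p \<subseteq> {x. adm A x}" using adm(1) by auto
    fix u v assume "set u \<subseteq> {x. adm A x}" "set v \<subseteq> {x. adm A x}"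
    then have "admL A (p0 # u @ p0 # v)" using adm(1) by auto
    from sh_o(2)[OF this adm(2)] show "lift2 (shF A B f) (oC A 0 # u @ p0 # v) (q0 # q) = shf (JJ f (iB A q0)) (map (iA B) u @ iA B p0 # map (iA B) v) (map (iB A) q)" by simp
  qed
  then show "lift2 (act1 (Ebig A) (shF A B f)) (p0 # p) (q0 # q)
      = - rotE eA (\<lambda>u a v. shf (JJ f (iB A q0)) (u @ a # v) (map (iB A) q)) (iA B p0) (map (iA B) p)"
    unfolding lift2_E1[OF gdA gdB adm(1) low] rotE_map[where g="iA B" and E="eA" and E'="DC A 1", OF DC_iA(2)[OF dA dB]] by simp
  have "rotE (DC B 1) (\<lambda>u a v. lift2 (shF A B f) (p0 # p) (oC B 0 # u @ a # v)) q0 q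
    = rotE (DC B 1) (\<lambda>u a v. - shf (JJ f (iA B p0)) (map (iA B) p) (map (iB A) u @ iB A a # map (iB A) v)) q0 q"
  proof (rule letter_ops_E.rotE_cong[OF letter_ops_E_C E_on_adm[OF gdB]])
    show "set q \<subseteq> {x. adm B x}" using adm(2) by auto
    fix u v assume "set u \<subseteq> {x. adm B x}" "set v \<subseteq> {x. adm B x}"
    then have "admL B (q0 # u @ q0 # v)" using adm(2) by auto
    from sh_o(1)[OF adm(1) this] show "lift2 (shF A B f) (p0 # p) (oC B 0 # u @ q0 # v) = - shf (JJ f (iA B p0)) (map (iA B) p) (map (iB A) u @ iB A q0 # map (iB A) v)" by simp
  qed
  then show "lift2 (act2 A False (Ebig B) (shF A B f)) (p0 # p) (q0 # q)
      = rotE eB (\<lambda>u a v. shf (JJ f (iA B p0)) (map (iA B) p) (u @ a # v)) (iB A q0) (map (iB A) q)"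
    unfolding lift2_E2[OF gdA gdB adm(1) list.simps(3) adm(2) low] rotE_map[where g="iB A" and E="eB" and E'="DC B 1", OF DC_iB(2)[OF dA dB]] rotE_minus by simp
  assume X: "gda X" "adm X = adm CC" "oC X = oC CC"
  show "lift2 (shF A B (pr (Ebig X) f)) (p0 # p) (q0 # q)
      = - shf (rotE (DC X 1) (\<lambda>u a v. lift [] [] f (oC CC 0 # u @ a # v)) (LL p0 q0)) (map (iA B) p) (map (iB A) q)"
    unfolding lift2_shF[OF adm] fs_minus[OF fs_shf, symmetric]
  proof (rule shf_sh_cong[OF adm low])
    fix w assume w: "admL CC (LL p0 q0 # w)" "low 1 (tags (LL p0 q0 # w))"
    have l: "low 1 ([] @ tags (LL p0 q0 # w) @ [])" using w(2) by (simp del: tags_simps)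
    show "lift [] [] (pr (Ebig X) f) (LL p0 q0 # w) = - rotE (DC X 1) (\<lambda>u a v. lift [] [] f (oC CC 0 # u @ a # v)) (LL p0 q0) w"
      using lift_Ebig[OF X(1) _ l, of 0 f] w(1) unfolding X(2,3) by simp
  qed
qed

lemma ShF_e:
  assumes adm: "admL A (p0 # p)" "admL B (q0 # q)" and low: "low 1 (tags (p0 # p) @ 2 # tags (q0 # q))"
    and X: "gda X" "adm X = adm CC" "mC X = mC CC"
  shows "SR (\<lambda>w. lift [] [] (pr (edel X) f) (oC CC 2 # w)) (iA B p0) (map (iA B) p) (iB A q0) (map (iB A) q)
      = - SR (Fst (\<lambda>x w. DC X 1 x (\<lambda>f'. JJ f f' w))) (iA B p0) (map (iA B) p) (iB A q0) (map (iB A) q)"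
    "SR (\<lambda>w. lift [] [] (pr (edel X) f) (oC CC 2 # w)) (iB A q0) (map (iB A) q) (iA B p0) (map (iA B) p)
      = - SR (Fst (\<lambda>x w. DC X 1 x (\<lambda>f'. JJ f f' w))) (iB A q0) (map (iB A) q) (iA B p0) (map (iA B) p)"
proof -
  have *: "lift [] [] (pr (edel X) f) (oC CC 2 # w) = - Fst (\<lambda>x w. DC X 1 x (\<lambda>f'. JJ f f' w)) w" if "admL CC w" "low 1 (tags w)" for w
  proof -
    have a: "admL CC (oC CC 2 # w)" using that(1) gdaD(1)[OF gdC] by (auto simp: adm_def oC_def)
    have l: "low 1 ([] @ tags (oC CC 2 # w) @ [])" using that(2) by (simp add: oC_def)
    show ?thesis using lift_edel[OF X(1) _ l, of 0 f] a unfolding X(2,3) ehat_def by simp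
  qed
  show "SR (\<lambda>w. lift [] [] (pr (edel X) f) (oC CC 2 # w)) (iA B p0) (map (iA B) p) (iB A q0) (map (iB A) q)
      = - SR (Fst (\<lambda>x w. DC X 1 x (\<lambda>f'. JJ f f' w))) (iA B p0) (map (iA B) p) (iB A q0) (map (iB A) q)"
    unfolding fs_minus[OF fs_SR, symmetric] by (rule SR_word_cong(1)[OF adm low *])
  show "SR (\<lambda>w. lift [] [] (pr (edel X) f) (oC CC 2 # w)) (iB A q0) (map (iB A) q) (iA B p0) (map (iA B) p)
      = - SR (Fst (\<lambda>x w. DC X 1 x (\<lambda>f'. JJ f f' w))) (iB A q0) (map (iB A) q) (iA B p0) (map (iA B) p)"
    unfolding fs_minus[OF fs_SR, symmetric] by (rule SR_word_cong(2)[OF adm low *])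
qed


section \<open>The commutators of \<open>b\<close> with Q and P\<close>

lemma SE_word_cong:
  assumes "admL CC (l0 # l @ r0 # r)" "low 0 (tags (l0 # l @ r0 # r))" "gda X" "adm X = adm CC"
    and "\<And>w. admL CC w \<Longrightarrow> low 0 (tags w) \<Longrightarrow> length (tags w) = Suc (length (tags (l0 # l @ r0 # r))) \<Longrightarrow> \<phi> w = \<psi> w"
  shows "SE (DC X 1) \<phi> l0 l r0 r = SE (DC X 1) \<psi> l0 l r0 r"
proof (rule SE_DC_cong, rule assms(5))
  fix u x z v W assume *: "r = u @ x # v" "dif X (snd x) (snd z) \<noteq> 0" "fst z = 1 # fst x" "mset W = mset (l0 # l @ r0 # u @ z # v)"
  have "adm CC x" using assms(1) *(1) by simp
  then have "adm CC z" using adm_DC[OF assms(3) _ *(2,3)] unfolding assms(4) by blast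
  moreover have "set W = set (l0 # l @ r0 # u @ z # v)" using *(4) by (metis set_mset_mset)
  ultimately show "admL CC W" using assms(1) *(1) by auto
  have "set (tags W) = set (tags (l0 # l @ r0 # u @ z # v))" using tags_mset[OF *(4)] by (metis set_mset_mset)
  then show "low 0 (tags W)" using assms(2) *(1,3) by (auto simp: low_def)
  show "length (tags W) = Suc (length (tags (l0 # l @ r0 # r)))" using arg_cong[OF tags_mset[OF *(4)], of size] *(1,3) by simp
qed

lemma leib_PQ: "letter_ops_E.leib mm dD eB QB (lift U V f)" "letter_ops_E.leib mm dD eA PA (lift U V f)"
proof -
  show "letter_ops_E.leib mm dD eB QB (lift U V f)"
    unfolding letter_ops_E.leib_def[OF letter_ops_E_C] ann_def
  proof (intro conjI ballI allI)
    fix x y u w assume "x \<in> QB" "y \<in> QB"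
    then obtain x' y' where xy: "adm B x'" "x = iB A x'" "y = iB A y'" by (auto simp: QB_def)
    show "mm x y (\<lambda>z. eB z (\<lambda>z. lift U V f (u @ z # w))) - eB x (\<lambda>x'. mm x' y (\<lambda>z. lift U V f (u @ z # w))) - eB y (\<lambda>y'. mm x y' (\<lambda>z. lift U V f (u @ z # w))) = 0"
      unfolding lift_is_loc xy(2,3) rel_leib_B(1)[OF dA dB xy(1)] by simp
  next
    fix x u w assume "x \<in> QB"
    then obtain x' where xy: "adm B x'" "x = iB A x'" by (auto simp: QB_def)
    show "dD x (\<lambda>y. eB y (\<lambda>z. lift U V f (u @ z # w))) - eB x (\<lambda>y. dD y (\<lambda>z. lift U V f (u @ z # w))) = 0"
      unfolding lift_is_loc xy(2) rel_leib_B(2,3)[OF dA dB xy(1)] by simp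
  qed
  show "letter_ops_E.leib mm dD eA PA (lift U V f)"
    unfolding letter_ops_E.leib_def[OF letter_ops_E_C] ann_def
  proof (intro conjI ballI allI)
    fix x y u w assume "x \<in> PA" "y \<in> PA"
    then obtain x' y' where xy: "adm A x'" "x = iA B x'" "y = iA B y'" by (auto simp: PA_def)
    show "mm x y (\<lambda>z. eA z (\<lambda>z. lift U V f (u @ z # w))) - eA x (\<lambda>x'. mm x' y (\<lambda>z. lift U V f (u @ z # w))) - eA y (\<lambda>y'. mm x y' (\<lambda>z. lift U V f (u @ z # w))) = 0"
      unfolding lift_is_loc xy(2,3) rel_leib_A(1)[OF dA dB xy(1)] by simp
  next
    fix x u w assume "x \<in> PA"
    then obtain x' where xy: "adm A x'" "x = iA B x'" by (auto simp: PA_def)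
    show "dD x (\<lambda>y. eA y (\<lambda>z. lift U V f (u @ z # w))) - eA x (\<lambda>y. dD y (\<lambda>z. lift U V f (u @ z # w))) = 0"
      unfolding lift_is_loc xy(2) rel_leib_A(2,3)[OF dA dB xy(1)] by simp
  qed
qed

lemma E_on_PQ: "letter_ops_E.E_on eB QB" "letter_ops_E.E_on eA PA"
proof -
  show "letter_ops_E.E_on eB QB"
    unfolding letter_ops_E.E_on_def[OF letter_ops_E_C]
  proof (intro ballI allI impI)
    fix x and G G' :: "nat list \<times> 'i \<times> 'j \<Rightarrow> 'k" assume "x \<in> QB" and G: "\<forall>y\<in>QB. G y = G' y"
    then obtain x' where x: "adm B x'" "x = iB A x'" by (auto simp: QB_def)
    show "eB x G = eB x G'" unfolding x(2) DC_iB(2)[OF dA dB]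
      by (rule DC_adm[OF gdB x(1)]) (rule bspec[OF G], simp add: QB_def)
  qed
  show "letter_ops_E.E_on eA PA"
    unfolding letter_ops_E.E_on_def[OF letter_ops_E_C]
  proof (intro ballI allI impI)
    fix x and G G' :: "nat list \<times> 'i \<times> 'j \<Rightarrow> 'k" assume "x \<in> PA" and G: "\<forall>y\<in>PA. G y = G' y"
    then obtain x' where x: "adm A x'" "x = iA B x'" by (auto simp: PA_def)
    show "eA x G = eA x G'" unfolding x(2) DC_iA(2)[OF dA dB]
      by (rule DC_adm[OF gdA x(1)]) (rule bspec[OF G], simp add: PA_def)
  qed
qed

lemma lift2_btot_H:
  assumes adm: "admL A (p0 # p)" "admL B (q0 # q)" and low: "low 1 (tags (p0 # p) @ 2 # tags (q0 # q))"
    and H: "\<And>p0 p q0 q. admL A (p0 # p) \<Longrightarrow> admL B (q0 # q) \<Longrightarrow>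
      c1 1 (tags (p0 # p) @ 2 # tags (q0 # q)) * lift2 H (p0 # p) (q0 # q) = G (iA B p0) (map (iA B) p) (iB A q0) (map (iB A) q)"
  shows "lift2 (btot A B H) (p0 # p) (q0 # q) = - (bch mm dD (\<lambda>a w. G a w (iB A q0) (map (iB A) q)) (iA B p0) (map (iA B) p)
    + bch mm dD (\<lambda>a w. G (iA B p0) (map (iA B) p) a w) (iB A q0) (map (iB A) q))"
proof (rule lift2_btot[OF adm low_01[OF low]])
  fix p0' p' q0' q' assume a: "admL A (p0' # p')" "admL B (q0' # q')"
    and t: "mset (tags (p0' # p') @ tags (q0' # q')) = add_mset 0 (mset (tags (p0 # p) @ tags (q0 # q)))"
  have "c1 1 (tags (p0' # p') @ 2 # tags (q0' # q')) = (c1 1 (0 # tags (p0 # p) @ 2 # tags (q0 # q)) :: 'k)"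
    by (rule c1_mset) (use t in simp)
  \<comment> \<open>The tag 0 of \<open>b\<close> is below the tag 1 of the differential: the
    homotopies are odd, and their commutator with \<open>b\<close> is an anticommutator.\<close>
  also have "\<dots> = - 1" using low_c1[OF low, where ?'a='k] by (simp add: sg_def del: tags_simps)
  finally have "- lift2 H (p0' # p') (q0' # q') = G (iA B p0') (map (iA B) p') (iB A q0') (map (iB A) q')"
    using H[OF a] by simp
  from this[symmetric] show "lift2 H (p0' # p') (q0' # q') = - G (iA B p0') (map (iA B) p') (iB A q0') (map (iB A) q')" by simp
qed

text \<open>Four sources: the wall gives E'' after \<open>sh\<close>, the boundary term with
  \<open>p0\<close> in front gives \<open>sh\<close> after 1 \<otimes> E, the excess of
  \<open>rotE_ddp\<close> gives \<open>Sh\<close> after 1 \<otimes> e, and a differentiated last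
  letter moved to the front gives e'' after \<open>Sh\<close>.\<close>

lemma b_HQ:
  assumes n: "nrm CC f"
  shows "HQ A B (pr (hoch_b CC) f) x y + btot A B (HQ A B f) x y
    = act2 A False (Ebig B) (shF A B f) x y - shF A B (pr (Ebig (cB A B)) f) x y + act2 A False (edel B) (ShF A B f) x y - ShF A B (pr (edel (cB A B)) f) x y"
    (is "?L x y = ?R x y")
proof -
  have "?L = ?R"
  proof (rule lift2_eqI[OF gdA gdB])
    fix p0 p q0 q assume adm: "admL A (p0 # p)" "admL B (q0 # q)" and low: "low 1 (tags (p0 # p) @ 2 # tags (q0 # q))"
    let ?X = "iA B p0" and ?P = "map (iA B) p" and ?Y = "iB A q0" and ?Q = "map (iB A) q"
    let ?\<phi> = "\<lambda>w. lift [] [] f (oC CC 2 # w)"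
    note LE = letter_ops_E_C[of "dga_tensor A B" 0 "dga_tensor A B" 0 "cB A B" 1]
    have a: "set ?P \<subseteq> PA" "?X \<in> PA" "set ?Q \<subseteq> QB" "?Y \<in> QB" using adm PQ by (simp_all del: set_map)
    have aw: "admL CC (?X # ?P @ ?Y # ?Q)" "low 0 (tags (?X # ?P @ ?Y # ?Q))" using adm adm_i low_01[OF low] by auto
    have 0: "lift2 (HQ A B (pr (hoch_b CC) f)) (p0 # p) (q0 # q) = SE eB (\<lambda>w. dd mm dD ?\<phi> w + (Fst (JJ f) w - Lst (JJ f) w)) ?X ?P ?Y ?Q"
    proof -
      have "lift2 (HQ A B (pr (hoch_b CC) f)) (p0 # p) (q0 # q) = SE eB (\<lambda>w. lift [] [] (pr (hoch_b CC) f) (oC CC 2 # w)) ?X ?P ?Y ?Q"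
        using lift2_H(1)[OF gdA gdB adm, of "pr (hoch_b CC) f"] unfolding low_c1[OF low] mult_1 .
      also have "\<dots> = SE eB (\<lambda>w. dd mm dD ?\<phi> w + (Fst (JJ f) w - Lst (JJ f) w)) ?X ?P ?Y ?Q"
        by (rule SE_word_cong[OF aw gcB adm_c'(2)]) (rule lift_b_o)
      finally show ?thesis .
    qed
    have 1: "SE eB (dd mm dD ?\<phi>) ?X ?P ?Y ?Q = bch mm dD (\<lambda>p0 p. SE eB ?\<phi> p0 p ?Y ?Q) ?X ?P + bch mm dD (\<lambda>q0 q. SE eB ?\<phi> ?X ?P q0 q) ?Y ?Q
      + rot (\<lambda>p2 p0 p1. rotE eB (\<lambda>q2 q0 q1. shf (\<lambda>x. shf (\<lambda>y. mm p0 q0 (\<lambda>z. ?\<phi> (x @ z # y))) p1 q1) p2 q2) ?Y ?Q) ?X ?P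
      + ehat mm eB (\<lambda>q0 q. SR ?\<phi> ?X ?P q0 q) ?Y ?Q"
      by (rule letter_ops_E.SE_dd[OF LE comm_Cons[OF comm_PQ] a letter_ops_E.leib_Cons[OF LE leib_PQ(1)] E_on_PQ(1)])
    have 2: "rot (\<lambda>p2 p0 p1. rotE eB (\<lambda>q2 q0 q1. shf (\<lambda>x. shf (\<lambda>y. mm p0 q0 (\<lambda>z. ?\<phi> (x @ z # y))) p1 q1) p2 q2) ?Y ?Q) ?X ?P
        = - lift2 (shF A B (pr (Ebig (cB A B)) f)) (p0 # p) (q0 # q)"
    proof -
      have "rot (\<lambda>p2 p0 p1. rotE eB (\<lambda>q2 q0 q1. shf (\<lambda>x. shf (\<lambda>y. mm p0 q0 (\<lambda>z. ?\<phi> (x @ z # y))) p1 q1) p2 q2) ?Y ?Q) ?X ?P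
        = rot (\<lambda>p2 _ p1. rotE eB (\<lambda>q2 _ q1. shf (\<lambda>x. shf (\<lambda>y. lift [] [] f (oC CC 0 # x @ LL p0 q0 # y)) p1 q1) p2 q2) ?Y ?Q) ?X ?P"
        by (rule rot_cong, rule rotE_cong') (simp only: wall_m)
      also have "\<dots> = shf (rotE eB (\<lambda>u a v. lift [] [] f (oC CC 0 # u @ a # v)) (LL p0 q0)) ?P ?Q"
        by (rule letter_ops_E.wall_rotE[OF LE, symmetric]) (auto simp: DC_iA(3)[OF dA dB])
      finally show ?thesis unfolding lift2_E_sh(3)[OF adm low gcB adm_c'(2) mC_c(4)] by simp
    qed
    have 3: "SE eB (\<lambda>w. Fst (JJ f) w - Lst (JJ f) w) ?X ?P ?Y ?Q = lift2 (act2 A False (Ebig B) (shF A B f)) (p0 # p) (q0 # q)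
        - lift2 (ShF A B (pr (edel (cB A B)) f)) (p0 # p) (q0 # q)"
      unfolding lift2_E_sh(2)[OF adm low] lift2_ShF[OF adm] ShF_e(1)[OF adm low gcB adm_c'(2) mC_c(2)] minus_minus
      by (rule letter_ops_E.SE_cyc[OF LE _ a(1,2)]) (auto simp: PA_def DC_iA(3)[OF dA dB])
    have 4: "ehat mm eB (\<lambda>q0 q. SR ?\<phi> ?X ?P q0 q) ?Y ?Q = lift2 (act2 A False (edel B) (ShF A B f)) (p0 # p) (q0 # q)"
      by (rule lift2_e_map(1)[OF adm low, symmetric]) (rule lift2_ShF[OF adm(1)])
    have 5: "lift2 (btot A B (HQ A B f)) (p0 # p) (q0 # q) = - (bch mm dD (\<lambda>p0 p. SE eB ?\<phi> p0 p ?Y ?Q) ?X ?P + bch mm dD (\<lambda>q0 q. SE eB ?\<phi> ?X ?P q0 q) ?Y ?Q)"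
      by (rule lift2_btot_H[OF adm low, where G="SE eB ?\<phi>"]) (rule lift2_H(1)[OF gdA gdB])
    show "lift2 ?L (p0 # p) (q0 # q) = lift2 ?R (p0 # p) (q0 # q)"
      unfolding lift2_lin 0 fs_add[OF fs_SE[OF fs_DC]] 1 2 3 4 5 by simp
  qed
  then show ?thesis by (rule fun_cong[THEN fun_cong])
qed

text \<open>The argument of \<open>b_HQ\<close> with the factors exchanged. The sum
  \<open>SR\<close> with \<open>q0\<close> to the left of \<open>p0\<close> is expressed through
  \<open>ZZ\<close> and \<open>ShF\<close> by \<open>lift2_Z\<close>, and the wall changes its
  sign.\<close>

lemma b_HP:
  assumes n: "nrm CC f"
  shows "HP A B (pr (hoch_b CC) f) x y + btot A B (HP A B f) x y
    = shF A B (pr (Ebig (cA A B)) f) x y - act1 (Ebig A) (shF A B f) x y + act1 (edel A) (ZZ f) x y - ZZ (pr (edel (cA A B)) f) x y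
     - act1 (edel A) (ShF A B f) x y + ShF A B (pr (edel (cA A B)) f) x y"
    (is "?L x y = ?R x y")
proof -
  have n': "nrm CC (pr (edel (cA A B)) f)" using nrm_e[OF gcA, of f] n unfolding mC_c by simp
  have "?L = ?R"
  proof (rule lift2_eqI[OF gdA gdB])
    fix p0 p q0 q assume adm: "admL A (p0 # p)" "admL B (q0 # q)" and low: "low 1 (tags (p0 # p) @ 2 # tags (q0 # q))"
    let ?X = "iA B p0" and ?P = "map (iA B) p" and ?Y = "iB A q0" and ?Q = "map (iB A) q"
    let ?\<phi> = "\<lambda>w. lift [] [] f (oC CC 2 # w)"
    note LE = letter_ops_E_C[of "dga_tensor A B" 0 "dga_tensor A B" 0 "cA A B" 1]
    have a: "set ?Q \<subseteq> QB" "?Y \<in> QB" "set ?P \<subseteq> PA" "?X \<in> PA" using adm PQ by (simp_all del: set_map)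
    have aw: "admL CC (?Y # ?Q @ ?X # ?P)" "low 0 (tags (?Y # ?Q @ ?X # ?P))" using adm adm_i low_01[OF low] by auto
    have 0: "lift2 (HP A B (pr (hoch_b CC) f)) (p0 # p) (q0 # q) = SE eA (\<lambda>w. dd mm dD ?\<phi> w + (Fst (JJ f) w - Lst (JJ f) w)) ?Y ?Q ?X ?P"
    proof -
      have "lift2 (HP A B (pr (hoch_b CC) f)) (p0 # p) (q0 # q) = SE eA (\<lambda>w. lift [] [] (pr (hoch_b CC) f) (oC CC 2 # w)) ?Y ?Q ?X ?P"
        using lift2_H(2)[OF gdA gdB adm, of "pr (hoch_b CC) f"] unfolding low_c1[OF low] mult_1 .
      also have "\<dots> = SE eA (\<lambda>w. dd mm dD ?\<phi> w + (Fst (JJ f) w - Lst (JJ f) w)) ?Y ?Q ?X ?P"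
        by (rule SE_word_cong[OF aw gcA adm_c'(1)]) (rule lift_b_o)
      finally show ?thesis .
    qed
    have 1: "SE eA (dd mm dD ?\<phi>) ?Y ?Q ?X ?P = bch mm dD (\<lambda>q0 q. SE eA ?\<phi> q0 q ?X ?P) ?Y ?Q + bch mm dD (\<lambda>p0 p. SE eA ?\<phi> ?Y ?Q p0 p) ?X ?P
      + rot (\<lambda>q2 q0 q1. rotE eA (\<lambda>p2 p0 p1. shf (\<lambda>x. shf (\<lambda>y. mm q0 p0 (\<lambda>z. ?\<phi> (x @ z # y))) q1 p1) q2 p2) ?X ?P) ?Y ?Q
      + ehat mm eA (\<lambda>p0 p. SR ?\<phi> ?Y ?Q p0 p) ?X ?P"
      by (rule letter_ops_E.SE_dd[OF LE comm_Cons[OF comm_QP] a letter_ops_E.leib_Cons[OF LE leib_PQ(2)] E_on_PQ(2)])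
    \<comment> \<open>The zeroth letters are multiplied in the order opposite to the one in
      \<open>sh\<close>, so the sign of \<open>comm\<close> enters.\<close>
    have wall: "mm ?Y ?X (\<lambda>z. ?\<phi> (x @ z # y)) = - lift [] [] f (oC CC 0 # x @ LL p0 q0 # y)" for x y
    proof -
      have "mm ?Y ?X (\<lambda>z. ?\<phi> (x @ z # y)) + mm ?X ?Y (\<lambda>z. ?\<phi> (x @ z # y)) = 0"
        using comm_Cons[OF comm_QP] a(2,4) unfolding comm_def by blast
      then show ?thesis unfolding wall_m by (simp add: eq_neg_iff_add_eq_0)
    qed
    have 2: "rot (\<lambda>q2 q0 q1. rotE eA (\<lambda>p2 p0 p1. shf (\<lambda>x. shf (\<lambda>y. mm q0 p0 (\<lambda>z. ?\<phi> (x @ z # y))) q1 p1) q2 p2) ?X ?P) ?Y ?Q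
        = lift2 (shF A B (pr (Ebig (cA A B)) f)) (p0 # p) (q0 # q)"
    proof -
      have "rot (\<lambda>q2 q0 q1. rotE eA (\<lambda>p2 p0 p1. shf (\<lambda>x. shf (\<lambda>y. mm q0 p0 (\<lambda>z. ?\<phi> (x @ z # y))) q1 p1) q2 p2) ?X ?P) ?Y ?Q
        = rot (\<lambda>q2 _ q1. rotE eA (\<lambda>p2 _ p1. - shf (\<lambda>x. shf (\<lambda>y. lift [] [] f (oC CC 0 # x @ LL p0 q0 # y)) q1 p1) q2 p2) ?X ?P) ?Y ?Q"
        by (rule rot_cong, rule rotE_cong') (simp only: wall fs_minus[OF fs_shf])
      also have "\<dots> = - rot (\<lambda>q2 _ q1. rotE eA (\<lambda>p2 _ p1. shf (\<lambda>x. shf (\<lambda>y. lift [] [] f (oC CC 0 # x @ LL p0 q0 # y)) q1 p1) q2 p2) ?X ?P) ?Y ?Q"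
        unfolding rotE_minus rot_minus ..
      also have "rot (\<lambda>q2 _ q1. rotE eA (\<lambda>p2 _ p1. shf (\<lambda>x. shf (\<lambda>y. lift [] [] f (oC CC 0 # x @ LL p0 q0 # y)) q1 p1) q2 p2) ?X ?P) ?Y ?Q
         = shf (rotE eA (\<lambda>u a v. lift [] [] f (oC CC 0 # u @ a # v)) (LL p0 q0)) ?Q ?P"
        by (rule letter_ops_E.wall_rotE[OF LE, symmetric]) (auto simp: DC_iB(3)[OF dA dB])
      finally show ?thesis unfolding lift2_E_sh(3)[OF adm low gcA adm_c'(1) mC_c(3)] by (simp add: shf_commute)
    qed
    have 3: "SE eA (\<lambda>w. Fst (JJ f) w - Lst (JJ f) w) ?Y ?Q ?X ?P = - lift2 (act1 (Ebig A) (shF A B f)) (p0 # p) (q0 # q)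
        - SR (Fst (\<lambda>x w. eA x (\<lambda>f'. JJ f f' w))) ?Y ?Q ?X ?P"
      unfolding lift2_E_sh(1)[OF adm low] minus_minus
      by (subst shf_commute) (rule letter_ops_E.SE_cyc[OF LE _ a(1,2)], auto simp: QB_def DC_iB(3)[OF dA dB])
    have 4: "lift2 (act1 (edel A) (\<lambda>x y. ZZ f x y - ShF A B f x y)) (p0 # p) (q0 # q) = ehat mm eA (\<lambda>p0 p. SR ?\<phi> ?Y ?Q p0 p) ?X ?P"
      \<comment> \<open>On words \<open>ZZ\<close> is minus the sum of both orders and
        \<open>ShF\<close> is minus one of them, so their difference is minus the complementary
        order, as required by \<open>lift2_e_map\<close>.\<close>
      by (rule lift2_e_map(2)[OF adm low]) (simp add: lift2_lin lift2_Z[OF n _ adm(2)] lift2_ShF[OF _ adm(2)])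
    have 7: "act1 (edel A) (\<lambda>x y. ZZ f x y - ShF A B f x y) = (\<lambda>x y. act1 (edel A) (ZZ f) x y - act1 (edel A) (ShF A B f) x y)"
      by (intro ext) (simp add: act1_def fs_diff[OF fs_pr])
    have 5: "lift2 (btot A B (HP A B f)) (p0 # p) (q0 # q) = - (bch mm dD (\<lambda>p0 p. SE eA ?\<phi> ?Y ?Q p0 p) ?X ?P + bch mm dD (\<lambda>q0 q. SE eA ?\<phi> q0 q ?X ?P) ?Y ?Q)"
      by (rule lift2_btot_H[OF adm low, where G="\<lambda>p0 p q0 q. SE eA ?\<phi> q0 q p0 p"]) (rule lift2_H(2)[OF gdA gdB])
    have 6: "lift2 (ZZ (pr (edel (cA A B)) f)) (p0 # p) (q0 # q) - lift2 (ShF A B (pr (edel (cA A B)) f)) (p0 # p) (q0 # q)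
        = SR (Fst (\<lambda>x w. eA x (\<lambda>f'. JJ f f' w))) ?Y ?Q ?X ?P"
      unfolding lift2_Z[OF n' adm] lift2_ShF[OF adm] ShF_e(2)[OF adm low gcA adm_c'(1) mC_c(1)] by simp
    show "lift2 ?L (p0 # p) (q0 # q) = lift2 ?R (p0 # p) (q0 # q)"
      unfolding lift2_lin 0 fs_add[OF fs_SE[OF fs_DC]] 1 2 3 5 6[symmetric] 4[symmetric] 7 by simp
  qed
  then show ?thesis by (rule fun_cong[THEN fun_cong])
qed


section \<open>The correction term and the operator \<open>B\<close>\<close>

text \<open>Here \<open>b\<close> receives the tag 2, since 0 and 1 are taken by \<open>e\<close>;
  the condition \<open>low 1\<close> for \<open>e\<close> then still holds after \<open>b\<close>
  has acted.\<close>

lemma e_b: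
  fixes X :: "('x, 'k) dga"
  assumes "is_dga X"
  shows "pr (edel X) (pr (hoch_b X) h) c = pr (hoch_b X) (pr (edel X) h) c"
proof -
  have gX: "gda X" by (rule is_dga_gda[OF assms])
  have "pr (edel X) (pr (hoch_b X) h) c - pr (hoch_b X) (pr (edel X) h) c = 0"
  proof (rule lift_eq0I[where A=X])
    fix a w assume *: "admL X (a # w)" "low 2 (tags (a # w))"
    let ?l = "\<lambda>a w. lift [] [] h (a # w)"
    have l: "low 1 ([] @ tags (a # w) @ [])" using lowD(1)[OF *(2)] by simp
    have "lift [] [] (pr (edel X) (pr (hoch_b X) h)) (a # w) = - ehat (mC X 0) (DC X 1) (\<lambda>a w. lift [] [] (pr (hoch_b X) h) (a # w)) a w"
      by (rule lift_edel[OF gX *(1) l]) simp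
    also have "ehat (mC X 0) (DC X 1) (\<lambda>a w. lift [] [] (pr (hoch_b X) h) (a # w)) a w
      = ehat (mC X 0) (DC X 1) (\<lambda>a w. (\<lambda>W. bch (mC X 2) (DC X 2) ?l (hd W) (tl W)) (a # w)) a w"
    proof (rule ehat_cong[OF gX *(1)])
      fix W assume W: "admL X W" "W \<noteq> []" "mset (tags W) = add_mset 0 (add_mset 1 (mset (tags (a # w))))"
      obtain z v where e: "W = z # v" using W(2) by (cases W) auto
      \<comment> \<open>Exactly two tags, 0 and 1, are smaller than 2, so \<open>b\<close> passes
        \<open>e\<close> without a sign.\<close>
      have "c1 2 (tags W) = (c1 2 (0 # 1 # tags (a # w)) :: 'k)" by (rule c1_mset) (use W(3) in simp)
      also have "\<dots> = 1" using low_c1[OF *(2), where ?'a='k] by (simp add: sg_def del: tags_simps)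
      finally have "kap [] [] 2 W = (1 :: 'k)" by (simp add: kap_def)
      then show "lift [] [] (pr (hoch_b X) h) W = bch (mC X 2) (DC X 2) ?l (hd W) (tl W)"
        using lift_hoch_b[OF gX W(1)[unfolded e], of "[]" "[]" 2 h] unfolding e by simp
    qed
    also have "\<dots> = bch (mC X 2) (DC X 2) (ehat (mC X 0) (DC X 1) ?l) a w"
      unfolding list.sel
    proof (rule letter_ops_E.ehat_bch[OF letter_ops_E_C fs_mC, where X="{x. adm X x}"])
      show "a \<in> {x. adm X x}" "set w \<subseteq> {x. adm X x}" using *(1) by auto
    qed (simp_all add: lift_is_loc0 dga_rel_ehat(1)[OF assms] dga_rel_ehat(2)[OF assms, symmetric] dga_rel_ehat(3)[OF assms])
    also have "- bch (mC X 2) (DC X 2) (ehat (mC X 0) (DC X 1) ?l) a w = bch (mC X 2) (DC X 2) (\<lambda>a w. (\<lambda>W. - ehat (mC X 0) (DC X 1) ?l (hd W) (tl W)) (a # w)) a w"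
      unfolding list.sel bch_minus ..
    also have "\<dots> = bch (mC X 2) (DC X 2) (\<lambda>a w. lift [] [] (pr (edel X) h) (a # w)) a w"
    proof (rule bch_cong[OF gX *(1)])
      fix W assume W: "admL X W" "W \<noteq> []" "mset (tags W) = add_mset 2 (mset (tags (a # w)))"
      obtain z v where e: "W = z # v" using W(2) by (cases W) auto
      have "set (tags W) = insert 2 (set (tags (a # w)))" using arg_cong[OF W(3), of set_mset] by (simp del: tags_simps)
      then have "low 1 ([] @ tags W @ [])" using l by (auto simp: low_def)
      from lift_edel[OF gX W(1)[unfolded e] this[unfolded e], of 0 h]
      show "- ehat (mC X 0) (DC X 1) ?l (hd W) (tl W) = lift [] [] (pr (edel X) h) W" unfolding e by simp
    qed
    also have "\<dots> = lift [] [] (pr (hoch_b X) (pr (edel X) h)) (a # w)"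
      using lift_hoch_b[OF gX *(1), of "[]" "[]" 2 "pr (edel X) h"] low_c1[OF *(2), where ?'a='k] by (simp add: kap_def del: tags_simps)
    finally show "lift [] [] (\<lambda>c. pr (edel X) (pr (hoch_b X) h) c - pr (hoch_b X) (pr (edel X) h) c) (a # w) = 0"
      by (simp add: lift_def algebra_simps del: psgn_append psgn.simps tags_simps)
  qed
  then show ?thesis by simp
qed

text \<open>\<open>rot_bch\<close> for the unit inserted by \<open>B\<close>. The minus sign is that
  of the two odd tags 0 and 1 of the operators.\<close>

lemma B_b:
  fixes X :: "('x, 'k) dga"
  assumes gX: "gda X" and n: "nrm X h"
  shows "pr (Bop X) (pr (hoch_b X) h) c = - pr (hoch_b X) (pr (Bop X) h) c"
proof -
  have "pr (Bop X) (pr (hoch_b X) h) c + pr (hoch_b X) (pr (Bop X) h) c = 0"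
  proof (rule lift_eq0I[where A=X])
    fix a w assume *: "admL X (a # w)" "low 2 (tags (a # w))"
    let ?l = "\<lambda>a w. lift [] [] h (a # w)"
    have k: "kap [] [] 0 (a # w) = (1 :: 'k)" "kap [] [] 1 (a # w) = (1 :: 'k)" using lowD(2,3)[OF *(2)] by (simp_all add: kap_def del: tags_simps)
    have "lift [] [] (pr (Bop X) (pr (hoch_b X) h)) (a # w) = rot (\<lambda>u a v. lift [] [] (pr (hoch_b X) h) (oC X 0 # u @ a # v)) a w"
      using lift_Bop[OF gX *(1) nrm_b[OF gX n], of "[]" "[]" 0] unfolding k by simp
    also have "\<dots> = rot (\<lambda>u a v. - bch (mC X 1) (DC X 1) ?l (oC X 0) (u @ a # v)) a w"
    proof (rule rot_cong)
      fix u v assume w: "w = v @ u"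
      have a: "admL X (oC X 0 # u @ a # v)" using *(1) gdaD(1)[OF gX] by (auto simp: w adm_def oC_def)
      \<comment> \<open>The tag 0 of the inserted unit is the only one below 1; this single
        inversion is the sign of the anticommutation.\<close>
      have "c1 1 (tags (oC X 0 # u @ a # v)) = (c1 1 (0 # tags (a # w)) :: 'k)" by (rule c1_mset) (simp add: w oC_def)
      also have "\<dots> = - 1" using lowD(3)[OF *(2)] by (simp add: sg_def del: tags_simps)
      finally have "kap [] [] 1 (oC X 0 # u @ a # v) = (- 1 :: 'k)" by (simp add: kap_def del: tags_simps)
      then show "lift [] [] (pr (hoch_b X) h) (oC X 0 # u @ a # v) = - bch (mC X 1) (DC X 1) ?l (oC X 0) (u @ a # v)"
        using lift_hoch_b[OF gX a, of "[]" "[]" 1 h] by (simp add: equation_minus_iff[of _ "bch _ _ _ _ _"] del: One_nat_def)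
    qed
    also have "\<dots> = - bch (mC X 1) (DC X 1) (rot (\<lambda>u a v. ?l (oC X 0) (u @ a # v))) a w"
      unfolding rot_minus letter_ops.rot_bch[OF letter_ops_C refl J_unit'[OF gX] rel_unit(2)[OF gX]] ..
    also have "bch (mC X 1) (DC X 1) (rot (\<lambda>u a v. ?l (oC X 0) (u @ a # v))) a w
       = bch (mC X 1) (DC X 1) (\<lambda>a w. (\<lambda>W. rot (\<lambda>u a v. ?l (oC X 0) (u @ a # v)) (hd W) (tl W)) (a # w)) a w" by simp
    also have "\<dots> = bch (mC X 1) (DC X 1) (\<lambda>a w. lift [] [] (pr (Bop X) h) (a # w)) a w"
    proof (rule bch_cong[OF gX *(1)])
      fix W assume W: "admL X W" "W \<noteq> []" "mset (tags W) = add_mset 1 (mset (tags (a # w)))"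
      obtain z v where e: "W = z # v" using W(2) by (cases W) auto
      have "c1 0 (tags W) = (c1 0 (1 # tags (a # w)) :: 'k)" by (rule c1_mset) (use W(3) in simp)
      also have "\<dots> = 1" using lowD(2)[OF *(2)] by (simp add: sg_def del: tags_simps)
      finally have "kap [] [] 0 W = (1 :: 'k)" by (simp add: kap_def)
      then show "rot (\<lambda>u a v. ?l (oC X 0) (u @ a # v)) (hd W) (tl W) = lift [] [] (pr (Bop X) h) W"
        using lift_Bop[OF gX W(1)[unfolded e] n, of "[]" "[]" 0] unfolding e by simp
    qed
    also have "\<dots> = lift [] [] (pr (hoch_b X) (pr (Bop X) h)) (a # w)"
      using lift_hoch_b[OF gX *(1), of "[]" "[]" 1 "pr (Bop X) h"] unfolding k by simp
    finally show "lift [] [] (\<lambda>c. pr (Bop X) (pr (hoch_b X) h) c + pr (hoch_b X) (pr (Bop X) h) c) (a # w) = 0"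
      by (simp add: lift_def algebra_simps del: psgn_append psgn.simps tags_simps)
  qed
  then show ?thesis by (simp add: eq_neg_iff_add_eq_0)
qed

text \<open>The condition \<open>bar\<close> for a single algebra.\<close>

definition van :: "('x, 'k) dga \<Rightarrow> ('x \<times> 'x list \<Rightarrow> 'k) \<Rightarrow> bool" where
  "van X h \<longleftrightarrow> (\<forall>c. one_idx X \<in> insert (fst c) (set (snd c)) \<longrightarrow> h c = 0)"


lemma van_nrm: "van X h \<Longrightarrow> nrm X h"
  by (auto simp: van_def nrm_def normal_def)

lemma lift_van: "van X h \<Longrightarrow> lift U V h (oC X \<epsilon> # W) = 0"
  by (simp add: lift_def oC_def van_def)

lemma vanI:
  fixes X :: "('x, 'k) dga"
  assumes "\<And>a w. admL X (a # w) \<Longrightarrow> low 2 (tags (a # w)) \<Longrightarrow> one_idx X \<in> snd ` set (a # w) \<Longrightarrow> lift [] [] F (a # w) = 0"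
  shows "van X F"
  unfolding van_def
proof (intro allI impI)
  fix c assume n: "one_idx X \<in> insert (fst c) (set (snd c))"
  show "F c = 0"
  proof (rule lift_eq0I)
    fix a w assume *: "admL X (a # w)" "chn (map snd (a # w)) = c" "low 2 (tags (a # w))"
    then have "one_idx X \<in> snd ` set (a # w)" using n by auto
    then show "lift [] [] F (a # w) = 0" using assms * by blast
  qed
qed

lemma van_B:
  fixes X :: "('x, 'k) dga"
  assumes gX: "gda X" and n: "nrm X h" shows "van X (pr (Bop X) h)"
proof (rule vanI)
  fix a w assume *: "admL X (a # w)" "low 2 (tags (a # w))" "one_idx X \<in> snd ` set (a # w)"
  have "kap [] [] 0 (a # w) * lift [] [] (pr (Bop X) h) (a # w) = rot (\<lambda>_ _ _. 0) a w"
    unfolding lift_Bop[OF gX *(1) n] by (rule rot_cong, rule lift_unit[OF n]) (use *(3) in auto)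
  then show "lift [] [] (pr (Bop X) h) (a # w) = 0"
    by (simp add: kap_def lowD[OF *(2)] rot_0 del: tags_simps)
qed

lemma van_E:
  fixes X :: "('x, 'k) dga"
  assumes gX: "gda X" and n: "nrm X h" shows "van X (pr (Ebig X) h)"
proof (rule vanI)
  fix a w assume *: "admL X (a # w)" "low 2 (tags (a # w))" "one_idx X \<in> snd ` set (a # w)"
  have "rotE (DC X 1) (\<lambda>u a v. lift [] [] h (oC X 0 # u @ a # v)) a w = spl (\<lambda>_ _. 0) w"
    unfolding rotE_def
  proof (rule spl_cong)
    fix w1 w2 assume w: "w = w1 @ w2"
    show "LD (DC X 1) (\<lambda>r. lift [] [] h (oC X 0 # w2 @ a # r)) w1 = 0"
      by (rule LD_unit[OF gX, where U="one_idx X \<in> insert (snd a) (snd ` set w2)"], rule lift_unit[OF n]) (use *(3) w in auto)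
  qed
  then show "lift [] [] (pr (Ebig X) h) (a # w) = 0"
    using lift_Ebig[OF gX *(1), of 1 "[]" "[]" 0 h] lowD(1)[OF *(2)] by (simp add: spl_0 del: tags_simps)
qed

text \<open>Dually, \<open>B\<close> produces chains starting with a unit. Together with
  \<open>van_B\<close> this contains B B = 0 on the normalized complex.\<close>

lemma B_of_van:
  fixes X :: "('x, 'k) dga"
  assumes gX: "gda X" and v: "van X h" shows "pr (Bop X) h c = 0"
proof (rule lift_eq0I)
  fix a w assume *: "admL X (a # w)" "low 2 (tags (a # w))"
  show "lift [] [] (pr (Bop X) h) (a # w) = 0"
    using lift_Bop[OF gX *(1) van_nrm[OF v], of "[]" "[]" 0] by (simp add: kap_def lowD[OF *(2)] rot_0 lift_van[OF v] del: tags_simps)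
qed

lemma E_of_van:
  fixes X :: "('x, 'k) dga"
  assumes gX: "gda X" and v: "van X h" shows "pr (Ebig X) h c = 0"
proof (rule lift_eq0I)
  fix a w assume *: "admL X (a # w)" "low 2 (tags (a # w))"
  have "rotE (DC X 1) (\<lambda>u a v. 0) a w = 0"
    using letter_ops_E.rotE_diff[OF letter_ops_E_C[where A=X and \<epsilon>=0 and A'=X and \<epsilon>'=0 and A''=X and \<epsilon>''=1], of "\<lambda>_ _ _. 0" "\<lambda>_ _ _. 0" a w] by simp
  then show "lift [] [] (pr (Ebig X) h) (a # w) = 0"
    using lift_Ebig[OF gX *(1), of 1 "[]" "[]" 0 h] lowD(1)[OF *(2)] by (simp add: lift_van[OF v] del: tags_simps)
qed

lemma Sh_of_van: assumes "van CC f" shows "ShF A B f x y = 0"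
  by (rule lift2_at[OF gdA gdB, where G="\<lambda>_ _. 0"])
    (simp add: lift2_ShF lift_van[OF assms] fs_zero[OF fs_SR] lift2_def[of "\<lambda>_ _. 0"] del: list.map tags_simps)

lemma H_of_van: assumes v: "van CC f" shows "HQ A B f x y = 0" "HP A B f x y = 0"
proof -
  have *: "lift2 (HQ A B f) (p0 # p) (q0 # q) = 0 \<and> lift2 (HP A B f) (p0 # p) (q0 # q) = 0"
    if adm: "admL A (p0 # p)" "admL B (q0 # q)" and low: "low 1 (tags (p0 # p) @ 2 # tags (q0 # q))" for p0 p q0 q
    using lift2_H[OF gdA gdB adm, of f] unfolding low_c1[OF low] lift_van[OF v] fs_zero[OF fs_SE[OF fs_DC]] by simp
  show "HQ A B f x y = 0" "HP A B f x y = 0"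
    by (rule lift2_at[OF gdA gdB, where G="\<lambda>_ _. 0"], simp add: * lift2_def[of "\<lambda>_ _. 0"] del: list.map tags_simps)+
qed

lemma bar_van: "bar g \<Longrightarrow> van A (\<lambda>x. g x y)" "bar g \<Longrightarrow> van B (g x)"
  unfolding bar_def van_def by blast+

lemma act_of_bar:
  assumes "bar g"
  shows "act1 (Bop A) g = (\<lambda>_ _. 0)" "act2 A s (Bop B) g = (\<lambda>_ _. 0)" "act1 (Ebig A) g = (\<lambda>_ _. 0)" "act2 A s (Ebig B) g = (\<lambda>_ _. 0)"
  by (intro ext, simp add: act1_def act2_def B_of_van[OF gdA bar_van(1)[OF assms]] B_of_van[OF gdB bar_van(2)[OF assms]]
     E_of_van[OF gdA bar_van(1)[OF assms]] E_of_van[OF gdB bar_van(2)[OF assms]])+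

lemma act1_add:
  "act1 T (\<lambda>x y. g x y + h x y) x y = act1 T g x y + act1 T h x y" "act1 T (\<lambda>x y. g x y - h x y) x y = act1 T g x y - act1 T h x y"
  by (simp_all add: act1_def fs_add[OF fs_pr] fs_diff[OF fs_pr])

lemma act2_add:
  "act2 A s T (\<lambda>x y. g x y + h x y) x y = act2 A s T g x y + act2 A s T h x y" "act2 A s T (\<lambda>x y. g x y - h x y) x y = act2 A s T g x y - act2 A s T h x y"
  by (simp_all add: act2_def fs_add[OF fs_pr] fs_diff[OF fs_pr] distrib_left right_diff_distrib)

lemmas act_add = act1_add act2_add

definition "H2F f = act2 A True (Bop B) (act1 (edel A) (shF A B f))"

lemma act_B_b:
  assumes g: "nrm2 A B g"
  shows "act2 A True (Bop B) (btot A B g) x y = - btot A B (act2 A True (Bop B) g) x y"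
proof -
  have c: "act1 (hoch_b A) (act2 A True (Bop B) g) x y = - act2 A True (Bop B) (act1 (hoch_b A) g) x y"
    using act_commute[OF ndeg_b[OF gdA] g, of True "Bop B" x y] by simp
  have "pr (Bop B) (pr (hoch_b B) (g x)) y = - pr (hoch_b B) (pr (Bop B) (g x)) y"
    using g unfolding nrm2_def by (intro B_b[OF gdB]) blast
  then have d: "act2 A True (Bop B) (act2 A True (hoch_b B) g) x y = - act2 A True (hoch_b B) (act2 A True (Bop B) g) x y"
    by (simp add: act2_def[abs_def] fs_scale[OF fs_pr])
  show ?thesis unfolding btot_def[abs_def] act_add c d by simp
qed

lemma act_e_b:
  assumes g: "nrm2 A B g"
  shows "act1 (edel A) (btot A B g) x y = btot A B (act1 (edel A) g) x y"
proof -
  have c: "act1 (edel A) (act2 A True (hoch_b B) g) x y = act2 A True (hoch_b B) (act1 (edel A) g) x y"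
    using act_commute[OF ndeg_e[OF gdA] g, of True "hoch_b B" x y] by simp
  have d: "act1 (edel A) (act1 (hoch_b A) g) x y = act1 (hoch_b A) (act1 (edel A) g) x y"
    by (simp add: act1_def[abs_def] e_b[OF dA])
  show ?thesis unfolding btot_def[abs_def] act_add c d by simp
qed

lemma nrm2_e_sh: "nrm CC f \<Longrightarrow> nrm2 A B (act1 (edel A) (shF A B f))"
  by (rule nrm2_act1[OF nrm_e[OF gdA] nrm2_sh])

text \<open>\<open>b\<close> commutes with \<open>sh\<close> and \<open>e\<close> and anticommutes
  with \<open>B\<close>, so the term in u^(-2) has no commutator with \<open>b\<close>.\<close>

lemma H2_b:
  assumes n: "nrm CC f"
  shows "H2F (pr (hoch_b CC) f) x y + btot A B (H2F f) x y = 0"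
proof -
  have "act1 (edel A) (btot A B (shF A B f)) = btot A B (act1 (edel A) (shF A B f))"
    by (intro ext act_e_b nrm2_sh n)
  then have "H2F (pr (hoch_b CC) f) x y = - btot A B (H2F f) x y"
    unfolding H2F_def b_sh using act_B_b[OF nrm2_e_sh[OF n]] by simp
  then show ?thesis by simp
qed

lemma act_BB: "nrm2 A B g \<Longrightarrow> act2 A True (Bop B) (act2 A True (Bop B) g) = (\<lambda>_ _. 0)"
proof (intro ext)
  fix x y assume g: "nrm2 A B g"
  have "pr (Bop B) (pr (Bop B) (g x)) y = 0"
    using g unfolding nrm2_def by (intro B_of_van[OF gdB] van_B[OF gdB]) blast
  then show "act2 A True (Bop B) (act2 A True (Bop B) g) x y = 0" by (simp add: act2_def[abs_def] fs_scale[OF fs_pr])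
qed

text \<open>\<open>b_Sh\<close> is composed with 1 \<otimes> B. Both terms containing
  \<open>Sh\<close> vanish, because \<open>Sh\<close> kills chains starting with a unit, and of
  \<open>Btot\<close> only the first part is left, since B B = 0.\<close>

lemma B_sh_B:
  assumes n: "nrm CC f"
  shows "act2 A True (Bop B) (shF A B (pr (Bop CC) f)) x y = ZZ f x y"
proof -
  have nb: "nrm CC (pr (hoch_b CC) f)" by (rule nrm_b[OF gdC n])
  have "shF A B (pr (Bop CC) f) = (\<lambda>x y. Btot (shF A B f) x y + (btot A B (ShF A B f) x y + - ShF A B (pr (hoch_b CC) f) x y))"
    using b_Sh[OF n] by (intro ext) (simp add: algebra_simps)
  then have "act2 A True (Bop B) (shF A B (pr (Bop CC) f)) x y = act2 A True (Bop B) (Btot (shF A B f)) x y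
      + act2 A True (Bop B) (btot A B (ShF A B f)) x y - act2 A True (Bop B) (ShF A B (pr (hoch_b CC) f)) x y"
    by (simp add: act_add)
  moreover have "act2 A True (Bop B) (btot A B (ShF A B f)) x y = 0"
    unfolding act_B_b[OF bar_nrm2[OF bar_Sh[OF n]]] act_of_bar(2)[OF bar_Sh[OF n]]
    by (simp add: btot_def act1_def act2_def fs_zero[OF fs_pr])
  moreover have "act2 A True (Bop B) (Btot (shF A B f)) x y = ZZ f x y"
    unfolding Btot_def[abs_def] act_add act_BB[OF nrm2_sh[OF n]] ZZ_def by simp
  ultimately show ?thesis by (simp add: act_of_bar(2)[OF bar_Sh[OF nb]])
qed

text \<open>On one side \<open>B_sh_B\<close> produces Z after moving e \<otimes> 1 out of the way;
  on the other side e \<otimes> 1 is moved through \<open>sh\<close> by \<open>e_sh\<close> and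
  becomes e'.\<close>

lemma H2_B:
  assumes n: "nrm CC f"
  shows "H2F (pr (Bop CC) f) x y + Btot (H2F f) x y = act1 (edel A) (ZZ f) x y - ZZ (pr (edel (cA A B)) f) x y"
proof -
  have nB: "nrm CC (pr (Bop CC) f)" by (rule nrm_B[OF gdC n])
  have "H2F (pr (Bop CC) f) x y = act1 (edel A) (act2 A True (Bop B) (shF A B (pr (Bop CC) f))) x y"
    using act_commute[OF ndeg_e[OF gdA] nrm2_sh[OF nB], of True "Bop B" x y] by (simp add: H2F_def)
  also have "act2 A True (Bop B) (shF A B (pr (Bop CC) f)) = ZZ f" by (intro ext B_sh_B n)
  finally have 1: "H2F (pr (Bop CC) f) x y = act1 (edel A) (ZZ f) x y" .
  have "Btot (H2F f) x y = - act2 A True (Bop B) (act1 (Bop A) (act1 (edel A) (shF A B f))) x y"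
    unfolding Btot_def H2F_def act_BB[OF nrm2_e_sh[OF n]] using act_commute[OF ndeg_B[OF gdA] nrm2_e_sh[OF n], of True "Bop B" x y] by simp
  also have "\<dots> = - ZZ (pr (edel (cA A B)) f) x y" unfolding ZZ_def e_sh(2) ..
  finally show ?thesis using 1 by simp
qed

section \<open>Bar length and parity\<close>

lemma fin_gam: "fin (gam X)" for X :: "('x, 'k) dga"
  unfolding fin_def gam_def by (intro allI finite_vsupp_scale) (simp add: vsupp_bv)

lemma pr_gam: "pr (gam X) f c = of_nat (length (snd c)) * f c" for X :: "('x, 'k) dga"
  unfolding pr_def gam_def by (subst pair_scale) (simp_all add: vsupp_bv)

lemma sh_gam: "shF A B (pr (gam CC) f) x y = (of_nat (length (snd x)) + of_nat (length (snd y))) * shF A B f x y"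
proof (rule lift2_at[OF gdA gdB, where G="\<lambda>x y. (of_nat (length (snd x)) + of_nat (length (snd y))) * shF A B f x y"])
  fix p0 p q0 q assume adm: "admL A (p0 # p)" "admL B (q0 # q)" and low: "low 1 (tags (p0 # p) @ 2 # tags (q0 # q))"
  have "lift2 (shF A B (pr (gam CC) f)) (p0 # p) (q0 # q) = shf (\<lambda>w. (of_nat (length p) + of_nat (length q)) * lift [] [] f (LL p0 q0 # w)) (map (iA B) p) (map (iB A) q)"
    unfolding lift2_shF[OF adm] by (rule shf_sh_cong[OF adm low]) (simp add: lift_def pr_gam del: psgn_append psgn.simps tags_simps)
  also have "\<dots> = (of_nat (length p) + of_nat (length q)) * lift2 (shF A B f) (p0 # p) (q0 # q)"
    unfolding lift2_shF[OF adm] by (rule fs_scale[OF fs_shf])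
  finally show "lift2 (shF A B (pr (gam CC) f)) (p0 # p) (q0 # q) = lift2 (\<lambda>x y. (of_nat (length (snd x)) + of_nat (length (snd y))) * shF A B f x y) (p0 # p) (q0 # q)"
    by (simp add: lift2_def ac_simps del: psgn_append psgn.simps tags_simps)
qed

text \<open>Both zeroth letters become bar entries of the new chain. Halved by the connection, this
  shift by 2 cancels the derivative of u Sh.\<close>

lemma Sh_gam: "ShF A B (pr (gam CC) f) x y = (of_nat (length (snd x)) + of_nat (length (snd y)) + 2) * ShF A B f x y"
proof (rule lift2_at[OF gdA gdB, where G="\<lambda>x y. (of_nat (length (snd x)) + of_nat (length (snd y)) + 2) * ShF A B f x y"])
  fix p0 p q0 q assume adm: "admL A (p0 # p)" "admL B (q0 # q)"
  have "SR (\<lambda>w. lift [] [] (pr (gam CC) f) (oC CC 2 # w)) (iA B p0) (map (iA B) p) (iB A q0) (map (iB A) q)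
     = SR (\<lambda>w. (of_nat (length p) + of_nat (length q) + 2) * lift [] [] f (oC CC 2 # w)) (iA B p0) (map (iA B) p) (iB A q0) (map (iB A) q)"
  proof (rule SR_cong)
    fix w assume "mset w = mset (iA B p0 # map (iA B) p @ iB A q0 # map (iB A) q)"
    from arg_cong[OF this, of size] have "length w = length p + length q + 2" by simp
    then show "lift [] [] (pr (gam CC) f) (oC CC 2 # w) = (of_nat (length p) + of_nat (length q) + 2) * lift [] [] f (oC CC 2 # w)"
      by (simp add: lift_def pr_gam ac_simps del: psgn_append psgn.simps tags_simps)
  qed
  also have "\<dots> = (of_nat (length p) + of_nat (length q) + 2) * SR (\<lambda>w. lift [] [] f (oC CC 2 # w)) (iA B p0) (map (iA B) p) (iB A q0) (map (iB A) q)"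
    by (rule fs_scale[OF fs_SR])
  finally have "lift2 (ShF A B (pr (gam CC) f)) (p0 # p) (q0 # q) = (of_nat (length p) + of_nat (length q) + 2) * lift2 (ShF A B f) (p0 # p) (q0 # q)"
    unfolding lift2_ShF[OF adm] by simp
  then show "lift2 (ShF A B (pr (gam CC) f)) (p0 # p) (q0 # q) = lift2 (\<lambda>x y. (of_nat (length (snd x)) + of_nat (length (snd y)) + 2) * ShF A B f x y) (p0 # p) (q0 # q)"
    by (simp add: lift2_def ac_simps del: psgn_append psgn.simps tags_simps)
qed

lemma sh_par:
  assumes f: "\<forall>d. cpar CC d = (cpar A x \<noteq> cpar B y) \<longrightarrow> f d = 0"
  shows "shF A B f x y = 0"
proof (rule lift2_at[OF gdA gdB, where G="\<lambda>_ _. 0"])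
  fix p0 p q0 q assume adm: "admL A (p0 # p)" "admL B (q0 # q)" and low: "low 1 (tags (p0 # p) @ 2 # tags (q0 # q))"
    and xy: "chn (map snd (p0 # p)) = x" "chn (map snd (q0 # q)) = y"
  have c: "cpar A x = even (length (tags (p0 # p)))" "cpar B y = even (length (tags (q0 # q)))"
    using cpar_tags[OF adm(1)] cpar_tags[OF adm(2)] xy by simp_all
  have "lift2 (shF A B f) (p0 # p) (q0 # q) = shf (\<lambda>w. 0) (map (iA B) p) (map (iB A) q)"
    unfolding lift2_shF[OF adm]
  proof (rule shf_sh_cong[OF adm low], rule lift_par[OF _ _ f])
    fix w assume l: "length (tags (LL p0 q0 # w)) = Suc (length (tags (p0 # p)) + length (tags (q0 # q)))"
    show "(cpar A x \<noteq> cpar B y) = even (length (tags (LL p0 q0 # w)))" unfolding l c by simp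
  qed auto
  then show "lift2 (shF A B f) (p0 # p) (q0 # q) = lift2 (\<lambda>_ _. 0) (p0 # p) (q0 # q)" by (simp add: fs_zero[OF fs_shf] lift2_def)
qed

lemma SE_par:
  assumes a: "admL CC (l0 # l @ r0 # r)" "low 0 (tags (l0 # l @ r0 # r))" "gda X" "adm X = adm CC"
    and f: "\<forall>d. cpar CC d = even (length (tags (l0 # l @ r0 # r))) \<longrightarrow> f d = 0"
  shows "SE (DC X 1) (\<lambda>w. lift [] [] f (oC CC 2 # w)) l0 l r0 r = 0"
proof -
  have "SE (DC X 1) (\<lambda>w. lift [] [] f (oC CC 2 # w)) l0 l r0 r = SE (DC X 1) (\<lambda>w. 0) l0 l r0 r"
  proof (rule SE_word_cong[OF a], rule lift_par[OF _ _ f])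
    fix w assume w: "admL CC w" "length (tags w) = Suc (length (tags (l0 # l @ r0 # r)))"
    show "admL CC (oC CC 2 # w)" using w(1) gdaD(1)[OF gdC] by (auto simp: adm_def oC_def)
    have "length (tags (oC CC 2 # w)) = Suc (Suc (length (tags (l0 # l @ r0 # r))))" unfolding w(2)[symmetric] by (simp add: oC_def)
    then show "even (length (tags (l0 # l @ r0 # r))) = even (length (tags (oC CC 2 # w)))" by (simp del: tags_simps)
  qed simp
  then show ?thesis by (simp add: fs_zero[OF fs_SE[OF fs_DC]])
qed

lemma H_par:
  assumes f: "\<forall>d. cpar CC d = (cpar A x = cpar B y) \<longrightarrow> f d = 0"
  shows "HQ A B f x y = 0" "HP A B f x y = 0"
proof -
  have *: "lift2 (HQ A B f) (p0 # p) (q0 # q) = 0 \<and> lift2 (HP A B f) (p0 # p) (q0 # q) = 0"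
    if adm: "admL A (p0 # p)" "admL B (q0 # q)" and low: "low 1 (tags (p0 # p) @ 2 # tags (q0 # q))"
    and xy: "chn (map snd (p0 # p)) = x" "chn (map snd (q0 # q)) = y" for p0 p q0 q
  proof -
    let ?X = "iA B p0" and ?P = "map (iA B) p" and ?Y = "iB A q0" and ?Q = "map (iB A) q"
    have c: "cpar A x = even (length (tags (p0 # p)))" "cpar B y = even (length (tags (q0 # q)))"
      using cpar_tags[OF adm(1)] cpar_tags[OF adm(2)] xy by simp_all
    have f': "\<forall>d. cpar CC d = even (length (tags (?X # ?P @ ?Y # ?Q))) \<longrightarrow> f d = 0" "\<forall>d. cpar CC d = even (length (tags (?Y # ?Q @ ?X # ?P))) \<longrightarrow> f d = 0"
    proof -
      have e: "even (length (tags (?X # ?P @ ?Y # ?Q))) = (cpar A x = cpar B y)" "even (length (tags (?Y # ?Q @ ?X # ?P))) = (cpar A x = cpar B y)"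
        unfolding c by auto
      show "\<forall>d. cpar CC d = even (length (tags (?X # ?P @ ?Y # ?Q))) \<longrightarrow> f d = 0" "\<forall>d. cpar CC d = even (length (tags (?Y # ?Q @ ?X # ?P))) \<longrightarrow> f d = 0"
        unfolding e by (rule f)+
    qed
    have a: "admL CC (?X # ?P @ ?Y # ?Q)" "low 0 (tags (?X # ?P @ ?Y # ?Q))" "admL CC (?Y # ?Q @ ?X # ?P)" "low 0 (tags (?Y # ?Q @ ?X # ?P))"
      using adm adm_i low_01[OF low] by auto
    show ?thesis
      using lift2_H(1)[OF gdA gdB adm, of f] lift2_H(2)[OF gdA gdB adm, of f] low_c1[OF low, where ?'a='k]
        SE_par[OF a(1,2) gcB adm_c'(2) f'(1)] SE_par[OF a(3,4) gcA adm_c'(1) f'(2)] by simp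
  qed
  show "HQ A B f x y = 0" "HP A B f x y = 0"
    by (rule lift2_at[OF gdA gdB, where G="\<lambda>_ _. 0"], use * in \<open>simp add: lift2_def[of "\<lambda>_ _. 0"] del: list.map tags_simps\<close>)+
qed

lemma H2_par:
  assumes f: "\<forall>d. cpar CC d = (cpar A x = cpar B y) \<longrightarrow> f d = 0" and n: "nrm CC f"
  shows "H2F f x y = 0"
proof -
  have 1: "shF A B f x' y' = 0" if "(cpar A x' \<noteq> cpar B y') = (cpar A x = cpar B y)" for x' y'
    by (rule sh_par) (use f that in blast)
  have "act1 (edel A) (shF A B f) x y' = 0" if "(cpar A x \<noteq> cpar B y') = (cpar A x = cpar B y)" for y'
    unfolding act1_def using ndeg_e[OF gdA] nrm2_sh[OF n] 1 that unfolding ndeg_def nrm2_def by blast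
  then have "pr (Bop B) (act1 (edel A) (shF A B f) x) y = 0"
    using ndeg_B[OF gdB] nrm2_e_sh[OF n] unfolding ndeg_def nrm2_def by blast
  then show ?thesis by (simp add: H2F_def act2_def)
qed


section \<open>Assembling the coefficients of the Laurent series\<close>

lemma fin_edel: "gda X \<Longrightarrow> fin (edel X)"
  unfolding edel_def by (intro fin_uminus fin_ocomp fin_mui fin_deltai)

lemma fin_Ebig: "gda X \<Longrightarrow> fin (Ebig X)"
  unfolding fin_def Ebig_def
  by (intro allI finite_vsupp_minus finite_vsupp_sum finite_atLeastAtMost finD fin_ocomp fin_hop fin_opow fin_tau fin_deltai)

lemma fin_zero: "fin (\<lambda>_ _. 0)"
  by (simp add: fin_def vsupp_def)

lemma pr_zero: "pr (\<lambda>_ _. 0) h c = 0"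
  by (simp add: pr_def)

lemma fin_scale: "fin T \<Longrightarrow> fin (\<lambda>c d. r * T c d)" for T :: "'b \<Rightarrow> 'c \<Rightarrow> 'k"
  unfolding fin_def using finite_vsupp_scale by blast

lemma pr_scale: "fin T \<Longrightarrow> pr (\<lambda>c d. r * T c d) h c = r * pr T h c" for T :: "'b \<Rightarrow> 'c \<Rightarrow> 'k"
  unfolding pr_def by (rule pair_scale[OF finD])

lemma fin_nop: "fin T \<Longrightarrow> fin (nop X T)"
  unfolding fin_def by (auto simp: nop_def vsupp_def intro: rev_finite_subset)

lemma pr_nop:
  assumes "fin T" "nrm X h" shows "pr (nop X T) h c = pr T h c"
proof -
  have "pair (nop X T c) h = (\<Sum>z\<in>vsupp (T c). nop X T c z * h z)"
    by (rule pair_superset[OF finD[OF assms(1)]]) (auto simp: vsupp_def nop_def)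
  also have "\<dots> = pair (T c) h" unfolding pair_def by (rule sum.cong) (use assms(2) in \<open>auto simp: nop_def nrm_def\<close>)
  finally show ?thesis by (simp add: pr_def)
qed

lemma nop_col: "fin T \<Longrightarrow> normal X d \<Longrightarrow> (\<lambda>z. nop X T z d) = pr T (bv d)"
  by (rule ext) (simp add: nop_def pr_at)

lemma nrm_bv: "normal X d \<Longrightarrow> nrm X (bv d)"
  by (auto simp: nrm_def bv_def)

lemma lmul_supp:
  assumes "finite I" "\<And>i. i \<notin> I \<Longrightarrow> F i = (\<lambda>_ _. 0)"
  shows "lmul F G n c d = (\<Sum>i\<in>I. pr (G (n - i)) (\<lambda>z. F i z d) c)"
proof -
  have 0: "pr (G (n - i)) (\<lambda>z. F i z d) c = 0" if "F i = (\<lambda>_ _. 0) \<or> G (n - i) = (\<lambda>_ _. 0)" for i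
    using that by (auto simp: pr_zero fs_zero[OF fs_pr])
  show ?thesis unfolding lmul_def ocomp_pr
    by (rule sum.mono_neutral_left) (use assms 0 in auto)
qed

lemma lmul_diffu: "lmul (diffu X) G n c d = pr (G n) (\<lambda>z. nop X (hoch_b X) z d) c + pr (G (n - 1)) (\<lambda>z. nop X (Bop X) z d) c"
  by (subst lmul_supp[where I="{0, 1}"]) (auto simp: diffu_def)

lemma lmul_Phi: "lmul (Phi A B) G n c d = pr (G n) (\<lambda>z. nop CC (sh A B) z d) c + pr (G (n - 1)) (\<lambda>z. nop CC (Sh A B) z d) c"
  by (subst lmul_supp[where I="{0, 1}"]) (auto simp: Phi_def)

lemma lmul_conn: "lmul (conn X) G n c d = pr (G (n + 2)) (\<lambda>z. conn X (-2) z d) c + pr (G (n + 1)) (\<lambda>z. conn X (-1) z d) c"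
  by (subst lmul_supp[where I="{-2, -1}"]) (auto simp: conn_def)

lemma fin_Phi: "fin (Phi A B n)"
  by (simp add: Phi_def fin_nop fin_sh[OF gdA gdB] fin_Sh[OF gdA gdB] fin_zero)

lemma pr_Phi: "nrm CC h \<Longrightarrow> pr (Phi A B n) h (x, y) = (if n = 0 then shF A B h x y else if n = 1 then ShF A B h x y else 0)"
  by (simp add: Phi_def pr_nop fin_sh[OF gdA gdB] fin_Sh[OF gdA gdB] pr_zero shF_def ShF_def)

lemma fin_diffu: "gda X \<Longrightarrow> fin (diffu X n)"
  by (simp add: diffu_def fin_nop fin_hoch_b fin_Bop fin_zero)

lemma pr_diffu: "gda X \<Longrightarrow> nrm X h \<Longrightarrow> pr (diffu X n) h c = (if n = 0 then pr (hoch_b X) h c else if n = 1 then pr (Bop X) h c else 0)"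
  by (simp add: diffu_def pr_nop fin_hoch_b fin_Bop pr_zero)

lemma pr_src_diffu: "nrm2 A B k \<Longrightarrow> pr (src_diffu A B n) (case_prod k) (x, y) = (if n = 0 then btot A B k x y else if n = 1 then Btot k x y else 0)"
proof -
  assume k: "nrm2 A B k"
  have n: "nrm A (\<lambda>x. k x y)" "nrm B (k x)" using k unfolding nrm2_def by blast+
  show ?thesis unfolding src_diffu_def
    by (simp add: pr_plus fin_ten1 fin_ten2 fin_diffu gdA gdB pr_ten1 pr_ten2 act1_def act2_def pr_diffu[OF gdA n(1)] pr_diffu[OF gdB n(2)] btot_def Btot_def)
qed

lemma fin_conn: fixes X :: "('x, 'k) dga" assumes X: "gda X" shows "fin (conn X n)"
proof -
  have a: "fin (\<lambda>c d. (1/2) * nop X (edel X) c d)" by (intro fin_scale fin_nop fin_edel X)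
  have g: "fin (nop X (Ebig X))" "fin (\<lambda>c d. - nop X (gam X) c d)" by (intro fin_uminus fin_nop fin_Ebig[OF X] fin_gam)+
  have "fin (\<lambda>c d. nop X (Ebig X) c d - nop X (gam X) c d)" using fin_plus[OF g] by simp
  then have b: "fin (\<lambda>c d. (1/2) * (nop X (Ebig X) c d - nop X (gam X) c d))" by (rule fin_scale)
  show ?thesis unfolding conn_def by (split if_split, intro conjI impI a, split if_split, intro conjI impI b fin_zero)
qed

lemma pr_conn: "gda X \<Longrightarrow> nrm X h \<Longrightarrow> pr (conn X n) h c = (if n = -2 then (1/2) * pr (edel X) h c
    else if n = -1 then (1/2) * (pr (Ebig X) h c - of_nat (length (snd c)) * h c) else 0)" for X :: "('x, 'k) dga"
proof -
  assume X: "gda X" and h: "nrm X h"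
  have g: "fin (nop X (Ebig X))" "fin (\<lambda>c d. - nop X (gam X) c d)" by (intro fin_uminus fin_nop fin_Ebig[OF X] fin_gam)+
  have "pr (\<lambda>c d. nop X (Ebig X) c d - nop X (gam X) c d) h c = pr (Ebig X) h c - of_nat (length (snd c)) * h c"
    using pr_plus[OF g] by (simp add: X h pr_uminus pr_nop fin_nop fin_Ebig fin_gam pr_gam)
  moreover have "fin (\<lambda>c d. nop X (Ebig X) c d - nop X (gam X) c d)" using fin_plus[OF g] by simp
  ultimately have "pr (\<lambda>c d. (1/2) * (nop X (Ebig X) c d - nop X (gam X) c d)) h c = (1/2) * (pr (Ebig X) h c - of_nat (length (snd c)) * h c)"
    by (simp only: pr_scale)
  moreover have "pr (\<lambda>c d. (1/2) * nop X (edel X) c d) h c = (1/2) * pr (edel X) h c"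
    by (simp only: pr_scale fin_nop fin_edel[OF X] pr_nop[OF fin_edel[OF X] h])
  ultimately show ?thesis by (cases "n = -2"; cases "n = -1"; simp only: conn_def pr_zero if_True if_False simp_thms)
qed

lemma pr_src_conn: "nrm2 A B k \<Longrightarrow> pr (src_conn A B n) (case_prod k) (x, y) =
   (if n = -2 then (1/2) * (act1 (edel A) k x y + act2 A False (edel B) k x y)
    else if n = -1 then (1/2) * (act1 (Ebig A) k x y + act2 A False (Ebig B) k x y - (of_nat (length (snd x)) + of_nat (length (snd y))) * k x y) else 0)"
proof -
  assume k: "nrm2 A B k"
  have n: "nrm A (\<lambda>x. k x y)" "nrm B (k x)" using k unfolding nrm2_def by blast+
  have "pr (src_conn A B n) (case_prod k) (x, y) = pr (conn A n) (\<lambda>x. k x y) x + pr (conn B n) (k x) y"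
    unfolding src_conn_def by (simp add: pr_plus fin_ten1 fin_ten2 fin_conn gdA gdB pr_ten1 pr_ten2 act1_def act2_def)
  then show ?thesis unfolding pr_conn[OF gdA n(1)] pr_conn[OF gdB n(2)] by (simp add: act1_def act2_def algebra_simps)
qed

lemma fs_lift: "fs (\<lambda>f. lift U V f L)"
  unfolding lift_def by (rule fs_mult[OF fs_point])

lemma fs_H: "fs (\<lambda>f. HQ A B f x y)" "fs (\<lambda>f. HP A B f x y)"
proof -
  have "fs (\<lambda>f. SE (DC X 1) (\<lambda>w. lift [] [] f (oC CC 2 # w)) l0 l r0 r)" for X :: "('i \<times> 'j, 'k) dga" and l0 l r0 r
    by (rule fs_bind[OF fs_SE[OF fs_DC], where Y="\<lambda>w f. lift [] [] f (oC CC 2 # w)"]) (rule fs_lift)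
  note * = fs_mult[OF this]
  show "fs (\<lambda>f. HQ A B f x y)" "fs (\<lambda>f. HP A B f x y)"
    unfolding HQ_def HP_def Let_def by (rule *)+
qed

definition "KK = ocomp (ocomp (sh A B) (ten1 (edel A))) (ten2 A True (Bop B))"

lemma fin_KK: "fin KK"
  unfolding KK_def by (intro fin_ocomp fin_ten1 fin_ten2 fin_sh[OF gdA gdB] fin_edel[OF gdA] fin_Bop[OF gdB])

lemma pr_KK: "pr KK h (x, y) = H2F h x y"
proof -
  have 1: "pr (sh A B) h = case_prod (shF A B h)" by (auto simp: shF_def)
  have 2: "pr (ten1 (edel A)) (case_prod (shF A B h)) = case_prod (act1 (edel A) (shF A B h))"
    by (auto simp: pr_ten1 fin_edel[OF gdA])
  show ?thesis unfolding KK_def H2F_def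
    by (simp add: pr_ocomp fin_ocomp fin_ten1 fin_ten2 fin_sh[OF gdA gdB] fin_edel[OF gdA] fin_Bop[OF gdB] 1 2 pr_ten2)
qed

definition "KH = (\<lambda>(x, y) d. HP A B (bv d) x y - HQ A B (bv d) x y)"

lemma KH: "fin KH" "pr KH h (x, y) = HP A B h x y - HQ A B h x y"
proof -
  have f: "fs (\<lambda>f. HP A B f x y - HQ A B f x y)" for x y
    using fs_plus[OF fs_H(2) fs_uminus[OF fs_H(1)]] by simp
  show "fin KH" by (rule fin_pairI) (simp add: KH_def fs_matrix(1)[OF f])
  show "pr KH h (x, y) = HP A B h x y - HQ A B h x y" by (simp add: KH_def pr_def fs_matrix(2)[OF f])
qed

text \<open>The sign of the coefficient of u^(-2) is chosen so that \<open>H2_B\<close> cancels the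
  terms with \<open>ZZ\<close> in \<open>b_HP\<close>.\<close>

definition HH :: "int \<Rightarrow> ('i \<times> 'i list) \<times> ('j \<times> 'j list) \<Rightarrow> ('i \<times> 'j) \<times> ('i \<times> 'j) list \<Rightarrow> 'k" where
  "HH n = (if n = -2 then nop CC (\<lambda>c d. - (1/2) * KK c d) else if n = -1 then nop CC (\<lambda>c d. (1/2) * KH c d) else (\<lambda>_ _. 0))"

lemma lmul_HH: "lmul HH G n c d = pr (G (n + 2)) (\<lambda>z. HH (-2) z d) c + pr (G (n + 1)) (\<lambda>z. HH (-1) z d) c"
  by (subst lmul_supp[where I="{-2, -1}"]) (auto simp: HH_def)

lemma fin_HH: "fin (HH n)"
proof -
  have a: "fin (nop CC (\<lambda>c d. - (1/2) * KK c d))" "fin (nop CC (\<lambda>c d. (1/2) * KH c d))"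
    by (intro fin_nop fin_scale fin_KK KH(1))+
  show ?thesis unfolding HH_def by (split if_split, intro conjI impI a, split if_split, intro conjI impI a fin_zero)
qed

lemma pr_HH: "nrm CC h \<Longrightarrow> pr (HH n) h (x, y) = (if n = -2 then - (1/2) * H2F h x y else if n = -1 then (1/2) * (HP A B h x y - HQ A B h x y) else 0)"
  unfolding HH_def by (simp only: pr_nop fin_scale fin_KK KH(1) pr_scale pr_KK KH(2) pr_zero if_distrib[of "\<lambda>T. pr T _ _"] cong: if_cong) 

lemma HH_par:
  assumes "HH n (x, y) d \<noteq> 0" shows "normal CC d \<and> cpar CC d \<noteq> (cpar A x \<noteq> cpar B y)"
proof
  show d: "normal CC d" using assms by (auto simp: HH_def nop_def split: if_splits)
  show "cpar CC d \<noteq> (cpar A x \<noteq> cpar B y)"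
  proof
    assume p: "cpar CC d = (cpar A x \<noteq> cpar B y)"
    have f: "\<forall>d'. cpar CC d' = (cpar A x = cpar B y) \<longrightarrow> bv d d' = (0 :: 'k)" using p by (auto simp: bv_def)
    have "pr (HH n) (bv d) (x, y) = 0"
      unfolding pr_HH[OF nrm_bv[OF d]] H_par[OF f] H2_par[OF f nrm_bv[OF d]] by simp
    then show False using assms pr_at[OF fin_HH] by metis
  qed
qed

lemma ShF_add: "fs (\<lambda>f. ShF A B f x y)" "fs (\<lambda>f. shF A B f x y)"
  unfolding ShF_def shF_def by (rule fs_pr)+

lemma part1: "lmul (diffu CC) (Phi A B) n c = lmul (Phi A B) (src_diffu A B) n c"
proof
  fix d obtain x y where c: "c = (x, y)" by (cases c)
  show "lmul (diffu CC) (Phi A B) n c d = lmul (Phi A B) (src_diffu A B) n c d"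
  proof (cases "normal CC d")
    case False
    then show ?thesis unfolding lmul_diffu lmul_Phi by (simp add: nop_def fs_zero[OF fs_pr])
  next
    case True
    let ?f = "bv d :: _ \<Rightarrow> 'k"
    have n: "nrm CC ?f" by (rule nrm_bv[OF True])
    have s: "pr (sh A B) ?f = case_prod (shF A B ?f)" "pr (Sh A B) ?f = case_prod (ShF A B ?f)" by (auto simp: shF_def ShF_def)
    \<comment> \<open>The coefficient of u^2: \<open>Sh\<close> turns a zeroth unit into a bar
      entry, and so does \<open>B\<close>; hence \<open>Sh\<close> after \<open>B\<close> and
      \<open>B\<close> after \<open>Sh\<close> both vanish on the normalized complex.\<close>
    have BB: "Btot (ShF A B ?f) x y = 0" "ShF A B (pr (Bop CC) ?f) x y = 0"
      by (simp_all add: Btot_def act_of_bar[OF bar_Sh[OF n]] Sh_of_van[OF van_B[OF gdC n]])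
    have "btot A B (shF A B ?f) = shF A B (pr (hoch_b CC) ?f)" by (rule b_sh[symmetric])
    then show ?thesis using b_Sh[OF n, of x y] BB
      unfolding lmul_diffu lmul_Phi c nop_col[OF fin_hoch_b[OF gdC] True] nop_col[OF fin_Bop[OF gdC] True] nop_col[OF fin_sh[OF gdA gdB] True] nop_col[OF fin_Sh[OF gdA gdB] True] s
        pr_Phi[OF nrm_b[OF gdC n]] pr_Phi[OF nrm_B[OF gdC n]] pr_src_diffu[OF nrm2_sh[OF n]] pr_src_diffu[OF bar_nrm2[OF bar_Sh[OF n]]]
      by auto
  qed
qed

text \<open>For every normal \<open>d\<close> the matrix entries are values of the functionals at
  the basis function \<open>bv d\<close>, so the operator identities proved on test functions apply.
  Only the powers u^(-2), u^(-1) and u^0 contribute.\<close>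

lemma defect_HH: "defect A B n c = (\<lambda>d. lmul (diffu CC) HH n c d + lmul HH (src_diffu A B) n c d)"
proof
  fix d obtain x y where c: "c = (x, y)" by (cases c)
  show "defect A B n c d = lmul (diffu CC) HH n c d + lmul HH (src_diffu A B) n c d"
  proof (cases "normal CC d")
    case False
    then have 0: "nop CC T z d = 0" for T :: "'b \<Rightarrow> _ \<Rightarrow> 'k" and z by (simp add: nop_def)
    show ?thesis unfolding defect_def lderiv_def lmul_diffu lmul_Phi lmul_conn lmul_HH
      using False by (simp add: nop_def conn_def HH_def Phi_def fs_zero[OF fs_pr])
  next
    case True
    let ?f = "bv d :: _ \<Rightarrow> 'k"
    have n: "nrm CC ?f" by (rule nrm_bv[OF True])
    have s: "(\<lambda>z. nop CC (sh A B) z d) = case_prod (shF A B ?f)" "(\<lambda>z. nop CC (Sh A B) z d) = case_prod (ShF A B ?f)"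
      unfolding nop_col[OF fin_sh[OF gdA gdB] True] nop_col[OF fin_Sh[OF gdA gdB] True] by (auto simp: shF_def ShF_def)
    have h: "(\<lambda>z. HH (-2) z d) = case_prod (\<lambda>x y. - (1/2) * H2F ?f x y)" "(\<lambda>z. HH (-1) z d) = case_prod (\<lambda>x y. (1/2) * (HP A B ?f x y - HQ A B ?f x y))"
      using pr_at[OF fin_HH, symmetric] pr_HH[OF n] by (auto simp: fun_eq_iff)
    have e: "(\<lambda>z. conn CC (-2) z d) = (\<lambda>z. (1/2) * pr (edel CC) ?f z)" "(\<lambda>z. conn CC (-1) z d) = (\<lambda>z. (1/2) * (pr (Ebig CC) ?f z - pr (gam CC) ?f z))"
      using pr_at[OF fin_conn[OF gdC], symmetric] pr_conn[OF gdC n] by (auto simp: fun_eq_iff pr_gam)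
    have ne: "nrm CC (\<lambda>z. (1/2) * pr (edel CC) ?f z)" "nrm CC (\<lambda>z. (1/2) * (pr (Ebig CC) ?f z - pr (gam CC) ?f z))"
      using nrm_e[OF gdC n] nrm_E[OF gdC n] n by (auto simp: nrm_def pr_gam)
    have H: "bar (HQ A B ?f)" "bar (HP A B ?f)" by (rule bar_H[OF n])+
    have nk: "nrm2 A B (\<lambda>x y. - (1/2) * H2F ?f x y)" "nrm2 A B (\<lambda>x y. (1/2) * (HP A B ?f x y - HQ A B ?f x y))"
    proof -
      have "nrm2 A B (H2F ?f)" unfolding H2F_def by (rule nrm2_act2[OF nrm_B[OF gdB] nrm2_e_sh[OF n]])
      then show "nrm2 A B (\<lambda>x y. - (1/2) * H2F ?f x y)" by (auto simp: nrm2_def nrm_def)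
      show "nrm2 A B (\<lambda>x y. (1/2) * (HP A B ?f x y - HQ A B ?f x y))"
        using H[THEN bar_nrm2] by (auto simp: nrm2_def nrm_def)
    qed
    have lin: "btot A B (\<lambda>x y. - (1/2) * H2F ?f x y) x y = - (1/2) * btot A B (H2F ?f) x y" "Btot (\<lambda>x y. - (1/2) * H2F ?f x y) x y = - (1/2) * Btot (H2F ?f) x y"
      "btot A B (\<lambda>x y. (1/2) * (HP A B ?f x y - HQ A B ?f x y)) x y = (1/2) * (btot A B (HP A B ?f) x y - btot A B (HQ A B ?f) x y)"
      "Btot (\<lambda>x y. (1/2) * (HP A B ?f x y - HQ A B ?f x y)) x y = 0"
      by (simp_all only: btot_def Btot_def act1_def act2_def fs_scale[OF fs_pr] fs_diff[OF fs_pr])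
        (simp_all add: algebra_simps B_of_van[OF gdA bar_van(1)[OF H(1)]] B_of_van[OF gdA bar_van(1)[OF H(2)]] B_of_van[OF gdB bar_van(2)[OF H(1)]] B_of_van[OF gdB bar_van(2)[OF H(2)]])
    have Phi: "Phi A B m (x, y) d = (if m = 0 then shF A B ?f x y else if m = 1 then ShF A B ?f x y else 0)" for m
      using pr_Phi[OF n, of m x y] pr_at[OF fin_Phi] by simp
    have v: "HQ A B (pr (Bop CC) ?f) x y = 0" "HP A B (pr (Bop CC) ?f) x y = 0" "ShF A B (pr (Ebig CC) ?f) x y = 0"
      by (rule H_of_van[OF van_B[OF gdC n]] Sh_of_van[OF van_E[OF gdC n]])+
    have sp: "shF A B (\<lambda>z. (1/2) * pr (edel CC) ?f z) x y = (1/2) * (act1 (edel A) (shF A B ?f) x y + act2 A False (edel B) (shF A B ?f) x y)"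
      "ShF A B (\<lambda>z. (1/2) * pr (edel CC) ?f z) x y = (1/2) * (ShF A B (pr (edel (cA A B)) ?f) x y + ShF A B (pr (edel (cB A B)) ?f) x y)"
      "shF A B (\<lambda>z. (1/2) * (pr (Ebig CC) ?f z - pr (gam CC) ?f z)) x y = (1/2) * (shF A B (pr (Ebig (cA A B)) ?f) x y + shF A B (pr (Ebig (cB A B)) ?f) x y
         - (of_nat (length (snd x)) + of_nat (length (snd y))) * shF A B ?f x y)"
      unfolding fs_scale[OF ShF_add(1)] fs_scale[OF ShF_add(2)] fs_diff[OF ShF_add(1)] fs_diff[OF ShF_add(2)] sh_gam edel_split Ebig_split
        fs_add[OF ShF_add(1)] fs_add[OF ShF_add(2)] e_sh by simp_all
    have sp': "ShF A B (\<lambda>z. (1/2) * (pr (Ebig CC) ?f z - pr (gam CC) ?f z)) x y = (1/2) * (- (of_nat (length (snd x)) + of_nat (length (snd y)) + 2) * ShF A B ?f x y)"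
      unfolding fs_scale[OF ShF_add(1)] fs_diff[OF ShF_add(1)] Sh_gam v(3) by (simp add: algebra_simps)
    have a: "act1 (Ebig A) (ShF A B ?f) x y = 0" "act2 A False (Ebig B) (ShF A B ?f) x y = 0"
      by (simp_all add: act_of_bar[OF bar_Sh[OF n]])
    note eqs = defect_def lderiv_def lmul_diffu lmul_Phi lmul_conn lmul_HH c s h e nop_col[OF fin_hoch_b[OF gdC] True] nop_col[OF fin_Bop[OF gdC] True]
      pr_Phi[OF ne(1)] pr_Phi[OF ne(2)] pr_src_conn[OF nrm2_sh[OF n]] pr_src_conn[OF bar_nrm2[OF bar_Sh[OF n]]] pr_HH[OF nrm_b[OF gdC n]] pr_HH[OF nrm_B[OF gdC n]]
      pr_src_diffu[OF nk(1)] pr_src_diffu[OF nk(2)] lin Phi v(1,2) sp sp' a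
    consider "n = -2" | "n = -1" | "n = 0" | "n \<noteq> -2" "n \<noteq> -1" "n \<noteq> 0" by blast
    then show ?thesis
    proof cases
      case 1
      \<comment> \<open>In u^(-2) the defect is zero, because \<open>e\<close> commutes with
        \<open>sh\<close>; the homotopy contributes its vanishing commutator with
        \<open>b\<close>.\<close>
      have "H2F (pr (hoch_b CC) ?f) x y = - btot A B (H2F ?f) x y" using H2_b[OF n, of x y] by (simp add: eq_neg_iff_add_eq_0)
      then show ?thesis unfolding eqs by (simp add: 1)
    next
      case 2
      \<comment> \<open>In u^(-1) the three commutators are inserted; the terms with
        \<open>\<gamma>\<close> drop out, because \<open>sh\<close> preserves the total number of
        bar entries.\<close>
      have z: "ZZ (pr (edel (cA A B)) ?f) x y = act1 (edel A) (ZZ ?f) x y - H2F (pr (Bop CC) ?f) x y - Btot (H2F ?f) x y"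
        using H2_B[OF n, of x y] by (simp add: algebra_simps)
      have q: "HQ A B (pr (hoch_b CC) ?f) x y = act2 A False (Ebig B) (shF A B ?f) x y - shF A B (pr (Ebig (cB A B)) ?f) x y
         + act2 A False (edel B) (ShF A B ?f) x y - ShF A B (pr (edel (cB A B)) ?f) x y - btot A B (HQ A B ?f) x y"
        using b_HQ[OF n, of x y] by (simp add: algebra_simps)
      have p: "HP A B (pr (hoch_b CC) ?f) x y = shF A B (pr (Ebig (cA A B)) ?f) x y - act1 (Ebig A) (shF A B ?f) x y + act1 (edel A) (ZZ ?f) x y - ZZ (pr (edel (cA A B)) ?f) x y
         - act1 (edel A) (ShF A B ?f) x y + ShF A B (pr (edel (cA A B)) ?f) x y - btot A B (HP A B ?f) x y"
        using b_HP[OF n, of x y] by (simp add: algebra_simps)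
      show ?thesis unfolding eqs q p z by (simp add: 2 field_simps)
    next
      case 3
      \<comment> \<open>In u^0 the summand \<open>Sh\<close> of the derivative cancels against half
        of the shift by 2; the terms with \<open>E\<close> and those pairing \<open>B\<close> with P
        or Q are already zero.\<close>
      show ?thesis unfolding eqs by (simp add: 3 algebra_simps)
    next
      case 4
      then have "n + 2 \<noteq> 0" "n + 1 \<noteq> 0" by auto
      with 4 show ?thesis unfolding eqs by auto
    qed
  qed
qed

end

theorem theorem2p3:
  fixes A :: "('i, 'k::field_char_0) dga" and B :: "('j, 'k) dga"
  assumes "is_dga A" and "is_dga B"
  shows "(\<forall>n c. normal A (fst c) \<and> normal B (snd c) \<longrightarrow>
            lmul (diffu (dga_tensor A B)) (Phi A B) n c = lmul (Phi A B) (src_diffu A B) n c)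
       \<and> (\<exists>H :: int \<Rightarrow> ('i \<times> 'i list) \<times> ('j \<times> 'j list) \<Rightarrow> ('i \<times> 'j) \<times> ('i \<times> 'j) list \<Rightarrow> 'k.
            lbb H
          \<and> (\<forall>n c. finite (vsupp (H n c)))
          \<and> (\<forall>n c d. H n c d \<noteq> 0 \<longrightarrow> normal (dga_tensor A B) d
                 \<and> cpar (dga_tensor A B) d \<noteq> (cpar A (fst c) \<noteq> cpar B (snd c)))
          \<and> (\<forall>n c. normal A (fst c) \<and> normal B (snd c) \<longrightarrow>
                 defect A B n c = (\<lambda>d. lmul (diffu (dga_tensor A B)) H n c d
                                      + lmul H (src_diffu A B) n c d)))"
proof (intro conjI exI[of _ "HH A B"])
  show "\<forall>n c. normal A (fst c) \<and> normal B (snd c) \<longrightarrow> lmul (diffu (dga_tensor A B)) (Phi A B) n c = lmul (Phi A B) (src_diffu A B) n c"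
    by (simp add: part1[OF assms])
  show "lbb (HH A B)"
    unfolding lbb_def by (rule exI[of _ "-2"]) (simp add: HH_def[OF assms])
  show "\<forall>n c. finite (vsupp (HH A B n c))"
    using fin_HH[OF assms] by (auto simp: fin_def)
  show "\<forall>n c d. HH A B n c d \<noteq> 0 \<longrightarrow> normal (dga_tensor A B) d \<and> cpar (dga_tensor A B) d \<noteq> (cpar A (fst c) \<noteq> cpar B (snd c))"
    using HH_par[OF assms] by (metis prod.collapse)
  show "\<forall>n c. normal A (fst c) \<and> normal B (snd c) \<longrightarrow> defect A B n c = (\<lambda>d. lmul (diffu (dga_tensor A B)) (HH A B) n c d + lmul (HH A B) (src_diffu A B) n c d)"
    by (simp add: defect_HH[OF assms])
qed

end
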